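(* Let $n\ge 3$. There is a small number $\epsilon>0$ such that the following holds. Let $p,q>0$ lie on the critical hyperbola $\frac{1}{p+1}+\frac{1}{q+1}=\frac{n-2}{n}$, and suppose that either $|p-1|\le\epsilon$ and $n\ge 5$, or $\left|p-\frac{n+2}{n-2}\right|\le\epsilon$ (with $n\ge 3$). Let $(U,V)$ be the unique positive ground state of $$-\Delta u=v^p,\qquad -\Delta v=u^q,\qquad u,v>0\qquad\text{in }\mathbb{R}^n$$ that is radially symmetric about the origin and satisfies $U(0)=1$. Then $(U,V)$ is non-degenerate: every weak solution $(\phi,\psi)$ of $$-\Delta\phi=pV^{p-1}\psi,\qquad -\Delta\psi=qU^{q-1}\phi\qquad\text{in }\mathbb{R}^n$$ with $\lim_{|x|\to\infty}(\phi(x),\psi(x))=(0,0)$ is a linear combination of $$Z_0(x)=\left(x\cdot\nabla U+\frac{2(p+1)}{pq-1}U,\; x\cdot\nabla V+\frac{2(q+1)}{pq-1}V\right),\qquad Z_i(x)=\left(\frac{\partial U}{\partial x_i},\frac{\partial V}{\partial x_i}\right),\quad i=1,\dots,n.$$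
   Context: For $s\ge1$, $\mathcal{D}^{2,s}_0(\mathbb{R}^n)$ is the completion of $C_c^\infty(\mathbb{R}^n)$ with respect to the norm $\|\Delta\cdot\|_{L^s(\mathbb{R}^n)}$. For $p,q>0$ on the critical hyperbola $\frac1{p+1}+\frac1{q+1}=\frac{n-2}{n}$, a positive ground state of the system is a solution $(U,V)\in\mathcal{D}^{2,\frac{p+1}{p}}_0(\mathbb{R}^n)\times\mathcal{D}^{2,\frac{q+1}{q}}_0(\mathbb{R}^n)$ with $U,V>0$ such that $U$ attains the infimum $$\inf_{u\in\mathcal{D}^{2,\frac{p+1}{p}}_0(\mathbb{R}^n)\setminus\{0\}}\frac{\int_{\mathbb{R}^n}|\Delta u|^{\frac{p+1}{p}}}{\left(\int_{\mathbb{R}^n}|u|^{q+1}\right)^{\frac{p+1}{p(q+1)}}}.$$ Known facts (Lions; Alvino–Lions–Trombetti; Hulshof–Van der Vorst): a positive ground state exists; after a translation it is radially symmetric about $0$ and decreasing in $r=|x|$; and a positive radial solution of the system is unique up to the scaling $(U,V)\mapsto(\delta^{\frac{2(p+1)}{pq-1}}U(\delta\,\cdot),\delta^{\frac{2(q+1)}{pq-1}}V(\delta\,\cdot))$, $\delta>0$. Hence the radial ground state with $U(0)=1$ is unique. *)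

theory Defs
  imports "HOL-Analysis.Analysis"
begin

definition partial_deriv :: "'n \<Rightarrow> (real^'n::finite \<Rightarrow> real) \<Rightarrow> real^'n \<Rightarrow> real" where
  "partial_deriv i f x = deriv (\<lambda>t. f (x + t *\<^sub>R axis i 1)) 0"

definition grad :: "(real^'n::finite \<Rightarrow> real) \<Rightarrow> real^'n \<Rightarrow> real^'n" where
  "grad f x = (\<chi> i. partial_deriv i f x)"

definition laplacian :: "(real^'n::finite \<Rightarrow> real) \<Rightarrow> real^'n \<Rightarrow> real" where
  "laplacian f x = (\<Sum>i\<in>UNIV. partial_deriv i (partial_deriv i f) x)"

primrec C_k :: "nat \<Rightarrow> (real^'n::finite \<Rightarrow> real) \<Rightarrow> bool" where
  "C_k 0 f \<longleftrightarrow> continuous_on UNIV f"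
| "C_k (Suc k) f \<longleftrightarrow> f differentiable_on UNIV \<and> (\<forall>i. C_k k (partial_deriv i f))"

definition test_function :: "(real^'n::finite \<Rightarrow> real) \<Rightarrow> bool" where
  "test_function \<eta> \<longleftrightarrow> (\<forall>k. C_k k \<eta>) \<and> compact (closure {x. \<eta> x \<noteq> 0})"

definition loc_integrable :: "(real^'n::finite \<Rightarrow> real) \<Rightarrow> bool" where
  "loc_integrable f \<longleftrightarrow> (\<forall>K. compact K \<longrightarrow> f absolutely_integrable_on K)"

text \<open>\<open>-\<Delta>u = f\<close> in the sense of distributions on the whole space.\<close>

definition weak_neg_laplacian :: "(real^'n::finite \<Rightarrow> real) \<Rightarrow> (real^'n \<Rightarrow> real) \<Rightarrow> bool" where
  "weak_neg_laplacian u f \<longleftrightarrow> loc_integrable u \<and> loc_integrable f \<and>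
     (\<forall>\<eta>. test_function \<eta> \<longrightarrow>
        - (LINT x|lebesgue. u x * laplacian \<eta> x) = (LINT x|lebesgue. f x * \<eta> x))"

text \<open>The distributional Laplacian as a function; it is determined up to a null set, and it is
  only used inside integrals.\<close>

definition weak_laplacian :: "(real^'n::finite \<Rightarrow> real) \<Rightarrow> real^'n \<Rightarrow> real" where
  "weak_laplacian u = (SOME g. weak_neg_laplacian u (\<lambda>x. - g x))"

definition Lp_fun :: "real \<Rightarrow> (real^'n::finite \<Rightarrow> real) \<Rightarrow> bool" where
  "Lp_fun s f \<longleftrightarrow> f \<in> borel_measurable lebesgue \<and> integrable lebesgue (\<lambda>x. \<bar>f x\<bar> powr s)"

definition Lp_norm :: "real \<Rightarrow> (real^'n::finite \<Rightarrow> real) \<Rightarrow> real" where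
  "Lp_norm s f = (LINT x|lebesgue. \<bar>f x\<bar> powr s) powr (1 / s)"

text \<open>The completion of the test functions under \<open>\<parallel>\<Delta>\<cdot>\<parallel>\<close> in \<open>L\<^sup>s\<close>, realised as a
  space of functions: \<open>u\<close> is the local \<open>L\<^sup>1\<close> limit of test functions whose Laplacians converge in
  \<open>L\<^sup>s\<close>. For \<open>1 < s < n/2\<close>, which holds for both exponents on the critical hyperbola, the
  Sobolev inequality makes every Cauchy sequence converge locally in \<open>L\<^sup>1\<close>, the limit being zero
  only for null sequences, so this is the abstract completion (elements being functions up to
  null sets).\<close>

definition D2 :: "real \<Rightarrow> (real^'n::finite \<Rightarrow> real) set" where
  "D2 s = {u. loc_integrable u \<and>
     (\<exists>(\<phi> :: nat \<Rightarrow> real^'n \<Rightarrow> real) g.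
        (\<forall>k. test_function (\<phi> k)) \<and> Lp_fun s g \<and>
        (\<forall>K. compact K \<longrightarrow> (\<lambda>k. LINT x:K|lebesgue. \<bar>\<phi> k x - u x\<bar>) \<longlonglongrightarrow> 0) \<and>
        (\<lambda>k. Lp_norm s (\<lambda>x. laplacian (\<phi> k) x - g x)) \<longlonglongrightarrow> 0)}"

definition energy_quotient :: "real \<Rightarrow> real \<Rightarrow> (real^'n::finite \<Rightarrow> real) \<Rightarrow> real" where
  "energy_quotient p q u =
     (LINT x|lebesgue. \<bar>weak_laplacian u x\<bar> powr ((p + 1) / p)) /
     (LINT x|lebesgue. \<bar>u x\<bar> powr (q + 1)) powr ((p + 1) / (p * (q + 1)))"

text \<open>Continuity selects the pointwise representatives of the two (regular) solutions, so that
  point values and derivatives make sense.\<close>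

definition positive_ground_state ::
  "real \<Rightarrow> real \<Rightarrow> (real^'n::finite \<Rightarrow> real) \<Rightarrow> (real^'n \<Rightarrow> real) \<Rightarrow> bool" where
  "positive_ground_state p q U V \<longleftrightarrow>
     U \<in> D2 ((p + 1) / p) \<and> V \<in> D2 ((q + 1) / q) \<and>
     continuous_on UNIV U \<and> continuous_on UNIV V \<and>
     (\<forall>x. U x > 0) \<and> (\<forall>x. V x > 0) \<and>
     weak_neg_laplacian U (\<lambda>x. V x powr p) \<and>
     weak_neg_laplacian V (\<lambda>x. U x powr q) \<and>
     energy_quotient p q U =
       (INF u\<in>{u :: real^'n \<Rightarrow> real. u \<in> D2 ((p + 1) / p) \<and> \<not> (AE x in lebesgue. u x = 0)}.
          energy_quotient p q u)"

definition radially_symmetric :: "(real^'n::finite \<Rightarrow> real) \<Rightarrow> bool" where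
  "radially_symmetric f \<longleftrightarrow> (\<forall>x y. norm x = norm y \<longrightarrow> f x = f y)"

definition linearized_solution ::
  "real \<Rightarrow> real \<Rightarrow> (real^'n::finite \<Rightarrow> real) \<Rightarrow> (real^'n \<Rightarrow> real) \<Rightarrow>
   (real^'n \<Rightarrow> real) \<Rightarrow> (real^'n \<Rightarrow> real) \<Rightarrow> bool" where
  "linearized_solution p q U V \<phi> \<psi> \<longleftrightarrow>
     weak_neg_laplacian \<phi> (\<lambda>x. p * V x powr (p - 1) * \<psi> x) \<and>
     weak_neg_laplacian \<psi> (\<lambda>x. q * U x powr (q - 1) * \<phi> x)"

definition Z_dilation ::
  "real \<Rightarrow> real \<Rightarrow> (real^'n::finite \<Rightarrow> real) \<Rightarrow> (real^'n \<Rightarrow> real) \<Rightarrow> real^'n \<Rightarrow> real \<times> real" where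
  "Z_dilation p q U V x =
     (x \<bullet> grad U x + 2 * (p + 1) / (p * q - 1) * U x,
      x \<bullet> grad V x + 2 * (q + 1) / (p * q - 1) * V x)"

definition Z_translation ::
  "'n \<Rightarrow> (real^'n::finite \<Rightarrow> real) \<Rightarrow> (real^'n \<Rightarrow> real) \<Rightarrow> real^'n \<Rightarrow> real \<times> real" where
  "Z_translation i U V x = (partial_deriv i U x, partial_deriv i V x)"

text \<open>Weak solutions are defined up to null sets. The limit is imposed on a representative, which
  amounts to an essential limit, and the conclusion identifies the pair almost everywhere.\<close>

definition nondegenerate ::
  "real \<Rightarrow> real \<Rightarrow> (real^'n::finite \<Rightarrow> real) \<Rightarrow> (real^'n \<Rightarrow> real) \<Rightarrow> bool" where
  "nondegenerate p q U V \<longleftrightarrow>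
     (\<forall>\<phi> \<psi>. linearized_solution p q U V \<phi> \<psi> \<longrightarrow>
        ((\<lambda>x. (\<phi> x, \<psi> x)) \<longlongrightarrow> (0, 0)) at_infinity \<longrightarrow>
        (\<exists>a b. AE x in lebesgue.
           (\<phi> x, \<psi> x) =
             a *\<^sub>R Z_dilation p q U V x + (\<Sum>i\<in>UNIV. b i *\<^sub>R Z_translation i U V x)))"

end

theory Submission
  imports Defs "HOL-Real_Asymp.Real_Asymp"
begin

text \<open>The result holds for every pair on the critical hyperbola. Testing with radial functions \<open>h(|x - z|\<^sup>2)\<close>
  only, a linearized solution that vanishes at infinity is a Newtonian potential. Its odd part with
  respect to a hyperplane with unit normal \<open>e\<close> solves a system with a positive kernel on the half
  space, and \<open>(-\<partial>\<^sub>e U, -\<partial>\<^sub>e V)\<close> is a positive solution of that system; pairing the two shows that the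
  odd part is a multiple of \<open>(\<partial>\<^sub>e U, \<partial>\<^sub>e V)\<close>. After subtracting translations the solution is invariant
  under all reflections, hence radial. In the variable \<open>s = |x|\<^sup>2\<close> the radial system is an ODE whose
  solutions are determined by their values at \<open>0\<close>, and one that starts from \<open>(0, 1)\<close> stays away
  from \<open>0\<close> in the second component, so the dilation mode spans the radial solutions.
  The pairing converges because finite energy forces \<open>V = o(|x|\<^bsup>-n/(p+1)\<^esup>)\<close>, which a bootstrap along slowly varying majorants improves.\<close>

text \<open>Write G for the half-space Green operator and P, Q for the linearized weights. An odd
  solution satisfies |phi| <= G(P |psi|) and |psi| <= G(Q |phi|), while the positive pair satisfies
  f = G(P g) and g = G(Q f). As G is symmetric, testing the first inequality with Q f and the second
  with P g bounds each of the numbers int Q f |phi| and int P g |psi| by the other. Both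
  inequalities are then equalities, provided that one number is finite; the improved decay serves
  this purpose. The rate supplied by finite energy is the scaling-critical one, which linear
  potential estimates merely reproduce; the gain comes from \<open>p * q > 1\<close>. The variable s
  = |x|^2 with nu = n/2 keeps h(|x - z|^2) smooth at its centre and turns the Laplacian into 4
  s^(1-nu) (s^nu h')'. Test functions yield the Newtonian kernel only up to additive constants,
  which cancel because the odd problem sees differences of the kernel. Working with all reflections
  at once replaces a decomposition into spherical harmonics.\<close>

abbreviation "bmeas \<equiv> borel_measurable borel"
abbreviation sq :: "'a::real_inner => real" where "sq x \<equiv> x \<bullet> x"

section \<open>Smooth functions of one real variable\<close>

text \<open>The derivative is an existential witness instead of an iterated \<open>deriv\<close>, so
  that closure under sums, products and affine substitutions is a plain induction on the
  order.\<close>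

primrec diff_times :: "nat => (real => real) => bool" where
 "diff_times 0 f \<longleftrightarrow> continuous_on UNIV f"
| "diff_times (Suc k) f \<longleftrightarrow>
   (\<exists>f'. (\<forall>x. (f has_real_derivative f' x) (at x)) \<and> diff_times k f')"

definition smooth :: "(real => real) => bool" where
 "smooth f \<longleftrightarrow> (\<forall>k. diff_times k f)"

lemma diff_times_continuous: "diff_times k f ==> continuous_on UNIV f"
 by (cases k) (auto intro!: continuous_at_imp_continuous_on dest: DERIV_isCont)

lemma diff_times_Suc_imp: "diff_times (Suc k) f ==> diff_times k f"
proof (induction k arbitrary: f)
 case 0
 then show ?case using diff_times_continuous diff_times.simps(1) by blast
next
 case (Suc k)
 then show ?case by (metis diff_times.simps(2))
qed

lemma diff_times_const: "diff_times k (%x. c)"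
 by (induction k arbitrary: c) (auto intro!: exI[of _ "%x. 0::real"])

lemma diff_times_add:
 "diff_times k f ==> diff_times k g ==> diff_times k (%x. f x + g x)"
proof (induction k arbitrary: f g)
 case 0
 then show ?case by (auto intro: continuous_intros)
next
 case (Suc k)
 then obtain f' g' where "\<forall>x. (f has_real_derivative f' x) (at x)" "diff_times k f'"
  "\<forall>x. (g has_real_derivative g' x) (at x)" "diff_times k g'" by auto
 then show ?case using Suc.IH
  by (auto intro!: exI[of _ "%x. f' x + g' x"] derivative_intros)
qed

lemma diff_times_mult:
 "diff_times k f ==> diff_times k g ==> diff_times k (%x. f x * g x)"
proof (induction k arbitrary: f g)
 case 0
 then show ?case by (auto intro: continuous_intros)
next
 case (Suc k)
 then obtain f' g' where *: "\<forall>x. (f has_real_derivative f' x) (at x)" "diff_times k f'"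
  "\<forall>x. (g has_real_derivative g' x) (at x)" "diff_times k g'" by auto
 have "diff_times k (%x. f' x * g x + g' x * f x)"
  using Suc.IH * diff_times_add diff_times_Suc_imp[OF Suc.prems(1)]
   diff_times_Suc_imp[OF Suc.prems(2)] by blast
 moreover have "\<forall>x. ((%x. f x * g x) has_real_derivative f' x * g x + g' x * f x) (at x)"
  using * by (auto intro!: derivative_eq_intros)
 ultimately show ?case by auto
qed

lemma diff_times_affine: "diff_times k f ==> diff_times k (%x. f (c * x + d))"
proof (induction k arbitrary: f)
 case 0
 then show ?case
  by (auto intro!: continuous_intros continuous_on_compose2[of UNIV f])
next
 case (Suc k)
 then obtain f' where *: "\<forall>x. (f has_real_derivative f' x) (at x)" "diff_times k f'" by auto
 have "\<forall>x. ((%x. f (c * x + d)) has_real_derivative f' (c * x + d) * c) (at x)"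
  by (intro allI DERIV_chain2[of f]) (use * in \<open>auto intro!: derivative_eq_intros\<close>)
 moreover have "diff_times k (%x. f' (c * x + d) * c)"
  using diff_times_mult[OF Suc.IH[OF *(2)] diff_times_const] .
 ultimately show ?case by auto
qed

lemma smooth_const: "smooth (%x. c)" by (simp add: smooth_def diff_times_const)
lemma smooth_add: "smooth f ==> smooth g ==> smooth (%x. f x + g x)"
 by (simp add: smooth_def diff_times_add)
lemma smooth_mult: "smooth f ==> smooth g ==> smooth (%x. f x * g x)"
 by (simp add: smooth_def diff_times_mult)
lemma smooth_affine: "smooth f ==> smooth (%x. f (c * x + d))"
 by (simp add: smooth_def diff_times_affine)
lemma smooth_cmult: "smooth f ==> smooth (%x. c * f x)"
 using smooth_mult[OF smooth_const] .
lemma smooth_diff: "smooth f ==> smooth g ==> smooth (%x. f x - g x)"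
 using smooth_add[of f "%x. (-1) * g x"] smooth_cmult[of g "-1"] by simp
lemma smooth_continuous: "smooth f ==> continuous_on S f"
 using diff_times_continuous continuous_on_subset unfolding smooth_def by blast

lemma smooth_of_deriv:
 assumes "\<And>x. (f has_real_derivative f' x) (at x)" "smooth f'"
 shows "smooth f"
 unfolding smooth_def
proof
 fix k show "diff_times k f"
  using assms by (cases k) (auto simp: smooth_def intro!: continuous_at_imp_continuous_on DERIV_isCont)
qed

lemma smooth_derivD:
 assumes "smooth f"
 shows "(f has_real_derivative deriv f x) (at x)" and "smooth (deriv f)"
proof -
 have *: "\<exists>f'. (\<forall>x. (f has_real_derivative f' x) (at x)) \<and> diff_times k f'" for k
  using assms diff_times.simps(2) unfolding smooth_def by blast
 then have eq: "(f has_real_derivative f' x) (at x) ==> deriv f x = f' x" for f' x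
  by (simp add: DERIV_imp_deriv)
 from * show "(f has_real_derivative deriv f x) (at x)"
  by (metis DERIV_imp_deriv)
 show "smooth (deriv f)"
  unfolding smooth_def
 proof
  fix k
  obtain f' where f': "\<forall>x. (f has_real_derivative f' x) (at x)" "diff_times k f'" using * by blast
  then have "deriv f = f'" using DERIV_imp_deriv by blast
  then show "diff_times k (deriv f)" using f' by simp
 qed
qed

text \<open>A real power is smooth only away from 0, so the other factor has to vanish up to some
  \<open>delta > 0\<close>. The derivative is a sum of two products of the same shape, with
  exponents \<open>mu\<close> and \<open>mu - 1\<close>; hence the induction with \<open>f\<close>
  and \<open>mu\<close> arbitrary.\<close>

lemma smooth_powr:
 assumes "smooth f" "delta > 0" "\<And>s. s <= delta ==> f s = 0"
 shows "smooth (%s. f s * s powr mu)"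
 unfolding smooth_def
proof
 fix k
 have main: "((%s. f s * s powr mu) has_real_derivative (deriv f s * s powr mu + (mu * f s) * s powr (mu - 1))) (at s)"
  and d0: "s < delta ==> deriv f s = 0"
  if "smooth f" "\<And>s. s <= delta ==> f s = 0" for f :: "real => real" and mu s
 proof -
  show d0: "deriv f s = 0" if "s < delta" for s
  proof -
   have "(f has_real_derivative 0) (at s)"
    by (rule DERIV_cong_ev[THEN iffD1, OF refl _ refl DERIV_const[of 0]])
      (use that \<open>\<And>s. s <= delta ==> f s = 0\<close> in \<open>auto intro!: eventually_mono[OF order_tendstoD(2)[OF tendsto_ident_at, of s delta]] simp: eventually_nhds intro!: exI[of _ "{..<delta}"]\<close>)
   then show ?thesis by (rule DERIV_imp_deriv)
  qed
  show "((%s. f s * s powr mu) has_real_derivative (deriv f s * s powr mu + (mu * f s) * s powr (mu - 1))) (at s)"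
  proof (cases "s > 0")
   case True
   then show ?thesis
    by (auto intro!: derivative_eq_intros smooth_derivD(1)[OF that(1)] simp: field_simps)
  next
   case False
   have "((%s. f s * s powr mu) has_real_derivative 0) (at s)"
    by (rule DERIV_cong_ev[THEN iffD1, OF refl _ refl DERIV_const[of 0]])
      (use that False \<open>delta > 0\<close> in \<open>auto simp: eventually_nhds intro!: exI[of _ "{..<delta}"]\<close>)
   moreover have "deriv f s = 0" "f s = 0" using d0[of s] that(2)[of s] False \<open>delta > 0\<close> by auto
   ultimately show ?thesis by simp
  qed
 qed
 \<comment> \<open>The vanishing of \<open>f\<close> gives that of \<open>deriv f\<close> only
   strictly to the left of \<open>delta\<close>. Continuity of \<open>deriv f\<close> supplies the
   endpoint, so the hypothesis on \<open>f\<close> passes to \<open>deriv f\<close> with the same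
   \<open>delta\<close>.\<close>
 have vanish: "s <= delta ==> deriv f s = 0" if "smooth f" "\<And>s. s <= delta ==> f s = 0" for f s
 proof -
  assume "s <= delta"
  have "continuous_on UNIV (deriv f)" using smooth_continuous smooth_derivD(2) that(1) by blast
  then have "isCont (deriv f) delta" by (simp add: continuous_on_eq_continuous_at)
  then have t: "((deriv f) \<longlongrightarrow> deriv f delta) (at_left delta)"
   by (simp add: isCont_def filterlim_at_split)
  have "((deriv f) \<longlongrightarrow> 0) (at_left delta)"
   by (rule tendsto_eventually) (use d0[OF that] in \<open>auto simp: eventually_at_filter\<close>)
  from tendsto_unique[OF _ t this] have "deriv f delta = 0" by simp
  then show "deriv f s = 0" using d0[OF that, of s] \<open>s <= delta\<close> by (cases "s = delta") auto
 qed
 show "diff_times k (%s. f s * s powr mu)" using assms(1,3)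
 proof (induction k arbitrary: f mu)
  case 0
  show ?case using main[OF 0]
   by (auto intro!: continuous_at_imp_continuous_on DERIV_isCont)
 next
  case (Suc k)
  have "diff_times k (%s. deriv f s * s powr mu)"
   by (rule Suc.IH) (use vanish Suc.prems smooth_derivD in auto)
  moreover have "diff_times k (%s. (mu * f s) * s powr (mu - 1))"
   by (rule Suc.IH) (use Suc.prems smooth_cmult in auto)
  ultimately have "diff_times k (%s. deriv f s * s powr mu + (mu * f s) * s powr (mu - 1))"
   by (rule diff_times_add)
  then show ?case using main[OF Suc.prems] by (auto intro!: exI)
 qed
qed

section \<open>A flat function and a compactly supported bump\<close>

definition flat_exp :: "nat => real => real" where
 "flat_exp m x = (if x > 0 then exp (- (1 / x)) / x ^ m else 0)"

text \<open>The parameter \<open>m\<close> makes the family closed under differentiation up to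
  linear combinations, which reduces smoothness to an induction with \<open>m\<close> arbitrary. At
  0 the exponential beats every power.\<close>

lemma flat_exp_deriv:
 "(flat_exp m has_real_derivative (flat_exp (m + 2) x - real m * flat_exp (m + 1) x)) (at x)"
proof -
 consider "x > 0" | "x < 0" | "x = 0" by linarith
 then show ?thesis
 proof cases
  case 1
  have "((%x. exp (- (1 / x)) / x ^ m) has_real_derivative
    (exp (- (1 / x)) / x ^ (m + 2) - real m * (exp (- (1 / x)) / x ^ (m + 1)))) (at x)"
   using 1
   apply (auto intro!: derivative_eq_intros)
   apply (cases m)
   apply (auto simp: field_simps power2_eq_square)
   done
  then have "(flat_exp m has_real_derivative
    (exp (- (1 / x)) / x ^ (m + 2) - real m * (exp (- (1 / x)) / x ^ (m + 1)))) (at x)"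
   by (rule DERIV_cong_ev[THEN iffD1, OF refl _ refl, rotated])
     (use 1 in \<open>auto simp: eventually_nhds flat_exp_def intro!: exI[of _ "{0<..}"]\<close>)
  then show ?thesis using 1 by (simp add: flat_exp_def)
 next
  case 2
  have "(flat_exp m has_real_derivative 0) (at x)"
   by (rule DERIV_cong_ev[THEN iffD1, OF refl _ refl DERIV_const[of 0]])
     (use 2 in \<open>auto simp: eventually_nhds flat_exp_def intro!: exI[of _ "{..<0}"]\<close>)
  then show ?thesis using 2 by (simp add: flat_exp_def)
 next
  case 3
  have r: "((%h. flat_exp m h / h) \<longlongrightarrow> 0) (at_right 0)"
  proof (rule Lim_transform_eventually)
   show "((%h::real. exp (- (1 / h)) / h ^ m / h) \<longlongrightarrow> 0) (at_right 0)"
    by real_asymp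
   show "\<forall>\<^sub>F h in at_right 0. exp (- (1 / h)) / h ^ m / h = flat_exp m h / h"
    by (auto simp: eventually_at_filter flat_exp_def)
  qed
  have l: "((%h. flat_exp m h / h) \<longlongrightarrow> 0) (at_left 0)"
   by (rule tendsto_eventually) (auto simp: eventually_at_filter flat_exp_def)
  have "(flat_exp m has_real_derivative 0) (at 0)"
   using filterlim_split_at[OF l r] by (simp add: DERIV_def flat_exp_def)
  then show ?thesis using 3 by (simp add: flat_exp_def)
 qed
qed

lemma flat_exp_smooth: "smooth (flat_exp m)"
 unfolding smooth_def
proof
 fix k show "diff_times k (flat_exp m)"
 proof (induction k arbitrary: m)
  case 0
  then show ?case using flat_exp_deriv
   by (auto intro!: continuous_at_imp_continuous_on DERIV_isCont)
 next
  case (Suc k)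
  have "diff_times k (%x. flat_exp (m + 2) x + (- real m) * flat_exp (m + 1) x)"
   by (intro diff_times_add diff_times_mult diff_times_const Suc.IH)
  then have "diff_times k (%x. flat_exp (m + 2) x - real m * flat_exp (m + 1) x)" by simp
  then show ?case unfolding diff_times.simps
   by (intro exI[of _ "%x. flat_exp (m + 2) x - real m * flat_exp (m + 1) x"] conjI allI flat_exp_deriv)
 qed
qed

text \<open>Meant as a function of s = |x|^2. It is not normalised: the constants
  \<open>ramp_max\<close> and the integral of \<open>shell\<close> are carried along
  instead.\<close>

definition bump :: "real => real" where
 "bump s = flat_exp 0 (s - 1) * flat_exp 0 (2 - s)"

lemma bump_smooth: "smooth bump"
 using smooth_mult[OF smooth_affine[OF flat_exp_smooth, of 0 1 "-1"]
   smooth_affine[OF flat_exp_smooth, of 0 "-1" 2]]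
 unfolding bump_def[abs_def] by (simp add: add.commute)

lemma bump_pos_iff: "bump s > 0 \<longleftrightarrow> 1 < s \<and> s < 2"
 and bump_nonneg: "bump s >= 0"
 and bump_zero: "s <= 1 \<or> 2 <= s ==> bump s = 0"
 by (auto simp: bump_def flat_exp_def)

lemma bump_le_1: "bump s <= 1"
 by (auto simp: bump_def flat_exp_def mult_le_one)

section \<open>Radial test functions\<close>

lemma partial_deriv_eq:
 assumes "(f has_derivative f') (at x)"
 shows "partial_deriv i f x = f' (axis i 1)"
proof -
 have "((%t::real. f (x + t *\<^sub>R axis i 1)) has_derivative (%t. f' (t *\<^sub>R axis i 1))) (at 0)"
  by (rule has_derivative_compose[of "%t. x + t *\<^sub>R axis i 1" "%t. t *\<^sub>R axis i 1" 0 UNIV f f'])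
    (use assms in \<open>auto intro!: derivative_eq_intros\<close>)
 moreover have "(%t. f' (t *\<^sub>R axis i 1)) = (*) (f' (axis i 1))"
  using linear_cmul[OF has_derivative_linear[OF assms]] by (auto simp: fun_eq_iff mult.commute)
 ultimately have "((%t::real. f (x + t *\<^sub>R axis i 1)) has_real_derivative f' (axis i 1)) (at 0)"
  by (simp add: has_field_derivative_def)
 then show ?thesis unfolding partial_deriv_def by (rule DERIV_imp_deriv)
qed

lemma C_k_Suc_imp: "C_k (Suc k) f ==> C_k k f"
proof (induction k arbitrary: f)
 case 0
 then show ?case by (auto intro: differentiable_imp_continuous_on)
next
 case (Suc k)
 then show ?case using C_k.simps(2) by blast
qed

lemma C_k_const: "C_k k (%x. c)"
proof (induction k arbitrary: c)
 case (Suc k)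
 have "partial_deriv i (%x. c) = (%x. 0)" for i :: 'a
  by (rule ext, subst partial_deriv_eq[OF has_derivative_const]) simp
 then show ?case using Suc by simp
qed simp

lemma partial_deriv_add:
 assumes "f differentiable_on UNIV" "g differentiable_on UNIV"
 shows "partial_deriv i (%x. f x + g x) = (%x. partial_deriv i f x + partial_deriv i g x)"
proof
 fix x
 obtain f' g' where *: "(f has_derivative f') (at x)" "(g has_derivative g') (at x)"
  using assms unfolding differentiable_on_def differentiable_def by (metis UNIV_I)
 show "partial_deriv i (%x. f x + g x) x = partial_deriv i f x + partial_deriv i g x"
  by (simp add: partial_deriv_eq[OF *(1)] partial_deriv_eq[OF *(2)]
    partial_deriv_eq[OF has_derivative_add[OF *]])
qed

lemma partial_deriv_mult:
 assumes "f differentiable_on UNIV" "g differentiable_on UNIV"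
 shows "partial_deriv i (%x. f x * g x) = (%x. f x * partial_deriv i g x + partial_deriv i f x * g x)"
proof
 fix x
 obtain f' g' where *: "(f has_derivative f') (at x)" "(g has_derivative g') (at x)"
  using assms unfolding differentiable_on_def differentiable_def by (metis UNIV_I)
 show "partial_deriv i (%x. f x * g x) x = f x * partial_deriv i g x + partial_deriv i f x * g x"
  by (simp add: partial_deriv_eq[OF *(1)] partial_deriv_eq[OF *(2)]
    partial_deriv_eq[OF has_derivative_mult[OF *]])
qed

lemma C_k_add: "C_k k f ==> C_k k g ==> C_k k (%x. f x + g x)"
proof (induction k arbitrary: f g)
 case 0
 then show ?case by (auto intro: continuous_intros)
next
 case (Suc k)
 then show ?case by (auto simp: partial_deriv_add)
qed

lemma C_k_mult: "C_k k f ==> C_k k g ==> C_k k (%x. f x * g x)"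
proof (induction k arbitrary: f g)
 case 0
 then show ?case by (auto intro: continuous_intros)
next
 case (Suc k)
 have "C_k k f" "C_k k g" using Suc.prems C_k_Suc_imp by blast+
 with Suc show ?case by (auto simp: partial_deriv_mult intro!: C_k_add differentiable_on_mult)
qed

lemma C_k_coord: "C_k k (%x::real^'n::finite. x $ i - z)"
proof (cases k)
 case (Suc m)
 have d: "((%x::real^'n. x $ i - z) has_derivative (%h. h $ i)) (at x)" for x
  by (auto intro!: derivative_eq_intros bounded_linear.has_derivative[OF bounded_linear_vec_nth])
 have "partial_deriv j (%x::real^'n. x $ i - z) = (%x. axis j 1 $ i)" for j
  by (rule ext, subst partial_deriv_eq[OF d]) simp
 moreover have "(%x::real^'n. x $ i - z) differentiable_on UNIV"
  using d by (auto simp: differentiable_on_def differentiable_def)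
 ultimately show ?thesis using Suc C_k_const by (auto simp: )
qed (auto intro!: continuous_intros)

lemma radial_has_derivative:
 fixes x z :: "real^'n::finite"
 assumes "(h has_real_derivative h') (at ((x - z) \<bullet> (x - z)))"
 shows "((%x. h ((x - z) \<bullet> (x - z))) has_derivative (%v. h' * (2 * ((x - z) \<bullet> v)))) (at x)"
proof -
 have "((%x. (x - z) \<bullet> (x - z)) has_derivative (%v. 2 * ((x - z) \<bullet> v))) (at x)"
  by (auto intro!: derivative_eq_intros simp: inner_commute)
 then show ?thesis
  using has_derivative_compose[where g=h and f="%x. (x - z) \<bullet> (x - z)",
    OF _ assms[unfolded has_field_derivative_def]] by blast
qed

lemma partial_deriv_radial:
 assumes "smooth h"
 shows "partial_deriv i (%x::real^'n::finite. h ((x - z) \<bullet> (x - z))) =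
  (%x. deriv h ((x - z) \<bullet> (x - z)) * (2 * (x $ i - z $ i)))"
 by (rule ext, subst partial_deriv_eq[OF radial_has_derivative[OF smooth_derivD(1)[OF assms]]])
   (simp add: inner_axis)

lemma radial_differentiable:
 "smooth h ==> (%x::real^'n::finite. h ((x - z) \<bullet> (x - z))) differentiable_on UNIV"
 using radial_has_derivative[OF smooth_derivD(1)]
 by (auto simp: differentiable_on_def differentiable_def)

lemma C_k_radial:
 "smooth h ==> C_k k (%x::real^'n::finite. h ((x - z) \<bullet> (x - z)))"
proof (induction k arbitrary: h)
 case 0
 then show ?case using radial_differentiable differentiable_imp_continuous_on by fastforce
next
 case (Suc k)
 have "C_k k (%x::real^'n. deriv h ((x - z) \<bullet> (x - z)) * (2 * (x $ i - z $ i)))" for i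
  by (intro C_k_mult C_k_const C_k_coord Suc.IH smooth_derivD Suc.prems)
 then show ?case using Suc.prems by (simp add: partial_deriv_radial radial_differentiable)
qed

text \<open>Expressed through the squared distance, the radial Laplacian has no coefficient that is
  singular at the centre, in contrast to h'' + (n-1) h'/r. This is why radial functions are
  parametrised by s = |x - z|^2 throughout.\<close>

lemma laplacian_radial:
 fixes z :: "real^'n::finite"
 assumes "smooth h"
 shows "laplacian (%x. h ((x - z) \<bullet> (x - z))) x =
  4 * ((x - z) \<bullet> (x - z)) * deriv (deriv h) ((x - z) \<bullet> (x - z)) +
  2 * real CARD('n) * deriv h ((x - z) \<bullet> (x - z))"
proof -
 let ?s = "(x - z) \<bullet> (x - z)"
 have "partial_deriv i (partial_deriv i (%x. h ((x - z) \<bullet> (x - z)))) x =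
   4 * deriv (deriv h) ?s * (x $ i - z $ i)\<^sup>2 + 2 * deriv h ?s" for i
 proof -
  have d: "((%x. deriv h ((x - z) \<bullet> (x - z)) * (2 * (x $ i - z $ i))) has_derivative
   (%v. deriv h ?s * (2 * v $ i) + deriv (deriv h) ?s * (2 * ((x - z) \<bullet> v)) * (2 * (x $ i - z $ i)))) (at x)"
   by (rule has_derivative_mult[OF radial_has_derivative[OF smooth_derivD(1)[OF smooth_derivD(2)[OF assms]]]])
     (auto intro!: derivative_eq_intros bounded_linear.has_derivative[OF bounded_linear_vec_nth])
  show ?thesis
   unfolding partial_deriv_radial[OF assms] partial_deriv_eq[OF d]
   by (simp add: inner_axis power2_eq_square) (simp add: algebra_simps)
 qed
 then have "laplacian (%x. h ((x - z) \<bullet> (x - z))) x =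
   4 * deriv (deriv h) ?s * (\<Sum>i\<in>UNIV. (x $ i - z $ i)\<^sup>2) + 2 * real CARD('n) * deriv h ?s"
  by (simp add: laplacian_def sum.distrib sum_distrib_left)
 moreover have "(\<Sum>i\<in>UNIV. (x $ i - z $ i)\<^sup>2) = ?s"
  by (simp add: inner_vec_def power2_eq_square)
 ultimately show ?thesis by (simp add: algebra_simps)
qed

lemma test_function_radial:
 fixes z :: "real^'n::finite"
 assumes "smooth h" "\<And>s. s >= S ==> h s = 0"
 shows "test_function (%x. h ((x - z) \<bullet> (x - z)))"
proof -
 have "{x. h ((x - z) \<bullet> (x - z)) \<noteq> 0} \<subseteq> cball z (sqrt (max 0 S))"
 proof
  fix x assume "x \<in> {x. h ((x - z) \<bullet> (x - z)) \<noteq> 0}"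
  then have "(x - z) \<bullet> (x - z) < S" using assms(2) not_le by blast
  then have "sqrt ((x - z) \<bullet> (x - z)) <= sqrt (max 0 S)" by (intro real_sqrt_le_mono) auto
  then show "x \<in> cball z (sqrt (max 0 S))" by (simp add: dist_norm norm_minus_commute[of z x] norm_eq_sqrt_inner[of "x - z"])
 qed
 then have "compact (closure {x. h ((x - z) \<bullet> (x - z)) \<noteq> 0})"
  by (meson bounded_cball bounded_subset compact_closure)
 then show ?thesis unfolding test_function_def by (intro conjI allI C_k_radial assms(1))
qed

section \<open>Mollification\<close>

lemma integrable_shift:
 fixes f :: "'a::euclidean_space => real"
 assumes "integrable lborel f"
 shows "integrable lborel (%x. f (x + h))"
proof -
 have "integrable (distr lborel borel ((+) h)) f" using assms by (simp add: lborel_distr_plus)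
 then have "integrable lborel (%x. f (h + x))"
  by (rule integrable_distr[rotated]) simp
 then show ?thesis by (simp add: add.commute)
qed

lemma integral_shift:
 fixes f :: "'a::euclidean_space => real"
 assumes [measurable]: "f \<in> bmeas"
 shows "(LINT x|lborel. f (x + h)) = (LINT x|lborel. f x)"
proof -
 have "(LINT x|lborel. f x) = (LINT x|distr lborel borel ((+) h). f x)" by (simp add: lborel_distr_plus)
 also have "\<dots> = (LINT x|lborel. f (h + x))" by (rule integral_distr) auto
 finally show ?thesis by (simp add: add.commute)
qed

lemma nn_integral_shift:
 fixes f :: "'a::euclidean_space => ennreal"
 assumes [measurable]: "f \<in> bmeas"
 shows "(\<integral>\<^sup>+x. f (x + h) \<partial>lborel) = (\<integral>\<^sup>+x. f x \<partial>lborel)"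
proof -
 have "(\<integral>\<^sup>+x. f x \<partial>lborel) = (\<integral>\<^sup>+x. f x \<partial>distr lborel borel ((+) h))" by (simp add: lborel_distr_plus)
 also have "\<dots> = (\<integral>\<^sup>+x. f (h + x) \<partial>lborel)" by (rule nn_integral_distr) auto
 finally show ?thesis by (simp add: add.commute)
qed

section \<open>Continuity of translations in L^1\<close>

abbreviation L1_translation_continuous :: "('a::euclidean_space => real) => bool" where
 "L1_translation_continuous f \<equiv>
   (\<forall>e>0. \<exists>d>0. \<forall>h. norm h < d --> (LINT x|lborel. \<bar>f (x + h) - f x\<bar>) < e)"

text \<open>Closure under L^1 limits: an epsilon/3 argument in which translation invariance makes
  the two approximation errors equal.\<close>

lemma L1_translation_continuous_approx:
 fixes f :: "'a::euclidean_space => real"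
 assumes f: "integrable lborel f"
  and ap: "\<And>e. e > 0 ==> \<exists>g. integrable lborel g \<and> L1_translation_continuous g \<and> (LINT x|lborel. \<bar>f x - g x\<bar>) < e"
 shows "L1_translation_continuous f"
proof (intro allI impI)
 fix e :: real assume "e > 0"
 then obtain g where g: "integrable lborel g" "L1_translation_continuous g" "(LINT x|lborel. \<bar>f x - g x\<bar>) < e/3"
  using ap[of "e/3"] by auto
 obtain d where d: "d > 0" "\<And>h. norm h < d ==> (LINT x|lborel. \<bar>g (x + h) - g x\<bar>) < e/3"
  using g(2)[rule_format, of "e/3"] \<open>e > 0\<close> by auto
 show "\<exists>d>0. \<forall>h. norm h < d --> (LINT x|lborel. \<bar>f (x + h) - f x\<bar>) < e"
 proof (intro exI conjI allI impI)
  fix h :: 'a assume h: "norm h < d"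
  note int = f g(1) integrable_shift[OF f, of h] integrable_shift[OF g(1), of h]
  have "(LINT x|lborel. \<bar>f (x + h) - f x\<bar>) <=
   (LINT x|lborel. \<bar>f (x + h) - g (x + h)\<bar> + \<bar>g (x + h) - g x\<bar> + \<bar>f x - g x\<bar>)"
   by (intro integral_mono) (use int in auto)
  also have "\<dots> = (LINT x|lborel. \<bar>f (x + h) - g (x + h)\<bar>) + (LINT x|lborel. \<bar>g (x + h) - g x\<bar>) + (LINT x|lborel. \<bar>f x - g x\<bar>)"
   using int by simp
  also have "(LINT x|lborel. \<bar>f (x + h) - g (x + h)\<bar>) = (LINT x|lborel. \<bar>f x - g x\<bar>)"
   using f g(1) by (intro integral_shift[of "%x. \<bar>f x - g x\<bar>"]) auto
  finally show "(LINT x|lborel. \<bar>f (x + h) - f x\<bar>) < e" using d(2)[OF h] g(3) by simp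
 qed (use d in auto)
qed

lemma L1_translation_continuous_add:
 fixes f g :: "'a::euclidean_space => real"
 assumes f: "integrable lborel f" "L1_translation_continuous f"
  and g: "integrable lborel g" "L1_translation_continuous g"
 shows "L1_translation_continuous (%x. f x + c * g x)"
proof (intro allI impI)
 fix e :: real assume "e > 0"
 obtain d1 where d1: "d1 > 0" "\<And>h. norm h < d1 ==> (LINT x|lborel. \<bar>f (x + h) - f x\<bar>) < e/2"
  using f(2)[rule_format, of "e/2"] \<open>e > 0\<close> by auto
 have "e / (2 * (1 + \<bar>c\<bar>)) > 0" using \<open>e > 0\<close> by (simp add: add_pos_nonneg)
 then obtain d2 where d2: "d2 > 0" "\<And>h. norm h < d2 ==> (LINT x|lborel. \<bar>g (x + h) - g x\<bar>) < e / (2 * (1 + \<bar>c\<bar>))"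
  using g(2)[rule_format, of "e / (2 * (1 + \<bar>c\<bar>))"] by auto
 show "\<exists>d>0. \<forall>h. norm h < d --> (LINT x|lborel. \<bar>f (x + h) + c * g (x + h) - (f x + c * g x)\<bar>) < e"
 proof (intro exI[of _ "min d1 d2"] conjI allI impI)
  fix h :: 'a assume h: "norm h < min d1 d2"
  note int = f(1) g(1) integrable_shift[OF f(1), of h] integrable_shift[OF g(1), of h]
  have "(LINT x|lborel. \<bar>f (x + h) + c * g (x + h) - (f x + c * g x)\<bar>) <=
   (LINT x|lborel. \<bar>f (x + h) - f x\<bar> + \<bar>c\<bar> * \<bar>g (x + h) - g x\<bar>)"
  proof (intro integral_mono)
   fix x show "\<bar>f (x + h) + c * g (x + h) - (f x + c * g x)\<bar> <= \<bar>f (x + h) - f x\<bar> + \<bar>c\<bar> * \<bar>g (x + h) - g x\<bar>"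
    using abs_triangle_ineq[of "f (x + h) - f x" "c * (g (x + h) - g x)"]
    by (simp only: abs_mult[symmetric]) (simp add: algebra_simps)
  qed (use int in auto)
  also have "\<dots> = (LINT x|lborel. \<bar>f (x + h) - f x\<bar>) + \<bar>c\<bar> * (LINT x|lborel. \<bar>g (x + h) - g x\<bar>)"
   using int by simp
  also have "\<dots> <= (LINT x|lborel. \<bar>f (x + h) - f x\<bar>) + (1 + \<bar>c\<bar>) * (LINT x|lborel. \<bar>g (x + h) - g x\<bar>)"
   by (simp add: mult_right_mono)
  also have "\<dots> < e / 2 + (1 + \<bar>c\<bar>) * (e / (2 * (1 + \<bar>c\<bar>)))"
   by (intro add_strict_mono mult_strict_left_mono d1 d2) (use h in \<open>auto simp: add_pos_nonneg\<close>)
  also have "\<dots> = e" by (simp add: field_simps)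
  finally show "(LINT x|lborel. \<bar>f (x + h) + c * g (x + h) - (f x + c * g x)\<bar>) < e" .
 qed (use d1 d2 in auto)
qed

text \<open>A point off the boundary keeps its membership under small shifts, and the boundary is
  null. Dominated convergence along a sequence of violating shifts gives the contradiction.\<close>

lemma L1_translation_continuous_box:
 fixes a b :: "'a::euclidean_space"
 shows "L1_translation_continuous (indicator (box a b) :: 'a => real)"
proof (rule ccontr)
 let ?f = "indicator (box a b) :: 'a => real"
 assume "\<not> L1_translation_continuous ?f"
 then obtain e where e: "e > 0"
  and ne: "\<not> (\<exists>d>0. \<forall>h. norm h < d --> (LINT x|lborel. \<bar>?f (x + h) - ?f x\<bar>) < e)" by auto
 have "\<exists>h. norm h < 1 / (real k + 1) \<and> (LINT x|lborel. \<bar>?f (x + h) - ?f x\<bar>) >= e" for k :: nat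
 proof (rule ccontr)
  assume "\<nexists>h. norm h < 1 / (real k + 1) \<and> (LINT x|lborel. \<bar>?f (x + h) - ?f x\<bar>) >= e"
  then have "1 / (real k + 1) > 0 \<and> (\<forall>h. norm h < 1 / (real k + 1) --> (LINT x|lborel. \<bar>?f (x + h) - ?f x\<bar>) < e)"
   by (simp add: not_le)
  then show False using ne by blast
 qed
 then have "\<exists>h. \<forall>k. norm (h k) < 1 / (real k + 1) \<and> (LINT x|lborel. \<bar>?f (x + h k) - ?f x\<bar>) >= e"
  by (intro choice allI)
 then obtain h where h: "\<And>k. norm (h k) < 1 / (real k + 1)" "\<And>k. (LINT x|lborel. \<bar>?f (x + h k) - ?f x\<bar>) >= e"
  by auto
 have h0: "h \<longlonglongrightarrow> 0"
 proof (rule tendsto_norm_zero_cancel, rule tendsto_sandwich[where f="%_. 0" and h="%k. 1 / (real k + 1)"])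
  show "(%k. 1 / (real k + 1)) \<longlonglongrightarrow> 0" by real_asymp
 qed (auto intro!: always_eventually less_imp_le[OF h(1)])
 have "(%k. LINT x|lborel. \<bar>?f (x + h k) - ?f x\<bar>) \<longlonglongrightarrow> (LINT x|(lborel :: 'a measure). 0)"
 proof (rule integral_dominated_convergence[where w="indicator (cbox (a - One) (b + One))"])
  have null: "AE x in lborel. x \<notin> cbox a b - box a b"
  proof (rule AE_not_in)
   have "emeasure lborel (cbox a b - box a b) = emeasure lborel (cbox a b) - emeasure lborel (box a b)"
    by (rule emeasure_Diff) (auto simp: emeasure_lborel_box_eq box_subset_cbox)
   also have "\<dots> = 0" by (simp add: emeasure_lborel_box_eq emeasure_lborel_cbox_eq)
   finally show "cbox a b - box a b \<in> null_sets lborel" by (simp add: null_sets_def)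
  qed
  show "AE x in lborel. (%k. \<bar>?f (x + h k) - ?f x\<bar>) \<longlonglongrightarrow> 0"
   using null
  proof eventually_elim
   case (elim x)
   have lim: "(%k. x + h k) \<longlonglongrightarrow> x" using tendsto_add[OF tendsto_const h0, of x] by simp
   have "x \<in> box a b \<or> x \<in> - cbox a b" using elim by auto
   then have "\<forall>\<^sub>F k in sequentially. ?f (x + h k) = ?f x"
   proof
    assume "x \<in> box a b"
    then have "\<forall>\<^sub>F k in sequentially. x + h k \<in> box a b"
     by (intro topological_tendstoD[OF lim]) auto
    then show ?thesis using \<open>x \<in> box a b\<close> by (auto elim!: eventually_mono simp: indicator_def)
   next
    assume "x \<in> - cbox a b"
    then have "\<forall>\<^sub>F k in sequentially. x + h k \<in> - cbox a b"
     by (intro topological_tendstoD[OF lim]) (auto simp: open_Compl)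
    then show ?thesis using \<open>x \<in> - cbox a b\<close> box_subset_cbox[of a b] by (auto elim!: eventually_mono simp: indicator_def)
   qed
   then show ?case by (intro tendsto_eventually) (auto elim: eventually_mono)
  qed
  show "AE x in lborel. norm \<bar>?f (x + h k) - ?f x\<bar> <= indicator (cbox (a - One) (b + One)) x" for k
  proof (rule AE_I2)
   fix x
   have hb: "\<bar>h k \<bullet> i\<bar> <= 1" if "i \<in> Basis" for i
    
  proof -
   have "1 / (real k + 1) <= 1" by simp
   then show ?thesis using Basis_le_norm[OF that, of "h k"] h(1)[of k] by linarith
  qed
   have "x \<in> cbox (a - One) (b + One)" if "x + h k \<in> box a b \<or> x \<in> box a b"
    unfolding mem_box
   proof
    fix i :: 'a assume i: "i \<in> Basis"
    show "(a - One) \<bullet> i <= x \<bullet> i \<and> x \<bullet> i <= (b + One) \<bullet> i"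
    proof -
     have "(a \<bullet> i < x \<bullet> i + h k \<bullet> i \<and> x \<bullet> i + h k \<bullet> i < b \<bullet> i) \<or> (a \<bullet> i < x \<bullet> i \<and> x \<bullet> i < b \<bullet> i)"
      using that i by (auto simp: mem_box inner_add_left)
     then show ?thesis using hb[OF i] i by (auto simp: inner_diff_left inner_add_left)
    qed
   qed
   then show "norm \<bar>?f (x + h k) - ?f x\<bar> <= indicator (cbox (a - One) (b + One)) x"
    by (auto simp: indicator_def)
  qed
 qed (auto intro!: integrable_real_indicator simp: emeasure_lborel_cbox_eq)
 then have "(%k. LINT x|lborel. \<bar>?f (x + h k) - ?f x\<bar>) \<longlonglongrightarrow> 0" by simp
 from LIMSEQ_le_const[OF this, of e] h(2) e(1) show False by auto
qed

text \<open>A Dynkin argument over the boxes. The intersection with a fixed box keeps all measures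
  finite, so that a complement becomes a difference of two integrable indicators.\<close>

lemma L1_translation_continuous_bounded_set:
 fixes A :: "'a::euclidean_space set"
 assumes "A \<in> sets borel"
 shows "L1_translation_continuous (indicator (A \<inter> box a b) :: 'a => real)"
proof -
 have sb: "sigma_sets UNIV (range (%(a, b). box a b :: 'a set)) = sets borel" by (simp add: borel_eq_box)
 have "Int_stable (range (%(a, b). box a b :: 'a set))"
  unfolding Int_stable_def
 proof (intro ballI)
  fix A B :: "'a set" assume "A \<in> range (%(a, b). box a b)" "B \<in> range (%(a, b). box a b)"
  then obtain a b c d where "A = box a b" "B = box c d" by auto
  then have "A \<inter> B = (%(a, b). box a b) (\<Sum>i\<in>Basis. max (a \<bullet> i) (c \<bullet> i) *\<^sub>R i, \<Sum>i\<in>Basis. min (b \<bullet> i) (d \<bullet> i) *\<^sub>R i)"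
   by (simp add: box_Int_box)
  then show "A \<inter> B \<in> range (%(a, b). box a b)" by (rule range_eqI)
 qed
 moreover have "range (%(a, b). box a b :: 'a set) \<subseteq> Pow UNIV" by simp
 moreover have "A \<in> sigma_sets UNIV (range (%(a, b). box a b))"
  using assms by (simp only: sb)
 ultimately show ?thesis
 proof (induction A rule: sigma_sets_induct_disjoint[consumes 3, case_names basic empty compl union])
  case (basic A)
  then obtain c d where "A = box c d" by auto
  then show ?case using L1_translation_continuous_box by (simp only: box_Int_box)
 next
  case empty
  then show ?case by (auto intro!: exI[of _ "1::real"])
 next
  case (compl A)
  have A: "A \<in> sets borel" using compl(1) by (simp only: sb)
  have i1: "integrable lborel (indicator (box a b) :: 'a => real)"
   by (auto intro!: integrable_real_indicator simp: emeasure_lborel_box_eq)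
  have "emeasure lborel (A \<inter> box a b) <= emeasure lborel (box a b)" by (rule emeasure_mono) auto
  also have "\<dots> < \<infinity>" by (auto simp: emeasure_lborel_box_eq)
  finally have i2: "integrable lborel (indicator (A \<inter> box a b) :: 'a => real)"
   using A by (intro integrable_real_indicator) auto
  have "indicator ((UNIV - A) \<inter> box a b) = (%x. indicator (box a b) x + (-1) * indicator (A \<inter> box a b) x :: real)"
   by (auto simp: indicator_def fun_eq_iff)
  then show ?case
   using L1_translation_continuous_add[OF i1 L1_translation_continuous_box i2 compl(2), of "-1"] by simp
 next
  case (union A)
  have A: "A i \<in> sets borel" for i using union(2) by (auto simp only: sb)
  have fin: "emeasure lborel (B \<inter> box a b) < \<infinity>" for B
  proof -
   have "emeasure lborel (B \<inter> box a b) <= emeasure lborel (box a b)" by (rule emeasure_mono) auto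
   also have "\<dots> < \<infinity>" by (auto simp: emeasure_lborel_box_eq)
   finally show ?thesis .
  qed
  have int: "integrable lborel (indicator (B \<inter> box a b) :: 'a => real)" if "B \<in> sets borel" for B
   using that fin by (intro integrable_real_indicator) auto
  have UA: "\<Union> (range A) \<in> sets borel" using A by auto
  have part: "integrable lborel (%x. \<Sum>i<k. indicator (A i \<inter> box a b) x :: real) \<and>
    L1_translation_continuous (%x. \<Sum>i<k. indicator (A i \<inter> box a b) x :: real)" for k :: nat
  proof (induction k)
   case 0
   then show ?case by (auto intro!: exI[of _ "1::real"])
  next
   case (Suc k)
   then show ?case
    using L1_translation_continuous_add[of "%x. \<Sum>i<k. indicator (A i \<inter> box a b) x" "indicator (A k \<inter> box a b)" 1]
     union(3)[of k] int[OF A] by simp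
  qed
  show ?case
  proof (rule L1_translation_continuous_approx[OF int[OF UA]])
   fix e :: real assume "e > 0"
   have "(%k. LINT x|lborel. \<bar>indicator (\<Union> (range A) \<inter> box a b) x - (\<Sum>i<k. indicator (A i \<inter> box a b) x :: real)\<bar>)
     \<longlonglongrightarrow> (LINT x|(lborel :: 'a measure). 0)"
   proof (rule integral_dominated_convergence[where w="indicator (box a b)"])
    have sumeq: "(\<Sum>i<k. indicator (A i \<inter> box a b) x :: real) = indicator ((\<Union>i<k. A i) \<inter> box a b) x" for k :: nat and x
    proof -
     have "(\<Sum>i<k. indicator (A i) x :: real) = indicator (\<Union>i<k. A i) x"
      using union(1) by (intro indicator_UN_disjoint[symmetric]) (auto intro: disjoint_family_on_mono)
     then show ?thesis by (simp add: indicator_inter_arith sum_distrib_right[symmetric])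
    qed
    show "AE x in lborel. (%k. \<bar>indicator (\<Union> (range A) \<inter> box a b) x - (\<Sum>i<k. indicator (A i \<inter> box a b) x :: real)\<bar>) \<longlonglongrightarrow> 0"
    proof (rule AE_I2)
     fix x
     have "\<forall>\<^sub>F k in sequentially. indicator (\<Union> (range A) \<inter> box a b) x = (indicator ((\<Union>i<k. A i) \<inter> box a b) x :: real)"
     proof (cases "\<exists>i. x \<in> A i")
      case True
      then obtain i where "x \<in> A i" by auto
      then show ?thesis
       by (intro eventually_sequentiallyI[of "Suc i"]) (auto simp: indicator_def)
     qed (auto simp: indicator_def)
     then show "(%k. \<bar>indicator (\<Union> (range A) \<inter> box a b) x - (\<Sum>i<k. indicator (A i \<inter> box a b) x :: real)\<bar>) \<longlonglongrightarrow> 0"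
      unfolding sumeq by (intro tendsto_eventually) (auto elim: eventually_mono)
    qed
    show "AE x in lborel. norm \<bar>indicator (\<Union> (range A) \<inter> box a b) x - (\<Sum>i<k. indicator (A i \<inter> box a b) x :: real)\<bar> <= indicator (box a b) x" for k
     unfolding sumeq by (auto simp: indicator_def)
    show "(%x. \<bar>indicator (\<Union> (range A) \<inter> box a b) x - (\<Sum>i<k. indicator (A i \<inter> box a b) x :: real)\<bar>) \<in> borel_measurable lborel" for k
     by (intro borel_measurable_abs borel_measurable_diff borel_measurable_sum borel_measurable_indicator) (use A UA in auto)
   qed (auto intro!: integrable_real_indicator simp: emeasure_lborel_box_eq)
   then have "\<forall>\<^sub>F k in sequentially. (LINT x|lborel. \<bar>indicator (\<Union> (range A) \<inter> box a b) x - (\<Sum>i<k. indicator (A i \<inter> box a b) x :: real)\<bar>) < e"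
    using \<open>e > 0\<close> by (simp add: order_tendstoD(2))
   then obtain k where "(LINT x|lborel. \<bar>indicator (\<Union> (range A) \<inter> box a b) x - (\<Sum>i<k. indicator (A i \<inter> box a b) x :: real)\<bar>) < e"
    by (auto simp: eventually_sequentially)
   then show "\<exists>g. integrable lborel g \<and> L1_translation_continuous g \<and> (LINT x|lborel. \<bar>indicator (\<Union> (range A) \<inter> box a b) x - g x\<bar>) < e"
    using part[of k] by (intro exI[of _ "%x. \<Sum>i<k. indicator (A i \<inter> box a b) x"]) auto
  qed
 qed
qed

lemma L1_translation_continuous:
 fixes f :: "'a::euclidean_space => real"
 assumes "integrable lborel f"
 shows "L1_translation_continuous f"
 using assms
proof (induction f rule: integrable_induct)
 case (base A c)
 have A: "A \<in> sets borel" using base by simp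
 have int: "integrable lborel (indicator B :: 'a => real)" if "B \<in> sets borel" "B \<subseteq> A" for B
 proof (intro integrable_real_indicator)
  have "emeasure lborel B <= emeasure lborel A" using that A by (intro emeasure_mono) auto
  then show "emeasure lborel B < \<infinity>" using base(2) by (rule le_less_trans)
 qed (use that in simp)
 have *: "L1_translation_continuous (indicator A :: 'a => real)"
 proof (rule L1_translation_continuous_approx)
  fix e :: real assume "e > 0"
  let ?B = "%k::nat. box (- (real k *\<^sub>R One)) (real k *\<^sub>R One) :: 'a set"
  have "(%k. LINT x|lborel. \<bar>indicator A x - indicator (A \<inter> ?B k) x :: real\<bar>) \<longlonglongrightarrow> (LINT x|(lborel :: 'a measure). 0)"
  proof (rule integral_dominated_convergence[where w="indicator A"])
   show "AE x in lborel. (%k. \<bar>indicator A x - indicator (A \<inter> ?B k) x :: real\<bar>) \<longlonglongrightarrow> 0"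
   proof (rule AE_I2)
    fix x :: 'a
    have "x \<in> \<Union> (range ?B)" unfolding UN_box_eq_UNIV by simp
    then obtain k0 where k0: "x \<in> ?B k0" by auto
    have "x \<in> ?B k" if "k >= k0" for k
    proof -
     have "?B k0 \<subseteq> ?B k" by (rule subset_box_imp) (use that in \<open>auto simp: inner_simps\<close>)
     then show ?thesis using k0 by auto
    qed
    then show "(%k. \<bar>indicator A x - indicator (A \<inter> ?B k) x :: real\<bar>) \<longlonglongrightarrow> 0"
     by (intro tendsto_eventually eventually_sequentiallyI[of k0]) (auto simp: indicator_def)
   qed
  qed (use A in \<open>auto intro!: int simp: indicator_def\<close>)
  then have "\<forall>\<^sub>F k in sequentially. (LINT x|lborel. \<bar>indicator A x - indicator (A \<inter> ?B k) x :: real\<bar>) < e"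
    using \<open>e > 0\<close> by (simp add: order_tendstoD(2))
  then obtain k where "(LINT x|lborel. \<bar>indicator A x - indicator (A \<inter> ?B k) x :: real\<bar>) < e"
    by (auto simp: eventually_sequentially)
  then show "\<exists>g. integrable lborel g \<and> L1_translation_continuous g \<and> (LINT x|lborel. \<bar>indicator A x - g x\<bar>) < e"
   using L1_translation_continuous_bounded_set[OF A, of "- (real k *\<^sub>R One)" "real k *\<^sub>R One"] int[of "A \<inter> ?B k"] A
   by (intro exI[of _ "indicator (A \<inter> ?B k)"]) auto
 qed (use int A in auto)
 have "L1_translation_continuous (%x. 0 + c * indicator A x)"
  by (rule L1_translation_continuous_add[OF _ _ int *]) (use A in \<open>auto intro!: exI[of _ "1::real"]\<close>)
 then show ?case by (simp add: mult.commute)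
next
 case (add f g)
 then show ?case using L1_translation_continuous_add[of f g 1] by simp
next
 case (lim f s)
 show ?case
 proof (rule L1_translation_continuous_approx[OF lim(4)])
  fix e :: real assume "e > 0"
  have "(%k. LINT x|lborel. \<bar>f x - s k x\<bar>) \<longlonglongrightarrow> (LINT x|(lborel :: 'a measure). 0)"
  \<comment> \<open>The approximants satisfy |s k x| <= 2 |f x|, whence the factor 3.\<close>
  proof (rule integral_dominated_convergence[where w="%x. 3 * \<bar>f x\<bar>"])
   show "AE x in lborel. (%k. \<bar>f x - s k x\<bar>) \<longlonglongrightarrow> 0"
    proof (rule AE_I2)
    fix x :: 'a
    have "(%k. f x - s k x) \<longlonglongrightarrow> f x - f x"
     by (intro tendsto_diff tendsto_const lim(2)) simp
    then show "(%k. \<bar>f x - s k x\<bar>) \<longlonglongrightarrow> 0" by (intro tendsto_rabs_zero) simp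
   qed
   show "AE x in lborel. norm \<bar>f x - s k x\<bar> <= 3 * \<bar>f x\<bar>" for k
   proof (rule AE_I2)
    fix x show "norm \<bar>f x - s k x\<bar> <= 3 * \<bar>f x\<bar>" using lim(3)[of x k] by (simp add: )
   qed
  qed (use lim in auto)
  then have "\<forall>\<^sub>F k in sequentially. (LINT x|lborel. \<bar>f x - s k x\<bar>) < e"
    using \<open>e > 0\<close> by (simp add: order_tendstoD(2))
  then obtain k where "(LINT x|lborel. \<bar>f x - s k x\<bar>) < e"
    by (auto simp: eventually_sequentially)
  then show "\<exists>g. integrable lborel g \<and> L1_translation_continuous g \<and> (LINT x|lborel. \<bar>f x - g x\<bar>) < e"
   using lim(1,5) by (intro exI[of _ "s k"]) auto
 qed
qed

section \<open>Local integrability and approximate identities\<close>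

definition locint :: "('a::euclidean_space => real) => bool" where
 "locint f \<longleftrightarrow> f \<in> bmeas \<and> (\<forall>R. integrable lborel (%x. indicator (ball 0 R) x * f x))"

lemma locint_measurable: "locint f ==> f \<in> bmeas"
 by (simp add: locint_def)

lemma locint_cmult: "locint f ==> locint (%x. c * f x)"
 unfolding locint_def by (auto simp: mult.left_commute[of _ c])

lemma locint_add: "locint f ==> locint g ==> locint (%x. f x + g x)"
 unfolding locint_def by (auto simp: distrib_left)

lemma locint_continuous:
 fixes f :: "'a::euclidean_space => real"
 assumes "continuous_on UNIV f" shows "locint f"
 unfolding locint_def
proof (intro conjI allI)
 show f: "f \<in> bmeas" using assms by (rule borel_measurable_continuous_onI)
 fix R
 have "integrable lborel (%x. indicator (cball 0 R) x *\<^sub>R f x)"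
  by (rule borel_integrable_compact) (use assms continuous_on_subset in auto)
 then have "integrable lborel (%x. indicator (ball 0 R) x *\<^sub>R (indicator (cball 0 R) x *\<^sub>R f x))"
  by (rule integrable_mult_indicator[rotated]) simp
 moreover have "(%x. indicator (ball 0 R) x *\<^sub>R (indicator (cball 0 R) x *\<^sub>R f x)) = (%x. indicator (ball 0 R) x * f x)"
  by (auto simp: indicator_def fun_eq_iff)
 ultimately show "integrable lborel (%x. indicator (ball 0 R) x * f x)" by simp
qed

lemma locint_mult_compact:
 fixes f w :: "'a::euclidean_space => real"
 assumes f: "locint f" and [measurable]: "w \<in> bmeas"
  and M: "\<And>x. \<bar>w x\<bar> <= M" and R: "\<And>x. norm x >= R ==> w x = 0"
 shows "integrable lborel (%x. f x * w x)"
proof -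
 have [measurable]: "f \<in> bmeas" using f by (rule locint_measurable)
 have i: "integrable lborel (%x. M * (indicator (ball 0 R) x * f x))"
  using f unfolding locint_def by auto
 show ?thesis
 proof (rule Bochner_Integration.integrable_bound[OF i])
  show "AE x in lborel. norm (f x * w x) <= norm (M * (indicator (ball 0 R) x * f x))"
  proof (rule AE_I2)
   fix x
   show "norm (f x * w x) <= norm (M * (indicator (ball 0 R) x * f x))"
   proof (cases "norm x < R")
    case True
    have "\<bar>f x\<bar> * \<bar>w x\<bar> <= \<bar>f x\<bar> * \<bar>M\<bar>" using M[of x] by (intro mult_left_mono) auto
    then show ?thesis using True by (simp add: abs_mult mult.commute)
   next
    case False
    then show ?thesis using R[of x] by simp
   qed
  qed
 qed auto
qed

lemma locint_shift:
 fixes f :: "'a::euclidean_space => real"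
 assumes "locint f" shows "locint (%x. f (z + x))"
 unfolding locint_def
proof (intro conjI allI)
 have [measurable]: "f \<in> bmeas" using assms by (rule locint_measurable)
 show "(%x. f (z + x)) \<in> bmeas" by measurable
 fix R
 have "integrable lborel (%x. f x * indicator (ball z R) x)"
 proof (rule locint_mult_compact[OF assms, of _ 1 "norm z + R"])
  fix x :: 'a assume "norm x >= norm z + R"
  then have "\<not> dist z x < R" using norm_triangle_ineq[of z "x - z"] by (simp add: dist_norm norm_minus_commute)
  then show "indicator (ball z R) x = (0::real)" by simp
 qed (auto simp: indicator_def)
 from integrable_shift[OF this, of z]
 have "integrable lborel (%x. f (x + z) * indicator (ball z R) (x + z))" .
 moreover have "(%x. f (x + z) * indicator (ball z R) (x + z)) = (%x. indicator (ball 0 R) x * f (z + x))"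
  by (auto simp: fun_eq_iff indicator_def dist_norm add.commute)
 ultimately show "integrable lborel (%x. indicator (ball 0 R) x * f (z + x))" by simp
qed

lemma bounded_support_integrable:
 fixes w :: "'a::euclidean_space => real"
 assumes [measurable]: "w \<in> bmeas"
  and M: "\<And>x. \<bar>w x\<bar> <= M" and R: "\<And>x. norm x >= R ==> w x = 0"
 shows "integrable lborel w"
proof -
 have "locint (%x::'a. 1)" by (rule locint_continuous) simp
 from locint_mult_compact[OF this assms] show ?thesis by simp
qed

text \<open>Continuity of translations yields L^1 convergence of the averages, hence convergence
  almost everywhere along a subsequence. The kernel \<open>rho\<close> is not normalised, so its
  integral stays as a factor; the subsequence depends on the radius \<open>R\<close>.\<close>

lemma mollifier_AE:
 fixes f rho :: "'a::euclidean_space => real"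
 assumes f: "locint f" and [measurable]: "rho \<in> bmeas"
  and M: "\<And>x. \<bar>rho x\<bar> <= M" and r0: "\<And>x. norm x >= r0 ==> rho x = 0" "r0 > 0"
 shows "\<exists>r. strict_mono r \<and> (AE z in lborel. norm z < R -->
  (%k. LINT y|lborel. f (z + (1 / (real (r k) + 1)) *\<^sub>R y) * rho y) \<longlonglongrightarrow> f z * (LINT y|lborel. rho y))"
proof -
 have [measurable]: "f \<in> bmeas" using f by (rule locint_measurable)
 \<comment> \<open>For |z| < R and |y| < r0 the points z + e_k y stay in the ball of radius
   \<open>R + r0\<close>, because the scales e_k are at most 1; there \<open>g\<close> and
   \<open>f\<close> agree.\<close>
 define g where "g = (%x. indicator (ball 0 (R + r0)) x * f x)"
 have g: "integrable lborel g" using f unfolding g_def locint_def by auto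
 have [measurable]: "g \<in> bmeas"
  using borel_measurable_integrable[OF g] by simp
 define e where "e k = 1 / (real k + 1)" for k :: nat
 have e: "e k > 0" "e k <= 1" for k by (auto simp: e_def)
 have rhoi: "integrable lborel rho" by (rule bounded_support_integrable[OF _ M r0(1)]) auto
 define H where "H k = (%(y, z). (g (z + e k *\<^sub>R y) - g z) * rho y)" for k
 define t where "t h = (LINT x|lborel. \<bar>g (x + h) - g x\<bar>)" for h
 have [measurable]: "H k \<in> borel_measurable (lborel \<Otimes>\<^sub>M lborel)" for k unfolding H_def by measurable
 have absint: "(LINT z|lborel. norm (H k (y, z))) = \<bar>rho y\<bar> * t (e k *\<^sub>R y)" for k y
  by (simp add: H_def t_def abs_mult mult.commute)
 have [measurable]: "(%y. LINT z|lborel. norm (H k (y, z))) \<in> borel_measurable lborel" for k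
  by measurable
 have tb: "0 <= t h \<and> t h <= 2 * (LINT x|lborel. \<bar>g x\<bar>)" for h
 proof
  show "0 <= t h" unfolding t_def by simp
  have "t h <= (LINT x|lborel. \<bar>g (x + h)\<bar> + \<bar>g x\<bar>)"
   unfolding t_def by (intro integral_mono) (use g integrable_shift[OF g] in auto)
  also have "\<dots> = (LINT x|lborel. \<bar>g (x + h)\<bar>) + (LINT x|lborel. \<bar>g x\<bar>)"
   using g integrable_shift[OF g] by simp
  also have "(LINT x|lborel. \<bar>g (x + h)\<bar>) = (LINT x|lborel. \<bar>g x\<bar>)"
   by (rule integral_shift[of "%x. \<bar>g x\<bar>"]) measurable
  finally show "t h <= 2 * (LINT x|lborel. \<bar>g x\<bar>)" by simp
 qed
 have Hi1: "integrable lborel (%y. LINT z|lborel. norm (H k (y, z)))" for k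
 proof (rule Bochner_Integration.integrable_bound)
  show "integrable lborel (%y. \<bar>rho y\<bar> * (2 * (LINT x|lborel. \<bar>g x\<bar>)))" using rhoi by simp
  show "AE y in lborel. norm (LINT z|lborel. norm (H k (y, z))) <= norm (\<bar>rho y\<bar> * (2 * (LINT x|lborel. \<bar>g x\<bar>)))"
   unfolding absint using tb by (intro AE_I2) (auto simp: abs_mult intro!: mult_left_mono)
 qed auto
 have Hint: "integrable (lborel \<Otimes>\<^sub>M lborel) (H k)" for k
 proof (rule lborel_pair.Fubini_integrable)
  show "AE x in lborel. integrable lborel (%y. H k (x, y))"
   unfolding H_def using g integrable_shift[OF g] by (intro AE_I2) auto
 qed (use Hi1 in auto)
 define u where "u k z = (LINT y|lborel. H k (y, z))" for k z
 have ui: "integrable lborel (u k)" for k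
  unfolding u_def using lborel_pair.integrable_snd[of "%y z. H k (y, z)"] Hint by simp
 \<comment> \<open>Fubini turns the L^1 norm of the error into an average of the translation modulus
   \<open>t\<close> with weight |rho|.\<close>
 have ub: "(LINT z|lborel. norm (u k z)) <= (LINT y|lborel. \<bar>rho y\<bar> * t (e k *\<^sub>R y))" for k
 proof -
  have Hn: "integrable (lborel \<Otimes>\<^sub>M lborel) (%(y, z). norm (H k (y, z)))"
   using integrable_norm[OF Hint[of k]] by (simp add: case_prod_unfold)
  have "(LINT z|lborel. norm (u k z)) <= (LINT z|lborel. (LINT y|lborel. norm (H k (y, z))))"
  proof (rule integral_mono)
   show "integrable lborel (%z. LINT y|lborel. norm (H k (y, z)))"
    using lborel_pair.integrable_snd[OF Hn] .
   show "integrable lborel (%z. norm (u k z))" using ui by (rule integrable_norm)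
   show "norm (u k z) <= (LINT y|lborel. norm (H k (y, z)))" for z
    unfolding u_def by (rule integral_norm_bound)
  qed
  also have "\<dots> = (LINT y|lborel. (LINT z|lborel. norm (H k (y, z))))"
   by (rule lborel_pair.Fubini_integral[OF Hn])
  finally show ?thesis unfolding absint .
 qed
 have lim0: "(%k. LINT z|lborel. norm (u k z)) \<longlonglongrightarrow> 0"
 proof (rule tendsto_sandwich[OF _ _ tendsto_const])
  show "(%k. LINT y|lborel. \<bar>rho y\<bar> * t (e k *\<^sub>R y)) \<longlonglongrightarrow> 0"
  proof (rule LIMSEQ_I)
   fix epsilon :: real assume "epsilon > 0"
   let ?I = "LINT y|lborel. \<bar>rho y\<bar>"
   have I: "?I >= 0" by simp
   then have "epsilon / (?I + 1) > 0" by (intro divide_pos_pos \<open>epsilon > 0\<close>) linarith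
   then obtain d where d: "d > 0" "\<And>h. norm h < d ==> t h < epsilon / (?I + 1)"
    using L1_translation_continuous[OF g] unfolding t_def by blast
   have "(%k. e k * r0) \<longlonglongrightarrow> 0" unfolding e_def by real_asymp
   then have "\<forall>\<^sub>F k in sequentially. e k * r0 < d" using d(1) by (rule order_tendstoD(2))
   then obtain K where K: "\<And>k. k >= K ==> e k * r0 < d" by (auto simp: eventually_sequentially)
   show "\<exists>K. \<forall>k\<ge>K. norm ((LINT y|lborel. \<bar>rho y\<bar> * t (e k *\<^sub>R y)) - 0) < epsilon"
   proof (intro exI[of _ K] allI impI)
    fix k assume "k >= K"
    have "(LINT y|lborel. \<bar>rho y\<bar> * t (e k *\<^sub>R y)) <= (LINT y|lborel. \<bar>rho y\<bar> * (epsilon / (?I + 1)))"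
    proof (rule integral_mono)
     show "integrable lborel (%y. \<bar>rho y\<bar> * t (e k *\<^sub>R y))" using Hi1[of k] unfolding absint .
     show "integrable lborel (%y. \<bar>rho y\<bar> * (epsilon / (?I + 1)))" using rhoi by simp
     fix y
     show "\<bar>rho y\<bar> * t (e k *\<^sub>R y) <= \<bar>rho y\<bar> * (epsilon / (?I + 1))"
     proof (cases "norm y < r0")
      case True
      then have "norm (e k *\<^sub>R y) <= e k * r0" using e(1)[of k] by simp
      also have "\<dots> < d" using K \<open>k >= K\<close> by simp
      finally have "t (e k *\<^sub>R y) < epsilon / (?I + 1)" by (rule d(2))
      then show ?thesis by (intro mult_left_mono) auto
     qed (simp add: r0)
    qed
    also have "\<dots> = ?I * (epsilon / (?I + 1))" by simp
    also have "\<dots> < epsilon"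
    proof -
     have "?I * epsilon < (?I + 1) * epsilon" by (rule mult_strict_right_mono) (use \<open>epsilon > 0\<close> in auto)
     moreover have "?I + 1 > 0" using I by linarith
     ultimately show ?thesis by (simp add: pos_divide_less_eq mult.commute)
    qed
    finally show "norm ((LINT y|lborel. \<bar>rho y\<bar> * t (e k *\<^sub>R y)) - 0) < epsilon"
     using tb by simp
   qed
  qed
 qed (use ub in auto)
 obtain r :: "nat => nat" where r: "strict_mono r" "AE z in lborel. (%k. u (r k) z) \<longlonglongrightarrow> 0"
  using tendsto_L1_AE_subseq[OF ui lim0] by auto
 have AEi: "AE z in lborel. integrable lborel (%y. H k (y, z))" for k
  using lborel_pair.AE_integrable_snd[of "%y z. H k (y, z)"] Hint by simp
 have AEi': "AE z in lborel. \<forall>k. integrable lborel (%y. H k (y, z))"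
  using AEi by (simp add: AE_all_countable)
 have "AE z in lborel. norm z < R -->
  (%k. LINT y|lborel. f (z + (1 / (real (r k) + 1)) *\<^sub>R y) * rho y) \<longlonglongrightarrow> f z * (LINT y|lborel. rho y)"
  using r(2) AEi'
 proof eventually_elim
  case (elim z)
  show ?case
  proof
   assume z: "norm z < R"
   have gz: "g z = f z" using z r0(2) by (simp add: g_def)
   have eq: "f (z + e k *\<^sub>R y) * rho y = H k (y, z) + f z * rho y" for k y
   proof (cases "norm y < r0")
    case True
    have "norm (z + e k *\<^sub>R y) <= norm z + e k * norm y" using norm_triangle_ineq[of z "e k *\<^sub>R y"] e(1)[of k] by simp
    also have "\<dots> < R + r0" using z True e[of k] mult_mono[of "e k" 1 "norm y" "norm y"] by auto
    finally have "g (z + e k *\<^sub>R y) = f (z + e k *\<^sub>R y)" by (simp add: g_def)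
    then show ?thesis by (simp add: H_def gz algebra_simps)
   qed (simp add: r0 H_def)
   have "(LINT y|lborel. f (z + e k *\<^sub>R y) * rho y) = u k z + f z * (LINT y|lborel. rho y)" for k
    unfolding eq u_def using elim(2) rhoi by simp
   moreover have "(%k. u (r k) z + f z * (LINT y|lborel. rho y)) \<longlonglongrightarrow> 0 + f z * (LINT y|lborel. rho y)"
    by (intro tendsto_add elim(1) tendsto_const)
   ultimately show "(%k. LINT y|lborel. f (z + (1 / (real (r k) + 1)) *\<^sub>R y) * rho y) \<longlonglongrightarrow> f z * (LINT y|lborel. rho y)"
    unfolding e_def by simp
  qed
 qed
 with r(1) show ?thesis by blast
qed

section \<open>Newtonian potentials tested radially\<close>

lemma DERIV_zero_of_locally_const:
 assumes "\<And>s. s < (d::real) ==> f s = (c::real)" "s < d"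
 shows "(f has_real_derivative 0) (at s)"
 by (rule DERIV_cong_ev[THEN iffD1, OF refl _ refl DERIV_const[of c]])
   (use assms in \<open>auto simp: eventually_nhds intro!: exI[of _ "{..<d}"]\<close>)

text \<open>The integral over \<open>{0..s}\<close> is 0 for negative \<open>s\<close>; for a
  continuous \<open>j\<close> that vanishes up to some \<open>d > 0\<close> this is therefore an
  antiderivative on the whole line.\<close>

definition primitive :: "(real => real) => real => real" where
 "primitive j s = integral {0..s} j"

lemma primitive_DERIV:
 assumes j: "continuous_on UNIV j" and d: "d > 0" "\<And>s. s <= d ==> j s = 0"
 shows "(primitive j has_real_derivative j s) (at s)"
proof (cases "s < d")
 case True
 have z: "primitive j s = 0" if "s < d" for s
  unfolding primitive_def by (rule integral_unique, rule has_integral_is_0) (use that d in auto)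
 from DERIV_zero_of_locally_const[OF z True] d(2)[of s] True show ?thesis by simp
next
 case False
 then have s: "0 < s" "s < s + 1" using d by auto
 have "((%x. integral {0..x} j) has_real_derivative j s) (at s within {0..s+1})"
  by (rule integral_has_real_derivative) (use continuous_on_subset[OF j] s in auto)
 moreover have "at s within {0..s+1} = at s" by (rule at_within_interior) (use s in simp)
 moreover have "primitive j = (%x. integral {0..x} j)" by (rule ext) (simp add: primitive_def)
 ultimately show ?thesis by simp
qed

lemma primitive_smooth:
 assumes "smooth j" "d > 0" "\<And>s. s <= d ==> j s = 0"
 shows "smooth (primitive j)"
 using smooth_of_deriv[OF primitive_DERIV[OF smooth_continuous[OF assms(1)] assms(2,3)] assms(1)] .

definition ramp :: "real => real" where "ramp = primitive bump"
definition ramp_max :: real where "ramp_max = ramp 2"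

lemma ramp_DERIV: "(ramp has_real_derivative bump s) (at s)"
 unfolding ramp_def by (rule primitive_DERIV[of _ 1]) (auto simp: bump_zero smooth_continuous[OF bump_smooth])

lemma ramp_smooth: "smooth ramp"
 unfolding ramp_def by (rule primitive_smooth[OF bump_smooth, of 1]) (auto simp: bump_zero)

lemma ramp_mono: "s <= t ==> ramp s <= ramp t"
 by (rule DERIV_nonneg_imp_nondecreasing) (use ramp_DERIV bump_nonneg in blast)+

lemma ramp_eq_0: "s <= 1 ==> ramp s = 0"
 unfolding ramp_def primitive_def by (rule integral_unique, rule has_integral_is_0) (auto simp: bump_zero)

lemma ramp_eq_max: "s >= 2 ==> ramp s = ramp_max"
proof -
 assume s: "s >= 2"
 have "\<exists>c. \<forall>x\<in>{2..}. ramp x = c"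
 proof (rule has_field_derivative_zero_constant)
  fix x :: real assume "x \<in> {2..}"
  then show "(ramp has_real_derivative 0) (at x within {2..})"
   using has_field_derivative_at_within[OF ramp_DERIV[of x]] bump_zero[of x] by simp
 qed auto
 then show ?thesis using s unfolding ramp_max_def by auto
qed

lemma ramp_max_pos: "ramp_max > 0"
proof -
 have "ramp 1 < ramp 2"
 proof (rule DERIV_pos_imp_increasing_open[where f=ramp])
  fix x :: real assume "1 < x" "x < 2"
  then show "\<exists>y. (ramp has_real_derivative y) (at x) \<and> y > 0" using ramp_DERIV bump_pos_iff by blast
 qed (auto intro: continuous_at_imp_continuous_on DERIV_isCont[OF ramp_DERIV])
 then show ?thesis by (simp add: ramp_eq_0 ramp_max_def)
qed

lemma ramp_bounds: "0 <= ramp s" "ramp s <= ramp_max"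
proof -
 show "0 <= ramp s" using ramp_mono[of "min s 1" s] ramp_eq_0[of "min s 1"] by auto
 show "ramp s <= ramp_max" using ramp_mono[of s "max s 2"] ramp_eq_max[of "max s 2"] by auto
qed

text \<open>The equation -Laplace phi = F tested with the functions h(|x - z|^2) after the shift x
  -> z + x; the bracket is the Laplacian of h(|x|^2) in the variable s. This class of test functions
  already contains the truncated Newtonian kernels with arbitrary pole. No partial derivatives
  occur, so the notion makes sense on every Euclidean space.\<close>

definition radial_weak :: "('a::euclidean_space => real) => ('a => real) => bool" where
 "radial_weak phi F \<longleftrightarrow> locint phi \<and> locint F \<and>
  (\<forall>h S z. smooth h --> (\<forall>s\<ge>S. h s = 0) -->
   (LINT x|lborel. phi (z + x) * (4 * (sq x) * deriv (deriv h) (sq x) + 2 * real DIM('a) * deriv h (sq x))) =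
   - (LINT x|lborel. F (z + x) * h (sq x)))"

text \<open>The integral of \<open>kappa t * t powr (- nu)\<close> from \<open>s\<close> to
  \<open>S\<close>. For constant \<open>kappa\<close> it would be the Newtonian kernel |x|^(2-n) up
  to constants, so \<open>kappa\<close> acts as a cutoff on the slope of that kernel.\<close>

definition tail :: "real => (real => real) => real => real => real" where
 "tail nu kappa S s = primitive (%t. kappa t * t powr (- nu)) S - primitive (%t. kappa t * t powr (- nu)) s"

lemma tail_props:
 assumes k: "smooth kappa" and d: "d > 0" "\<And>s. s <= d ==> kappa s = 0" and S: "\<And>s. s >= S ==> kappa s = 0"
 shows tail_DERIV: "(tail nu kappa S has_real_derivative - (kappa s * s powr (- nu))) (at s)"
  and tail_smooth: "smooth (tail nu kappa S)"
  and tail_eq_0: "s >= S ==> tail nu kappa S s = 0"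
proof -
 have j: "smooth (%t. kappa t * t powr (- nu))" by (rule smooth_powr[OF k d])
 have D: "(primitive (%t. kappa t * t powr (- nu)) has_real_derivative kappa s * s powr (- nu)) (at s)" for s
  by (rule primitive_DERIV[of _ d]) (use d smooth_continuous[OF j] in auto)
 show T: "(tail nu kappa S has_real_derivative - (kappa s * s powr (- nu))) (at s)" for s
  unfolding tail_def[abs_def] by (auto intro!: derivative_eq_intros D)
 show "smooth (tail nu kappa S)"
  unfolding tail_def[abs_def]
  by (intro smooth_diff smooth_const primitive_smooth[OF j, of d]) (use d in auto)
 show "tail nu kappa S s = 0" if "s >= S"
 proof -
  have "\<exists>c. \<forall>x\<in>{S..}. tail nu kappa S x = c"
  proof (rule has_field_derivative_zero_constant)
   fix x assume "x \<in> {S..}"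
   then show "(tail nu kappa S has_real_derivative 0) (at x within {S..})"
    using has_field_derivative_at_within[OF T[of x]] S[of x] by simp
  qed auto
  then obtain c where "\<And>x. x >= S ==> tail nu kappa S x = c" by auto
  moreover have "tail nu kappa S S = 0" by (simp add: tail_def)
  ultimately show ?thesis using that by force
 qed
qed

lemma deriv_zero_of_zero:
 assumes "smooth kappa" "\<And>s. s <= d ==> kappa s = 0" "s < d"
 shows "deriv kappa s = 0"
 by (rule DERIV_imp_deriv, rule DERIV_zero_of_locally_const[of d _ 0]) (use assms in auto)

text \<open>The radial Laplacian is 4 s^(1-nu) (s^nu h')', and the tail satisfies s^nu h' = - kappa.
  The outcome is supported where \<open>kappa\<close> varies, and at s = 0 both sides vanish with
  \<open>kappa\<close>.\<close>

lemma tail_laplacian: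
 assumes k: "smooth kappa" and d: "d > 0" "\<And>s. s <= d ==> kappa s = 0" and S: "\<And>s. s >= S ==> kappa s = 0"
  and s: "s >= 0"
 shows "4 * s * deriv (deriv (tail nu kappa S)) s + 4 * nu * deriv (tail nu kappa S) s = - (4 * s powr (1 - nu) * deriv kappa s)"
proof -
 have dt: "deriv (tail nu kappa S) = (%s. - (kappa s * s powr (- nu)))"
  by (intro ext DERIV_imp_deriv tail_DERIV[OF k d S])
 show ?thesis
 proof (cases "s = 0")
  case True
  then show ?thesis using d(2)[of 0] d(1) deriv_zero_of_zero[OF k d(2), of 0] by (simp add: dt)
 next
  case False
  then have s: "s > 0" using \<open>s >= 0\<close> by simp
  have "((%s. - (kappa s * s powr (- nu))) has_real_derivative
    - (deriv kappa s * s powr (- nu) - nu * kappa s * s powr (- nu - 1))) (at s)"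
   using s by (auto intro!: derivative_eq_intros smooth_derivD(1)[OF k])
  then have "deriv (deriv (tail nu kappa S)) s = - (deriv kappa s * s powr (- nu) - nu * kappa s * s powr (- nu - 1))"
   unfolding dt by (rule DERIV_imp_deriv)
  then have "s * deriv (deriv (tail nu kappa S)) s =
    - (deriv kappa s * (s * s powr (- nu))) + nu * kappa s * (s * s powr (- nu - 1))"
   by (simp only:) (simp add: algebra_simps)
  moreover have "s * s powr (- nu - 1) = s powr (- nu)" "s * s powr (- nu) = s powr (1 - nu)"
   using s powr_mult_base[of s "- nu - 1"] powr_mult_base[of s "- nu"] by (auto simp: algebra_simps)
  ultimately have "s * deriv (deriv (tail nu kappa S)) s = - (deriv kappa s * s powr (1 - nu)) + nu * kappa s * s powr (- nu)"
   by simp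
  then show ?thesis unfolding dt by (simp add: algebra_simps)
 qed
qed

lemma radial_weak_locint: "radial_weak phi F ==> locint phi" "radial_weak phi F ==> locint F"
 by (auto simp: radial_weak_def)

lemma radial_weak_tail:
 fixes phi F :: "'a::euclidean_space => real"
 assumes w: "radial_weak phi F" and nu: "nu = real DIM('a) / 2"
  and k: "smooth kappa" and d: "d > 0" "\<And>s. s <= d ==> kappa s = 0" and S: "\<And>s. s >= S ==> kappa s = 0"
 shows "(LINT x|lborel. phi (z + x) * (4 * (sq x) powr (1 - nu) * deriv kappa (sq x))) =
  (LINT x|lborel. F (z + x) * tail nu kappa S (sq x))"
proof -
 have "(LINT x|lborel. phi (z + x) * (4 * (sq x) * deriv (deriv (tail nu kappa S)) (sq x) + 2 * real DIM('a) * deriv (tail nu kappa S) (sq x))) =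
   - (LINT x|lborel. F (z + x) * tail nu kappa S (sq x))"
  by (rule w[unfolded radial_weak_def, THEN conjunct2, THEN conjunct2, rule_format, of _ S, OF tail_smooth[OF k d S] tail_eq_0[OF k d S]])
 moreover have "4 * (sq x) * deriv (deriv (tail nu kappa S)) (sq x) + 2 * real DIM('a) * deriv (tail nu kappa S) (sq x)
   = - (4 * (sq x) powr (1 - nu) * deriv kappa (sq x))" for x :: 'a
  using tail_laplacian[OF k d S inner_ge_zero[of x], where nu=nu] by (simp add: nu)
 ultimately show ?thesis by simp
qed

text \<open>The weight that falls on \<open>phi\<close> in the tail identity when
  \<open>kappa\<close> is \<open>ramp\<close>. It lives on 1 < |y|^2 < 2 and serves as the mollifier
  of the whole argument.\<close>

definition shell :: "real => 'a::euclidean_space => real" where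
 "shell nu y = 4 * (sq y) powr (1 - nu) * bump (sq y)"

lemma bump_measurable [measurable]: "bump \<in> bmeas"
 by (rule borel_measurable_continuous_onI[OF smooth_continuous[OF bump_smooth]])

lemma shell_measurable [measurable]: "shell nu \<in> bmeas"
 unfolding shell_def[abs_def] by measurable

lemma shell_bounds:
 assumes "nu >= 1"
 shows "0 <= shell nu y" "shell nu y <= 4" "norm y >= 2 ==> shell nu y = 0" "norm y <= 1 ==> shell nu y = 0"
proof -
 show "0 <= shell nu y" by (simp add: shell_def bump_nonneg)
 show "shell nu y <= 4"
 proof (cases "y \<bullet> y <= 1")
  case False
  have "(sq y) powr (1 - nu) <= (sq y) powr 0" using assms False by (intro powr_mono) auto
  also have "\<dots> = 1" using False by auto
  finally have "(sq y) powr (1 - nu) * bump (sq y) <= 1 * 1"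
   by (intro mult_mono bump_le_1 bump_nonneg) auto
  then show ?thesis by (simp add: shell_def)
 qed (simp add: shell_def bump_zero)
 show "shell nu y = 0" if "norm y >= 2"
 proof -
  have "norm y * norm y >= 2 * 2" using that by (intro mult_mono) auto
  then have "y \<bullet> y >= 2" by (simp add: dot_square_norm power2_eq_square)
  then show ?thesis by (simp add: shell_def bump_zero)
 qed
 show "shell nu y = 0" if "norm y <= 1"
 proof -
  have "y \<bullet> y <= 1" using that by (simp add: dot_square_norm power_le_one_iff)
  then show ?thesis by (simp add: shell_def bump_zero)
 qed
qed

lemma integral_scale:
 fixes f :: "'a::euclidean_space => real"
 assumes [measurable]: "f \<in> bmeas" and c: "c > 0"
 shows "(LINT x|lborel. f x) = c ^ DIM('a) * (LINT x|lborel. f (c *\<^sub>R x))"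
proof -
 have "(LINT x|lborel. f x) = (LINT x|density (distr lborel borel (%x. 0 + c *\<^sub>R x)) (%_. ennreal (\<bar>c\<bar> ^ DIM('a))). f x)"
  by (subst lborel_affine[of c 0]) (use c in auto)
 also have "\<dots> = (LINT x|distr lborel borel (%x. 0 + c *\<^sub>R x). (\<bar>c\<bar> ^ DIM('a)) *\<^sub>R f x)"
  by (subst integral_density) (use c in auto)
 also have "\<dots> = (LINT x|lborel. c ^ DIM('a) * f (c *\<^sub>R x))"
  by (subst integral_distr) (use c in auto)
 finally show ?thesis by simp
qed

text \<open>The substitution y = c x contributes c^(-n), the power |x|^(2-n) contributes c^(n-2),
  and the derivative of the rescaled step contributes c^2. They cancel because \<open>2 * nu\<close>
  is the dimension, so every scale produces the same mollifier.\<close>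

lemma shell_scale:
 fixes phi :: "'a::euclidean_space => real"
 assumes [measurable]: "phi \<in> bmeas" and nu: "nu = real DIM('a) / 2" and c: "c > 0"
 shows "(LINT x|lborel. phi (z + x) * (4 * (sq x) powr (1 - nu) * (c\<^sup>2 * bump (c\<^sup>2 * (sq x))))) =
  (LINT y|lborel. phi (z + (1 / c) *\<^sub>R y) * shell nu y)"
proof -
 have ic: "1 / c > 0" using c by simp
 define f where "f = (%x. phi (z + x) * (4 * (sq x) powr (1 - nu) * (c\<^sup>2 * bump (c\<^sup>2 * (sq x)))))"
 have [measurable]: "f \<in> bmeas" unfolding f_def by measurable
 have key: "phi (z + (1 / c) *\<^sub>R y) * shell nu y = (1/c) ^ DIM('a) * f ((1/c) *\<^sub>R y)" for y
 proof -
  have e1: "(1/c) ^ DIM('a) = c powr (- 2 * nu)"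
  proof -
   have "c powr (- 2 * nu) = 1 / c powr real DIM('a)" by (simp add: nu powr_minus_divide)
   then show ?thesis using c by (simp add: powr_realpow power_one_over)
  qed
  have e2: "(((1/c) *\<^sub>R y) \<bullet> ((1/c) *\<^sub>R y)) powr (1 - nu) = c powr (2 * nu - 2) * (sq y) powr (1 - nu)"
  proof -
   have "((1/c) *\<^sub>R y) \<bullet> ((1/c) *\<^sub>R y) = c powr (- 2) * (sq y)"
    using c by (simp add: powr_minus powr_numeral divide_simps power2_eq_square)
   then show ?thesis using c by (simp add: powr_mult powr_powr algebra_simps)
  qed
  have e3: "c\<^sup>2 * (((1/c) *\<^sub>R y) \<bullet> ((1/c) *\<^sub>R y)) = sq y"
   using c by (simp add: power2_eq_square)
  have c2: "c\<^sup>2 = c powr 2" using c by (simp add: powr_numeral)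
  have e4: "c powr (- 2 * nu) * (c powr (2 * nu - 2) * c\<^sup>2) = 1"
   using c by (simp only: c2 powr_add[symmetric]) simp
  have "c powr (- 2 * nu) * (phi (z + (1/c) *\<^sub>R y) * (4 * (c powr (2 * nu - 2) * (sq y) powr (1 - nu)) * (c\<^sup>2 * bump (sq y))))
    = (c powr (- 2 * nu) * (c powr (2 * nu - 2) * c\<^sup>2)) * (phi (z + (1/c) *\<^sub>R y) * (4 * (sq y) powr (1 - nu) * bump (sq y)))"
   by (simp only: mult_ac)
  then show ?thesis
   unfolding f_def shell_def e3 e2 e1 e4 by simp
 qed
 have "(LINT x|lborel. f x) = (1/c) ^ DIM('a) * (LINT x|lborel. f ((1/c) *\<^sub>R x))"
  by (rule integral_scale[OF _ ic]) measurable
 moreover have "(LINT y|lborel. (1/c) ^ DIM('a) * f ((1/c) *\<^sub>R y)) = (1/c) ^ DIM('a) * (LINT x|lborel. f ((1/c) *\<^sub>R x))"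
  by (rule integral_mult_right_zero)
 ultimately have "(LINT x|lborel. f x) = (LINT y|lborel. phi (z + (1 / c) *\<^sub>R y) * shell nu y)"
  unfolding key by (rule trans[OF _ sym])
 then show ?thesis unfolding f_def .
qed

section \<open>Truncated Newtonian kernels\<close>

definition window :: "real => real => real" where
 "window k t = ramp (k\<^sup>2 * t) - ramp ((1 / k)\<^sup>2 * t)"

text \<open>For \<open>k >= 1\<close> this is the Newtonian kernel with its slope switched off near
  the pole and far away: constant for s <= 1/k^2, zero for s >= 2 k^2, and equal to
  \<open>newton_kernel\<close> up to an additive constant on [2/k^2, k^2].\<close>

definition newton :: "real => real => real => real" where
 "newton nu k = tail nu (window k) (2 * k\<^sup>2)"

lemma window_smooth: "smooth (window k)"
 using smooth_diff[OF smooth_affine[OF ramp_smooth, of "k\<^sup>2" 0] smooth_affine[OF ramp_smooth, of "(1/k)\<^sup>2" 0]]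
 unfolding window_def[abs_def] by simp

lemma window_DERIV:
 "(window k has_real_derivative (k\<^sup>2 * bump (k\<^sup>2 * s) - (1/k)\<^sup>2 * bump ((1/k)\<^sup>2 * s))) (at s)"
proof -
 have "((%s. ramp (c * s)) has_real_derivative bump (c * s) * c) (at s)" for c
  by (rule DERIV_chain2[OF ramp_DERIV]) (auto intro!: derivative_eq_intros)
 then have "((%s. ramp (c * s)) has_real_derivative c * bump (c * s)) (at s)" for c
  by (simp only: mult.commute[of c "bump (c * s)"])
 from DERIV_diff[OF this this] show ?thesis unfolding window_def[abs_def] .
qed

lemma window_low:
 assumes "k >= 1" "s <= 1 / k\<^sup>2" shows "window k s = 0"
proof -
 have k: "k\<^sup>2 >= 1" using assms by simp
 have "k\<^sup>2 * s <= k\<^sup>2 * (1 / k\<^sup>2)" using assms(2) by (intro mult_left_mono) auto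
 then have a: "k\<^sup>2 * s <= 1" using assms(1) by simp
 have "(1/k)\<^sup>2 * s <= 1"
 proof (cases "s <= 0")
  case True
  then have "(1/k)\<^sup>2 * s <= 0" by (simp add: mult_nonneg_nonpos)
  then show ?thesis by simp
 next
  case False
  have "1 / k <= 1" using assms(1) by simp
  then have "(1/k)\<^sup>2 <= k\<^sup>2" using assms(1) by (intro power_mono) (linarith, simp)
  then have "(1/k)\<^sup>2 * s <= k\<^sup>2 * s" using False by (intro mult_right_mono) auto
  then show ?thesis using a by simp
 qed
 then show ?thesis using a by (simp add: window_def ramp_eq_0)
qed

lemma window_mid:
 assumes "k >= 1" "2 / k\<^sup>2 <= s" "s <= k\<^sup>2" shows "window k s = ramp_max"
proof -
 have "k\<^sup>2 * s >= 2" using assms by (simp add: divide_le_eq mult.commute split: if_splits)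
 moreover have "(1/k)\<^sup>2 * s <= 1" using assms by (simp add: power_divide divide_le_eq split: if_splits)
 ultimately show ?thesis by (simp add: window_def ramp_eq_max ramp_eq_0)
qed

lemma window_high:
 assumes "k >= 1" "s >= 2 * k\<^sup>2" shows "window k s = 0"
proof -
 have k: "k\<^sup>2 >= 1" using assms by simp
 have a: "(1/k)\<^sup>2 * s >= 2" using assms by (simp add: power_divide le_divide_eq)
 have "s >= 2" using assms k by linarith
 then have "k\<^sup>2 * s >= 1 * 2" using k by (intro mult_mono) auto
 then show ?thesis using a by (simp add: window_def ramp_eq_max)
qed

lemma window_bounds:
 assumes "k >= 1" shows "0 <= window k s" "window k s <= ramp_max"
proof -
 have k: "(1/k)\<^sup>2 <= k\<^sup>2"
 proof -
  have "1 / k <= 1" using assms by simp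
  then show ?thesis using assms by (intro power_mono) (linarith, simp)
 qed
 show "0 <= window k s"
 proof (cases "s <= 1 / k\<^sup>2")
  case False
  have "1 / k\<^sup>2 >= 0" by simp
  then have "s >= 0" using False by linarith
  then have "(1/k)\<^sup>2 * s <= k\<^sup>2 * s" using k by (intro mult_right_mono) auto
  then show ?thesis using ramp_mono by (simp add: window_def)
 qed (simp add: window_low assms)
 show "window k s <= ramp_max"
  unfolding window_def using ramp_bounds[of "k\<^sup>2 * s"] ramp_bounds[of "(1/k)\<^sup>2 * s"] by linarith
qed

text \<open>Each of the two smoothed steps of the window contributes one shell average of
  \<open>phi\<close>: one at distance about 1/k from \<open>z\<close>, which recovers the value at
  \<open>z\<close>, and one at distance about k, which disappears in the limit for a
  \<open>phi\<close> that vanishes at infinity.\<close>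

lemma newton_identity:
 fixes phi F :: "'a::euclidean_space => real"
 assumes w: "radial_weak phi F" and nu: "nu = real DIM('a) / 2" "nu >= 1" and k: "k >= 1"
 shows "(LINT x|lborel. F (z + x) * newton nu k (sq x)) =
  (LINT y|lborel. phi (z + (1 / k) *\<^sub>R y) * shell nu y) - (LINT y|lborel. phi (z + k *\<^sub>R y) * shell nu y)"
proof -
 have l: "locint phi" using w by (rule radial_weak_locint)
 have [measurable]: "phi \<in> bmeas" using l by (rule locint_measurable)
 have d: "1 / k\<^sup>2 > 0" using k by simp
 have dw: "deriv (window k) s = k\<^sup>2 * bump (k\<^sup>2 * s) - (1/k)\<^sup>2 * bump ((1/k)\<^sup>2 * s)" for s
  by (rule DERIV_imp_deriv[OF window_DERIV])
 define A where "A c x = 4 * (sq x) powr (1 - nu) * (c\<^sup>2 * bump (c\<^sup>2 * (sq x)))" for c and x :: 'a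
 have int: "integrable lborel (%x. phi (z + x) * A c x)" if c: "c > 0" for c
 proof -
  have eq: "A c x = c ^ DIM('a) * shell nu (c *\<^sub>R x)" for x
  proof -
   have P1: "(c *\<^sub>R x \<bullet> c *\<^sub>R x) powr (1 - nu) = (c\<^sup>2) powr (1 - nu) * (sq x) powr (1 - nu)"
    using c by (simp add: power2_eq_square powr_mult[symmetric] mult.assoc)
   have P2: "(c\<^sup>2) powr (1 - nu) * c ^ DIM('a) = c\<^sup>2"
   proof -
    have "c ^ DIM('a) = c powr (2 * nu)" using c by (simp add: nu powr_realpow)
    moreover have "c\<^sup>2 = c powr 2" using c by simp
    moreover have "(c powr 2) powr (1 - nu) * c powr (2 * nu) = c powr 2"
     using c by (simp only: powr_powr powr_add[symmetric]) simp
    ultimately show ?thesis by simp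
   qed
   have b: "bump (c *\<^sub>R x \<bullet> c *\<^sub>R x) = bump (c\<^sup>2 * (sq x))" by (simp add: power2_eq_square mult.assoc)
   have P3: "c ^ DIM('a) * (4 * ((c\<^sup>2) powr (1 - nu) * (sq x) powr (1 - nu)) * bump (c\<^sup>2 * (sq x)))
     = 4 * (sq x) powr (1 - nu) * (((c\<^sup>2) powr (1 - nu) * c ^ DIM('a)) * bump (c\<^sup>2 * (sq x)))"
    by (simp only: mult_ac)
   show ?thesis unfolding A_def shell_def b P1 by (simp only: P3 P2)
  qed
  show ?thesis unfolding eq
  proof (rule locint_mult_compact[OF locint_shift[OF l], of _ "c ^ DIM('a) * 4" "2 / c"])
   show "\<bar>c ^ DIM('a) * shell nu (c *\<^sub>R x)\<bar> <= c ^ DIM('a) * 4" for x :: 'a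
    using shell_bounds(1,2)[OF nu(2), of "c *\<^sub>R x"] c by (simp add: abs_mult)
   show "c ^ DIM('a) * shell nu (c *\<^sub>R x) = 0" if "2 / c <= norm x" for x :: 'a
    using shell_bounds(3)[OF nu(2), of "c *\<^sub>R x"] that c by (simp add: divide_le_eq mult.commute)
  qed measurable
 qed
 have "(LINT x|lborel. F (z + x) * newton nu k (sq x)) =
   (LINT x|lborel. phi (z + x) * (4 * (sq x) powr (1 - nu) * deriv (window k) (sq x)))"
  unfolding newton_def
  by (rule radial_weak_tail[symmetric, OF w nu(1) window_smooth d window_low[OF k] window_high[OF k]])
 also have "\<dots> = (LINT x|lborel. phi (z + x) * A k x - phi (z + x) * A (1/k) x)"
  unfolding dw A_def by (simp only: right_diff_distrib)
 also have "\<dots> = (LINT x|lborel. phi (z + x) * A k x) - (LINT x|lborel. phi (z + x) * A (1/k) x)"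
  by (rule Bochner_Integration.integral_diff) (use int k in auto)
 also have "(LINT x|lborel. phi (z + x) * A k x) = (LINT y|lborel. phi (z + (1 / k) *\<^sub>R y) * shell nu y)"
  unfolding A_def by (rule shell_scale[OF _ nu(1)]) (use k in auto)
 also have "(LINT x|lborel. phi (z + x) * A (1/k) x) = (LINT y|lborel. phi (z + (1 / (1/k)) *\<^sub>R y) * shell nu y)"
  unfolding A_def by (rule shell_scale[OF _ nu(1)]) (use k in auto)
 finally show ?thesis by simp
qed

definition newton_kernel :: "real => real => real" where
 "newton_kernel nu s = ramp_max / (nu - 1) * s powr (1 - nu)"

lemma newton_kernel_DERIV:
 assumes "nu > 1" "s > 0"
 shows "(newton_kernel nu has_real_derivative - (ramp_max * s powr (- nu))) (at s)"
proof -
 have "((%s. ramp_max / (nu - 1) * s powr (1 - nu)) has_real_derivative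
   ramp_max / (nu - 1) * ((1 - nu) * s powr (1 - nu - 1))) (at s)"
  using assms by (intro DERIV_cmult has_real_derivative_powr)
 moreover have "ramp_max / (nu - 1) * ((1 - nu) * s powr (1 - nu - 1)) = - (ramp_max * s powr (- nu))"
 proof -
  have "ramp_max / (nu - 1) * (1 - nu) = - ramp_max" using assms by (simp add: divide_simps) (simp add: algebra_simps)
  then show ?thesis by (simp add: mult.assoc[symmetric])
 qed
 ultimately show ?thesis unfolding newton_kernel_def[abs_def] by simp
qed

lemma newton_DERIV:
 assumes "k >= 1"
 shows "(newton nu k has_real_derivative - (window k s * s powr (- nu))) (at s)"
proof -
 have d: "1 / k\<^sup>2 > 0" using assms by simp
 show ?thesis unfolding newton_def
  by (rule tail_DERIV[OF window_smooth d window_low[OF assms] window_high[OF assms]])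
qed

text \<open>The truncation fixes the additive constant differently for each \<open>k\<close>, so
  only differences can be compared with the exact kernel. The truncated slope is the exact slope
  times a factor between 0 and 1, which gives both monotonicity and domination.\<close>

lemma newton_diff_bounds:
 assumes "nu > 1" "k >= 1" "0 < s" "s <= t"
 shows "0 <= newton nu k s - newton nu k t"
  and "newton nu k s - newton nu k t <= newton_kernel nu s - newton_kernel nu t"
proof -
 have "newton nu k t <= newton nu k s"
 proof (rule DERIV_nonpos_imp_nonincreasing[OF assms(4)])
  fix x
  show "\<exists>y. (newton nu k has_real_derivative y) (at x) \<and> y <= 0"
   using newton_DERIV[OF assms(2)] window_bounds[OF assms(2)]
   by (intro exI[of _ "- (window k x * x powr (- nu))"]) auto
 qed
 then show "0 <= newton nu k s - newton nu k t" by simp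
 have "newton_kernel nu t - newton nu k t <= newton_kernel nu s - newton nu k s"
 proof (rule DERIV_nonpos_imp_nonincreasing[OF assms(4), where f="%s. newton_kernel nu s - newton nu k s"])
  fix x assume "s <= x"
  then have "((%s. newton_kernel nu s - newton nu k s) has_real_derivative
    - (ramp_max * x powr (- nu)) - - (window k x * x powr (- nu))) (at x)"
   using assms by (intro DERIV_diff newton_kernel_DERIV newton_DERIV) auto
  moreover have "- (ramp_max * x powr (- nu)) - - (window k x * x powr (- nu)) <= 0"
   using window_bounds(2)[OF assms(2), of x] by (simp add: mult_right_mono)
  ultimately show "\<exists>y. ((%s. newton_kernel nu s - newton nu k s) has_real_derivative y) (at x) \<and> y <= 0"
   by blast
 qed
 then show "newton nu k s - newton nu k t <= newton_kernel nu s - newton_kernel nu t" by simp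
qed

lemma newton_diff_eq:
 assumes "nu > 1" "k >= 1" "0 < s" "s <= t" "2 / k\<^sup>2 <= s" "t <= k\<^sup>2"
 shows "newton nu k s - newton nu k t = newton_kernel nu s - newton_kernel nu t"
proof -
 have "\<exists>c. \<forall>x\<in>{s..t}. newton_kernel nu x - newton nu k x = c"
 proof (rule has_field_derivative_zero_constant)
  fix x assume x: "x \<in> {s..t}"
  then have "((%s. newton_kernel nu s - newton nu k s) has_real_derivative
    - (ramp_max * x powr (- nu)) - - (window k x * x powr (- nu))) (at x)"
   using assms by (intro DERIV_diff newton_kernel_DERIV newton_DERIV) auto
  moreover have "window k x = ramp_max" using x assms by (intro window_mid) auto
  ultimately show "((%s. newton_kernel nu s - newton nu k s) has_real_derivative 0) (at x within {s..t})"
   by (simp add: has_field_derivative_at_within)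
 qed auto
 then obtain c where c: "\<And>x. x \<in> {s..t} ==> newton_kernel nu x - newton nu k x = c" by auto
 from c[of s] c[of t] assms show ?thesis by simp
qed

section \<open>Essential decay at infinity and removal of the truncation\<close>

definition vanishes :: "('a::euclidean_space => real) => bool" where
 "vanishes phi \<longleftrightarrow> (\<forall>e>0. \<exists>R. AE x in lborel. norm x >= R --> \<bar>phi x\<bar> <= e)"

lemma AE_scale_shift:
 fixes P :: "'a::euclidean_space => bool"
 assumes AE: "AE x in lborel. P x" and c: "c \<noteq> 0"
 shows "AE y in lborel. P (z + c *\<^sub>R y)"
proof -
 obtain N where N: "N \<in> null_sets lborel" "\<And>x. x \<notin> N ==> P x" using AE by (rule AE_E3) auto
 have [measurable]: "N \<in> sets borel" using N(1) by auto
 have "AE x in lborel. x \<notin> N" using N(1) by (rule AE_not_in)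
 then have "AE x in density (distr lborel borel (%x. z + c *\<^sub>R x)) (%_. ennreal (\<bar>c\<bar> ^ DIM('a))). x \<notin> N"
  by (subst lborel_affine[OF c, of z, symmetric])
 then have "AE x in distr lborel borel (%x. z + c *\<^sub>R x). x \<notin> N"
  using c by (subst (asm) AE_density) auto
 then have "AE y in lborel. z + c *\<^sub>R y \<notin> N" by (subst (asm) AE_distr_iff) auto
 then show ?thesis by eventually_elim (use N(2) in auto)
qed

lemma shell_abs: "nu >= 1 ==> \<bar>shell nu y\<bar> <= 4"
 using shell_bounds(1,2)[of nu y] by simp

lemma shell_integrable:
 assumes "nu >= 1" shows "integrable lborel (shell nu :: 'a::euclidean_space => real)"
 by (rule bounded_support_integrable[OF _ shell_abs[OF assms] shell_bounds(3)[OF assms]]) measurable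

lemma shell_integral_pos:
 assumes "nu >= 1" shows "(LINT y|lborel. shell nu (y :: 'a::euclidean_space)) > 0"
proof -
 have "(LINT y|lborel. shell nu (y :: 'a)) \<noteq> 0"
 proof
  assume "(LINT y|lborel. shell nu (y :: 'a)) = 0"
  then have AE: "AE y in lborel. shell nu (y::'a) = 0"
   by (subst (asm) integral_nonneg_eq_0_iff_AE[OF shell_integrable[OF assms]])
     (auto intro: shell_bounds(1)[OF assms])
  define S where "S = {y :: 'a. 1 < y \<bullet> y \<and> y \<bullet> y < 2}"
  have S: "open S" unfolding S_def
   by (intro open_Collect_conj open_Collect_less continuous_intros)
  obtain b :: 'a where b: "b \<in> Basis" using nonempty_Basis by blast
  \<comment> \<open>The squared norm is 36/25, between 1 and 2.\<close>
  have "((6/5) *\<^sub>R b) \<in> S" using b by (simp add: S_def inner_Basis)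
  then have "\<not> negligible S" using open_not_negligible[OF S] by auto
  moreover have "AE y in lborel. y \<notin> S"
   using AE
  proof eventually_elim
   case (elim y)
   show ?case
   proof
    assume "y \<in> S"
    then have "bump (sq y) > 0" "y \<bullet> y > 0" by (auto simp: S_def bump_pos_iff)
    then have "shell nu y > 0" by (simp add: shell_def)
    then show False using elim by simp
   qed
  qed
  then have "S \<in> null_sets lborel" using S by (subst AE_iff_null_sets) auto
  then have "negligible S" unfolding negligible_iff_null_sets by (rule null_sets_completionI)
  ultimately show False by blast
 qed
 moreover have "(LINT y|lborel. shell nu (y :: 'a)) >= 0"
  by (intro Bochner_Integration.integral_nonneg shell_bounds(1)[OF assms])
 ultimately show ?thesis by linarith
qed

text \<open>The shell lies outside the unit ball, so on its support z + (k+1) y has norm at least k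
  + 1 - |z|, and the essential bound on \<open>phi\<close> applies there.\<close>

lemma far_shell_tendsto_0:
 fixes phi :: "'a::euclidean_space => real"
 assumes l: "locint phi" and v: "vanishes phi" and nu: "nu >= 1"
 shows "(%k. LINT y|lborel. phi (z + (real k + 1) *\<^sub>R y) * shell nu y) \<longlonglongrightarrow> 0"
proof (rule LIMSEQ_I)
 fix e :: real assume "e > 0"
 let ?C = "LINT y|lborel. shell nu (y :: 'a)"
 have C: "?C > 0" by (rule shell_integral_pos[OF nu])
 have [measurable]: "phi \<in> bmeas" using l by (rule locint_measurable)
 have "e / (2 * ?C) > 0" using C \<open>e > 0\<close> by simp
 then obtain R where R: "AE x in lborel. norm x >= R --> \<bar>phi x\<bar> <= e / (2 * ?C)"
  using v unfolding vanishes_def by blast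
 obtain K :: nat where K: "real K >= R + norm z" using real_arch_simple by blast
 show "\<exists>K. \<forall>k\<ge>K. norm ((LINT y|lborel. phi (z + (real k + 1) *\<^sub>R y) * shell nu y) - 0) < e"
 proof (intro exI[of _ K] allI impI)
  fix k assume k: "k >= K"
  have AE: "AE y in lborel. norm (z + (real k + 1) *\<^sub>R y) >= R --> \<bar>phi (z + (real k + 1) *\<^sub>R y)\<bar> <= e / (2 * ?C)"
   by (rule AE_scale_shift[OF R]) simp
  have bd: "AE y in lborel. norm (phi (z + (real k + 1) *\<^sub>R y) * shell nu y) <= e / (2 * ?C) * shell nu y"
   using AE
  proof eventually_elim
   case (elim y)
   show ?case
   proof (cases "norm y <= 1")
    case False
    have "(real k + 1) * 1 <= norm ((real k + 1) *\<^sub>R y)" using False by (simp add: mult_left_mono)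
    also have "norm ((real k + 1) *\<^sub>R y) <= norm (z + (real k + 1) *\<^sub>R y) + norm z"
     using norm_triangle_ineq4[of "z + (real k + 1) *\<^sub>R y" z] by (simp only: add_diff_cancel_left')
    finally have w: "real k + 1 <= norm (z + (real k + 1) *\<^sub>R y) + norm z" by (simp only: mult_1_right)
    have "R + norm z <= real k" using K of_nat_mono[OF k, where 'a=real] by linarith
    then have "norm (z + (real k + 1) *\<^sub>R y) >= R" using w by (smt (verit))
    then have "\<bar>phi (z + (real k + 1) *\<^sub>R y)\<bar> * shell nu y <= e / (2 * ?C) * shell nu y"
     using elim by (intro mult_right_mono shell_bounds(1)[OF nu]) blast
    then show ?thesis by (simp only: real_norm_def abs_mult abs_of_nonneg[OF shell_bounds(1)[OF nu]])
   qed (simp add: shell_bounds(4)[OF nu])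
  qed
  have si: "integrable lborel (%y :: 'a. e / (2 * ?C) * shell nu y)"
   by (intro integrable_mult_right shell_integrable[OF nu])
  have fi: "integrable lborel (%y. phi (z + (real k + 1) *\<^sub>R y) * shell nu y)"
  proof (rule Bochner_Integration.integrable_bound[OF si])
   show "AE y in lborel. norm (phi (z + (real k + 1) *\<^sub>R y) * shell nu y) <= norm (e / (2 * ?C) * shell nu y)"
    using bd by eventually_elim (erule order_trans, simp only: real_norm_def abs_ge_self)
  qed measurable
  have "norm (LINT y|lborel. phi (z + (real k + 1) *\<^sub>R y) * shell nu y) <= (LINT y|lborel. norm (phi (z + (real k + 1) *\<^sub>R y) * shell nu y))"
   by (rule integral_norm_bound)
  also have "\<dots> <= (LINT y|lborel. e / (2 * ?C) * shell nu (y :: 'a))"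
   by (intro integral_mono_AE integrable_norm fi si bd)
  also have "\<dots> = e / 2" using C by simp
  also have "\<dots> < e" using \<open>e > 0\<close> by simp
  finally show "norm ((LINT y|lborel. phi (z + (real k + 1) *\<^sub>R y) * shell nu y) - 0) < e" by simp
 qed
qed

text \<open>In \<open>newton_identity\<close> the near shell mollifies \<open>phi\<close> at
  \<open>z\<close> and the far shell tends to 0. The limit is not yet taken inside the integral,
  since integrability of \<open>F\<close> against the full kernel is not known at this
  point.\<close>

lemma newton_limit_AE:
 fixes phi F :: "'a::euclidean_space => real"
 assumes w: "radial_weak phi F" and v: "vanishes phi" and nu: "nu = real DIM('a) / 2" "nu >= 1"
 shows "\<exists>r. strict_mono r \<and> (AE z in lborel. norm z < R -->
  (%k. LINT x|lborel. F (z + x) * newton nu (real (r k) + 1) (sq x)) \<longlonglongrightarrow> phi z * (LINT y|lborel. shell nu (y :: 'a)))"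
proof -
 have l: "locint phi" using w by (rule radial_weak_locint)
 obtain r where r: "strict_mono r" "AE z in lborel. norm z < R -->
  (%k. LINT y|lborel. phi (z + (1 / (real (r k) + 1)) *\<^sub>R y) * shell nu y) \<longlonglongrightarrow> phi z * (LINT y|lborel. shell nu (y :: 'a))"
  using mollifier_AE[OF l shell_measurable shell_abs[OF nu(2)] shell_bounds(3)[OF nu(2)], where R=R and ?r0.0=2] by auto
 have "AE z in lborel. norm z < R -->
  (%k. LINT x|lborel. F (z + x) * newton nu (real (r k) + 1) (sq x)) \<longlonglongrightarrow> phi z * (LINT y|lborel. shell nu (y :: 'a))"
  using r(2)
 proof eventually_elim
  case (elim z)
  show ?case
  proof
   assume "norm z < R"
   then have 1: "(%k. LINT y|lborel. phi (z + (1 / (real (r k) + 1)) *\<^sub>R y) * shell nu y) \<longlonglongrightarrow> phi z * (LINT y|lborel. shell nu (y :: 'a))"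
    using elim by blast
   have 2: "(%k. LINT y|lborel. phi (z + (real (r k) + 1) *\<^sub>R y) * shell nu y) \<longlonglongrightarrow> 0"
    using LIMSEQ_subseq_LIMSEQ[OF far_shell_tendsto_0[OF l v nu(2), of z] r(1)] by (simp add: o_def)
   have "(LINT x|lborel. F (z + x) * newton nu (real (r k) + 1) (sq x)) =
    (LINT y|lborel. phi (z + (1 / (real (r k) + 1)) *\<^sub>R y) * shell nu y) -
    (LINT y|lborel. phi (z + (real (r k) + 1) *\<^sub>R y) * shell nu y)" for k
    by (rule newton_identity[OF w nu]) simp
   then show "(%k. LINT x|lborel. F (z + x) * newton nu (real (r k) + 1) (sq x)) \<longlonglongrightarrow> phi z * (LINT y|lborel. shell nu (y :: 'a))"
    using tendsto_diff[OF 1 2] by simp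
  qed
 qed
 with r(1) show ?thesis by blast
qed

section \<open>Reflections and odd solutions\<close>

definition mirror :: "'a::euclidean_space => 'a => 'a" where
 "mirror e x = x - (2 * (x \<bullet> e)) *\<^sub>R e"

lemma mirror_add: "mirror e (x + y) = mirror e x + mirror e y"
 by (simp add: mirror_def inner_add_left algebra_simps)

lemma mirror_diff: "mirror e (x - y) = mirror e x - mirror e y"
 by (simp add: mirror_def inner_diff_left algebra_simps)

lemma mirror_inner_e: "norm e = 1 ==> mirror e x \<bullet> e = - (x \<bullet> e)"
 by (simp add: mirror_def inner_diff_left dot_square_norm)

lemma mirror_mirror: "norm e = 1 ==> mirror e (mirror e x) = x"
 unfolding mirror_def[of e "mirror e x"] by (simp add: mirror_inner_e) (simp add: mirror_def)

lemma mirror_inner: "norm e = 1 ==> mirror e x \<bullet> mirror e y = x \<bullet> y"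
 by (simp add: mirror_def inner_diff_left inner_diff_right dot_square_norm inner_commute[of e y])

lemma mirror_norm: "norm e = 1 ==> norm (mirror e x) = norm x"
 by (simp add: norm_eq_sqrt_inner mirror_inner)

lemma mirror_measurable [measurable]: "mirror e \<in> bmeas"
 unfolding mirror_def[abs_def] by measurable

section \<open>Reflections preserve Lebesgue measure and the tested equation\<close>

lemma nn_integral_reflect_shift:
 fixes f :: "'a::euclidean_space => ennreal"
 assumes [measurable]: "f \<in> bmeas"
 shows "(\<integral>\<^sup>+y. f (c - y) \<partial>lborel) = (\<integral>\<^sup>+y. f y \<partial>lborel)"
proof -
 have "(\<integral>\<^sup>+y. f y \<partial>lborel) = (\<integral>\<^sup>+y. f y \<partial>density (distr lborel borel (%x. c + (-1) *\<^sub>R x)) (%_. ennreal (\<bar>-1\<bar> ^ DIM('a))))"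
  by (subst lborel_affine[of "-1" c]) auto
 also have "\<dots> = (\<integral>\<^sup>+y. f y \<partial>distr lborel borel (%x. c + (-1) *\<^sub>R x))"
  by (simp add: density_1)
 also have "\<dots> = (\<integral>\<^sup>+y. f (c + (-1) *\<^sub>R y) \<partial>lborel)" by (rule nn_integral_distr) auto
 finally show ?thesis by simp
qed

text \<open>Haar uniqueness in miniature: by Tonelli, \<open>\<integral>f\<circ>R \<cdot> |B| = |R\<inverse>B| \<cdot> \<integral>f\<close> for the unit ball \<open>B\<close>.\<close>

lemma nn_integral_refl:
 fixes f :: "'a::euclidean_space => ennreal"
 assumes [measurable]: "f \<in> bmeas" and e: "norm e = 1"
 shows "(\<integral>\<^sup>+x. f (mirror e x) \<partial>lborel) = (\<integral>\<^sup>+x. f x \<partial>lborel)"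
proof -
 define b :: "'a => ennreal" where "b = indicator (ball 0 1)"
 have [measurable]: "b \<in> bmeas" unfolding b_def by (intro borel_measurable_indicator) auto
 let ?beta = "\<integral>\<^sup>+y. b y \<partial>lborel"
 have beta: "?beta = ennreal (unit_ball_vol (real DIM('a)))"
  unfolding b_def by (simp add: emeasure_ball)
 have br: "b (mirror e x) = b x" for x by (simp add: b_def indicator_def mirror_norm[OF e])
 have "(\<integral>\<^sup>+x. f (mirror e x) \<partial>lborel) * ?beta = (\<integral>\<^sup>+x. f (mirror e x) * (\<integral>\<^sup>+y. b (y + mirror e x) \<partial>lborel) \<partial>lborel)"
  by (subst nn_integral_shift) (auto simp: nn_integral_multc)
 also have "\<dots> = (\<integral>\<^sup>+x. \<integral>\<^sup>+y. f (mirror e x) * b (y + mirror e x) \<partial>lborel \<partial>lborel)"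
  by (simp add: nn_integral_cmult)
 also have "\<dots> = (\<integral>\<^sup>+y. \<integral>\<^sup>+x. f (mirror e x) * b (y + mirror e x) \<partial>lborel \<partial>lborel)"
  by (rule lborel_pair.Fubini'[symmetric, where f="%x y. f (mirror e x) * b (y + mirror e x)"]) measurable
 also have "\<dots> = (\<integral>\<^sup>+y. \<integral>\<^sup>+x. f (mirror e x - y) * b (mirror e x) \<partial>lborel \<partial>lborel)"
 proof (rule nn_integral_cong)
  fix y
  have "(\<integral>\<^sup>+x. f (mirror e x) * b (y + mirror e x) \<partial>lborel) =
   (\<integral>\<^sup>+x. f (mirror e (x + - mirror e y)) * b (y + mirror e (x + - mirror e y)) \<partial>lborel)"
   by (rule nn_integral_shift[symmetric]) measurable
  also have "\<dots> = (\<integral>\<^sup>+x. f (mirror e x - y) * b (mirror e x) \<partial>lborel)"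
   by (simp add: mirror_diff mirror_mirror[OF e])
  finally show "(\<integral>\<^sup>+x. f (mirror e x) * b (y + mirror e x) \<partial>lborel) = \<dots>" .
 qed
 also have "\<dots> = (\<integral>\<^sup>+x. \<integral>\<^sup>+y. f (mirror e x - y) * b (mirror e x) \<partial>lborel \<partial>lborel)"
  by (rule lborel_pair.Fubini'[where f="%x y. f (mirror e x - y) * b (mirror e x)"]) measurable
 also have "\<dots> = (\<integral>\<^sup>+x. (\<integral>\<^sup>+y. f y \<partial>lborel) * b x \<partial>lborel)"
  by (simp add: nn_integral_multc nn_integral_reflect_shift br)
 also have "\<dots> = (\<integral>\<^sup>+y. f y \<partial>lborel) * ?beta" by (simp add: nn_integral_cmult)
 finally have "(\<integral>\<^sup>+x. f (mirror e x) \<partial>lborel) * ?beta = (\<integral>\<^sup>+y. f y \<partial>lborel) * ?beta" .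
 moreover have "unit_ball_vol (real DIM('a)) \<noteq> 0" by (rule less_imp_neq[OF unit_ball_vol_pos, symmetric]) simp
 then have "?beta \<noteq> 0" "?beta \<noteq> top" unfolding beta by (auto simp: ennreal_eq_0_iff not_le order.strict_iff_order)
 ultimately show ?thesis by (simp only: ennreal_mult_cancel_left mult.commute[of _ ?beta]) auto
qed

lemma distr_refl:
 fixes e :: "'a::euclidean_space"
 assumes e: "norm e = 1"
 shows "distr lborel borel (mirror e) = lborel"
proof (rule measure_eqI)
 fix A assume "A \<in> sets (distr lborel borel (mirror e))"
 then have [measurable]: "A \<in> sets borel" by simp
 have "emeasure (distr lborel borel (mirror e)) A = (\<integral>\<^sup>+x. indicator A x \<partial>distr lborel borel (mirror e))" by simp
 also have "\<dots> = (\<integral>\<^sup>+x. indicator A (mirror e x) \<partial>lborel)" by (rule nn_integral_distr) auto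
 also have "\<dots> = (\<integral>\<^sup>+x. indicator A x \<partial>lborel)" by (rule nn_integral_refl[OF _ e]) auto
 finally show "emeasure (distr lborel borel (mirror e)) A = emeasure lborel A" by simp
qed simp

lemma integral_refl:
 fixes f :: "'a::euclidean_space => real"
 assumes [measurable]: "f \<in> bmeas" and e: "norm e = 1"
 shows "(LINT x|lborel. f (mirror e x)) = (LINT x|lborel. f x)"
proof -
 have "(LINT x|lborel. f x) = (LINT x|distr lborel borel (mirror e). f x)" by (simp add: distr_refl[OF e])
 also have "\<dots> = (LINT x|lborel. f (mirror e x))" by (rule integral_distr) auto
 finally show ?thesis ..
qed

lemma integrable_refl:
 fixes f :: "'a::euclidean_space => real"
 assumes f: "integrable lborel f" and e: "norm e = 1"
 shows "integrable lborel (%x. f (mirror e x))"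
proof -
 have "integrable (distr lborel borel (mirror e)) f" using f by (simp add: distr_refl[OF e])
 then show ?thesis by (rule integrable_distr[rotated]) simp
qed

lemma AE_refl:
 fixes P :: "'a::euclidean_space => bool"
 assumes AE: "AE x in lborel. P x" and e: "norm e = 1"
 shows "AE y in lborel. P (mirror e y)"
proof -
 obtain N where N: "N \<in> null_sets lborel" "\<And>x. x \<notin> N ==> P x" using AE by (rule AE_E3) auto
 have [measurable]: "N \<in> sets borel" using N(1) by auto
 have "AE x in lborel. x \<notin> N" using N(1) by (rule AE_not_in)
 then have "AE x in distr lborel borel (mirror e). x \<notin> N" by (subst distr_refl[OF e])
 then have "AE y in lborel. mirror e y \<notin> N" by (subst (asm) AE_distr_iff) auto
 then show ?thesis by eventually_elim (use N(2) in auto)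
qed

lemma locint_refl:
 assumes l: "locint f" and e: "norm e = 1" shows "locint (%x. f (mirror e x))"
 unfolding locint_def
proof (intro conjI allI)
 have [measurable]: "f \<in> bmeas" using l by (rule locint_measurable)
 show "(%x. f (mirror e x)) \<in> bmeas" by measurable
 fix R
 have "integrable lborel (%x. indicator (ball 0 R) x * f x)" using l by (simp add: locint_def)
 from integrable_refl[OF this e]
 show "integrable lborel (%x. indicator (ball 0 R) x * f (mirror e x))"
  by (simp add: indicator_def mirror_norm[OF e])
qed

lemma vanishes_refl:
 assumes v: "vanishes f" and e: "norm e = 1" shows "vanishes (%x. f (mirror e x))"
 unfolding vanishes_def
proof (intro allI impI)
 fix epsilon :: real assume "epsilon > 0"
 then obtain R where "AE x in lborel. norm x >= R --> \<bar>f x\<bar> <= epsilon" using v unfolding vanishes_def by blast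
 from AE_refl[OF this e] show "\<exists>R. AE x in lborel. norm x >= R --> \<bar>f (mirror e x)\<bar> <= epsilon"
  by (auto simp: mirror_norm[OF e])
qed

lemma vanishes_add_scaled:
 assumes "vanishes f" "vanishes g" shows "vanishes (%x. f x + c * g x)"
 unfolding vanishes_def
proof (intro allI impI)
 fix epsilon :: real assume e: "epsilon > 0"
 then obtain R1 where R1: "AE x in lborel. norm x >= R1 --> \<bar>f x\<bar> <= epsilon / 2"
  using assms(1) unfolding vanishes_def by (meson half_gt_zero)
 have "epsilon / (2 * (\<bar>c\<bar> + 1)) > 0" using e by (intro divide_pos_pos) auto
 then obtain R2 where R2: "AE x in lborel. norm x >= R2 --> \<bar>g x\<bar> <= epsilon / (2 * (\<bar>c\<bar> + 1))"
  using assms(2) unfolding vanishes_def by blast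
 have "AE x in lborel. norm x >= max R1 R2 --> \<bar>f x + c * g x\<bar> <= epsilon"
  using R1 R2
 proof eventually_elim
  case (elim x)
  show ?case
  proof
   assume x: "norm x >= max R1 R2"
   have "\<bar>f x + c * g x\<bar> <= \<bar>f x\<bar> + \<bar>c\<bar> * \<bar>g x\<bar>" using abs_triangle_ineq[of "f x" "c * g x"] by (simp add: abs_mult)
   also have "\<dots> <= epsilon / 2 + (\<bar>c\<bar> + 1) * (epsilon / (2 * (\<bar>c\<bar> + 1)))"
    using elim x by (intro add_mono mult_mono) auto
   also have "\<dots> = epsilon / 2 + epsilon / 2" by (simp add: add_pos_nonneg field_simps)
   finally show "\<bar>f x + c * g x\<bar> <= epsilon" by simp
  qed
 qed
 then show "\<exists>R. AE x in lborel. norm x >= R --> \<bar>f x + c * g x\<bar> <= epsilon" by blast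
qed

text \<open>Reflections preserve measure and distances, so they turn a test function centred at
  \<open>z\<close> into one centred at the mirror image of \<open>z\<close>.\<close>

lemma radial_weak_refl:
 fixes phi F :: "'a::euclidean_space => real"
 assumes w: "radial_weak phi F" and e: "norm e = 1"
 shows "radial_weak (%x. phi (mirror e x)) (%x. F (mirror e x))"
 unfolding radial_weak_def
proof (intro conjI allI impI)
 note l = radial_weak_locint[OF w]
 have [measurable]: "phi \<in> bmeas" "F \<in> bmeas" using l by (auto intro: locint_measurable)
 show "locint (%x. phi (mirror e x))" "locint (%x. F (mirror e x))" using l e by (auto intro: locint_refl)
 fix h S and z :: 'a assume h: "smooth h" "\<forall>s\<ge>S. h s = 0"
 define L where "L s = 4 * s * deriv (deriv h) s + 2 * real DIM('a) * deriv h s" for s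
 have [measurable]: "h \<in> bmeas" "deriv h \<in> bmeas" "deriv (deriv h) \<in> bmeas"
  using h(1) by (auto intro!: borel_measurable_continuous_onI smooth_continuous smooth_derivD)
 have [measurable]: "L \<in> bmeas" unfolding L_def[abs_def] by measurable
 have "(LINT x|lborel. phi (mirror e (z + x)) * L (sq x)) = (LINT x|lborel. phi (mirror e z + mirror e x) * L (mirror e x \<bullet> mirror e x))"
  by (simp add: mirror_add mirror_inner[OF e])
 also have "\<dots> = (LINT x|lborel. phi (mirror e z + x) * L (sq x))"
  by (rule integral_refl[OF _ e, of "%x. phi (mirror e z + x) * L (sq x)"]) measurable
 also have "\<dots> = - (LINT x|lborel. F (mirror e z + x) * h (sq x))"
  using w h unfolding radial_weak_def L_def by blast
 also have "(LINT x|lborel. F (mirror e z + x) * h (sq x)) = (LINT x|lborel. F (mirror e z + mirror e x) * h (mirror e x \<bullet> mirror e x))"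
  by (rule integral_refl[OF _ e, of "%x. F (mirror e z + x) * h (sq x)", symmetric]) measurable
 also have "\<dots> = (LINT x|lborel. F (mirror e (z + x)) * h (sq x))" by (simp add: mirror_add mirror_inner[OF e])
 finally show "(LINT x|lborel. phi (mirror e (z + x)) * (4 * (sq x) * deriv (deriv h) (sq x) + 2 * real DIM('a) * deriv h (sq x))) =
   - (LINT x|lborel. F (mirror e (z + x)) * h (sq x))" unfolding L_def .
qed

lemma radial_test_compact:
 fixes h :: "real => real"
 assumes h: "smooth h" "\<forall>s\<ge>S. h s = 0"
 shows "\<exists>M R. \<forall>x::'a::euclidean_space. \<bar>h (sq x)\<bar> <= M \<and> (norm x >= R --> h (sq x) = 0)"
proof -
 have "compact (h ` {0..max 0 S})"
  by (intro compact_continuous_image smooth_continuous h(1)) auto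
 then have "bounded (h ` {0..max 0 S})" by (rule compact_imp_bounded)
 then obtain M where "\<forall>y\<in>h ` {0..max 0 S}. norm y <= M" unfolding bounded_iff by blast
 then have M: "\<And>s. s \<in> {0..max 0 S} ==> \<bar>h s\<bar> <= M" by simp
 have "\<bar>h s\<bar> <= M" if "s >= 0" for s
 proof (cases "s <= max 0 S")
  case False
  then have "h s = 0" using h(2) by auto
  then show ?thesis using M[of 0] by auto
 qed (use M that in auto)
 moreover have "h (sq x) = 0" if "norm x >= \<bar>S\<bar> + 1" for x :: 'a
 proof -
  have "\<bar>S\<bar> + 1 <= (\<bar>S\<bar> + 1) * (\<bar>S\<bar> + 1)" by (simp add: algebra_simps)
  also have "\<dots> <= norm x * norm x" using that by (intro mult_mono) auto
  finally show ?thesis using h(2) by (auto simp: dot_square_norm power2_eq_square)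
 qed
 ultimately show ?thesis by (intro exI[of _ M] exI[of _ "\<bar>S\<bar> + 1"]) auto
qed

lemma smooth_eventually_zero_derivs:
 assumes h: "smooth h" "\<forall>s\<ge>S. h s = 0"
 shows "\<forall>s\<ge>S + 1. deriv h s = 0"
proof (intro allI impI)
 fix s assume "s >= S + 1"
 have "(h has_real_derivative 0) (at s)"
  by (rule DERIV_cong_ev[THEN iffD1, OF refl _ refl DERIV_const[of 0]])
    (use h(2) \<open>s >= S + 1\<close> in \<open>auto simp: eventually_nhds intro!: exI[of _ "{S<..}"]\<close>)
 then show "deriv h s = 0" by (rule DERIV_imp_deriv)
qed

lemma radial_test_integrable:
 fixes f :: "'a::euclidean_space => real"
 assumes l: "locint f" and h: "smooth h" "\<forall>s\<ge>S. h s = 0"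
 shows "integrable lborel (%x. f (z + x) * h (sq x))"
  and "integrable lborel (%x. f (z + x) * (4 * (sq x) * deriv (deriv h) (sq x) + 2 * real DIM('a) * deriv h (sq x)))"
proof -
 have int: "integrable lborel (%x. f (z + x) * h (sq x))" if h: "smooth h" "\<forall>s\<ge>S. h s = 0" for h S
 proof -
  obtain M R where MR: "\<And>x::'a. \<bar>h (sq x)\<bar> <= M \<and> (norm x >= R --> h (sq x) = 0)"
   using radial_test_compact[OF h] by blast
  have [measurable]: "h \<in> bmeas"
   using h(1) by (auto intro!: borel_measurable_continuous_onI smooth_continuous)
  show ?thesis
   by (rule locint_mult_compact[OF locint_shift[OF l], of _ M R]) (use MR in auto)
 qed
 from int[OF h] show "integrable lborel (%x. f (z + x) * h (sq x))" .
 note d1 = smooth_derivD(2)[OF h(1)] and d2 = smooth_derivD(2)[OF smooth_derivD(2)[OF h(1)]]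
 note z1 = smooth_eventually_zero_derivs[OF h] and z2 = smooth_eventually_zero_derivs[OF d1 smooth_eventually_zero_derivs[OF h]]
 have id: "smooth (%s. s)" by (rule smooth_of_deriv[OF DERIV_ident]) (rule smooth_const)
 have "smooth (%s. 4 * s * deriv (deriv h) s + 2 * real DIM('a) * deriv h s)"
  by (intro smooth_add smooth_mult smooth_const id d1 d2)
 moreover have "\<forall>s\<ge>S + 2. 4 * s * deriv (deriv h) s + 2 * real DIM('a) * deriv h s = 0"
  using z1 z2 by auto
 ultimately show "integrable lborel (%x. f (z + x) * (4 * (sq x) * deriv (deriv h) (sq x) + 2 * real DIM('a) * deriv h (sq x)))"
  by (rule int)
qed

lemma radial_weak_add_scaled:
 fixes phi F :: "'a::euclidean_space => real"
 assumes w: "radial_weak phi F" "radial_weak psi G"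
 shows "radial_weak (%x. phi x + c * psi x) (%x. F x + c * G x)"
 unfolding radial_weak_def
proof (intro conjI allI impI)
 note l = radial_weak_locint[OF w(1)] radial_weak_locint[OF w(2)]
 show "locint (%x. phi x + c * psi x)" "locint (%x. F x + c * G x)"
  using l by (auto intro: locint_add locint_cmult)
 fix h S and z :: 'a assume h: "smooth h" "\<forall>s\<ge>S. h s = 0"
 define L where "L x = 4 * (sq x) * deriv (deriv h) (sq x) + 2 * real DIM('a) * deriv h (sq x)" for x :: 'a
 note i = radial_test_integrable[OF l(1) h, of z] radial_test_integrable[OF l(2) h, of z]
   radial_test_integrable[OF l(3) h, of z] radial_test_integrable[OF l(4) h, of z]
 have e1: "(LINT x|lborel. phi (z + x) * L x) = - (LINT x|lborel. F (z + x) * h (sq x))"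
  using w(1) h unfolding radial_weak_def L_def by blast
 have e2: "(LINT x|lborel. psi (z + x) * L x) = - (LINT x|lborel. G (z + x) * h (sq x))"
  using w(2) h unfolding radial_weak_def L_def by blast
 have "(LINT x|lborel. (phi (z + x) + c * psi (z + x)) * L x) = (LINT x|lborel. phi (z + x) * L x + c * (psi (z + x) * L x))"
  by (simp add: algebra_simps)
 also have "\<dots> = (LINT x|lborel. phi (z + x) * L x) + c * (LINT x|lborel. psi (z + x) * L x)"
  using i unfolding L_def[symmetric] by simp
 also have "\<dots> = - ((LINT x|lborel. F (z + x) * h (sq x)) + c * (LINT x|lborel. G (z + x) * h (sq x)))"
  by (simp add: e1 e2)
 also have "(LINT x|lborel. F (z + x) * h (sq x)) + c * (LINT x|lborel. G (z + x) * h (sq x)) =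
   (LINT x|lborel. F (z + x) * h (sq x) + c * (G (z + x) * h (sq x)))" using i by simp
 also have "\<dots> = (LINT x|lborel. (F (z + x) + c * G (z + x)) * h (sq x))" by (simp add: algebra_simps)
 finally show "(LINT x|lborel. (phi (z + x) + c * psi (z + x)) *
   (4 * (sq x) * deriv (deriv h) (sq x) + 2 * real DIM('a) * deriv h (sq x))) =
   - (LINT x|lborel. (F (z + x) + c * G (z + x)) * h (sq x))" unfolding L_def .
qed

section \<open>The Green kernel of the half space and its potentials\<close>

definition mirror_kernel :: "real => 'a::euclidean_space => 'a => 'a => real" where
 "mirror_kernel nu e y z = newton_kernel nu ((y - z) \<bullet> (y - z)) - newton_kernel nu ((mirror e y - z) \<bullet> (mirror e y - z))"

definition mirror_newton :: "real => real => 'a::euclidean_space => 'a => 'a => real" where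
 "mirror_newton nu k e y z = newton nu k ((y - z) \<bullet> (y - z)) - newton nu k ((mirror e y - z) \<bullet> (mirror e y - z))"

text \<open>The sign of the product of the signed heights of \<open>y\<close> and \<open>z\<close>
  over the hyperplane decides which of the two distances is larger, hence the sign of every mirror
  kernel. Up to a constant the exact one is the odd extension of the Dirichlet Green function of a
  half space.\<close>

lemma mirror_dist:
 assumes "norm e = 1"
 shows "(mirror e y - z) \<bullet> (mirror e y - z) = (y - z) \<bullet> (y - z) + 4 * ((y \<bullet> e) * (z \<bullet> e))"
proof -
 have "e \<bullet> e = 1" using assms by (simp add: dot_square_norm)
 then show ?thesis by (simp add: mirror_def inner_diff_left inner_diff_right inner_commute algebra_simps)
qed

lemma newton_kernel_strict:
 assumes "nu > 1" "0 < s" "s < t" shows "newton_kernel nu t < newton_kernel nu s"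
proof -
 have "t powr (1 - nu) < s powr (1 - nu)" using assms by (intro powr_less_mono2_neg) auto
 moreover have "ramp_max / (nu - 1) > 0" using assms ramp_max_pos by simp
 ultimately show ?thesis unfolding newton_kernel_def by (rule mult_strict_left_mono)
qed

text \<open>Everything follows by comparing \<open>newton\<close> at the squared distances s and t =
  s + 4 w, with w the product of the heights. The truncated kernels have the sign of the exact one,
  are dominated by it, and for fixed y and z coincide with it for large k.\<close>

lemma mirror_kernel_props:
 fixes y z e :: "'a::euclidean_space"
 assumes e: "norm e = 1" and nu: "nu > 1" and ne: "y \<noteq> z" "mirror e y \<noteq> z"
 shows mirror_newton_abs_le: "k >= 1 ==> \<bar>mirror_newton nu k e y z\<bar> <= \<bar>mirror_kernel nu e y z\<bar>"
  and mirror_newton_sign: "k >= 1 ==> mirror_newton nu k e y z * ((y \<bullet> e) * (z \<bullet> e)) >= 0"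
  and mirror_newton_zero: "(y \<bullet> e) * (z \<bullet> e) = 0 ==> mirror_newton nu k e y z = 0"
  and mirror_kernel_sign: "(y \<bullet> e) * (z \<bullet> e) \<noteq> 0 ==> mirror_kernel nu e y z * ((y \<bullet> e) * (z \<bullet> e)) > 0"
  and mirror_newton_eventually: "\<forall>\<^sub>F k in sequentially. mirror_newton nu (real k + 1) e y z = mirror_kernel nu e y z"
proof -
 define s t w where "s = (y - z) \<bullet> (y - z)" and "t = (mirror e y - z) \<bullet> (mirror e y - z)" and "w = (y \<bullet> e) * (z \<bullet> e)"
 have "s > 0" "t > 0" using ne by (simp_all add: s_def t_def)
 then have st: "s > 0" "t > 0" "t = s + 4 * w" using mirror_dist[OF e, of y z] by (auto simp: s_def t_def w_def)
 have K: "mirror_kernel nu e y z = newton_kernel nu s - newton_kernel nu t"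
  and M: "mirror_newton nu k e y z = newton nu k s - newton nu k t" for k
  by (auto simp: mirror_kernel_def mirror_newton_def s_def t_def)
 show "\<bar>mirror_newton nu k e y z\<bar> <= \<bar>mirror_kernel nu e y z\<bar>" if k: "k >= 1"
 proof (cases "w >= 0")
  case True
  then show ?thesis using newton_diff_bounds[OF nu k st(1), of t] st(3) unfolding K M by simp
 next
  case False
  then show ?thesis using newton_diff_bounds[OF nu k st(2), of s] st(3) unfolding K M by simp
 qed
 show "mirror_newton nu k e y z * ((y \<bullet> e) * (z \<bullet> e)) >= 0" if k: "k >= 1"
 proof (cases "w >= 0")
  case True
  then show ?thesis using newton_diff_bounds(1)[OF nu k st(1), of t] st(3) unfolding M w_def[symmetric] by simp
 next
  case False
  then show ?thesis using newton_diff_bounds(1)[OF nu k st(2), of s] st(3) unfolding M w_def[symmetric]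
   by (simp add: mult_nonpos_nonpos)
 qed
 show "mirror_newton nu k e y z = 0" if "(y \<bullet> e) * (z \<bullet> e) = 0"
  using that st(3) unfolding M w_def[symmetric] by simp
 show "mirror_kernel nu e y z * ((y \<bullet> e) * (z \<bullet> e)) > 0" if "(y \<bullet> e) * (z \<bullet> e) \<noteq> 0"
 proof (cases "w > 0")
  case True
  then show ?thesis using newton_kernel_strict[OF nu st(1), of t] st(3) unfolding K w_def[symmetric] by simp
 next
  case False
  moreover have "w \<noteq> 0" using that unfolding w_def .
  ultimately have "w < 0" by linarith
  then show ?thesis using newton_kernel_strict[OF nu st(2), of s] st(3) unfolding K w_def[symmetric]
   by (simp add: mult_neg_neg)
 qed
 show "\<forall>\<^sub>F k in sequentially. mirror_newton nu (real k + 1) e y z = mirror_kernel nu e y z"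
 proof -
  have "filterlim (%k. (real k + 1)\<^sup>2) at_top sequentially" by real_asymp
  then have 1: "\<forall>\<^sub>F k in sequentially. max s t <= (real k + 1)\<^sup>2" unfolding filterlim_at_top by blast
  have "(%k. 2 / (real k + 1)\<^sup>2) \<longlonglongrightarrow> 0" by real_asymp
  then have 2: "\<forall>\<^sub>F k in sequentially. 2 / (real k + 1)\<^sup>2 < min s t"
   by (rule order_tendstoD(2)) (use st in simp)
  from 1 2 show ?thesis
  proof eventually_elim
   case (elim k)
   have k: "real k + 1 >= 1" by simp
   show ?case
   proof (cases "s <= t")
    case True
    then show ?thesis using newton_diff_eq[OF nu k st(1) True] elim unfolding K M by simp
   next
    case False
    then show ?thesis using newton_diff_eq[OF nu k st(2), of s] elim unfolding K M by simp
   qed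
  qed
 qed
qed

lemma mirror_kernel_sym:
 assumes "norm e = 1" shows "mirror_kernel nu e y z = mirror_kernel nu e z y"
proof -
 have "(mirror e y - z) \<bullet> (mirror e y - z) = (mirror e z - y) \<bullet> (mirror e z - y)"
  unfolding mirror_dist[OF assms] by (simp add: inner_diff_left inner_diff_right inner_commute)
 moreover have "(y - z) \<bullet> (y - z) = (z - y) \<bullet> (z - y)" by (simp add: inner_diff_left inner_diff_right inner_commute)
 ultimately show ?thesis by (simp add: mirror_kernel_def)
qed

lemma AE_generic:
 fixes z e :: "'a::euclidean_space"
 assumes e: "norm e = 1"
 shows "AE y in lborel. y \<noteq> z \<and> mirror e y \<noteq> z"
proof -
 have "AE y in lborel. y \<noteq> z" "AE y in lborel. y \<noteq> mirror e z" by (rule AE_lborel_singleton)+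
 then show ?thesis by eventually_elim (use mirror_mirror[OF e] in auto)
qed

lemma AE_off_hyperplane:
 fixes e :: "'a::euclidean_space"
 assumes e: "norm e = 1" shows "AE y in lborel. y \<bullet> e \<noteq> 0"
proof -
 have "e \<noteq> 0" using e by auto
 then have "negligible {x. e \<bullet> x = 0}" using negligible_hyperplane by blast
 moreover have "{x. e \<bullet> x = 0} \<in> sets lborel" by measurable
 ultimately have "{x. e \<bullet> x = 0} \<in> null_sets lborel"
  by (simp add: negligible_iff_null_sets null_sets_completion_iff)
 from AE_not_in[OF this] show ?thesis by eventually_elim (simp add: inner_commute)
qed

lemma newton_smooth: "k >= 1 ==> smooth (newton nu k)"
 and newton_zero: "k >= 1 ==> s >= 2 * k\<^sup>2 ==> newton nu k s = 0"
proof -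
 assume k: "k >= 1"
 then have d: "1 / k\<^sup>2 > 0" by simp
 show "smooth (newton nu k)" unfolding newton_def
  by (rule tail_smooth[OF window_smooth d window_low[OF k] window_high[OF k]])
 show "newton nu k s = 0" if "s >= 2 * k\<^sup>2" unfolding newton_def
  by (rule tail_eq_0[OF window_smooth d window_low[OF k] window_high[OF k] that])
qed

text \<open>Averaging the integrand with its reflection replaces the kernel by half of the mirror
  kernel. The integral still runs over the whole space instead of a half space, which accounts for
  the factor 1/2 from here on.\<close>

lemma newton_fold:
 fixes F :: "'a::euclidean_space => real"
 assumes l: "locint F" and e: "norm e = 1" and odd: "\<And>y. F (mirror e y) = - F y" and k: "k >= 1"
 shows "integrable lborel (%y. F y * (mirror_newton nu k e y z / 2))"
  and "(LINT x|lborel. F (z + x) * newton nu k (sq x)) = (LINT y|lborel. F y * (mirror_newton nu k e y z / 2))"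
proof -
 define f where "f = (%y. F y * newton nu k ((y - z) \<bullet> (y - z)))"
 have "integrable lborel (%x. F (z + x) * newton nu k (sq x))"
  by (rule radial_test_integrable(1)[OF l newton_smooth[OF k], of "2 * k\<^sup>2"]) (use newton_zero[OF k] in auto)
 from integrable_shift[OF this, of "- z"] have f: "integrable lborel f"
  by (simp add: f_def algebra_simps)
 have fm [measurable]: "f \<in> bmeas" using borel_measurable_integrable[OF f] by simp
 have fe: "f (mirror e y) = - F y * newton nu k ((mirror e y - z) \<bullet> (mirror e y - z))" for y
  by (simp add: f_def odd)
 have eq: "F y * (mirror_newton nu k e y z / 2) = (f y + f (mirror e y)) / 2" for y
  unfolding fe by (simp add: f_def mirror_newton_def algebra_simps diff_divide_distrib)
 note fr = integrable_refl[OF f e]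
 show "integrable lborel (%y. F y * (mirror_newton nu k e y z / 2))"
  unfolding eq using f fr by auto
 have "(LINT x|lborel. F (z + x) * newton nu k (sq x)) = (LINT x|lborel. f (x + z))"
  by (simp add: f_def add.commute)
 also have "\<dots> = (LINT y|lborel. f y)" by (rule integral_shift[OF fm])
 also have "\<dots> = (LINT y|lborel. (f y + f (mirror e y)) / 2)"
  using f fr integral_refl[OF fm e] by simp
 finally show "(LINT x|lborel. F (z + x) * newton nu k (sq x)) = (LINT y|lborel. F y * (mirror_newton nu k e y z / 2))"
  unfolding eq .
qed

lemma mirror_measurable2 [measurable]:
 "(%(y, z). mirror_kernel nu e y z) \<in> borel_measurable (borel \<Otimes>\<^sub>M borel)"
proof -
 have [measurable]: "newton_kernel nu \<in> bmeas" unfolding newton_kernel_def[abs_def] by measurable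
 show ?thesis unfolding mirror_kernel_def mirror_def by measurable
qed

text \<open>Absolute values are taken inside the integral, so that the potential always makes sense
  in \<open>ennreal\<close> and its finiteness can be a conclusion.\<close>

definition mirror_potential :: "real => 'a::euclidean_space => ('a => real) => 'a => ennreal" where
 "mirror_potential nu e F z = (\<integral>\<^sup>+y. ennreal \<bar>F y\<bar> * ennreal (\<bar>mirror_kernel nu e y z\<bar> / 2) \<partial>lborel)"

lemma mirror_potential_tonelli:
 fixes A F :: "'a::euclidean_space => real"
 assumes [measurable]: "A \<in> bmeas" "F \<in> bmeas" and e: "norm e = 1"
 shows "(\<integral>\<^sup>+z. ennreal \<bar>A z\<bar> * mirror_potential nu e F z \<partial>lborel) = (\<integral>\<^sup>+y. ennreal \<bar>F y\<bar> * mirror_potential nu e A y \<partial>lborel)"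
proof -
 have "(\<integral>\<^sup>+z. ennreal \<bar>A z\<bar> * mirror_potential nu e F z \<partial>lborel) =
   (\<integral>\<^sup>+z. \<integral>\<^sup>+y. ennreal \<bar>A z\<bar> * (ennreal \<bar>F y\<bar> * ennreal (\<bar>mirror_kernel nu e y z\<bar> / 2)) \<partial>lborel \<partial>lborel)"
  unfolding mirror_potential_def by (intro nn_integral_cong nn_integral_cmult[symmetric]) measurable
 also have "\<dots> = (\<integral>\<^sup>+y. \<integral>\<^sup>+z. ennreal \<bar>A z\<bar> * (ennreal \<bar>F y\<bar> * ennreal (\<bar>mirror_kernel nu e y z\<bar> / 2)) \<partial>lborel \<partial>lborel)"
  by (rule lborel_pair.Fubini'[symmetric, where f="%z y. ennreal \<bar>A z\<bar> * (ennreal \<bar>F y\<bar> * ennreal (\<bar>mirror_kernel nu e y z\<bar> / 2))"]) measurable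
 also have "\<dots> = (\<integral>\<^sup>+y. \<integral>\<^sup>+z. ennreal \<bar>F y\<bar> * (ennreal \<bar>A z\<bar> * ennreal (\<bar>mirror_kernel nu e z y\<bar> / 2)) \<partial>lborel \<partial>lborel)"
  by (intro nn_integral_cong) (simp add: mirror_kernel_sym[OF e, of nu "_ :: 'a"] mult.left_commute)
 also have "\<dots> = (\<integral>\<^sup>+y. ennreal \<bar>F y\<bar> * mirror_potential nu e A y \<partial>lborel)"
  unfolding mirror_potential_def by (intro nn_integral_cong nn_integral_cmult) measurable
 finally show ?thesis .
qed

lemma AE_all_balls:
 assumes "\<And>R::real. AE z in M. norm (z::'a::real_normed_vector) < R --> P z"
 shows "AE z in M. P z"
proof -
 have "AE z in M. \<forall>n::nat. norm z < real n --> P z" by (intro AE_all_countable[THEN iffD2] allI assms)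
 then show ?thesis
 proof eventually_elim
  case (elim z)
  obtain n :: nat where "norm z < real n" using reals_Archimedean2 by blast
  then show ?case using elim by blast
 qed
qed

text \<open>The truncated integrals converge to a multiple of \<open>phi z\<close> and are dominated
  by the potential, which gives the first bound. Where the potential is finite, dominated
  convergence yields the exact representation. If \<open>F\<close> has the sign of the height, every
  truncated integrand has a single sign and Fatou's lemma reverses the first bound.\<close>

lemma odd_potential_upper:
 fixes phi F :: "'a::euclidean_space => real"
 assumes w: "radial_weak phi F" and v: "vanishes phi" and nu: "nu = real DIM('a) / 2" "nu > 1"
  and e: "norm e = 1" and odd: "\<And>y. F (mirror e y) = - F y"
 shows "AE z in lborel. ennreal ((LINT y|lborel. shell nu (y :: 'a)) * \<bar>phi z\<bar>) <= mirror_potential nu e F z"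
  and "AE z in lborel. mirror_potential nu e F z < \<infinity> -->
    integrable lborel (%y. F y * (mirror_kernel nu e y z / 2)) \<and>
    (LINT y|lborel. shell nu (y :: 'a)) * phi z = (LINT y|lborel. F y * (mirror_kernel nu e y z / 2))"
  and "(\<And>y. F y * (y \<bullet> e) >= 0) ==>
    AE z in lborel. mirror_potential nu e F z <= ennreal ((LINT y|lborel. shell nu (y :: 'a)) * \<bar>phi z\<bar>)"
proof -
 define c where "c = (LINT y|lborel. shell nu (y :: 'a))"
 have nu1: "nu >= 1" using nu by simp
 have c: "c > 0" unfolding c_def by (rule shell_integral_pos[OF nu1])
 note l = radial_weak_locint(2)[OF w]
 have [measurable]: "F \<in> bmeas" using l by (rule locint_measurable)
 define X where "X k z y = F y * (mirror_newton nu (real k + 1) e y z / 2)" for k :: nat and z y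
 define Y where "Y z y = F y * (mirror_kernel nu e y z / 2)" for z y
 have [measurable]: "Y z \<in> bmeas" for z unfolding Y_def by measurable
 have Xi: "integrable lborel (X k z)" for k z
  unfolding X_def by (rule newton_fold(1)[OF l e odd]) auto
 then have [measurable]: "X k z \<in> bmeas" for k z
  using borel_measurable_integrable by force
 have Yp: "mirror_potential nu e F z = (\<integral>\<^sup>+y. ennreal \<bar>Y z y\<bar> \<partial>lborel)" for z
  unfolding mirror_potential_def Y_def by (simp add: ennreal_mult[symmetric] abs_mult)
 have XY: "AE y in lborel. \<bar>X k z y\<bar> <= \<bar>Y z y\<bar>" for k z
  using AE_generic[OF e, of z]
 proof eventually_elim
  case (elim y)
  then have "\<bar>mirror_newton nu (real k + 1) e y z\<bar> <= \<bar>mirror_kernel nu e y z\<bar>"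
   by (intro mirror_newton_abs_le[OF e nu(2)]) auto
  then show ?case unfolding X_def Y_def by (simp add: abs_mult mult_left_mono)
 qed
 have Xlim: "AE y in lborel. (%j. X (r j) z y) \<longlonglongrightarrow> Y z y" if r: "strict_mono r" for r z
  using AE_generic[OF e, of z]
 proof eventually_elim
  case (elim y)
  have "\<forall>\<^sub>F k in sequentially. X k z y = Y z y"
   using mirror_newton_eventually[OF e nu(2), of y z] elim unfolding X_def Y_def by (auto elim: eventually_mono)
  then have "(%k. X k z y) \<longlonglongrightarrow> Y z y" by (rule tendsto_eventually)
  from LIMSEQ_subseq_LIMSEQ[OF this r] show ?case by (simp add: o_def)
 qed
 have Xnn: "(\<integral>\<^sup>+y. ennreal \<bar>X k z y\<bar> \<partial>lborel) = ennreal (LINT y|lborel. \<bar>X k z y\<bar>)" for k z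
  by (rule nn_integral_eq_integral) (use Xi in auto)
 have lim: "\<exists>r. strict_mono r \<and> (AE z in lborel. norm z < R --> (%j. LINT y|lborel. X (r j) z y) \<longlonglongrightarrow> phi z * c)" for R
 proof -
  have "(LINT x|lborel. F (z + x) * newton nu (real k + 1) (sq x)) = (LINT y|lborel. X k z y)" for z k
   unfolding X_def by (rule newton_fold(2)[OF l e odd]) auto
  then show ?thesis using newton_limit_AE[OF w v nu(1) nu1, of R] unfolding c_def by simp
 qed
 show "AE z in lborel. ennreal ((LINT y|lborel. shell nu (y :: 'a)) * \<bar>phi z\<bar>) <= mirror_potential nu e F z"
 proof (rule AE_all_balls)
  fix R
  obtain r where r: "strict_mono r" "AE z in lborel. norm z < R --> (%j. LINT y|lborel. X (r j) z y) \<longlonglongrightarrow> phi z * c"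
   using lim by blast
  show "AE z in lborel. norm z < R --> ennreal ((LINT y|lborel. shell nu (y :: 'a)) * \<bar>phi z\<bar>) <= mirror_potential nu e F z"
   using r(2)
  proof eventually_elim
   case (elim z)
   show ?case
   proof
    assume "norm z < R"
    with elim have "(%j. \<bar>LINT y|lborel. X (r j) z y\<bar>) \<longlonglongrightarrow> \<bar>phi z * c\<bar>" by (intro tendsto_rabs) auto
    then have 1: "(%j. ennreal \<bar>LINT y|lborel. X (r j) z y\<bar>) \<longlonglongrightarrow> ennreal \<bar>phi z * c\<bar>" by (rule tendsto_ennrealI)
    have 2: "ennreal \<bar>LINT y|lborel. X k z y\<bar> <= mirror_potential nu e F z" for k
    proof -
     have "\<bar>LINT y|lborel. X k z y\<bar> <= (LINT y|lborel. \<bar>X k z y\<bar>)"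
      using integral_norm_bound[of lborel "X k z"] by simp
     then have "ennreal \<bar>LINT y|lborel. X k z y\<bar> <= (\<integral>\<^sup>+y. ennreal \<bar>X k z y\<bar> \<partial>lborel)"
      unfolding Xnn by (rule ennreal_leI)
     also have "\<dots> <= (\<integral>\<^sup>+y. ennreal \<bar>Y z y\<bar> \<partial>lborel)"
      by (rule nn_integral_mono_AE) (use XY[of k z] in \<open>auto elim!: eventually_mono intro: ennreal_leI\<close>)
     finally show ?thesis unfolding Yp .
    qed
    have "ennreal \<bar>phi z * c\<bar> <= mirror_potential nu e F z"
     by (rule LIMSEQ_le_const2[OF 1]) (use 2 in auto)
    then show "ennreal ((LINT y|lborel. shell nu (y :: 'a)) * \<bar>phi z\<bar>) <= mirror_potential nu e F z"
     using c unfolding c_def[symmetric] by (simp add: abs_mult mult.commute)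
   qed
  qed
 qed
 show "AE z in lborel. mirror_potential nu e F z < \<infinity> -->
    integrable lborel (%y. F y * (mirror_kernel nu e y z / 2)) \<and>
    (LINT y|lborel. shell nu (y :: 'a)) * phi z = (LINT y|lborel. F y * (mirror_kernel nu e y z / 2))"
 proof (rule AE_all_balls)
  fix R
  obtain r where r: "strict_mono r" "AE z in lborel. norm z < R --> (%j. LINT y|lborel. X (r j) z y) \<longlonglongrightarrow> phi z * c"
   using lim by blast
  show "AE z in lborel. norm z < R --> mirror_potential nu e F z < \<infinity> -->
    integrable lborel (%y. F y * (mirror_kernel nu e y z / 2)) \<and>
    (LINT y|lborel. shell nu (y :: 'a)) * phi z = (LINT y|lborel. F y * (mirror_kernel nu e y z / 2))"
   using r(2)
  proof eventually_elim
   case (elim z)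
   show ?case
   proof (intro impI)
    assume z: "norm z < R" and fin: "mirror_potential nu e F z < \<infinity>"
    have Yi: "integrable lborel (Y z)"
     by (rule integrableI_bounded) (use fin in \<open>auto simp: Yp\<close>)
    have "(%j. LINT y|lborel. X (r j) z y) \<longlonglongrightarrow> (LINT y|lborel. Y z y)"
     by (rule integral_dominated_convergence[where w="%y. \<bar>Y z y\<bar>"])
       (use Yi Xlim[OF r(1)] XY in auto)
    with elim z have "phi z * c = (LINT y|lborel. Y z y)" using LIMSEQ_unique by blast
    with Yi show "integrable lborel (%y. F y * (mirror_kernel nu e y z / 2)) \<and>
     (LINT y|lborel. shell nu (y :: 'a)) * phi z = (LINT y|lborel. F y * (mirror_kernel nu e y z / 2))"
     unfolding Y_def c_def by (simp add: mult.commute)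
   qed
  qed
 qed
 show "AE z in lborel. mirror_potential nu e F z <= ennreal ((LINT y|lborel. shell nu (y :: 'a)) * \<bar>phi z\<bar>)"
  if sgn: "\<And>y. F y * (y \<bullet> e) >= 0"
 proof (rule AE_all_balls)
  fix R
  obtain r where r: "strict_mono r" "AE z in lborel. norm z < R --> (%j. LINT y|lborel. X (r j) z y) \<longlonglongrightarrow> phi z * c"
   using lim by blast
  show "AE z in lborel. norm z < R --> mirror_potential nu e F z <= ennreal ((LINT y|lborel. shell nu (y :: 'a)) * \<bar>phi z\<bar>)"
   using r(2)
  proof eventually_elim
   case (elim z)
   show ?case
   proof
    assume "norm z < R"
    with elim have "(%j. \<bar>LINT y|lborel. X (r j) z y\<bar>) \<longlonglongrightarrow> \<bar>phi z * c\<bar>" by (intro tendsto_rabs) auto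
    then have 1: "(%j. ennreal \<bar>LINT y|lborel. X (r j) z y\<bar>) \<longlonglongrightarrow> ennreal \<bar>phi z * c\<bar>" by (rule tendsto_ennrealI)
    have 2: "(\<integral>\<^sup>+y. ennreal \<bar>X k z y\<bar> \<partial>lborel) <= ennreal \<bar>LINT y|lborel. X k z y\<bar>" for k
    proof -
     \<comment> \<open>\<open>F\<close> carries the sign of the height of \<open>y\<close>, the
       kernel that of the product of both heights; together only the sign of the height of
       \<open>z\<close> remains.\<close>
     have "AE y in lborel. \<bar>X k z y\<bar> = sgn (z \<bullet> e) * X k z y"
      using AE_generic[OF e, of z]
     proof eventually_elim
      case (elim y)
      let ?m = "mirror_newton nu (real k + 1) e y z"
      have ne: "y \<noteq> z" "mirror e y \<noteq> z" using elim by auto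
      have m: "?m * ((y \<bullet> e) * (z \<bullet> e)) >= 0" by (rule mirror_newton_sign[OF e nu(2) ne]) auto
      have 0: "(y \<bullet> e) * (z \<bullet> e) = 0 ==> ?m = 0" by (rule mirror_newton_zero[OF e nu(2) ne])
      have "sgn (z \<bullet> e) * (F y * ?m) >= 0"
      proof (cases "(y \<bullet> e) * (z \<bullet> e) = 0")
       case False
       have "(F y * (y \<bullet> e)) * (?m * ((y \<bullet> e) * (z \<bullet> e))) >= 0" using sgn[of y] m by (rule mult_nonneg_nonneg)
       then have "(y \<bullet> e)\<^sup>2 * ((F y * ?m) * (z \<bullet> e)) >= 0" by (simp add: power2_eq_square mult_ac)
       then have "(F y * ?m) * (z \<bullet> e) >= 0" using False by (simp add: zero_le_mult_iff)
       then show ?thesis by (auto simp: sgn_if zero_le_mult_iff mult_le_0_iff split: if_splits)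
      qed (simp add: 0)
      moreover have "X k z y = F y * ?m / 2" by (simp add: X_def)
      moreover have "z \<bullet> e = 0 ==> F y * ?m = 0" using 0 by simp
      ultimately show ?case
       by (cases "z \<bullet> e" "0::real" rule: linorder_cases) (auto simp: sgn_if)
     qed
     then have "(LINT y|lborel. \<bar>X k z y\<bar>) = (LINT y|lborel. sgn (z \<bullet> e) * X k z y)"
      by (intro integral_cong_AE) auto
     also have "\<dots> = sgn (z \<bullet> e) * (LINT y|lborel. X k z y)" by simp
     also have "\<dots> <= \<bar>LINT y|lborel. X k z y\<bar>" by (auto simp: sgn_if abs_ge_self abs_ge_minus_self)
     finally show ?thesis unfolding Xnn by (rule ennreal_leI)
    qed
    have "mirror_potential nu e F z = (\<integral>\<^sup>+y. liminf (%j. ennreal \<bar>X (r j) z y\<bar>) \<partial>lborel)"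
     unfolding Yp
    proof (rule nn_integral_cong_AE)
     show "AE y in lborel. ennreal \<bar>Y z y\<bar> = liminf (%j. ennreal \<bar>X (r j) z y\<bar>)"
      using Xlim[OF r(1), of z]
     proof eventually_elim
      case (elim y)
      have "(%j. ennreal \<bar>X (r j) z y\<bar>) \<longlonglongrightarrow> ennreal \<bar>Y z y\<bar>"
       using elim by (intro tendsto_ennrealI tendsto_rabs)
      then show ?case by (intro lim_imp_Liminf[symmetric]) simp_all
     qed
    qed
    also have "\<dots> <= liminf (%j. \<integral>\<^sup>+y. ennreal \<bar>X (r j) z y\<bar> \<partial>lborel)"
     by (rule nn_integral_liminf) measurable
    also have "\<dots> <= liminf (%j. ennreal \<bar>LINT y|lborel. X (r j) z y\<bar>)"
     by (rule Liminf_mono) (use 2 in auto)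
    also have "\<dots> = ennreal \<bar>phi z * c\<bar>" by (rule lim_imp_Liminf[OF _ 1]) simp
    finally show "mirror_potential nu e F z <= ennreal ((LINT y|lborel. shell nu (y :: 'a)) * \<bar>phi z\<bar>)"
     using c unfolding c_def[symmetric] by (simp add: abs_mult mult.commute)
   qed
  qed
 qed
qed

section \<open>Uniqueness of odd solutions by duality\<close>

lemma AE_eq_of_nn_integral_le:
 assumes [measurable]: "u \<in> borel_measurable M" "v \<in> borel_measurable M"
  and le: "AE x in M. u x <= v x" and fin: "(\<integral>\<^sup>+x. u x \<partial>M) < \<infinity>" and int: "(\<integral>\<^sup>+x. v x \<partial>M) <= (\<integral>\<^sup>+x. u x \<partial>M)"
 shows "AE x in M. u x = v x"
proof -
 have "(\<integral>\<^sup>+x. v x - u x \<partial>M) = (\<integral>\<^sup>+x. v x \<partial>M) - (\<integral>\<^sup>+x. u x \<partial>M)"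
  by (rule nn_integral_diff) (use fin le in auto)
 also have "\<dots> = 0"
  using le_less_trans[OF int fin] int by (intro diff_eq_0_ennreal) auto
 finally have "AE x in M. v x - u x = 0" by (simp add: nn_integral_0_iff_AE)
 with le show ?thesis
 proof eventually_elim
  case (elim x)
  then show ?case by (metis diff_add_cancel_ennreal add_0)
 qed
qed

text \<open>\<open>P\<close> and \<open>Q\<close> stand for the even linearized weights,
  \<open>f\<close> and \<open>g\<close> for the odd solution that is positive on the half space.
  \<open>weight\<close> postulates finiteness of one of the two dual pairings, that of
  \<open>Q\<close> with \<open>f\<close>; finiteness of the pairing of \<open>P\<close> with
  \<open>g\<close> is derived.\<close>

locale odd_pair =
 fixes e :: "'a::euclidean_space" and P Q f g :: "'a => real"
 assumes dim: "DIM('a) >= 3" and e: "norm e = 1"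
  and PQ_cont: "continuous_on UNIV P" "continuous_on UNIV Q"
  and PQ_pos: "\<And>x. P x > 0" "\<And>x. Q x > 0"
  and PQ_even: "\<And>x. P (mirror e x) = P x" "\<And>x. Q (mirror e x) = Q x"
  and fg_weak: "radial_weak f (%x. P x * g x)" "radial_weak g (%x. Q x * f x)"
  and fg_vanishes: "vanishes f" "vanishes g"
  and fg_odd: "\<And>x. f (mirror e x) = - f x" "\<And>x. g (mirror e x) = - g x"
  and fg_sign: "\<And>x. x \<bullet> e \<noteq> 0 ==> f x * (x \<bullet> e) > 0" "\<And>x. x \<bullet> e \<noteq> 0 ==> g x * (x \<bullet> e) > 0"
  and weight: "\<And>h. locint h ==> vanishes h ==> (\<integral>\<^sup>+x. ennreal \<bar>Q x * h x\<bar> * ennreal \<bar>f x\<bar> \<partial>lborel) < \<infinity>"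
begin

definition nu :: real where "nu = real DIM('a) / 2"
definition c :: real where "c = (LINT y|lborel. shell nu (y :: 'a))"

lemma nu: "nu > 1" using dim by (simp add: nu_def)
lemma c: "c > 0" unfolding c_def by (rule shell_integral_pos) (use nu in simp)

lemma measurable_weights [measurable]:
 "P \<in> bmeas" "Q \<in> bmeas" "f \<in> bmeas" "g \<in> bmeas"
 using PQ_cont radial_weak_locint(1)[OF fg_weak(1)] radial_weak_locint(1)[OF fg_weak(2)]
 by (auto intro: borel_measurable_continuous_onI locint_measurable)

lemma sign_nonneg: "f x * (x \<bullet> e) >= 0" "g x * (x \<bullet> e) >= 0"
 using fg_sign[of x] by (cases "x \<bullet> e = 0"; force)+

definition solution :: "('a => real) => ('a => real) => bool" where
 "solution phi psi \<longleftrightarrow> radial_weak phi (%x. P x * psi x) \<and> radial_weak psi (%x. Q x * phi x) \<and>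
   vanishes phi \<and> vanishes psi \<and> (\<forall>x. phi (mirror e x) = - phi x) \<and> (\<forall>x. psi (mirror e x) = - psi x)"

lemma solution_fg: "solution f g"
 unfolding solution_def using fg_weak fg_vanishes fg_odd by auto

lemma solution_add_scaled:
 assumes "solution phi1 psi1" "solution phi2 psi2"
 shows "solution (%x. phi1 x + t * phi2 x) (%x. psi1 x + t * psi2 x)"
 using assms unfolding solution_def
 using radial_weak_add_scaled[of phi1 "%x. P x * psi1 x" phi2 "%x. P x * psi2 x" t]
  radial_weak_add_scaled[of psi1 "%x. Q x * phi1 x" psi2 "%x. Q x * phi2 x" t]
 by (auto simp: vanishes_add_scaled distrib_left mult.left_commute)

text \<open>Testing \<open>|\<phi>| \<le> G(P|\<psi>|)\<close> and \<open>|\<psi>| \<le> G(Q|\<phi>|)\<close> against the positive solution \<open>(f, g)\<close> and using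
  the symmetry of the kernel forces equality, hence constant sign on each side of the hyperplane.\<close>

lemma pairing:
 assumes s: "solution phi psi"
 shows "(\<integral>\<^sup>+x. ennreal \<bar>P x * psi x\<bar> * ennreal \<bar>g x\<bar> \<partial>lborel) < \<infinity>"
  and "AE z in lborel. mirror_potential nu e (%x. P x * psi x) z = ennreal (c * \<bar>phi z\<bar>)"
proof -
 note S = s[unfolded solution_def]
 have w: "radial_weak phi (%x. P x * psi x)" "radial_weak psi (%x. Q x * phi x)" and v: "vanishes phi" "vanishes psi"
  and o: "P (mirror e x) * psi (mirror e x) = - (P x * psi x)" "Q (mirror e x) * phi (mirror e x) = - (Q x * phi x)"
   "P (mirror e x) * g (mirror e x) = - (P x * g x)" "Q (mirror e x) * f (mirror e x) = - (Q x * f x)" for x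
  using S PQ_even fg_odd by auto
 have [measurable]: "phi \<in> bmeas" "psi \<in> bmeas"
  using radial_weak_locint(1)[OF w(1)] radial_weak_locint(1)[OF w(2)] by (auto intro: locint_measurable)
 have sg: "P y * g y * (y \<bullet> e) >= 0" "Q y * f y * (y \<bullet> e) >= 0" for y
  using mult_nonneg_nonneg[OF less_imp_le[OF PQ_pos(1)[of y]] sign_nonneg(2)[of y]]
   mult_nonneg_nonneg[OF less_imp_le[OF PQ_pos(2)[of y]] sign_nonneg(1)[of y]] by (auto simp: mult.assoc)
 let ?N = "mirror_potential nu e"
 have mN [measurable]: "?N F \<in> bmeas" if "F \<in> bmeas" for F
  using that unfolding mirror_potential_def[abs_def] by measurable
 note up = odd_potential_upper[OF _ _ nu_def nu e, folded c_def]
 have u1: "AE z in lborel. ennreal (c * \<bar>phi z\<bar>) <= ?N (%x. P x * psi x) z" by (rule up(1)[OF w(1) v(1) o(1)])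
 have u2: "AE z in lborel. ennreal (c * \<bar>psi z\<bar>) <= ?N (%x. Q x * phi x) z" by (rule up(1)[OF w(2) v(2) o(2)])
 have l1: "AE z in lborel. ?N (%x. P x * g x) z <= ennreal (c * \<bar>f z\<bar>)" by (rule up(3)[OF fg_weak(1) fg_vanishes(1) o(3) sg(1)])
 have l2: "AE z in lborel. ?N (%x. Q x * f x) z <= ennreal (c * \<bar>g z\<bar>)" by (rule up(3)[OF fg_weak(2) fg_vanishes(2) o(4) sg(2)])
 define a where "a = (\<integral>\<^sup>+x. ennreal \<bar>Q x * phi x\<bar> * ennreal \<bar>f x\<bar> \<partial>lborel)"
 define b where "b = (\<integral>\<^sup>+x. ennreal \<bar>P x * psi x\<bar> * ennreal \<bar>g x\<bar> \<partial>lborel)"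
 have a: "a < \<infinity>" unfolding a_def by (rule weight[OF radial_weak_locint(1)[OF w(1)] v(1)])
 have cpull: "(\<integral>\<^sup>+x. ennreal \<bar>A x\<bar> * ennreal (c * \<bar>B x\<bar>) \<partial>lborel) = ennreal c * (\<integral>\<^sup>+x. ennreal \<bar>A x\<bar> * ennreal \<bar>B x\<bar> \<partial>lborel)"
  if [measurable]: "A \<in> bmeas" "B \<in> bmeas" for A B :: "'a => real"
  using c by (subst nn_integral_cmult[symmetric]) (auto simp: ennreal_mult mult_ac intro!: nn_integral_cong)
 have swap: "ennreal \<bar>P x * g x\<bar> * ennreal \<bar>psi x\<bar> = ennreal \<bar>P x * psi x\<bar> * ennreal \<bar>g x\<bar>"
  "ennreal \<bar>Q x * f x\<bar> * ennreal \<bar>phi x\<bar> = ennreal \<bar>Q x * phi x\<bar> * ennreal \<bar>f x\<bar>" for x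
  by (simp_all add: ennreal_mult[symmetric] abs_mult mult_ac)
 have "ennreal c * b = (\<integral>\<^sup>+z. ennreal \<bar>P z * g z\<bar> * ennreal (c * \<bar>psi z\<bar>) \<partial>lborel)"
  by (subst cpull) (auto simp: b_def swap)
 also have "\<dots> <= (\<integral>\<^sup>+z. ennreal \<bar>P z * g z\<bar> * ?N (%x. Q x * phi x) z \<partial>lborel)"
  by (rule nn_integral_mono_AE) (use u2 in \<open>auto elim!: eventually_mono intro: mult_left_mono\<close>)
 also have "\<dots> = (\<integral>\<^sup>+z. ennreal \<bar>Q z * phi z\<bar> * ?N (%x. P x * g x) z \<partial>lborel)"
  by (rule mirror_potential_tonelli[OF _ _ e]) measurable
 also have "\<dots> <= (\<integral>\<^sup>+z. ennreal \<bar>Q z * phi z\<bar> * ennreal (c * \<bar>f z\<bar>) \<partial>lborel)"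
  by (rule nn_integral_mono_AE) (use l1 in \<open>auto elim!: eventually_mono intro: mult_left_mono\<close>)
 also have "\<dots> = ennreal c * a" by (subst cpull) (auto simp: a_def)
 finally have ba: "ennreal c * b <= ennreal c * a" .
 have "(\<integral>\<^sup>+z. ennreal \<bar>Q z * f z\<bar> * ?N (%x. P x * psi x) z \<partial>lborel) = (\<integral>\<^sup>+z. ennreal \<bar>P z * psi z\<bar> * ?N (%x. Q x * f x) z \<partial>lborel)"
  by (rule mirror_potential_tonelli[OF _ _ e]) measurable
 also have "\<dots> <= (\<integral>\<^sup>+z. ennreal \<bar>P z * psi z\<bar> * ennreal (c * \<bar>g z\<bar>) \<partial>lborel)"
  by (rule nn_integral_mono_AE) (use l2 in \<open>auto elim!: eventually_mono intro: mult_left_mono\<close>)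
 also have "\<dots> = ennreal c * b" by (subst cpull) (auto simp: b_def)
 also note ba
 also have "ennreal c * a = (\<integral>\<^sup>+z. ennreal \<bar>Q z * f z\<bar> * ennreal (c * \<bar>phi z\<bar>) \<partial>lborel)"
  by (subst cpull) (auto simp: a_def swap)
 finally have le: "(\<integral>\<^sup>+z. ennreal \<bar>Q z * f z\<bar> * ?N (%x. P x * psi x) z \<partial>lborel) <= (\<integral>\<^sup>+z. ennreal \<bar>Q z * f z\<bar> * ennreal (c * \<bar>phi z\<bar>) \<partial>lborel)" .
 have afin: "ennreal c * a < \<infinity>" using a by (simp add: ennreal_mult_less_top)
 then have "ennreal c * b < \<infinity>" using ba by (rule le_less_trans[rotated])
 then show "(\<integral>\<^sup>+x. ennreal \<bar>P x * psi x\<bar> * ennreal \<bar>g x\<bar> \<partial>lborel) < \<infinity>"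
  using c unfolding b_def[symmetric] by (auto simp: ennreal_mult_less_top)
 have "AE z in lborel. ennreal \<bar>Q z * f z\<bar> * ennreal (c * \<bar>phi z\<bar>) = ennreal \<bar>Q z * f z\<bar> * ?N (%x. P x * psi x) z"
 proof (rule AE_eq_of_nn_integral_le[OF _ _ _ _ le])
  show "AE x in lborel. ennreal \<bar>Q x * f x\<bar> * ennreal (c * \<bar>phi x\<bar>) <= ennreal \<bar>Q x * f x\<bar> * ?N (%x. P x * psi x) x"
   using u1 by eventually_elim (auto intro: mult_left_mono)
  show "(\<integral>\<^sup>+x. ennreal \<bar>Q x * f x\<bar> * ennreal (c * \<bar>phi x\<bar>) \<partial>lborel) < \<infinity>"
   using afin by (subst cpull) (auto simp: a_def swap)
 qed measurable
 with AE_off_hyperplane[OF e] show "AE z in lborel. ?N (%x. P x * psi x) z = ennreal (c * \<bar>phi z\<bar>)"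
 proof eventually_elim
  case (elim z)
  have "f z \<noteq> 0" using fg_sign(1)[OF elim(1)] by auto
  then have "\<bar>Q z * f z\<bar> > 0" using PQ_pos(2)[of z] by simp
  then have "ennreal \<bar>Q z * f z\<bar> \<noteq> 0" "ennreal \<bar>Q z * f z\<bar> \<noteq> top" by auto
  then show ?case using elim(2) by (metis ennreal_mult_cancel_left)
 qed
qed

text \<open>At one generic point \<open>z\<close> the potential of |P psi| equals the absolute value
  of the potential of P psi, so the integrand has constant sign in \<open>y\<close>. The sign of the
  kernel is known, hence \<open>psi\<close> has one sign on each side of the hyperplane. A single
  \<open>z\<close> suffices.\<close>

lemma solution_signed:
 assumes s: "solution phi psi"
 shows "(AE y in lborel. psi y * (y \<bullet> e) >= 0) \<or> (AE y in lborel. psi y * (y \<bullet> e) <= 0)"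
proof -
 have w: "radial_weak phi (%x. P x * psi x)" and v: "vanishes phi"
  and o: "P (mirror e x) * psi (mirror e x) = - (P x * psi x)" for x
  using s PQ_even unfolding solution_def by auto
 have "AE z in lborel. z \<bullet> e \<noteq> 0 \<and> (\<exists>X. integrable lborel X \<and> X = (%y. P y * psi y * (mirror_kernel nu e y z / 2)) \<and>
   \<bar>LINT y|lborel. X y\<bar> = (LINT y|lborel. \<bar>X y\<bar>))"
  using pairing(2)[OF s] AE_off_hyperplane[OF e] odd_potential_upper(2)[OF w v nu_def nu e o, folded c_def]
 proof eventually_elim
  case (elim z)
  let ?X = "%y. P y * psi y * (mirror_kernel nu e y z / 2)"
  have i: "integrable lborel ?X" "c * phi z = (LINT y|lborel. ?X y)" using elim by auto
  have "ennreal (c * \<bar>phi z\<bar>) = (\<integral>\<^sup>+y. ennreal \<bar>?X y\<bar> \<partial>lborel)"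
   using elim(1) unfolding mirror_potential_def by (simp add: ennreal_mult[symmetric] abs_mult)
  also have "\<dots> = ennreal (LINT y|lborel. \<bar>?X y\<bar>)" by (rule nn_integral_eq_integral[OF integrable_abs[OF i(1)]]) simp
  finally have "c * \<bar>phi z\<bar> = (LINT y|lborel. \<bar>?X y\<bar>)" using c by simp
  moreover have "\<bar>LINT y|lborel. ?X y\<bar> = c * \<bar>phi z\<bar>"
   unfolding i(2)[symmetric] using c by (simp add: abs_mult)
  ultimately have "\<bar>LINT y|lborel. ?X y\<bar> = (LINT y|lborel. \<bar>?X y\<bar>)" by (simp only:)
  then show ?case using elim(2) i(1) by blast
 qed
 moreover have "ae_filter (lborel :: 'a measure) \<noteq> bot" by (simp add: ae_filter_eq_bot_iff)
 ultimately obtain z X where z: "z \<bullet> e \<noteq> 0" and X: "integrable lborel X" "X = (%y. P y * psi y * (mirror_kernel nu e y z / 2))"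
  "\<bar>LINT y|lborel. X y\<bar> = (LINT y|lborel. \<bar>X y\<bar>)"
  using eventually_happens by blast
 have sg: "\<sigma> * psi y * (y \<bullet> e) * (z \<bullet> e) >= 0" if "y \<noteq> z \<and> mirror e y \<noteq> z" "\<sigma> * X y >= 0" for y \<sigma>
 proof (cases "y \<bullet> e = 0")
  case False
  then have m: "mirror_kernel nu e y z * ((y \<bullet> e) * (z \<bullet> e)) > 0"
   using z that by (intro mirror_kernel_sign[OF e nu]) auto
  let ?q = "(y \<bullet> e) * (z \<bullet> e)"
  have "(P y / 2) * ((\<sigma> * psi y) * mirror_kernel nu e y z) >= 0" using that(2) unfolding X(2) by (simp add: mult_ac)
  then have "(\<sigma> * psi y) * mirror_kernel nu e y z >= 0" using PQ_pos(1)[of y] by (simp add: zero_le_mult_iff)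
  then have "(\<sigma> * psi y) * mirror_kernel nu e y z * ?q\<^sup>2 >= 0" by simp
  then have "((\<sigma> * psi y) * ?q) * (mirror_kernel nu e y z * ?q) >= 0" by (simp add: power2_eq_square mult_ac)
  then have "(\<sigma> * psi y) * ?q >= 0" using m by (simp add: zero_le_mult_iff)
  then show ?thesis by (simp add: mult_ac)
 qed simp
 have main: "AE y in lborel. \<sigma> * psi y * (y \<bullet> e) * (z \<bullet> e) >= 0" if \<sigma>: "\<sigma> = 1 \<or> \<sigma> = -1" "\<sigma> * (LINT y|lborel. X y) = (LINT y|lborel. \<bar>X y\<bar>)" for \<sigma>
 proof -
  have "(LINT y|lborel. \<bar>X y\<bar> - \<sigma> * X y) = 0" using X(1) \<sigma>(2) by simp
  then have "AE y in lborel. \<bar>X y\<bar> - \<sigma> * X y = 0"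
   by (subst (asm) integral_nonneg_eq_0_iff_AE) (use X(1) \<sigma>(1) in auto)
  with AE_generic[OF e, of z] show ?thesis
  proof eventually_elim
   case (elim y)
   then show ?case by (intro sg) auto
  qed
 qed
 have "\<exists>\<sigma>. (\<sigma> = 1 \<or> \<sigma> = -1) \<and> \<sigma> * (LINT y|lborel. X y) = (LINT y|lborel. \<bar>X y\<bar>)"
  using X(3) by (cases "(LINT y|lborel. X y) >= 0") (auto simp: abs_if)
 then obtain \<sigma> where \<sigma>: "\<sigma> = 1 \<or> \<sigma> = -1" and "\<sigma> * (LINT y|lborel. X y) = (LINT y|lborel. \<bar>X y\<bar>)" by blast
 from main[OF this] have AE: "AE y in lborel. (\<sigma> * (z \<bullet> e)) * (psi y * (y \<bullet> e)) >= 0" by (simp add: mult_ac)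
 have "\<sigma> * (z \<bullet> e) \<noteq> 0" using z \<sigma> by auto
 then consider "\<sigma> * (z \<bullet> e) > 0" | "\<sigma> * (z \<bullet> e) < 0" by linarith
 then show ?thesis
 proof cases
  case 1
  from AE have "AE y in lborel. psi y * (y \<bullet> e) >= 0"
   by eventually_elim (use 1 in \<open>simp only: zero_le_mult_iff[of "\<sigma> * (z \<bullet> e)"], linarith\<close>)
  then show ?thesis ..
 next
  case 2
  from AE have "AE y in lborel. psi y * (y \<bullet> e) <= 0"
   by eventually_elim (use 2 in \<open>simp only: zero_le_mult_iff[of "\<sigma> * (z \<bullet> e)"], linarith\<close>)
  then show ?thesis ..
 qed
qed

lemma weighted_integrable:
 assumes s: "solution phi psi" shows "integrable lborel (%x. P x * g x * psi x)"
proof (rule integrableI_bounded)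
 have "radial_weak psi (%x. Q x * phi x)" using s unfolding solution_def by auto
 then have [measurable]: "psi \<in> bmeas" by (intro locint_measurable radial_weak_locint)
 show "(%x. P x * g x * psi x) \<in> borel_measurable lborel" by measurable
 show "(\<integral>\<^sup>+x. ennreal (norm (P x * g x * psi x)) \<partial>lborel) < \<infinity>"
  using pairing(1)[OF s] by (simp add: abs_mult ennreal_mult mult_ac)
qed

text \<open>For a \<open>psi\<close> of constant sign on each side, the integrand of the pairing
  with \<open>P\<close> and \<open>g\<close> has constant sign too. A vanishing pairing thus forces
  psi = 0, and the potential identity then forces phi = 0.\<close>

lemma signed_zero:
 assumes s: "solution phi psi" and z: "(LINT x|lborel. P x * g x * psi x) = 0"
 shows "AE x in lborel. phi x = 0 \<and> psi x = 0"
proof -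
 note i = weighted_integrable[OF s]
 have pos: "P x * g x * psi x * (x \<bullet> e)\<^sup>2 = (P x * (g x * (x \<bullet> e))) * (psi x * (x \<bullet> e))" for x
  by (simp add: power2_eq_square mult_ac)
 have key: "AE x in lborel. psi x = 0"
  if "\<sigma> = 1 \<or> \<sigma> = -1" and sg: "AE y in lborel. \<sigma> * (psi y * (y \<bullet> e)) >= 0" for \<sigma> :: real
 proof -
  have nn: "AE x in lborel. \<sigma> * (P x * g x * psi x) >= 0"
   using sg AE_off_hyperplane[OF e]
  proof eventually_elim
   case (elim x)
   have "(P x * (g x * (x \<bullet> e))) * (\<sigma> * (psi x * (x \<bullet> e))) >= 0"
    using elim PQ_pos(1)[of x] sign_nonneg(2)[of x] by simp
   then have "(x \<bullet> e)\<^sup>2 * (\<sigma> * (P x * g x * psi x)) >= 0" by (simp add: power2_eq_square mult_ac)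
   then show ?case using elim(2) by (simp add: zero_le_mult_iff)
  qed
  have "(LINT x|lborel. \<sigma> * (P x * g x * psi x)) = 0" using z by simp
  then have "AE x in lborel. \<sigma> * (P x * g x * psi x) = 0"
   by (subst (asm) integral_nonneg_eq_0_iff_AE) (use i nn in auto)
  with AE_off_hyperplane[OF e] show ?thesis
  proof eventually_elim
   case (elim x)
   have "g x \<noteq> 0" "P x \<noteq> 0" using fg_sign(2)[OF elim(1)] PQ_pos(1)[of x] by auto
   then show ?case using elim(2) that(1) by auto
  qed
 qed
 have psi0: "AE x in lborel. psi x = 0"
  using solution_signed[OF s]
 proof
  assume "AE y in lborel. psi y * (y \<bullet> e) >= 0"
  then show ?thesis by (intro key[of 1]) simp_all
 next
  assume "AE y in lborel. psi y * (y \<bullet> e) <= 0"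
  then show ?thesis by (intro key[of "-1"]) simp_all
 qed
 have pot: "mirror_potential nu e (%x. P x * psi x) z = 0" for z
 proof -
  have "mirror_potential nu e (%x. P x * psi x) z = (\<integral>\<^sup>+y. 0 \<partial>(lborel :: 'a measure))"
   unfolding mirror_potential_def by (rule nn_integral_cong_AE) (use psi0 in \<open>auto elim!: eventually_mono\<close>)
  then show ?thesis by simp
 qed
 from pairing(2)[OF s] psi0 show ?thesis
 proof eventually_elim
  case (elim x)
  then have "ennreal (c * \<bar>phi x\<bar>) = 0" unfolding pot by simp
  then have "c * \<bar>phi x\<bar> <= 0" by (simp only: ennreal_eq_0_iff)
  then show ?case using c elim by (simp add: mult_le_0_iff)
 qed
qed

text \<open>The multiple of \<open>(f, g)\<close> is chosen such that the pairing with
  \<open>P\<close> and \<open>g\<close> vanishes on the difference; the difference is again a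
  solution and therefore zero.\<close>

lemma solution_unique:
 assumes s: "solution phi psi"
 shows "\<exists>t. AE x in lborel. phi x = t * f x \<and> psi x = t * g x"
proof -
 let ?G = "LINT x|lborel. P x * g x * g x"
 have "?G \<noteq> 0"
 proof
  assume "?G = 0"
  from signed_zero[OF solution_fg this] AE_off_hyperplane[OF e]
  have "AE x in (lborel :: 'a measure). False"
   by eventually_elim (use fg_sign in force)
  moreover have "ae_filter (lborel :: 'a measure) \<noteq> bot" by (simp add: ae_filter_eq_bot_iff)
  ultimately show False using eventually_happens by blast
 qed
 define t where "t = (LINT x|lborel. P x * g x * psi x) / ?G"
 have s': "solution (%x. phi x + (- t) * f x) (%x. psi x + (- t) * g x)"
  by (rule solution_add_scaled[OF s solution_fg])
 have "(LINT x|lborel. P x * g x * (psi x + (- t) * g x)) = (LINT x|lborel. P x * g x * psi x - t * (P x * g x * g x))"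
  by (simp add: algebra_simps)
 also have "\<dots> = (LINT x|lborel. P x * g x * psi x) - t * ?G"
  using weighted_integrable[OF s] weighted_integrable[OF solution_fg] by simp
 also have "\<dots> = 0" using \<open>?G \<noteq> 0\<close> by (simp add: t_def)
 finally have "AE x in lborel. phi x + (- t) * f x = 0 \<and> psi x + (- t) * g x = 0"
  by (rule signed_zero[OF s'])
 then show ?thesis by (intro exI[of _ t]) (auto elim!: eventually_mono)
qed

end

section \<open>Radial solutions\<close>

text \<open>Up to a constant, the density of the image of Lebesgue measure under x -> |x|^2. The
  zero on the nonpositive axis is written out because the image lives on the positive half
  line.\<close>

definition radial_density :: "real => real => real" where
 "radial_density nu s = (if s > 0 then s powr (nu - 1) else 0)"

lemma radial_density_measurable [measurable]: "radial_density nu \<in> bmeas"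
 unfolding radial_density_def[abs_def] by measurable

lemma radial_density_nonneg: "radial_density nu s >= 0"
 by (simp add: radial_density_def)

text \<open>Both measures assign to \<open>{..s}\<close> the volume of the ball of radius sqrt s,
  which is s^nu times the volume of the unit ball. The half lines are stable under intersection and
  generate the Borel sets.\<close>

lemma distr_inner_self:
 fixes nu :: real
 assumes nu: "nu = real DIM('a::euclidean_space) / 2"
 defines "c \<equiv> unit_ball_vol (real DIM('a)) * nu"
 shows "distr lborel borel (%x::'a. x \<bullet> x) = density lborel (%s. ennreal (c * radial_density nu s))"
proof (rule measure_eqI_generator_eq[where E="range atMost" and \<Omega>=UNIV and A="%i. {..real i}"])
 have nu0: "nu > 0" unfolding nu by simp
 have c: "c >= 0" unfolding c_def using nu0 by simp
 show "Int_stable (range (atMost :: real => real set))"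
  by (auto simp: Int_stable_def Int_atMost)
 have emD: "emeasure (distr lborel borel (%x::'a. x \<bullet> x)) {..s} = (if s >= 0 then ennreal (unit_ball_vol (real DIM('a)) * s powr nu) else 0)" for s :: real
 proof -
  have "emeasure (distr lborel borel (%x::'a. x \<bullet> x)) {..s} = emeasure lborel {x::'a. x \<bullet> x <= s}"
   by (subst emeasure_distr) (auto intro!: arg_cong[where f="emeasure lborel"])
  also have "{x::'a. x \<bullet> x <= s} = (if s >= 0 then cball 0 (sqrt s) else {})"
  proof (cases "s >= 0")
   case True
   then show ?thesis by (auto simp: norm_eq_sqrt_inner)
  next
   case False
   have "\<not> x \<bullet> x <= s" for x :: 'a using False inner_ge_zero[of x] by linarith
   then show ?thesis using False by auto
  qed
  also have "emeasure lborel \<dots> = (if s >= 0 then ennreal (unit_ball_vol (real DIM('a)) * s powr nu) else 0)"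
  proof (cases "s >= 0")
   case True
   have "sqrt s ^ DIM('a) = s powr nu"
   proof (cases "s = 0")
    case False
    then have "sqrt s ^ DIM('a) = (s powr (1/2)) powr real DIM('a)" using True by (simp add: powr_realpow powr_half_sqrt)
    also have "\<dots> = s powr nu" by (simp add: powr_powr nu)
    finally show ?thesis .
   qed (simp add: power_0_left)
   then show ?thesis using True by (simp add: emeasure_cball)
  qed simp
  finally show ?thesis .
 qed
 have emR: "emeasure (density lborel (%s. ennreal (c * radial_density nu s))) {..s} = (if s >= 0 then ennreal (unit_ball_vol (real DIM('a)) * s powr nu) else 0)" for s :: real
 proof -
  have "emeasure (density lborel (%s. ennreal (c * radial_density nu s))) {..s} = (\<integral>\<^sup>+t. ennreal (c * radial_density nu t) * indicator {..s} t \<partial>lborel)"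
   by (rule emeasure_density) auto
  also have "\<dots> = (if s >= 0 then ennreal (unit_ball_vol (real DIM('a)) * s powr nu) else 0)"
  proof (cases "s >= 0")
   case True
   have I: "((%t. c * t powr (nu - 1)) has_integral (c * (s powr (nu - 1 + 1) / (nu - 1 + 1)))) {0..s}"
    by (intro has_integral_mult_right has_integral_powr_from_0) (use nu0 True in auto)
   have "(\<integral>\<^sup>+t. ennreal (c * radial_density nu t) * indicator {..s} t \<partial>lborel) = (\<integral>\<^sup>+t. ennreal (indicator {0..s} t * (c * t powr (nu - 1))) \<partial>lborel)"
   proof (rule nn_integral_cong_AE)
    show "AE t in lborel. ennreal (c * radial_density nu t) * indicator {..s} t = ennreal (indicator {0..s} t * (c * t powr (nu - 1)))"
     using AE_lborel_singleton[of "0::real"]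
     by eventually_elim (auto simp: radial_density_def indicator_def)
   qed
   also have "\<dots> = ennreal (c * (s powr (nu - 1 + 1) / (nu - 1 + 1)))"
    by (rule nn_integral_has_integral_lebesgue[OF _ I]) (use c in auto)
   also have "c * (s powr (nu - 1 + 1) / (nu - 1 + 1)) = unit_ball_vol (real DIM('a)) * s powr nu"
    using nu0 by (simp add: c_def)
   finally show ?thesis using True by simp
  next
   case False
   have "(\<integral>\<^sup>+t. ennreal (c * radial_density nu t) * indicator {..s} t \<partial>lborel) = (\<integral>\<^sup>+t. 0 \<partial>(lborel :: real measure))"
    by (rule nn_integral_cong) (use False in \<open>auto simp: radial_density_def indicator_def\<close>)
   then show ?thesis using False by simp
  qed
  finally show ?thesis .
 qed
 show "emeasure (distr lborel borel (%x::'a. x \<bullet> x)) X = emeasure (density lborel (%s. ennreal (c * radial_density nu s))) X"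
  if "X \<in> range atMost" for X
  using that emD emR by auto
 have sb: "sets (borel :: real measure) = sigma_sets UNIV (range atMost)"
  by (subst borel_eq_atMost) (simp add: sets_measure_of)
 show "sets (distr lborel borel (%x::'a. x \<bullet> x)) = sigma_sets UNIV (range atMost)"
  "sets (density lborel (%s. ennreal (c * radial_density nu s))) = sigma_sets UNIV (range atMost)"
  using sb by simp_all
 show "\<Union> (range (%i. {..real i})) = UNIV" by (auto intro: real_arch_simple)
 show "emeasure (distr lborel borel (%x::'a. x \<bullet> x)) {..real i} \<noteq> \<infinity>" for i
  unfolding emD by simp
qed auto

lemma radial_integral:
 fixes w :: "real => real"
 assumes [measurable]: "w \<in> bmeas" and nu: "nu = real DIM('a::euclidean_space) / 2"
 shows "integrable lborel (%x::'a. w (sq x)) \<longleftrightarrow> integrable lborel (%s. radial_density nu s * w s)"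
  and "(LINT x|lborel. w ((x::'a) \<bullet> x)) = unit_ball_vol (real DIM('a)) * nu * (LINT s|lborel. radial_density nu s * w s)"
proof -
 define c where "c = unit_ball_vol (real DIM('a)) * nu"
 have ub: "unit_ball_vol (real DIM('a)) > 0" by (rule unit_ball_vol_pos) simp
 have c: "c > 0" unfolding c_def by (rule mult_pos_pos[OF ub]) (simp add: nu)
 note D = distr_inner_self[OF nu, folded c_def]
 have "integrable lborel (%x::'a. w (sq x)) \<longleftrightarrow> integrable (distr lborel borel (%x::'a. x \<bullet> x)) w"
  by (rule integrable_distr_eq[symmetric]) auto
 also have "\<dots> \<longleftrightarrow> integrable lborel (%s. (c * radial_density nu s) *\<^sub>R w s)"
  unfolding D by (rule integrable_density) (use c radial_density_nonneg in auto)
 also have "\<dots> \<longleftrightarrow> integrable lborel (%s. c * (radial_density nu s * w s))" by (simp add: mult.assoc)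
 also have "\<dots> \<longleftrightarrow> integrable lborel (%s. radial_density nu s * w s)"
  using c by simp
 finally show "integrable lborel (%x::'a. w (sq x)) \<longleftrightarrow> integrable lborel (%s. radial_density nu s * w s)" .
 have "(LINT x|lborel. w ((x::'a) \<bullet> x)) = (LINT s|distr lborel borel (%x::'a. x \<bullet> x). w s)"
  by (rule integral_distr[symmetric]) auto
 also have "\<dots> = (LINT s|lborel. (c * radial_density nu s) *\<^sub>R w s)"
  unfolding D by (rule integral_density) (use c radial_density_nonneg in auto)
 also have "\<dots> = (LINT s|lborel. c * (radial_density nu s * w s))" by (simp add: mult.assoc)
 also have "\<dots> = c * (LINT s|lborel. radial_density nu s * w s)" by simp
 finally show "(LINT x|lborel. w ((x::'a) \<bullet> x)) = unit_ball_vol (real DIM('a)) * nu * (LINT s|lborel. radial_density nu s * w s)"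
  unfolding c_def .
qed

lemma radial_AE:
 assumes [measurable]: "Measurable.pred borel Q" and nu: "nu = real DIM('a::euclidean_space) / 2"
 shows "(AE x in lborel. Q ((x::'a) \<bullet> x)) \<longleftrightarrow> (AE s in lborel. s > 0 --> Q s)"
proof -
 have ub: "unit_ball_vol (real DIM('a)) > 0" by (rule unit_ball_vol_pos) simp
 have nu0: "nu > 0" by (simp add: nu)
 have "(AE x in lborel. Q ((x::'a) \<bullet> x)) \<longleftrightarrow> (AE s in distr lborel borel (%x::'a. x \<bullet> x). Q s)"
  by (subst AE_distr_iff) auto
 also have "\<dots> \<longleftrightarrow> (AE s in lborel. 0 < ennreal (unit_ball_vol (real DIM('a)) * nu * radial_density nu s) --> Q s)"
  unfolding distr_inner_self[OF nu] by (rule AE_density) measurable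
 also have "\<dots> \<longleftrightarrow> (AE s in lborel. s > 0 --> Q s)"
 proof -
  have "0 < unit_ball_vol (real DIM('a)) * nu * radial_density nu s \<longleftrightarrow> s > 0" for s
   using mult_pos_pos[OF ub nu0] by (simp add: radial_density_def zero_less_mult_iff)
  then show ?thesis by (simp add: ennreal_less_zero_iff)
 qed
 finally show ?thesis .
qed

section \<open>Weak radial solutions away from the origin\<close>

lemma locint_radial:
 fixes a :: "real => real"
 assumes [measurable]: "a \<in> bmeas" and l: "locint (%x::'a::euclidean_space. a (sq x))"
  and nu: "nu = real DIM('a) / 2"
 shows "integrable lborel (%s. indicator {..S} s * (radial_density nu s * a s))"
proof -
 have eq: "indicator {..S} (sq x) * a (sq x) = a (sq x) * indicator {..S} (sq x)" for x :: 'a by simp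
 have "integrable lborel (%x::'a. indicator {..S} (sq x) * a (sq x))"
  unfolding eq
 proof (rule locint_mult_compact[OF l, of _ 1 "\<bar>S\<bar> + 1"])
  fix x :: 'a assume x: "\<bar>S\<bar> + 1 <= norm x"
  have "S < (\<bar>S\<bar> + 1) * (\<bar>S\<bar> + 1)"
  proof -
   have "(\<bar>S\<bar> + 1) * (\<bar>S\<bar> + 1) = 1 + (S * S + \<bar>S\<bar> * 2)" by (simp add: algebra_simps)
   then show ?thesis using zero_le_square[of S] abs_ge_self[of S] abs_ge_zero[of S] by linarith
  qed
  also have "\<dots> <= norm x * norm x" using x by (intro mult_mono) auto
  finally show "indicator {..S} (sq x) = (0 :: real)" by (simp add: dot_square_norm power2_eq_square)
 qed (auto simp: indicator_def)
 then have "integrable lborel (%s. radial_density nu s * (indicator {..S} s * a s))"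
  by (subst (asm) radial_integral(1)[OF _ nu, of "%s. indicator {..S} s * a s"]) auto
 then show ?thesis by (simp add: mult.left_commute)
qed

text \<open>The density s^(nu-1) cancels the factor s^(1-nu) of the test weight, so that
  \<open>a\<close> is tested with a pure derivative. The \<open>tail\<close> is constant near 0: the
  test function reaches across the origin, and this is what later excludes a singular part
  there.\<close>

lemma radial_test_identity:
 fixes a b :: "real => real"
 assumes [measurable]: "a \<in> bmeas" "b \<in> bmeas"
  and w: "radial_weak (%x::'a::euclidean_space. a (sq x)) (%x. b (sq x))" and nu: "nu = real DIM('a) / 2"
  and k: "smooth kappa" and d: "d > 0" "\<And>s. s <= d ==> kappa s = 0" and S: "\<And>s. s >= S ==> kappa s = 0"
 shows "4 * (LINT s|lborel. a s * deriv kappa s) = (LINT s|lborel. (radial_density nu s * b s) * tail nu kappa S s)"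
proof -
 define c where "c = unit_ball_vol (real DIM('a)) * nu"
 have ub: "unit_ball_vol (real DIM('a)) > 0" by (rule unit_ball_vol_pos) simp
 have c: "c > 0" unfolding c_def by (rule mult_pos_pos[OF ub]) (simp add: nu)
 have [measurable]: "kappa \<in> bmeas" "deriv kappa \<in> bmeas" "tail nu kappa S \<in> bmeas"
  using smooth_derivD(2)[OF k] tail_smooth[OF k d S, where nu=nu] k by (auto intro!: borel_measurable_continuous_onI smooth_continuous)
 have dk: "deriv kappa s = 0" if "s <= 0" for s
  by (rule deriv_zero_of_zero[OF k d(2)]) (use that d in auto)
 have "(LINT x|lborel. a ((x::'a) \<bullet> x) * (4 * (sq x) powr (1 - nu) * deriv kappa (sq x))) =
  (LINT x|lborel. b ((x::'a) \<bullet> x) * tail nu kappa S (sq x))"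
  using radial_weak_tail[OF w nu k d S, where z=0] by simp
 then have "c * (LINT s|lborel. radial_density nu s * (a s * (4 * s powr (1 - nu) * deriv kappa s))) =
   c * (LINT s|lborel. radial_density nu s * (b s * tail nu kappa S s))"
  unfolding c_def
  using radial_integral(2)[OF _ nu, of "%s. a s * (4 * s powr (1 - nu) * deriv kappa s)"]
   radial_integral(2)[OF _ nu, of "%s. b s * tail nu kappa S s"] by simp
 then have id: "(LINT s|lborel. radial_density nu s * (a s * (4 * s powr (1 - nu) * deriv kappa s))) =
   (LINT s|lborel. radial_density nu s * (b s * tail nu kappa S s))" using c by simp
 have eq: "radial_density nu s * (a s * (4 * s powr (1 - nu) * deriv kappa s)) = 4 * (a s * deriv kappa s)" for s
 proof (cases "s > 0")
  case True
  then have "s powr (nu - 1) * s powr (1 - nu) = 1" by (simp add: powr_add[symmetric])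
  then have "(s powr (nu - 1) * s powr (1 - nu)) * (4 * (a s * deriv kappa s)) = 4 * (a s * deriv kappa s)" by simp
  then show ?thesis using True by (simp add: radial_density_def mult_ac)
 qed (simp add: dk radial_density_def)
 have "(LINT s|lborel. radial_density nu s * (a s * (4 * s powr (1 - nu) * deriv kappa s))) = (LINT s|lborel. 4 * (a s * deriv kappa s))"
  by (intro Bochner_Integration.integral_cong[OF refl] eq)
 with id show ?thesis by (simp only: integral_mult_right_zero mult.assoc)
qed

lemma integral_tail_LINT:
 fixes j :: "real => real"
 assumes j: "continuous_on UNIV j" and S: "\<And>t. t >= S ==> j t = (0::real)" and s: "0 <= s"
 shows "integral {0..max s S} j - integral {0..s} j = (LINT t|lborel. indicator {s<..} t * j t)"
proof -
 let ?T = "max s S"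
 have i: "j integrable_on {x..y}" for x y by (intro integrable_continuous_interval continuous_on_subset[OF j]) auto
 have "integral {0..s} j + integral {s..?T} j = integral {0..?T} j"
  by (rule Henstock_Kurzweil_Integration.integral_combine) (use s i in auto)
 moreover have "integral {s..?T} j = (LINT t:{s..?T}|lborel. j t)"
  by (rule set_borel_integral_eq_integral(2)[symmetric])
    (unfold set_integrable_def, rule borel_integrable_compact, auto intro: continuous_on_subset[OF j])
 moreover have "(LINT t:{s..?T}|lborel. j t) = (LINT t|lborel. indicator {s<..} t * j t)"
  unfolding set_lebesgue_integral_def
 proof (rule integral_cong_AE)
  have [measurable]: "j \<in> bmeas" using j by (rule borel_measurable_continuous_onI)
  show "(%t. indicator {s..?T} t *\<^sub>R j t) \<in> borel_measurable lborel" "(%t. indicator {s<..} t * j t) \<in> borel_measurable lborel"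
   by measurable
  show "AE t in lborel. indicator {s..?T} t *\<^sub>R j t = indicator {s<..} t * j t"
   using AE_lborel_singleton[of s]
  proof eventually_elim
   case (elim t)
   then show ?case using S[of t] by (auto simp: indicator_def)
  qed
 qed
 ultimately show ?thesis by simp
qed

lemma tail_LINT:
 assumes k: "smooth kappa" and d: "d > 0" "\<And>s. s <= d ==> kappa s = 0" and S: "\<And>s. s >= S ==> kappa s = 0" and s: "0 <= s"
 shows "tail nu kappa S s = (LINT t|lborel. indicator {s<..} t * (kappa t * t powr (- nu)))"
proof -
 let ?j = "%t. kappa t * t powr (- nu)"
 have j: "continuous_on UNIV ?j" by (rule smooth_continuous[OF smooth_powr[OF k d]])
 have "tail nu kappa S (max s S) = 0" by (rule tail_eq_0[OF k d S]) auto
 then have "tail nu kappa S s = primitive ?j (max s S) - primitive ?j s" by (simp add: tail_def)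
 then show ?thesis unfolding primitive_def using integral_tail_LINT[OF j _ s, of S] S by simp
qed

lemma bump_integral: "(LINT s|lborel. bump s) = ramp_max"
proof -
 have "integral {0..max 0 2} bump - integral {0..0} bump = (LINT t|lborel. indicator {0<..} t * bump t)"
  by (rule integral_tail_LINT) (auto simp: bump_zero smooth_continuous[OF bump_smooth])
 moreover have "indicator {0<..} t * bump t = bump t" for t by (auto simp: indicator_def bump_zero)
 ultimately show ?thesis by (simp add: ramp_max_def ramp_def primitive_def)
qed

lemma bump_scale:
 fixes f :: "real => real"
 assumes [measurable]: "f \<in> bmeas" and J: "J > 0"
 shows "(LINT s|lborel. f s * (J * bump (J * (s - alpha)))) = (LINT y|lborel. f (alpha + (1 / J) *\<^sub>R y) * bump y)"
proof -
 have "(LINT s|lborel. f s * (J * bump (J * (s - alpha)))) = (LINT s|lborel. f (s + alpha) * (J * bump (J * (s + alpha - alpha))))"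
  by (rule integral_shift[symmetric]) measurable
 also have "\<dots> = (LINT s|lborel. f (s + alpha) * (J * bump (J * s)))" by simp
 also have "\<dots> = (1 / J) ^ DIM(real) * (LINT y|lborel. f ((1 / J) *\<^sub>R y + alpha) * (J * bump (J * ((1 / J) *\<^sub>R y))))"
  by (rule integral_scale) (use J in auto)
 also have "\<dots> = (1 / J) * (LINT y|lborel. J * (f (alpha + (1 / J) *\<^sub>R y) * bump y))"
  using J by (simp add: add.commute mult.left_commute)
 also have "\<dots> = (LINT y|lborel. f (alpha + (1 / J) *\<^sub>R y) * bump y)"
  using J by (subst integral_mult_right_zero) simp
 finally show ?thesis .
qed

text \<open>A smooth approximation of \<open>ramp_max\<close> times the indicator of the interval
  between \<open>alpha\<close> and \<open>beta\<close>, sharper for larger \<open>J\<close>. Its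
  derivative is a difference of two approximate point masses, so testing with it reads off an
  increment of \<open>a\<close>.\<close>

definition edge :: "real => real => real => real => real" where
 "edge alpha beta J s = ramp (J * (s - alpha)) - ramp (J * (s - beta))"

lemma edge_props:
 assumes "J >= 1" "alpha < beta"
 shows edge_smooth: "smooth (edge alpha beta J)"
  and edge_deriv: "deriv (edge alpha beta J) s = J * bump (J * (s - alpha)) - J * bump (J * (s - beta))"
  and edge_low: "s <= alpha ==> edge alpha beta J s = 0"
  and edge_high: "s >= beta + 2 ==> edge alpha beta J s = 0"
  and edge_bounds: "0 <= edge alpha beta J s" "edge alpha beta J s <= ramp_max"
proof -
 have D: "((%s. ramp (J * (s - c))) has_real_derivative bump (J * (s - c)) * J) (at s)" for c s
  by (rule DERIV_chain2[OF ramp_DERIV]) (auto intro!: derivative_eq_intros)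
 have E: "(edge alpha beta J has_real_derivative (bump (J * (s - alpha)) * J - bump (J * (s - beta)) * J)) (at s)" for s
  unfolding edge_def[abs_def] by (intro DERIV_diff D)
 show "deriv (edge alpha beta J) s = J * bump (J * (s - alpha)) - J * bump (J * (s - beta))"
  using DERIV_imp_deriv[OF E[of s]] by (simp add: mult.commute)
 have "smooth (%s. ramp (J * s + (- (J * alpha))) - ramp (J * s + (- (J * beta))))"
  by (intro smooth_diff smooth_affine ramp_smooth)
 then show "smooth (edge alpha beta J)" unfolding edge_def[abs_def] by (simp add: right_diff_distrib)
 show "edge alpha beta J s = 0" if "s <= alpha"
 proof -
  have "J * (s - alpha) <= 0" "J * (s - beta) <= 0" using that assms by (auto intro: mult_nonneg_nonpos)
  then show ?thesis unfolding edge_def by (simp add: ramp_eq_0)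
 qed
 show "edge alpha beta J s = 0" if "s >= beta + 2"
 proof -
  have "1 * 2 <= J * (s - beta)" "1 * 2 <= J * (s - alpha)" using that assms by (intro mult_mono; simp)+
  then show ?thesis unfolding edge_def by (simp add: ramp_eq_max)
 qed
 have "J * (s - beta) <= J * (s - alpha)" using assms by (intro mult_left_mono) auto
 then show "0 <= edge alpha beta J s" unfolding edge_def using ramp_mono by simp
 show "edge alpha beta J s <= ramp_max"
  unfolding edge_def using ramp_bounds(2)[of "J * (s - alpha)"] ramp_bounds(1)[of "J * (s - beta)"] by linarith
qed

lemma edge_tendsto:
 assumes "filterlim J at_top sequentially" "alpha < beta"
 shows "(%k. edge alpha beta (J k) s) \<longlonglongrightarrow> ramp_max * indicator {alpha<..beta} s"
proof -
 have up: "\<forall>\<^sub>F k in sequentially. ramp (J k * (s - c)) = ramp_max" if "c < s" for c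
 proof -
  have "\<forall>\<^sub>F k in sequentially. J k >= 2 / (s - c)" using assms(1) unfolding filterlim_at_top by blast
  then show ?thesis
  proof eventually_elim
   case (elim k)
   then have "J k * (s - c) >= 2" using that by (simp add: divide_le_eq)
   then show ?case by (rule ramp_eq_max)
  qed
 qed
 have pos: "\<forall>\<^sub>F k in sequentially. J k >= 0" using assms(1) unfolding filterlim_at_top by blast
 have low: "\<forall>\<^sub>F k in sequentially. ramp (J k * (s - c)) = 0" if "s <= c" for c
  using pos
 proof eventually_elim
  case (elim k)
  then have "J k * (s - c) <= 0" using that by (intro mult_nonneg_nonpos) auto
  then show ?case by (intro ramp_eq_0) auto
 qed
 have "\<forall>\<^sub>F k in sequentially. edge alpha beta (J k) s = ramp_max * indicator {alpha<..beta} s"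
 proof (cases "s <= alpha")
  case True
  have "s <= beta" using True assms(2) by simp
  from low[OF True] low[OF this] show ?thesis
   by eventually_elim (use True in \<open>simp add: edge_def\<close>)
 next
  case False
  show ?thesis
  proof (cases "s <= beta")
   case True
   have "\<forall>\<^sub>F k in sequentially. ramp (J k * (s - alpha)) = ramp_max" using up False by simp
   with low[OF True] show ?thesis
    by eventually_elim (use True False in \<open>auto simp: edge_def\<close>)
  next
   case b: False
   have "\<forall>\<^sub>F k in sequentially. ramp (J k * (s - alpha)) = ramp_max" "\<forall>\<^sub>F k in sequentially. ramp (J k * (s - beta)) = ramp_max"
    using up False b by simp_all
   then show ?thesis
    by eventually_elim (use b False in \<open>auto simp: edge_def\<close>)
  qed
 qed
 then show ?thesis by (rule tendsto_eventually)
qed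

text \<open>The tail at \<open>s\<close> collects kappa t * t^(-nu) over t > s; exchanging the
  integrals hands to each \<open>t\<close> the mass of \<open>B\<close> below it. Cutting off at
  \<open>S\<close>, where the tail ends, makes the double integral absolutely convergent.\<close>

lemma tail_fubini:
 fixes B :: "real => real"
 assumes [measurable]: "B \<in> bmeas" and Bi: "\<And>S. integrable lborel (%s. indicator {..S} s * B s)"
  and B0: "\<And>s. s <= 0 ==> B s = 0"
  and k: "smooth kappa" and d: "d > 0" "\<And>s. s <= d ==> kappa s = 0" and S: "\<And>s. s >= S ==> kappa s = 0"
 shows "(LINT s|lborel. B s * tail nu kappa S s) = (LINT t|lborel. (kappa t * t powr (- nu)) * (LINT s|lborel. indicator {..<t} s * B s))"
proof -
 define j where "j t = kappa t * t powr (- nu)" for t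
 have jc: "continuous_on UNIV j" unfolding j_def[abs_def] by (rule smooth_continuous[OF smooth_powr[OF k d]])
 have [measurable]: "j \<in> bmeas" using jc by (rule borel_measurable_continuous_onI)
 have j0: "j t = 0" if "t <= 0 \<or> t >= S" for t using that d S unfolding j_def by auto
 have ji: "integrable lborel j"
 proof -
  have "integrable lborel (%x. indicator {0..S} x *\<^sub>R j x)"
   by (rule borel_integrable_compact) (auto intro: continuous_on_subset[OF jc])
  moreover have eq: "indicator {0..S} x *\<^sub>R j x = j x" for x using j0[of x] by (cases "x <= 0 \<or> S <= x") (auto simp: indicator_def)
  ultimately show ?thesis by (simp only: eq)
 qed
 define H where "H = (%(s, t). (indicator {..S} s * B s) * (indicator {s<..} t * j t))"
 have [measurable]: "H \<in> borel_measurable (lborel \<Otimes>\<^sub>M lborel)"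
 proof -
  have "H = (%(s, t). (indicator {..S} s * B s) * ((if s < t then 1 else 0) * j t))"
   by (auto simp: H_def fun_eq_iff indicator_def)
  then show ?thesis by simp
 qed
 have Hi: "integrable (lborel \<Otimes>\<^sub>M lborel) H"
 proof (rule lborel_pair.Fubini_integrable)
  show "integrable lborel (%s. LINT t|lborel. norm (H (s, t)))"
  proof (rule Bochner_Integration.integrable_bound)
   show "integrable lborel (%s. (indicator {..S} s * B s) * (LINT t|lborel. \<bar>j t\<bar>))" using Bi by simp
   show "AE s in lborel. norm (LINT t|lborel. norm (H (s, t))) <= norm ((indicator {..S} s * B s) * (LINT t|lborel. \<bar>j t\<bar>))"
   proof (rule AE_I2)
    fix s
    have "(LINT t|lborel. norm (H (s, t))) = \<bar>indicator {..S} s * B s\<bar> * (LINT t|lborel. indicator {s<..} t * \<bar>j t\<bar>)"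
     by (simp add: H_def abs_mult)
    also have "\<dots> <= \<bar>indicator {..S} s * B s\<bar> * (LINT t|lborel. \<bar>j t\<bar>)"
    proof (rule mult_left_mono)
     show "(LINT t|lborel. indicator {s<..} t * \<bar>j t\<bar>) <= (LINT t|lborel. \<bar>j t\<bar>)"
     proof (rule integral_mono)
      show "integrable lborel (%t. indicator {s<..} t * \<bar>j t\<bar>)"
       using integrable_mult_indicator[OF _ integrable_abs[OF ji], of "{s<..}"] by simp
     qed (use ji in \<open>auto simp: indicator_def\<close>)
    qed simp
    finally show "norm (LINT t|lborel. norm (H (s, t))) <= norm ((indicator {..S} s * B s) * (LINT t|lborel. \<bar>j t\<bar>))"
     by (simp add: abs_mult)
   qed
  qed measurable
  show "AE s in lborel. integrable lborel (%t. H (s, t))"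
  proof (rule AE_I2)
   fix s
   have "integrable lborel (%t. indicator {s<..} t * j t)"
    using integrable_mult_indicator[OF _ ji, of "{s<..}"] by simp
   then show "integrable lborel (%t. H (s, t))" unfolding H_def by simp
  qed
 qed measurable
 have "(LINT s|lborel. B s * tail nu kappa S s) = (LINT s|lborel. LINT t|lborel. H (s, t))"
 proof (rule Bochner_Integration.integral_cong[OF refl])
  fix s
  show "B s * tail nu kappa S s = (LINT t|lborel. H (s, t))"
  proof (cases "0 <= s \<and> s <= S")
   case True
   then show ?thesis using tail_LINT[OF k d S, where s=s and nu=nu] by (simp add: H_def j_def)
  next
   case False
   have z: "tail nu kappa S s = 0" if "s > S" by (rule tail_eq_0[OF k d S]) (use that in auto)
   show ?thesis using False z B0[of s] by (cases "s > S") (auto simp: H_def)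
  qed
 qed
 also have "\<dots> = (LINT t|lborel. LINT s|lborel. H (s, t))"
  using lborel_pair.Fubini_integral[of "%s t. H (s, t)"] Hi by simp
 also have "\<dots> = (LINT t|lborel. (kappa t * t powr (- nu)) * (LINT s|lborel. indicator {..<t} s * B s))"
 proof (rule Bochner_Integration.integral_cong[OF refl])
  fix t
  show "(LINT s|lborel. H (s, t)) = (kappa t * t powr (- nu)) * (LINT s|lborel. indicator {..<t} s * B s)"
  proof (cases "t >= S")
   case True
   then show ?thesis using j0[of t] by (simp add: H_def j_def[symmetric])
  next
   case False
   have "H (s, t) = j t * (indicator {..<t} s * B s)" for s
    using False by (auto simp: H_def indicator_def)
   then show ?thesis by (simp add: j_def[symmetric])
  qed
 qed
 finally show ?thesis .
qed

text \<open>Testing with \<open>edge\<close> functions of growing steepness: the left side converges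
  wherever the mollification of \<open>a\<close> does, and on the right \<open>K\<close> is bounded
  on bounded sets. The result is the integrated form of s^nu a' = - K/4, with no integration
  constant because the mass in \<open>K\<close> is counted from the origin.\<close>

lemma radial_weak_increments:
 fixes a b :: "real => real"
 assumes am [measurable]: "a \<in> bmeas" and bm [measurable]: "b \<in> bmeas"
  and w: "radial_weak (%x::'a::euclidean_space. a (sq x)) (%x. b (sq x))" and nu: "nu = real DIM('a) / 2" and nu1: "nu >= 1"
 defines "K \<equiv> %t. LINT s|lborel. indicator {..<t} s * (radial_density nu s * b s)"
 shows "\<exists>N\<in>null_sets lborel. \<forall>alpha beta. 0 < alpha --> alpha < beta --> alpha \<notin> N --> beta \<notin> N -->
  4 * (a alpha - a beta) = (LINT t|lborel. indicator {alpha<..beta} t * (t powr (- nu) * K t))"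
proof -
 define B where "B s = radial_density nu s * b s" for s
 have [measurable]: "B \<in> bmeas" unfolding B_def[abs_def] by measurable
 have Bi: "integrable lborel (%s. indicator {..S} s * B s)" for S
  unfolding B_def by (rule locint_radial[OF bm radial_weak_locint(2)[OF w] nu])
 have B0: "s <= 0 ==> B s = 0" for s by (simp add: B_def radial_density_def)
 have [measurable]: "K \<in> bmeas"
 proof -
  have "K = (%t. LINT s|lborel. (if s < t then 1 else 0) * B s)"
   by (auto simp: K_def B_def fun_eq_iff indicator_def intro!: Bochner_Integration.integral_cong)
  then show ?thesis by simp
 qed
 have window: "\<exists>N\<in>null_sets lborel. \<forall>alpha beta. delta < alpha --> alpha < beta --> beta < R --> alpha \<notin> N --> beta \<notin> N -->
  4 * (a alpha - a beta) = (LINT t|lborel. indicator {alpha<..beta} t * (t powr (- nu) * K t))" if delta: "delta > 0" for delta R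
 proof -
  \<comment> \<open>\<open>a\<close> is integrable only against s^(nu-1), which degenerates at 0;
    the cutoff at \<open>delta\<close> makes it locally integrable on the line.\<close>
  define f where "f s = indicator {delta..} s * a s" for s
  have [measurable]: "f \<in> bmeas" unfolding f_def[abs_def] by measurable
  have fl: "locint f" unfolding locint_def
  proof (intro conjI allI)
   fix R
   have i: "integrable lborel (%s. delta powr (1 - nu) * (indicator {..R} s * (radial_density nu s * a s)))"
    by (intro integrable_mult_right locint_radial[OF am radial_weak_locint(1)[OF w] nu])
   show "integrable lborel (%x. indicator (ball 0 R) x * f x)"
   proof (rule Bochner_Integration.integrable_bound[OF i])
    show "AE x in lborel. norm (indicator (ball 0 R) x * f x) <= norm (delta powr (1 - nu) * (indicator {..R} x * (radial_density nu x * a x)))"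
    proof (rule AE_I2)
     fix x
     show "norm (indicator (ball 0 R) x * f x) <= norm (delta powr (1 - nu) * (indicator {..R} x * (radial_density nu x * a x)))"
     proof (cases "delta <= x \<and> x < R")
      case True
      have "delta powr (nu - 1) <= x powr (nu - 1)" using True delta nu1 by (intro powr_mono2) auto
      then have "delta powr (1 - nu) * delta powr (nu - 1) <= delta powr (1 - nu) * x powr (nu - 1)" by (intro mult_left_mono) auto
      then have "1 <= delta powr (1 - nu) * x powr (nu - 1)" using delta by (simp add: powr_add[symmetric])
      then have "1 * \<bar>a x\<bar> <= (delta powr (1 - nu) * x powr (nu - 1)) * \<bar>a x\<bar>" by (intro mult_right_mono) auto
      then show ?thesis using True delta by (simp add: f_def radial_density_def abs_mult mult.assoc)
     qed (auto simp: f_def indicator_def)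
    qed
   qed (intro borel_measurable_times borel_measurable_indicator; simp)
  qed measurable
  have b2: "2 <= norm x ==> bump x = 0" for x by (rule bump_zero) auto
  have b1: "\<bar>bump x\<bar> <= 1" for x using bump_le_1 bump_nonneg by simp
  obtain r where r: "strict_mono r" "AE z in lborel. norm z < R -->
    (%k. LINT y|lborel. f (z + (1 / (real (r k) + 1)) *\<^sub>R y) * bump y) \<longlonglongrightarrow> f z * (LINT y|lborel. bump y)"
   using mollifier_AE[OF fl bump_measurable b1 b2, where R=R and ?r0.0=2] by auto
  from r(2) obtain N where N: "N \<in> null_sets lborel" "\<And>z. z \<notin> N ==> norm z < R -->
    (%k. LINT y|lborel. f (z + (1 / (real (r k) + 1)) *\<^sub>R y) * bump y) \<longlonglongrightarrow> f z * (LINT y|lborel. bump y)"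
   by (rule AE_E3) auto
  show ?thesis
  proof (intro bexI[OF _ N(1)] allI impI)
   fix alpha beta assume ab: "delta < alpha" "alpha < beta" "beta < R" "alpha \<notin> N" "beta \<notin> N"
   define J where "J k = real (r k) + 1" for k
   have J1: "J k >= 1" for k by (simp add: J_def)
   have Jlim: "filterlim J at_top sequentially"
   proof -
    have "filterlim (%k. real k + 1) at_top sequentially" by real_asymp
    from filterlim_compose[OF this filterlim_subseq[OF r(1)]] show ?thesis unfolding J_def[abs_def] by (simp add: o_def)
   qed
   have alpha0: "alpha > 0" using ab delta by simp
   have conv: "(%k. LINT s|lborel. f s * (J k * bump (J k * (s - z)))) \<longlonglongrightarrow> a z * ramp_max" if "z \<notin> N" "delta < z" "z < R" for z
   proof -
    have "norm z < R" using that delta by simp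
    then have "(%k. LINT y|lborel. f (z + (1 / J k) *\<^sub>R y) * bump y) \<longlonglongrightarrow> f z * ramp_max"
     using N(2)[OF that(1)] unfolding J_def bump_integral by blast
    moreover have "f z = a z" using that by (simp add: f_def)
    moreover have "(LINT s|lborel. f s * (J k * bump (J k * (s - z)))) = (LINT y|lborel. f (z + (1 / J k) *\<^sub>R y) * bump y)" for k
     by (rule bump_scale) (use J1[of k] in auto)
    ultimately show ?thesis by simp
   qed
   have int: "integrable lborel (%s. f s * (J k * bump (J k * (s - z))))" if "z > 0" for k z
   proof (rule locint_mult_compact[OF fl, of _ "J k" "z + 2"])
    show "\<bar>J k * bump (J k * (s - z))\<bar> <= J k" for s
     using b1[of "J k * (s - z)"] J1[of k] by (simp add: abs_mult mult_left_le)
    show "J k * bump (J k * (s - z)) = 0" if s: "z + 2 <= norm s" for s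
    proof (cases "s <= 0")
     case True
     then have "J k * (s - z) <= 0" using J1[of k] \<open>z > 0\<close> by (intro mult_nonneg_nonpos) auto
     then show ?thesis using bump_zero[of "J k * (s - z)"] by simp
    next
     case False
     then have "1 * 2 <= J k * (s - z)" using s J1[of k] by (intro mult_mono) auto
     then show ?thesis using bump_zero[of "J k * (s - z)"] by simp
    qed
   qed measurable
   have id: "4 * ((LINT s|lborel. f s * (J k * bump (J k * (s - alpha)))) - (LINT s|lborel. f s * (J k * bump (J k * (s - beta)))))
     = (LINT t|lborel. edge alpha beta (J k) t * (t powr (- nu) * K t))" for k
   proof -
    note ed = edge_smooth[OF J1 ab(2)] alpha0 edge_low[OF J1 ab(2)] edge_high[OF J1 ab(2)]
    have "4 * (LINT s|lborel. a s * deriv (edge alpha beta (J k)) s) = (LINT s|lborel. B s * tail nu (edge alpha beta (J k)) (beta + 2) s)"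
     unfolding B_def by (rule radial_test_identity[OF am bm w nu ed])
    also have "\<dots> = (LINT t|lborel. (edge alpha beta (J k) t * t powr (- nu)) * K t)"
     unfolding K_def B_def[symmetric] by (rule tail_fubini[OF _ Bi B0 ed]) measurable
    also have "(LINT s|lborel. a s * deriv (edge alpha beta (J k)) s) =
     (LINT s|lborel. f s * (J k * bump (J k * (s - alpha))) - f s * (J k * bump (J k * (s - beta))))"
    proof (rule Bochner_Integration.integral_cong[OF refl])
     fix s
     show "a s * deriv (edge alpha beta (J k)) s = f s * (J k * bump (J k * (s - alpha))) - f s * (J k * bump (J k * (s - beta)))"
     proof (cases "s <= alpha")
      case True
      have "J k * (s - alpha) <= 0" "J k * (s - beta) <= 0" using True ab J1[of k] by (auto intro: mult_nonneg_nonpos)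
      then show ?thesis unfolding edge_deriv[OF J1 ab(2)] by (simp add: bump_zero)
     next
      case False
      then have "f s = a s" using ab by (simp add: f_def)
      then show ?thesis unfolding edge_deriv[OF J1 ab(2)] by (simp add: algebra_simps)
     qed
    qed
    also have "\<dots> = (LINT s|lborel. f s * (J k * bump (J k * (s - alpha)))) - (LINT s|lborel. f s * (J k * bump (J k * (s - beta))))"
     by (rule Bochner_Integration.integral_diff) (use int alpha0 ab in auto)
    finally show ?thesis by (simp only: mult.assoc)
   qed
   have L: "(%k. 4 * ((LINT s|lborel. f s * (J k * bump (J k * (s - alpha)))) - (LINT s|lborel. f s * (J k * bump (J k * (s - beta))))))
     \<longlonglongrightarrow> 4 * (a alpha * ramp_max - a beta * ramp_max)"
    by (intro tendsto_mult tendsto_const tendsto_diff conv) (use ab in auto)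
   define M where "M = (LINT s|lborel. \<bar>indicator {..beta + 2} s * B s\<bar>)"
   have KM: "\<bar>K t\<bar> <= M" if "t <= beta + 2" for t
   proof -
    have i: "integrable lborel (%s. indicator {..<t} s * B s)"
     using integrable_mult_indicator[OF _ Bi[of t], of "{..<t}"]
     by (rule back_subst[of "integrable lborel"]) (auto simp: indicator_def fun_eq_iff)
    have "\<bar>K t\<bar> <= (LINT s|lborel. \<bar>indicator {..<t} s * B s\<bar>)"
     unfolding K_def B_def[symmetric] using integral_norm_bound[of lborel "%s. indicator {..<t} s * B s"] by simp
    also have "\<dots> <= M" unfolding M_def
     by (rule integral_mono) (use i Bi that in \<open>auto simp: indicator_def\<close>)
    finally show ?thesis .
   qed
   have Rlim: "(%k. LINT t|lborel. edge alpha beta (J k) t * (t powr (- nu) * K t)) \<longlonglongrightarrow>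
     (LINT t|lborel. (ramp_max * indicator {alpha<..beta} t) * (t powr (- nu) * K t))"
   proof (rule integral_dominated_convergence[where w="%t. indicator {alpha..beta + 2} t * (ramp_max * (alpha powr (- nu) * M))"])
    have [measurable]: "edge alpha beta (J k) \<in> bmeas" for k
     by (rule borel_measurable_continuous_onI[OF smooth_continuous[OF edge_smooth[OF J1 ab(2)]]])
    show "(%t. edge alpha beta (J k) t * (t powr (- nu) * K t)) \<in> borel_measurable lborel" for k by measurable
    show "(%t. ramp_max * indicator {alpha<..beta} t * (t powr (- nu) * K t)) \<in> borel_measurable lborel" by measurable
    show "AE t in lborel. (%k. edge alpha beta (J k) t * (t powr (- nu) * K t)) \<longlonglongrightarrow> ramp_max * indicator {alpha<..beta} t * (t powr (- nu) * K t)"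
     by (intro AE_I2 tendsto_mult tendsto_const edge_tendsto Jlim ab)
    show "integrable lborel (%t. indicator {alpha..beta + 2} t * (ramp_max * (alpha powr (- nu) * M)))"
     by (intro integrable_mult_left integrable_real_indicator) (use ab in auto)
    show "AE t in lborel. norm (edge alpha beta (J k) t * (t powr (- nu) * K t)) <= indicator {alpha..beta + 2} t * (ramp_max * (alpha powr (- nu) * M))" for k
    proof (rule AE_I2)
     fix t
     show "norm (edge alpha beta (J k) t * (t powr (- nu) * K t)) <= indicator {alpha..beta + 2} t * (ramp_max * (alpha powr (- nu) * M))"
     proof (cases "t \<in> {alpha..beta + 2}")
      case True
      have "t powr (- nu) <= alpha powr (- nu)" using True alpha0 nu1 by (intro powr_mono2') auto
      then have "\<bar>edge alpha beta (J k) t\<bar> * (t powr (- nu) * \<bar>K t\<bar>) <= ramp_max * (alpha powr (- nu) * M)"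
       using edge_bounds[OF J1 ab(2), of k t] KM[of t] True ramp_max_pos by (intro mult_mono) auto
      then show ?thesis using True by (simp add: abs_mult)
     next
      case False
      then have "edge alpha beta (J k) t = 0" using edge_low[OF J1 ab(2), of t k] edge_high[OF J1 ab(2), of t k] by auto
      then show ?thesis using False by simp
     qed
    qed
   qed
   have "4 * (a alpha * ramp_max - a beta * ramp_max) = (LINT t|lborel. (ramp_max * indicator {alpha<..beta} t) * (t powr (- nu) * K t))"
    using LIMSEQ_unique[OF L] Rlim unfolding id by blast
   also have "\<dots> = ramp_max * (LINT t|lborel. indicator {alpha<..beta} t * (t powr (- nu) * K t))" by (simp add: mult.assoc)
   finally have "ramp_max * (4 * (a alpha - a beta)) = ramp_max * (LINT t|lborel. indicator {alpha<..beta} t * (t powr (- nu) * K t))"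
    by (simp add: algebra_simps)
   then show "4 * (a alpha - a beta) = (LINT t|lborel. indicator {alpha<..beta} t * (t powr (- nu) * K t))"
    using ramp_max_pos by simp
  qed
 qed
 \<comment> \<open>The exceptional null set depends on the interval from \<open>delta\<close> to
   \<open>R\<close>. The intervals (1/(n+1), n+1) exhaust the positive half line, and countably many
   null sets can be united.\<close>
 have "\<exists>N. \<forall>n::nat. N n \<in> null_sets lborel \<and> (\<forall>alpha beta. 1 / (real n + 1) < alpha --> alpha < beta --> beta < real n + 1 --> alpha \<notin> N n --> beta \<notin> N n -->
  4 * (a alpha - a beta) = (LINT t|lborel. indicator {alpha<..beta} t * (t powr (- nu) * K t)))"
 proof (intro choice allI)
  fix n :: nat
  show "\<exists>N. N \<in> null_sets lborel \<and> (\<forall>alpha beta. 1 / (real n + 1) < alpha --> alpha < beta --> beta < real n + 1 --> alpha \<notin> N --> beta \<notin> N -->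
   4 * (a alpha - a beta) = (LINT t|lborel. indicator {alpha<..beta} t * (t powr (- nu) * K t)))"
   using window[of "1 / (real n + 1)" "real n + 1"] unfolding Bex_def by simp
 qed
 then obtain N where N: "\<And>n::nat. N n \<in> null_sets lborel" "\<And>n alpha beta. 1 / (real n + 1) < alpha ==> alpha < beta ==> beta < real n + 1 ==> alpha \<notin> N n ==> beta \<notin> N n ==>
  4 * (a alpha - a beta) = (LINT t|lborel. indicator {alpha<..beta} t * (t powr (- nu) * K t))" by blast
 show ?thesis
 proof (intro bexI[of _ "\<Union>n. N n"] allI impI)
  show "(\<Union>n. N n) \<in> null_sets lborel" using N(1) by (intro null_sets_UN) auto
  fix alpha beta :: real assume ab: "0 < alpha" "alpha < beta" "alpha \<notin> (\<Union>n. N n)" "beta \<notin> (\<Union>n. N n)"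
  obtain n :: nat where n: "real n > max (1 / alpha) beta" using reals_Archimedean2 by blast
  have "1 / alpha < real n + 1" using n by simp
  then have "1 / (real n + 1) < alpha" using ab(1) by (simp add: divide_less_eq mult.commute)
  then show "4 * (a alpha - a beta) = (LINT t|lborel. indicator {alpha<..beta} t * (t powr (- nu) * K t))"
   using N(2)[of n alpha beta] ab n by auto
 qed
qed

lemma cumulative_continuous:
 fixes B :: "real => real"
 assumes [measurable]: "B \<in> bmeas" and Bi: "\<And>S. integrable lborel (%s. indicator {..S} s * B s)"
 shows "continuous_on UNIV (%t. LINT s|lborel. indicator {..<t} s * B s)"
proof (intro continuous_at_imp_continuous_on ballI)
 fix t :: real
 show "isCont (%t. LINT s|lborel. indicator {..<t} s * B s) t"
  unfolding continuous_at_sequentially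
 proof (intro allI impI)
  fix x :: "nat => real" assume x: "x \<longlonglongrightarrow> t"
  obtain C where C: "\<And>n. \<bar>x n\<bar> <= C" using convergent_imp_Bseq[OF convergentI[OF x]] by (auto simp: Bseq_def)
  have "(%n. LINT s|lborel. indicator {..<x n} s * B s) \<longlonglongrightarrow> (LINT s|lborel. indicator {..<t} s * B s)"
  proof (rule integral_dominated_convergence[where w="%s. \<bar>indicator {..C} s * B s\<bar>"])
   show "AE s in lborel. (%n. indicator {..<x n} s * B s) \<longlonglongrightarrow> indicator {..<t} s * B s"
    using AE_lborel_singleton[of t]
   proof eventually_elim
    case (elim s)
    have "\<forall>\<^sub>F n in sequentially. indicator {..<x n} s = (indicator {..<t} s :: real)"
    proof (cases "s < t")
     case True
     then show ?thesis using order_tendstoD(1)[OF x, of s] by (auto elim!: eventually_mono)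
    next
     case False
     then have "t < s" using elim by simp
     then show ?thesis using order_tendstoD(2)[OF x, of s] by (auto elim!: eventually_mono)
    qed
    then show ?case by (intro tendsto_mult tendsto_const tendsto_eventually)
   qed
   show "AE s in lborel. norm (indicator {..<x n} s * B s) <= \<bar>indicator {..C} s * B s\<bar>" for n
   proof (rule AE_I2)
    fix s show "norm (indicator {..<x n} s * B s) <= \<bar>indicator {..C} s * B s\<bar>"
     using C[of n] by (auto simp: indicator_def)
   qed
   show "integrable lborel (%s. \<bar>indicator {..C} s * B s\<bar>)" by (rule integrable_abs[OF Bi])
  qed measurable
  then show "((%t. LINT s|lborel. indicator {..<t} s * B s) \<circ> x) \<longlonglongrightarrow> (LINT s|lborel. indicator {..<t} s * B s)"
   by (simp add: o_def)
 qed
qed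

text \<open>Integrating from one base point \<open>s0\<close> outside the exceptional set defines a
  differentiable representative; the increment identity makes \<open>a\<close> agree with it off
  that set.\<close>

lemma radial_ode:
 fixes a b :: "real => real"
 assumes am [measurable]: "a \<in> bmeas" and bm [measurable]: "b \<in> bmeas"
  and w: "radial_weak (%x::'a::euclidean_space. a (sq x)) (%x. b (sq x))" and nu: "nu = real DIM('a) / 2" and nu1: "nu >= 1"
 defines "K \<equiv> %t. LINT s|lborel. indicator {..<t} s * (radial_density nu s * b s)"
 shows "\<exists>A. (\<forall>s>0. (A has_real_derivative - (1/4) * (s powr (- nu) * K s)) (at s)) \<and> (AE s in lborel. s > 0 --> a s = A s)"
proof -
 obtain N where N: "N \<in> null_sets lborel" and inc: "\<And>alpha beta. 0 < alpha ==> alpha < beta ==> alpha \<notin> N ==> beta \<notin> N ==>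
  4 * (a alpha - a beta) = (LINT t|lborel. indicator {alpha<..beta} t * (t powr (- nu) * K t))"
  using radial_weak_increments[OF am bm w nu nu1] unfolding K_def by blast
 have Kc: "continuous_on UNIV K" unfolding K_def
  by (rule cumulative_continuous) (use locint_radial[OF bm radial_weak_locint(2)[OF w] nu] in auto)
 define k where "k t = t powr (- nu) * K t" for t
 have kc: "continuous_on {x..y} k" if "x > 0" for x y
  unfolding k_def[abs_def] using that by (intro continuous_intros continuous_on_subset[OF Kc]) auto
 have km: "k \<in> bmeas"
  unfolding k_def[abs_def] using borel_measurable_continuous_onI[OF Kc] by measurable
 have "\<exists>s0>0. s0 \<notin> N"
 proof (rule ccontr)
  assume "\<not> (\<exists>s0>0. s0 \<notin> N)"
  then have "{0<..<1} \<subseteq> N" by auto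
  then have "{0<..<1::real} \<in> null_sets lborel" using N null_sets_subset by (metis greaterThanLessThan_borel sets_lborel)
  then show False by (auto simp: null_sets_def)
 qed
 then obtain s0 where s0: "s0 > 0" "s0 \<notin> N" by blast
 define A where "A s = a s0 - (1/4) * (LBINT t=s0..s. k t)" for s :: real
 have "(A has_real_derivative - (1/4) * (s powr (- nu) * K s)) (at s)" if s: "s > 0" for s
 proof -
  let ?l = "min s0 s / 2" and ?u = "max s0 s + 1"
  have "((%u. LBINT y=s0..u. k y) has_vector_derivative k s) (at s within {?l..?u})"
   by (rule interval_integral_FTC2) (use s s0 in \<open>auto intro!: kc\<close>)
  moreover have "at s within {?l..?u} = at s" by (rule at_within_interior) (use s s0 in auto)
  ultimately have "((%u. LBINT y=s0..u. k y) has_real_derivative k s) (at s)"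
   by (simp add: has_real_derivative_iff_has_vector_derivative)
  then have "((%u. a s0 - (1/4) * (LBINT y=s0..u. k y)) has_real_derivative 0 - (1/4) * k s) (at s)"
   by (intro DERIV_diff DERIV_const DERIV_cmult)
  then show ?thesis unfolding A_def[abs_def] k_def by simp
 qed
 moreover have "AE s in lborel. s > 0 --> a s = A s"
  using AE_not_in[OF N]
 proof eventually_elim
  case (elim s)
  have seg: "(LBINT t=x..y. k t) = (LINT t|lborel. indicator {x<..y} t * k t)" if "x < y" for x y :: real
   using that by (simp add: interval_integral_Ioc set_lebesgue_integral_def)
  show ?case
  proof
   assume s: "s > 0"
   consider "s = s0" | "s0 < s" | "s < s0" by linarith
   then show "a s = A s"
   proof cases
    case 1
    then show ?thesis by (simp add: A_def interval_integral_endpoints_same)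
   next
    case 2
    then show ?thesis using inc[OF s0(1) 2 s0(2) elim] seg[OF 2] by (simp add: A_def k_def)
   next
    case 3
    have "(LBINT t=s0..s. k t) = - (LBINT t=s..s0. k t)" by (rule interval_integral_endpoints_reverse)
    then show ?thesis using inc[OF s 3 elim s0(2)] seg[OF 3] by (simp add: A_def k_def)
   qed
  qed
 qed
 ultimately show ?thesis by blast
qed

lemma AE_eq_continuous_pos:
 fixes f g :: "real => real"
 assumes c: "continuous_on {0<..} f" "continuous_on {0<..} g" and AE: "AE s in lborel. s > 0 --> f s = g s" and s: "s > 0"
 shows "f s = g s"
proof (rule ccontr)
 assume ne: "f s \<noteq> g s"
 have "open ({0<..} \<inter> (%s. f s - g s) -` (- {0}))"
  by (rule continuous_open_preimage) (use c in \<open>auto intro: continuous_intros\<close>)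
 moreover have "{0<..} \<inter> (%s. f s - g s) -` (- {0}) = {s. s > 0 \<and> f s \<noteq> g s}" by auto
 ultimately have o: "open {s. s > 0 \<and> f s \<noteq> g s}" by (simp only:)
 have "AE x in lborel. x \<notin> {s. s > 0 \<and> f s \<noteq> g s}" using AE by eventually_elim auto
 then have "{s. s > 0 \<and> f s \<noteq> g s} \<in> null_sets lborel" using o by (subst AE_iff_null_sets) auto
 then have "negligible {s. s > 0 \<and> f s \<noteq> g s}" unfolding negligible_iff_null_sets by (rule null_sets_completionI)
 then show False using open_not_negligible[OF o] ne s by auto
qed

lemma radial_ode_continuous:
 fixes a b :: "real => real"
 assumes am: "a \<in> bmeas" and bm: "b \<in> bmeas"
  and w: "radial_weak (%x::'a::euclidean_space. a (sq x)) (%x. b (sq x))" and nu: "nu = real DIM('a) / 2" and nu1: "nu >= 1"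
  and ac: "continuous_on {0..} a" and s: "s > 0"
 shows "(a has_real_derivative - (1/4) * (s powr (- nu) * (LINT t|lborel. indicator {..<s} t * (radial_density nu t * b t)))) (at s)"
proof -
 obtain A where A: "\<And>s. s > 0 ==> (A has_real_derivative - (1/4) * (s powr (- nu) * (LINT t|lborel. indicator {..<s} t * (radial_density nu t * b t)))) (at s)"
  and AE: "AE s in lborel. s > 0 --> a s = A s"
  using radial_ode[OF am bm w nu nu1] by blast
 have Ac: "continuous_on {0<..} A"
  by (intro continuous_at_imp_continuous_on ballI DERIV_isCont[OF A]) auto
 have "a s = A s" if "s > 0" for s
  by (rule AE_eq_continuous_pos[OF continuous_on_subset[OF ac] Ac AE that]) auto
 then have "\<forall>\<^sub>F x in nhds s. A x = a x"
  using s by (auto simp: eventually_nhds intro!: exI[of _ "{0<..}"])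
 then show ?thesis using DERIV_cong_ev[OF refl, of A a s] A[OF s] by simp
qed

section \<open>Regular solutions of the radial equation\<close>

lemma cumulative_eq_integral:
 assumes b: "continuous_on {0..} b" and nu: "nu >= 1" and s: "s >= 0"
 shows "(LINT t|lborel. indicator {..<s} t * (radial_density nu t * b t)) = integral {0..s} (%t. t powr (nu - 1) * b t)"
  and "(%t. t powr (nu - 1) * b t) integrable_on {0..s}"
proof -
 let ?f = "%t. t powr (nu - 1) * b t"
 have "continuous_on {0..s} b" using b by (rule continuous_on_subset) auto
 then have "bounded (b ` {0..s})" by (intro compact_imp_bounded compact_continuous_image) auto
 then obtain M where "\<forall>y\<in>b ` {0..s}. norm y <= M" unfolding bounded_iff by blast
 then have M: "\<And>t. t \<in> {0..s} ==> \<bar>b t\<bar> <= M" by simp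
 have c: "continuous_on {0<..s} ?f"
  by (intro continuous_intros continuous_on_subset[OF b]) auto
 have si: "set_integrable lborel {0<..s} ?f"
  unfolding set_integrable_def
 proof (rule Bochner_Integration.integrable_bound)
  show "integrable lborel (%t. indicator {0<..s} t * (s powr (nu - 1) * M) :: real)"
   by (intro integrable_mult_left integrable_real_indicator) (use s in auto)
  show "(%t. indicator {0<..s} t *\<^sub>R ?f t) \<in> borel_measurable lborel"
   using borel_measurable_continuous_on_indicator[OF _ c] by simp
  show "AE t in lborel. norm (indicator {0<..s} t *\<^sub>R ?f t) <= norm (indicator {0<..s} t * (s powr (nu - 1) * M))"
  proof (rule AE_I2)
   fix t
   show "norm (indicator {0<..s} t *\<^sub>R ?f t) <= norm (indicator {0<..s} t * (s powr (nu - 1) * M))"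
   proof (cases "t \<in> {0<..s}")
    case True
    have "t powr (nu - 1) * \<bar>b t\<bar> <= s powr (nu - 1) * M"
     by (intro mult_mono powr_mono2 M) (use True nu in auto)
    moreover have "M >= 0" using M[of 0] s by (auto intro: order_trans[OF abs_ge_zero])
    ultimately show ?thesis using True by (simp add: abs_mult)
   qed simp
  qed
 qed
 have "(LINT t|lborel. indicator {..<s} t * (radial_density nu t * b t)) = (LINT t:{0<..s}|lborel. ?f t)"
  unfolding set_lebesgue_integral_def
 proof (rule integral_cong_AE)
  have "(%t. indicator {0<..<s} t *\<^sub>R ?f t) \<in> bmeas"
   by (rule borel_measurable_continuous_on_indicator) (auto intro: continuous_on_subset[OF c])
  moreover have "(%t. indicator {0<..<s} t *\<^sub>R ?f t) = (%t. indicator {..<s} t * (radial_density nu t * b t))"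
   by (auto simp: fun_eq_iff indicator_def radial_density_def)
  ultimately show "(%t. indicator {..<s} t * (radial_density nu t * b t)) \<in> borel_measurable lborel" by simp
  show "(%t. indicator {0<..s} t *\<^sub>R ?f t) \<in> borel_measurable lborel"
   using borel_measurable_continuous_on_indicator[OF _ c] by simp
  show "AE t in lborel. indicator {..<s} t * (radial_density nu t * b t) = indicator {0<..s} t *\<^sub>R ?f t"
   using AE_lborel_singleton[of s] by eventually_elim (auto simp: indicator_def radial_density_def)
 qed
 also have "\<dots> = integral {0<..s} ?f" by (rule set_borel_integral_eq_integral(2)[OF si])
 also have "\<dots> = integral {0..s} ?f"
  by (rule integral_spike_set) (auto intro: negligible_subset[of "{0}"])
 finally show "(LINT t|lborel. indicator {..<s} t * (radial_density nu t * b t)) = integral {0..s} ?f" .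
 have "?f integrable_on {0<..s}" by (rule set_borel_integral_eq_integral(1)[OF si])
 then show "?f integrable_on {0..s}"
  by (rule integrable_spike_set) (auto intro: negligible_subset[of "{0}"])
qed

text \<open>Integrated form of 4 s a'' + 4 nu a' = - b. Starting the integral at 0 without an
  additional constant builds in regularity: it excludes the fundamental solution s^(1-nu).\<close>

definition radial_sol :: "real => (real => real) => (real => real) => bool" where
 "radial_sol nu a b \<longleftrightarrow> continuous_on {0..} a \<and> continuous_on {0..} b \<and>
  (\<forall>s>0. (a has_real_derivative - (1/4) * (s powr (- nu) * integral {0..s} (%t. t powr (nu - 1) * b t))) (at s))"

lemma powr_integrable:
 assumes b: "continuous_on {0..} b" and nu: "nu > 1"
 shows "(%t. t powr (nu - 1) * b t) integrable_on {0..(s::real)}"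
proof -
 have "continuous_on {0..s} (%t. t powr (nu - 1))"
  using nu by (intro continuous_on_powr' continuous_intros) auto
 then have "continuous_on {0..s} (%t. t powr (nu - 1) * b t)"
  by (intro continuous_on_mult continuous_on_subset[OF b]) auto
 then show ?thesis by (rule integrable_continuous_interval)
qed

text \<open>After multiplication by \<open>nu\<close> the left side is a weighted mean over [0, s],
  so that bounds on the right-hand side of the equation pass directly to the slope.\<close>

lemma powr_mean:
 assumes "nu > (1::real)" "s > 0"
 shows "s powr (- nu) * integral {0..s} (%t. t powr (nu - 1) * M) = M / nu"
proof -
 have "((%t. t powr (nu - 1)) has_integral (s powr (nu - 1 + 1) / (nu - 1 + 1))) {0..s}"
  by (rule has_integral_powr_from_0) (use assms in auto)
 then have "((%t. t powr (nu - 1) * M) has_integral (s powr nu / nu * M)) {0..s}"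
  by (intro has_integral_mult_left) simp
 then have "integral {0..s} (%t. t powr (nu - 1) * M) = s powr nu / nu * M" by (rule integral_unique)
 moreover have "s powr (- nu) * s powr nu = 1" using assms by (simp add: powr_add[symmetric])
 ultimately show ?thesis by (simp add: mult.assoc[symmetric])
qed

lemma powr_mean_mono:
 assumes nu: "nu > (1::real)" and b: "continuous_on {0..} b" "continuous_on {0..} b'"
  and le: "\<And>t. 0 <= t ==> t <= s ==> b t <= b' t"
 shows "s powr (- nu) * integral {0..s} (%t. t powr (nu - 1) * b t) <= s powr (- nu) * integral {0..s} (%t. t powr (nu - 1) * b' t)"
proof (rule mult_left_mono)
 show "integral {0..s} (%t. t powr (nu - 1) * b t) <= integral {0..s} (%t. t powr (nu - 1) * b' t)"
  by (rule integral_le[OF powr_integrable[OF b(1) nu] powr_integrable[OF b(2) nu]])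
    (use le in \<open>auto intro: mult_left_mono\<close>)
qed simp

lemma radial_sol_deriv_bounds:
 assumes nu: "nu > 1" and a: "radial_sol nu a b" and s: "s > 0"
 shows "(\<And>t. 0 <= t ==> t <= s ==> b t <= M) ==> s powr (- nu) * integral {0..s} (%t. t powr (nu - 1) * b t) <= M / nu"
  and "(\<And>t. 0 <= t ==> t <= s ==> b t >= M) ==> s powr (- nu) * integral {0..s} (%t. t powr (nu - 1) * b t) >= M / nu"
proof -
 have b: "continuous_on {0..} b" using a by (simp add: radial_sol_def)
 show "s powr (- nu) * integral {0..s} (%t. t powr (nu - 1) * b t) <= M / nu"
  if "\<And>t. 0 <= t ==> t <= s ==> b t <= M"
  using powr_mean_mono[where s=s, OF nu b continuous_on_const that] powr_mean[OF nu s, of M] by simp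
 show "s powr (- nu) * integral {0..s} (%t. t powr (nu - 1) * b t) >= M / nu"
  if "\<And>t. 0 <= t ==> t <= s ==> b t >= M"
  using powr_mean_mono[where s=s, OF nu continuous_on_const b that] powr_mean[OF nu s, of M] by simp
qed

lemma radial_sol_increment:
 assumes nu: "nu > 1" and a: "radial_sol nu a b" and rs: "0 <= r" "r <= s"
  and M: "\<And>t. 0 <= t ==> t <= s ==> b t <= M"
 shows "a s - a r >= - (M / (4 * nu)) * (s - r)"
proof (cases "r = s")
 case False
 then have "r < s" using rs by simp
 have c: "continuous_on {r..s} a" using a rs by (auto simp: radial_sol_def intro: continuous_on_subset)
 have df: "a differentiable (at x)" if "r < x" for x
  using a rs that unfolding radial_sol_def real_differentiable_def by (meson le_less_trans)
 obtain l z where z: "r < z" "z < s" "(a has_real_derivative l) (at z)" "a s - a r = (s - r) * l"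
  using MVT[OF \<open>r < s\<close> c df] by blast
 have "(a has_real_derivative - (1/4) * (z powr (- nu) * integral {0..z} (%t. t powr (nu - 1) * b t))) (at z)"
  using a z rs by (auto simp: radial_sol_def)
 then have l: "l = - (1/4) * (z powr (- nu) * integral {0..z} (%t. t powr (nu - 1) * b t))"
  using z(3) DERIV_unique by blast
 have "z powr (- nu) * integral {0..z} (%t. t powr (nu - 1) * b t) <= M / nu"
  by (rule radial_sol_deriv_bounds(1)[OF nu a]) (use z rs M in auto)
 then have "l >= - (M / (4 * nu))" unfolding l by simp
 then have "(s - r) * l >= (s - r) * (- (M / (4 * nu)))" using rs by (intro mult_left_mono) auto
 then show ?thesis using z(4) by (simp add: mult.commute)
qed simp

lemma radial_sol_neg: "radial_sol nu a b ==> radial_sol nu (%s. - a s) (%s. - b s)"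
 unfolding radial_sol_def by (auto intro!: continuous_intros derivative_eq_intros)

lemma radial_sol_add_scaled:
 assumes nu: "nu > 1" and a: "radial_sol nu a b" and c: "radial_sol nu c d"
 shows "radial_sol nu (%s. a s + k * c s) (%s. b s + k * d s)"
 unfolding radial_sol_def
proof (intro conjI allI impI)
 show "continuous_on {0..} (%s. a s + k * c s)" "continuous_on {0..} (%s. b s + k * d s)"
  using a c by (auto simp: radial_sol_def intro!: continuous_intros)
 fix s :: real assume s: "s > 0"
 have i: "(%t. t powr (nu - 1) * b t) integrable_on {0..s}" "(%t. t powr (nu - 1) * d t) integrable_on {0..s}"
  using a c nu by (auto simp: radial_sol_def intro!: powr_integrable)
 have "integral {0..s} (%t. t powr (nu - 1) * (b t + k * d t)) = integral {0..s} (%t. t powr (nu - 1) * b t + k * (t powr (nu - 1) * d t))"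
  by (simp add: algebra_simps)
 also have "\<dots> = integral {0..s} (%t. t powr (nu - 1) * b t) + k * integral {0..s} (%t. t powr (nu - 1) * d t)"
  using i integrable_on_cmult_left[OF i(2), of k] by (subst integral_add) auto
 finally have e: "integral {0..s} (%t. t powr (nu - 1) * (b t + k * d t)) = \<dots>" .
 have "((%s. a s + k * c s) has_real_derivative
   - (1/4) * (s powr (- nu) * integral {0..s} (%t. t powr (nu - 1) * b t)) + k * (- (1/4) * (s powr (- nu) * integral {0..s} (%t. t powr (nu - 1) * d t)))) (at s)"
  using a c s unfolding radial_sol_def by (intro DERIV_add DERIV_cmult) auto
 then show "((%s. a s + k * c s) has_real_derivative - (1/4) * (s powr (- nu) * integral {0..s} (%t. t powr (nu - 1) * (b t + k * d t)))) (at s)"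
  unfolding e by (simp add: algebra_simps)
qed

section \<open>Uniqueness for the linear radial system\<close>

lemma first_crossing:
 fixes f :: "real => real"
 assumes c: "continuous_on {0..} f" and f0: "f 0 > m" and s: "s >= 0" "f s < m"
 shows "\<exists>r\<ge>0. f r = m \<and> (\<forall>t. 0 <= t --> t <= r --> f t >= m)"
proof -
 let ?A = "{0..s} \<inter> f -` {..m}"
 have cl: "closed ?A"
  by (rule continuous_closed_preimage) (use c in \<open>auto intro: continuous_on_subset\<close>)
 have ne: "s \<in> ?A" using s by simp
 have bb: "bdd_below ?A" by (rule bdd_belowI[of _ 0]) simp
 define r where "r = Inf ?A"
 have r: "r \<in> ?A" unfolding r_def using closed_contains_Inf[OF _ bb cl] ne by blast
 have below: "f t > m" if "0 <= t" "t < r" for t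
 proof (rule ccontr)
  assume "\<not> f t > m"
  then have "t \<in> ?A" using that r by auto
  then have "r <= t" unfolding r_def by (rule cInf_lower[OF _ bb])
  then show False using that by simp
 qed
 have "r > 0" using r f0 by (cases "r = 0") auto
 have "f r >= m"
 proof (rule ccontr)
  assume "\<not> f r >= m"
  then have "\<exists>x. 0 <= x \<and> x <= r \<and> f x = (f r + m) / 2"
   using f0 r by (intro IVT2') (auto intro: continuous_on_subset[OF c])
  then obtain x where x: "0 <= x" "x <= r" "f x = (f r + m) / 2" by blast
  then have "f x < m" using \<open>\<not> f r >= m\<close> by simp
  moreover have "x \<noteq> r" using x(3) \<open>\<not> f r >= m\<close> by auto
  ultimately show False using below[of x] x by simp
 qed
 then have "f r = m" using r by auto
 moreover have "f t >= m" if "0 <= t" "t <= r" for t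
  using below[of t] that \<open>f r = m\<close> by (cases "t = r") auto
 ultimately show ?thesis using \<open>r > 0\<close> by (intro exI[of _ r]) auto
qed

text \<open>Until \<open>psi\<close> first drops to half of its initial value it is positive, so
  \<open>phi\<close> is nonincreasing from 0 and stays nonpositive, so \<open>psi\<close> is
  nondecreasing: the drop never happens.\<close>

lemma radial_linear_grows:
 assumes nu: "nu > 1" and phi: "radial_sol nu phi (%s. P s * psi s)" and psi: "radial_sol nu psi (%s. Q s * phi s)"
  and pos: "\<And>s. s >= 0 ==> P s > 0" "\<And>s. s >= 0 ==> Q s > 0" and init: "phi 0 = 0" "psi 0 > 0" and s: "s >= 0"
 shows "psi s >= psi 0 / 2"
proof (rule ccontr)
 assume "\<not> psi s >= psi 0 / 2"
 moreover have "continuous_on {0..} psi" using psi by (simp add: radial_sol_def)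
 ultimately obtain r where r: "r >= 0" "psi r = psi 0 / 2" "\<And>t. 0 <= t ==> t <= r ==> psi t >= psi 0 / 2"
  using first_crossing[of psi "psi 0 / 2" s] init s by auto
 have "phi t <= 0" if "0 <= t" "t <= r" for t
 proof -
  have "- phi t - (- phi 0) >= - (0 / (4 * nu)) * (t - 0)"
  proof (rule radial_sol_increment[OF nu radial_sol_neg[OF phi]])
   fix x assume "0 <= x" "x <= t"
   then have "psi x >= 0" using r(3)[of x] that init by simp
   then show "- (P x * psi x) <= 0" using pos(1)[of x] \<open>0 <= x\<close> by simp
  qed (use that in auto)
  then show ?thesis using init by simp
 qed
 then have "psi r - psi 0 >= - (0 / (4 * nu)) * (r - 0)"
  using pos(2) r(1) by (intro radial_sol_increment[OF nu psi]) (auto simp: mult_le_0_iff less_imp_le)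
 then show False using r(2) init by simp
qed

text \<open>The equation is singular at 0, but in averaged form the slope is bounded by the supremum
  of the right-hand side. On a step of length 1/(2 M) the supremum of |phi| and |psi| is thus at
  most half of itself; finitely many steps cover [0, s].\<close>

lemma radial_linear_zero:
 assumes nu: "nu > 1" and phi: "radial_sol nu phi (%s. P s * psi s)" and psi: "radial_sol nu psi (%s. Q s * phi s)"
  and PQ: "continuous_on {0..} P" "continuous_on {0..} Q" and init: "phi 0 = 0" "psi 0 = 0" and s: "s >= 0"
 shows "phi s = 0 \<and> psi s = 0"
proof -
 have c: "continuous_on {0..} phi" "continuous_on {0..} psi" using phi psi by (auto simp: radial_sol_def)
 have bd: "\<exists>M. \<forall>t\<in>{0..s}. \<bar>f t\<bar> <= M" if "continuous_on {0..} f" for f :: "real => real" and s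
 proof -
  have "bounded (f ` {0..s})"
   using that by (intro compact_imp_bounded compact_continuous_image) (auto intro: continuous_on_subset)
  then show ?thesis unfolding bounded_iff by auto
 qed
 obtain M1 M2 where M1: "\<forall>t\<in>{0..s}. \<bar>P t\<bar> <= M1" and M2: "\<forall>t\<in>{0..s}. \<bar>Q t\<bar> <= M2"
  using bd[OF PQ(1), of s] bd[OF PQ(2), of s] by blast
 define M where "M = max 1 (max M1 M2)"
 have M: "M >= 1" "\<And>t. 0 <= t ==> t <= s ==> \<bar>P t\<bar> <= M" "\<And>t. 0 <= t ==> t <= s ==> \<bar>Q t\<bar> <= M"
  using M1 M2 by (force simp: M_def)+
 define d where "d = 1 / M"
 have d: "d > 0" using M by (simp add: d_def)
 have lip: "\<bar>a y - a x\<bar> <= K * (y - x)" if a: "radial_sol nu a b" and xy: "0 <= x" "x <= y" and K: "\<And>t. 0 <= t ==> t <= y ==> \<bar>b t\<bar> <= K" for a b x y K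
 proof -
  have K0: "K >= 0" using K[of 0] xy by (auto intro: order_trans[OF abs_ge_zero])
  have "a y - a x >= - (K / (4 * nu)) * (y - x)" "- a y - (- a x) >= - (K / (4 * nu)) * (y - x)"
   by (intro radial_sol_increment[OF nu a] radial_sol_increment[OF nu radial_sol_neg[OF a]]; use xy K in \<open>force simp: abs_le_iff\<close>)+
  then have "\<bar>a y - a x\<bar> <= K / (4 * nu) * (y - x)" by (simp add: abs_le_iff)
  also have "\<dots> <= K * (y - x)"
  proof (rule mult_right_mono)
   show "K / (4 * nu) <= K" using K0 nu by (simp add: divide_le_eq mult_le_cancel_left1)
  qed (use xy in simp)
  finally show ?thesis .
 qed
 have step: "\<forall>t. 0 <= t --> t <= y --> phi t = 0 \<and> psi t = 0"
  if z: "\<forall>t. 0 <= t --> t <= x --> phi t = 0 \<and> psi t = 0" and xy: "0 <= x" "x <= y" "y <= x + d / 2" "y <= s" for x y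
 proof -
  have "continuous_on {0..y} (%t. max \<bar>phi t\<bar> \<bar>psi t\<bar>)"
   by (intro continuous_intros continuous_on_subset[OF c(1)] continuous_on_subset[OF c(2)]) auto
  then obtain t0 where t0: "t0 \<in> {0..y}" "\<And>t. t \<in> {0..y} ==> max \<bar>phi t\<bar> \<bar>psi t\<bar> <= max \<bar>phi t0\<bar> \<bar>psi t0\<bar>"
   using continuous_attains_sup[of "{0..y}" "%t. max \<bar>phi t\<bar> \<bar>psi t\<bar>"] xy by auto
  define m where "m = max \<bar>phi t0\<bar> \<bar>psi t0\<bar>"
  have m: "\<bar>phi t\<bar> <= m" "\<bar>psi t\<bar> <= m" if "0 <= t" "t <= y" for t
   using t0(2)[of t] that unfolding m_def by auto
  have m0: "m >= 0" by (simp add: m_def)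
  have half: "\<bar>a t\<bar> <= m / 2" if a: "radial_sol nu a b" "\<And>t. 0 <= t ==> t <= y ==> \<bar>b t\<bar> <= M * m"
   "\<And>t. 0 <= t ==> t <= x ==> a t = 0" and t: "0 <= t" "t <= y" for a b t
  proof (cases "t <= x")
   case False
   have "\<bar>a t - a x\<bar> <= M * m * (t - x)" by (rule lip[OF a(1)]) (use a(2) False t xy in auto)
   also have "\<dots> <= M * m * (d / 2)" using False t xy M m0 by (intro mult_left_mono) auto
   also have "\<dots> = m / 2" using M by (simp add: d_def)
   finally show ?thesis using a(3)[of x] xy by simp
  qed (use a t m0 in auto)
  have Mm: "\<bar>A t * w t\<bar> <= M * m" if "\<bar>A t\<bar> <= M" "\<bar>w t\<bar> <= m" for A w :: "real => real" and t
   unfolding abs_mult using that M m0 by (intro mult_mono) auto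
  have hphi: "\<bar>phi t\<bar> <= m / 2" if "0 <= t" "t <= y" for t
   by (rule half[OF phi]) (use that z xy m M in \<open>auto intro!: Mm\<close>)
  have hpsi: "\<bar>psi t\<bar> <= m / 2" if "0 <= t" "t <= y" for t
   by (rule half[OF psi]) (use that z xy m M in \<open>auto intro!: Mm\<close>)
  have "m <= m / 2" using hphi[of t0] hpsi[of t0] t0(1) unfolding m_def by auto
  then have "m = 0" using m0 by simp
  then show ?thesis using m by auto
 qed
 have "\<forall>t. 0 <= t --> t <= min s (real n * (d / 2)) --> phi t = 0 \<and> psi t = 0" for n :: nat
 proof (induction n)
  case 0
  show ?case
  proof (intro allI impI)
   fix t assume "0 <= t" "t <= min s (real 0 * (d / 2))"
   then have "t = 0" by simp
   then show "phi t = 0 \<and> psi t = 0" using init by simp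
  qed
 next
  case (Suc n)
  show ?case
   by (rule step[OF Suc]) (use s d in \<open>auto simp: min_def algebra_simps\<close>)
 qed
 moreover obtain n :: nat where "real n > s / (d / 2)" using reals_Archimedean2 by blast
 then have "s <= real n * (d / 2)" using d by (simp add: divide_less_eq)
 ultimately show ?thesis using s by (metis min.absorb1 order_refl)
qed

text \<open>If \<open>psi 0\<close> were nonzero, \<open>psi\<close> or its negative would stay
  above a positive constant, against the limit at infinity. One condition at the origin and decay of
  one component therefore determine the solution.\<close>

lemma radial_linear_unique:
 assumes nu: "nu > 1" and phi: "radial_sol nu phi (%s. P s * psi s)" and psi: "radial_sol nu psi (%s. Q s * phi s)"
  and PQ: "continuous_on {0..} P" "continuous_on {0..} Q"
  and pos: "\<And>s. s >= 0 ==> P s > 0" "\<And>s. s >= 0 ==> Q s > 0"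
  and init: "phi 0 = 0" and lim: "(psi \<longlongrightarrow> 0) at_top" and s: "s >= 0"
 shows "phi s = 0 \<and> psi s = 0"
proof -
 have no: False if phi: "radial_sol nu phi (%s. P s * psi s)" and psi: "radial_sol nu psi (%s. Q s * phi s)"
  and init: "phi 0 = 0" and lim: "(psi \<longlongrightarrow> 0) at_top" and p: "psi 0 > 0" for phi psi
 proof -
  have "\<forall>\<^sub>F s in at_top. psi s < psi 0 / 2" by (rule order_tendstoD(2)[OF lim]) (use p in simp)
  moreover have "\<forall>\<^sub>F s in at_top. (s::real) >= 0" by (rule eventually_ge_at_top)
  ultimately have "\<forall>\<^sub>F s in at_top. psi s < psi 0 / 2 \<and> (s::real) >= 0" by (rule eventually_conj)
  then obtain s where "psi s < psi 0 / 2" "s >= 0" by (auto dest: eventually_happens)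
  then show False using radial_linear_grows[OF nu phi psi pos init p, of s] by simp
 qed
 have "\<not> psi 0 > 0" using no[OF phi psi init lim] by blast
 moreover have "\<not> psi 0 < 0"
 proof
  assume "psi 0 < 0"
  have "radial_sol nu (%s. - phi s) (%s. P s * - psi s)" "radial_sol nu (%s. - psi s) (%s. Q s * - phi s)"
   using radial_sol_neg[OF phi] radial_sol_neg[OF psi] by simp_all
  from no[OF this] show False using init \<open>psi 0 < 0\<close> tendsto_minus[OF lim] by simp
 qed
 ultimately have "psi 0 = 0" by simp
 then show ?thesis using radial_linear_zero[OF nu phi psi PQ init _ s] by simp
qed

section \<open>Decay of radial solutions\<close>

lemma radial_sol_slope_mono:
 assumes nu: "nu > 1" and a: "radial_sol nu a b" and b: "\<And>t. t >= 0 ==> b t >= 0" and st: "0 < s" "s <= t"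
 shows "integral {0..s} (%t. t powr (nu - 1) * b t) <= integral {0..t} (%t. t powr (nu - 1) * b t)"
proof (rule integral_subset_le)
 have c: "continuous_on {0..} b" using a by (simp add: radial_sol_def)
 show "(%t. t powr (nu - 1) * b t) integrable_on {0..s}" "(%t. t powr (nu - 1) * b t) integrable_on {0..t}"
  by (rule powr_integrable[OF c nu])+
qed (use st b in auto)

text \<open>The slope at \<open>s\<close> persists up to \<open>2s\<close> up to the factor \<open>2\<^sup>\<nu>\<close>, so it is controlled by \<open>a s - a (2s)\<close>.\<close>

lemma radial_sol_slope_bound:
 assumes nu: "nu > 1" and a: "radial_sol nu a b" and b: "\<And>t. t >= 0 ==> b t >= 0" and a0: "\<And>t. t >= 0 ==> a t >= 0" and s: "s > 0"
 shows "s * ((1/4) * (s powr (- nu) * integral {0..s} (%t. t powr (nu - 1) * b t))) <= 2 powr nu * a s"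
proof -
 let ?I = "%s. integral {0..s} (%t. t powr (nu - 1) * b t)"
 have D: "(a has_real_derivative - (1/4) * (x powr (- nu) * ?I x)) (at x)" if "x > 0" for x
  using a that by (simp add: radial_sol_def)
 have I0: "?I s >= 0"
  by (rule Henstock_Kurzweil_Integration.integral_nonneg) (use a b nu in \<open>auto simp: radial_sol_def intro!: powr_integrable\<close>)
 obtain z where z: "s < z" "z < 2 * s" "a (2 * s) - a s = (2 * s - s) * (- (1/4) * (z powr (- nu) * ?I z))"
  using MVT2[of s "2 * s" a "%x. - (1/4) * (x powr (- nu) * ?I x)"] D s by auto
 have "(2 * s) powr (- nu) * ?I s <= z powr (- nu) * ?I z"
  by (rule mult_mono) (use z s nu I0 in \<open>auto intro!: powr_mono2' radial_sol_slope_mono[OF nu a b]\<close>)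
 then have "s * ((1/4) * ((2 * s) powr (- nu) * ?I s)) <= s * ((1/4) * (z powr (- nu) * ?I z))"
  using s by (intro mult_left_mono) auto
 also have "\<dots> = a s - a (2 * s)" using z(3) by simp
 also have "\<dots> <= a s" using a0[of "2 * s"] s by simp
 finally have "2 powr nu * (s * ((1/4) * ((2 * s) powr (- nu) * ?I s))) <= 2 powr nu * a s"
  by (intro mult_left_mono) auto
 moreover have e: "2 powr nu * (2 * s) powr (- nu) = s powr (- nu)"
  using s by (simp add: powr_mult powr_add[symmetric] mult.assoc[symmetric])
 have "s * ((1/4) * (s powr (- nu) * ?I s)) = 2 powr nu * (s * ((1/4) * ((2 * s) powr (- nu) * ?I s)))"
  unfolding e[symmetric] by (simp only: mult_ac)
 ultimately show ?thesis by (simp only:)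
qed

text \<open>Two integrations of t^(-A-1), in which the variation of \<open>Lambda\<close> costs at
  most a power of exponent \<open>theta\<close>. The inner integral starts at 0 and needs A + theta
  < nu - 1; the outer one runs to infinity and needs theta < A. The constant is made of the two
  resulting denominators and the factor 4 of the equation.\<close>

lemma radial_potential_bound:
 assumes nu: "nu > 1" and w: "radial_sol nu w F" and lim: "(w \<longlongrightarrow> 0) at_top"
  and exps: "0 <= theta" "theta < A" "A + theta < nu - 1"
  and F: "\<And>t. t > 0 ==> F t <= t powr (- A - 1) * Lambda t" and Lambda0: "\<And>t. t > 0 ==> Lambda t >= 0"
  and slow: "\<And>x s. 0 < x ==> x <= s ==> Lambda x <= Lambda s * (s powr theta * x powr (- theta))"
   "\<And>x s. 0 < x ==> x <= s ==> Lambda s <= Lambda x * (s powr theta * x powr (- theta))"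
  and r: "r > 0"
 shows "w r <= 1 / (4 * (nu - 1 - A - theta) * (A - theta)) * (r powr (- A) * Lambda r)"
proof -
 let ?I = "%s. integral {0..s} (%t. t powr (nu - 1) * F t)"
 define gamma where "gamma = nu - 1 - A - theta"
 have gamma: "gamma > 0" using exps by (simp add: gamma_def)
 have Fc: "continuous_on {0..} F" using w by (simp add: radial_sol_def)
 have inner: "s powr (- nu) * ?I s <= (s powr (- A - 1) * Lambda s) / gamma" if s: "s > 0" for s
 proof -
  have I: "((%t. t powr (gamma - 1)) has_integral (s powr (gamma - 1 + 1) / (gamma - 1 + 1))) {0..s}"
   by (rule has_integral_powr_from_0) (use gamma s in auto)
  then have I': "((%t. t powr (gamma - 1) * (Lambda s * s powr theta)) has_integral (s powr gamma / gamma * (Lambda s * s powr theta))) {0..s}"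
   by (intro has_integral_mult_left) simp
  have "?I s <= integral {0..s} (%t. t powr (gamma - 1) * (Lambda s * s powr theta))"
  proof (rule integral_le)
   show "(%t. t powr (nu - 1) * F t) integrable_on {0..s}" by (rule powr_integrable[OF Fc nu])
   show "(%t. t powr (gamma - 1) * (Lambda s * s powr theta)) integrable_on {0..s}" using I' by blast
   fix t assume t: "t \<in> {0..s}"
   show "t powr (nu - 1) * F t <= t powr (gamma - 1) * (Lambda s * s powr theta)"
   proof (cases "t = 0")
    case False
    then have t0: "t > 0" "t <= s" using t by auto
    have "F t <= t powr (- A - 1) * (Lambda s * (s powr theta * t powr (- theta)))"
     using F[OF t0(1)] slow(1)[OF t0] by (meson mult_left_mono order_trans powr_ge_zero)
    then have "t powr (nu - 1) * F t <= t powr (nu - 1) * (t powr (- A - 1) * (Lambda s * (s powr theta * t powr (- theta))))"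
     by (intro mult_left_mono) auto
    also have "\<dots> = (t powr (nu - 1) * t powr (- A - 1) * t powr (- theta)) * (Lambda s * s powr theta)" by (simp add: mult_ac)
    also have "t powr (nu - 1) * t powr (- A - 1) * t powr (- theta) = t powr (gamma - 1)"
     using t0 by (simp add: powr_add[symmetric] gamma_def algebra_simps)
    finally show ?thesis .
   qed simp
  qed
  also have "\<dots> = s powr gamma / gamma * (Lambda s * s powr theta)" using I' by (rule integral_unique)
  finally have "s powr (- nu) * ?I s <= s powr (- nu) * (s powr gamma / gamma * (Lambda s * s powr theta))" by (intro mult_left_mono) auto
  also have "\<dots> = ((s powr (- nu) * s powr gamma * s powr theta) * Lambda s) / gamma" by (simp add: mult_ac)
  also have "s powr (- nu) * s powr gamma * s powr theta = s powr (- A - 1)"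
   using s by (simp add: powr_add[symmetric] gamma_def algebra_simps)
  finally show ?thesis .
 qed
 \<comment> \<open>With this constant K s^(theta - A) falls at least as fast as \<open>w\<close> for
   s >= r; both tend to 0 at infinity, so it lies above \<open>w\<close> at
   \<open>r\<close>.\<close>
 define K where "K = r powr (- theta) * Lambda r / (4 * gamma * (A - theta))"
 have outer: "w s - K * s powr (theta - A) >= w r - K * r powr (theta - A)" if rs: "r <= s" for s
 proof (rule DERIV_nonneg_imp_nondecreasing[OF rs, where f="%s. w s - K * s powr (theta - A)"])
  fix x assume x: "r <= x" "x <= s"
  then have x0: "x > 0" using r by simp
  have D: "((%s. w s - K * s powr (theta - A)) has_real_derivative - (1/4) * (x powr (- nu) * ?I x) - K * ((theta - A) * x powr (theta - A - 1))) (at x)"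
   using w x0 unfolding radial_sol_def by (intro DERIV_diff DERIV_cmult has_real_derivative_powr) auto
  have "x powr (- nu) * ?I x <= (x powr (- A - 1) * (Lambda r * (x powr theta * r powr (- theta)))) / gamma"
   using inner[OF x0] slow(2)[OF r x(1)] gamma by (meson divide_right_mono less_imp_le mult_left_mono order_trans powr_ge_zero)
  also have "\<dots> = (x powr (- A - 1) * x powr theta) * (Lambda r * r powr (- theta)) / gamma" by (simp add: mult_ac)
  also have "x powr (- A - 1) * x powr theta = x powr (theta - A - 1)" using x0 by (simp add: powr_add[symmetric] algebra_simps)
  finally have "(1/4) * (x powr (- nu) * ?I x) <= (1/4) * (x powr (theta - A - 1) * (Lambda r * r powr (- theta)) / gamma)" by simp
  also have "\<dots> = K * ((A - theta) * x powr (theta - A - 1))" using exps gamma by (simp add: K_def field_simps)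
  finally have "- (1/4) * (x powr (- nu) * ?I x) - K * ((theta - A) * x powr (theta - A - 1)) >= 0" by (simp add: algebra_simps)
  with D show "\<exists>y. ((%s. w s - K * s powr (theta - A)) has_real_derivative y) (at x) \<and> 0 <= y" by blast
 qed
 have "((%s. s powr (theta - A)) \<longlongrightarrow> 0) at_top" by (rule tendsto_neg_powr) (use exps in \<open>auto intro: filterlim_ident\<close>)
 then have L: "((%s. w s - K * s powr (theta - A)) \<longlongrightarrow> 0 - K * 0) at_top" by (intro tendsto_diff lim tendsto_mult tendsto_const)
 have "w r - K * r powr (theta - A) <= 0 - K * 0"
  by (rule tendsto_lowerbound[OF L]) (use outer in \<open>auto intro: eventually_at_top_linorderI[of r]\<close>)
 then have "w r <= K * r powr (theta - A)" by simp
 also have "\<dots> = 1 / (4 * gamma * (A - theta)) * ((r powr (- theta) * r powr (theta - A)) * Lambda r)" by (simp add: K_def)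
 also have "r powr (- theta) * r powr (theta - A) = r powr (- A)" using r by (simp add: powr_add[symmetric])
 finally show ?thesis unfolding gamma_def .
qed

text \<open>\<open>\<Theta> r = sup\<^sub>s g s e\<^bsup>-\<eta> |ln s - ln r|\<^esup>\<close> is the smallest majorant of \<open>g\<close> which changes at most by the
  factor \<open>(s/r)\<^sup>\<eta>\<close> between \<open>r\<close> and \<open>s\<close>.\<close>

definition slow_majorant :: "real => (real => real) => real => real" where
 "slow_majorant eta g r = (SUP s\<in>{0<..}. g s * exp (- eta * \<bar>ln s - ln r\<bar>))"

text \<open>The slow variation is the triangle inequality for |ln s - ln r| in the exponent; the
  choice s = r shows that \<open>g\<close> is majorised. Boundedness of \<open>g\<close> makes the
  supremum finite.\<close>

lemma slow_majorant_props:
 assumes eta: "eta >= 0" and g: "\<And>s. s > 0 ==> 0 <= g s" "\<And>s. s > 0 ==> g s <= M"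
 shows slow_majorant_upper: "s > 0 ==> g s * exp (- eta * \<bar>ln s - ln r\<bar>) <= slow_majorant eta g r"
  and slow_majorant_least: "(\<And>s. s > 0 ==> g s * exp (- eta * \<bar>ln s - ln r\<bar>) <= C) ==> slow_majorant eta g r <= C"
  and slow_majorant_ge: "r > 0 ==> g r <= slow_majorant eta g r"
  and slow_majorant_slow: "slow_majorant eta g x <= slow_majorant eta g r * exp (eta * \<bar>ln x - ln r\<bar>)"
proof -
 have bdd: "bdd_above ((%s. g s * exp (- eta * \<bar>ln s - ln r\<bar>)) ` {0<..})" for r
 proof (rule bdd_aboveI[of _ M])
  fix y assume "y \<in> (%s. g s * exp (- eta * \<bar>ln s - ln r\<bar>)) ` {0<..}"
  then obtain s where s: "s > 0" "y = g s * exp (- eta * \<bar>ln s - ln r\<bar>)" by auto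
  have "y <= g s * 1" unfolding s(2) using eta g(1)[OF s(1)] by (intro mult_left_mono) auto
  then show "y <= M" using g(2)[OF s(1)] by simp
 qed
 show up: "g s * exp (- eta * \<bar>ln s - ln r\<bar>) <= slow_majorant eta g r" if "s > 0" for s r
  unfolding slow_majorant_def by (rule cSUP_upper[OF _ bdd]) (use that in simp)
 show least: "slow_majorant eta g r <= C" if "\<And>s. s > 0 ==> g s * exp (- eta * \<bar>ln s - ln r\<bar>) <= C" for r C
  unfolding slow_majorant_def by (rule cSUP_least) (use that in \<open>auto intro: exI[of _ 1]\<close>)
 show "g r <= slow_majorant eta g r" if "r > 0" using up[OF that, of r] by simp
 show "slow_majorant eta g x <= slow_majorant eta g r * exp (eta * \<bar>ln x - ln r\<bar>)"
 proof (rule least)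
  fix s :: real assume s: "s > 0"
  have "eta * \<bar>ln s - ln r\<bar> <= eta * (\<bar>ln s - ln x\<bar> + \<bar>ln x - ln r\<bar>)" using eta by (intro mult_left_mono) auto
  then have "exp (- eta * \<bar>ln s - ln x\<bar>) <= exp (- eta * \<bar>ln s - ln r\<bar> + eta * \<bar>ln x - ln r\<bar>)"
   by (simp add: algebra_simps)
  then have "g s * exp (- eta * \<bar>ln s - ln x\<bar>) <= g s * (exp (- eta * \<bar>ln s - ln r\<bar>) * exp (eta * \<bar>ln x - ln r\<bar>))"
   unfolding exp_add by (intro mult_left_mono g s)
  also have "\<dots> = (g s * exp (- eta * \<bar>ln s - ln r\<bar>)) * exp (eta * \<bar>ln x - ln r\<bar>)" by simp
  also have "\<dots> <= slow_majorant eta g r * exp (eta * \<bar>ln x - ln r\<bar>)" by (intro mult_right_mono up s) auto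
  finally show "g s * exp (- eta * \<bar>ln s - ln x\<bar>) <= slow_majorant eta g r * exp (eta * \<bar>ln x - ln r\<bar>)" .
 qed
qed

section \<open>Self-improvement of the critical decay rate\<close>

lemma exp_ln_diff_powr:
 assumes "0 < (x::real)" "x <= s" shows "exp (eta * \<bar>ln x - ln s\<bar>) = s powr eta * x powr (- eta)"
  and "exp (eta * \<bar>ln s - ln x\<bar>) = s powr eta * x powr (- eta)"
proof -
 have "ln x <= ln s" using assms by simp
 then have e: "\<bar>ln x - ln s\<bar> = ln s - ln x" "\<bar>ln s - ln x\<bar> = ln s - ln x" by auto
 have "exp (eta * (ln s - ln x)) = s powr eta * x powr (- eta)"
  using assms by (simp add: powr_def exp_add[symmetric] algebra_simps)
 then show "exp (eta * \<bar>ln x - ln s\<bar>) = s powr eta * x powr (- eta)" "exp (eta * \<bar>ln s - ln x\<bar>) = s powr eta * x powr (- eta)"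
  by (simp_all only: e)
qed

text \<open>Write Theta for the majorant. Far out it is small, so \<open>improve\<close> with
  \<open>omega > 1\<close> gives g <= Theta/2 there. Arguments s >= T then contribute at most Theta
  r / 2 to the supremum defining Theta r and cannot determine it. It is determined by s < T, where g
  <= M and the weight is at most (T/r)^eta.\<close>

lemma self_improving_decay:
 fixes g :: "real => real"
 assumes g: "\<And>s. s > 0 ==> 0 < g s" "\<And>s. s > 0 ==> g s <= M" and lim: "(g \<longlongrightarrow> 0) at_top"
  and eta: "eta > 0" and omega: "omega > 1" and C: "C > 0"
  and improve: "\<And>r. r > 0 ==> g r <= C * slow_majorant eta g r powr omega"
 shows "\<exists>T>0. \<forall>r\<ge>T. slow_majorant eta g r <= M * T powr eta * r powr (- eta)"
proof -
 let ?Theta = "slow_majorant eta g"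
 have M0: "M > 0" using g(1)[of 1] g(2)[of 1] by simp
 have g0: "\<And>s. s > 0 ==> 0 <= g s" using g(1) by (simp add: less_imp_le)
 have props1: "s > 0 ==> g s * exp (- eta * \<bar>ln s - ln r\<bar>) <= ?Theta r" for s r
  by (rule slow_majorant_upper[OF less_imp_le[OF eta] g0 g(2)])
 have props2: "(\<And>s. s > 0 ==> g s * exp (- eta * \<bar>ln s - ln r\<bar>) <= D) ==> ?Theta r <= D" for r D
  by (rule slow_majorant_least[OF less_imp_le[OF eta] g0 g(2)])
 have props3: "r > 0 ==> g r <= ?Theta r" for r by (rule slow_majorant_ge[OF less_imp_le[OF eta] g0 g(2)])
 have props4: "?Theta x <= ?Theta r * exp (eta * \<bar>ln x - ln r\<bar>)" for x r by (rule slow_majorant_slow[OF less_imp_le[OF eta] g0 g(2)])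
 note props = props1 props2 props3 props4
 have Thetapos: "?Theta r > 0" if "r > 0" for r using props(3)[of r] g(1)[OF that] that by simp
 have far: "?Theta r <= max e (M * (S powr eta * r powr (- eta)))"
  if S: "S > 0" "\<And>s. s >= S ==> g s <= e" and r: "r >= S" for e S r
 proof (rule props(2))
  fix s :: real assume s: "s > 0"
  show "g s * exp (- eta * \<bar>ln s - ln r\<bar>) <= max e (M * (S powr eta * r powr (- eta)))"
  proof (cases "s >= S")
   case True
   have "g s * exp (- eta * \<bar>ln s - ln r\<bar>) <= g s * 1" using eta g(1)[OF s] by (intro mult_left_mono) auto
   then show ?thesis using S(2)[OF True] by simp
  next
   case False
   have sr: "s <= r" using False r by simp
   have "exp (- eta * \<bar>ln s - ln r\<bar>) = r powr (- eta) * s powr (- (- eta))" by (rule exp_ln_diff_powr(1)[OF s sr])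
   also have "\<dots> <= r powr (- eta) * S powr eta" using False s eta by (intro mult_left_mono) (auto intro: powr_mono2)
   finally have "exp (- eta * \<bar>ln s - ln r\<bar>) <= r powr (- eta) * S powr eta" .
   then have "g s * exp (- eta * \<bar>ln s - ln r\<bar>) <= M * (r powr (- eta) * S powr eta)"
    by (rule mult_mono[OF g(2)[OF s]]) (use M0 in auto)
   then show ?thesis by (simp add: mult.commute)
  qed
 qed
 have Thetalim: "\<forall>\<^sub>F r in at_top. ?Theta r < e" if e: "e > 0" for e
 proof -
  have "\<forall>\<^sub>F s in at_top. g s < e / 2" by (rule order_tendstoD(2)[OF lim]) (use e in simp)
  then obtain S0 where S0: "\<And>s. s >= S0 ==> g s < e / 2" by (auto simp: eventually_at_top_linorder)
  define S where "S = max 1 S0"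
  have S: "S > 0" "\<And>s. s >= S ==> g s <= e / 2" using S0 by (auto simp: S_def less_imp_le)
  have "((%r. M * (S powr eta * r powr (- eta))) \<longlongrightarrow> M * (S powr eta * 0)) at_top"
   by (intro tendsto_mult tendsto_const tendsto_neg_powr filterlim_ident) (use eta in auto)
  then have "\<forall>\<^sub>F r in at_top. M * (S powr eta * r powr (- eta)) < e"
   by (rule order_tendstoD(2)) (use e in simp)
  moreover have "\<forall>\<^sub>F r in at_top. r >= S" by (rule eventually_ge_at_top)
  ultimately show ?thesis
  proof eventually_elim
   case (elim r)
   then show ?case using far[OF S, of r] e by (simp add: max_def split: if_splits)
  qed
 qed
 \<comment> \<open>The solution of C e^(omega - 1) = 1/2: below this level the superlinear bound is
   at most half of the majorant.\<close>
 define e where "e = (1 / (2 * C)) powr (1 / (omega - 1))"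
 have e: "e > 0" using C by (simp add: e_def)
 have eC: "C * e powr (omega - 1) = 1 / 2" using omega C by (simp add: e_def powr_powr)
 obtain T0 where T0: "\<And>r. r >= T0 ==> ?Theta r < e" using Thetalim[OF e] by (auto simp: eventually_at_top_linorder)
 define T where "T = max 1 T0"
 have T: "T > 0" "\<And>r. r >= T ==> ?Theta r < e" using T0 by (auto simp: T_def)
 have half: "g s <= ?Theta s / 2" if "s >= T" for s
 proof -
  have s: "s > 0" using that T by simp
  have "g s <= C * ?Theta s powr omega" by (rule improve[OF s])
  also have "?Theta s powr omega = ?Theta s powr (omega - 1) * ?Theta s"
   using Thetapos[OF s] by (simp add: powr_mult_base mult.commute)
  also have "C * (?Theta s powr (omega - 1) * ?Theta s) <= C * (e powr (omega - 1) * ?Theta s)"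
   using Thetapos[OF s] T(2)[OF that] omega C by (intro mult_left_mono mult_right_mono powr_mono2) auto
  also have "\<dots> = (C * e powr (omega - 1)) * ?Theta s" by simp
  finally show ?thesis unfolding eC by simp
 qed
 have "?Theta r <= M * T powr eta * r powr (- eta)" if rT: "r >= T" for r
 proof -
  have r: "r > 0" using rT T by simp
  have "?Theta r <= max (?Theta r / 2) (M * (T powr eta * r powr (- eta)))"
  proof (rule props(2))
   fix s :: real assume s: "s > 0"
   show "g s * exp (- eta * \<bar>ln s - ln r\<bar>) <= max (?Theta r / 2) (M * (T powr eta * r powr (- eta)))"
   proof (cases "s >= T")
    case True
    have "?Theta s * exp (- eta * \<bar>ln s - ln r\<bar>) <= (?Theta r * exp (eta * \<bar>ln s - ln r\<bar>)) * exp (- eta * \<bar>ln s - ln r\<bar>)"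
     by (intro mult_right_mono props(4)) auto
    also have "\<dots> = ?Theta r" by (simp add: mult.assoc exp_add[symmetric])
    finally have "?Theta s / 2 * exp (- eta * \<bar>ln s - ln r\<bar>) <= ?Theta r / 2" by simp
    moreover have "g s * exp (- eta * \<bar>ln s - ln r\<bar>) <= ?Theta s / 2 * exp (- eta * \<bar>ln s - ln r\<bar>)"
     by (intro mult_right_mono half True) auto
    ultimately have "g s * exp (- eta * \<bar>ln s - ln r\<bar>) <= ?Theta r / 2" by (rule order_trans[rotated])
    then show ?thesis by (rule max.coboundedI1)
   next
    case False
    have sr: "s <= r" using False rT by simp
    have "exp (- eta * \<bar>ln s - ln r\<bar>) = r powr (- eta) * s powr (- (- eta))" by (rule exp_ln_diff_powr(1)[OF s sr])
    also have "\<dots> <= r powr (- eta) * T powr eta" using False s eta by (intro mult_left_mono) (auto intro: powr_mono2)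
    finally have "exp (- eta * \<bar>ln s - ln r\<bar>) <= r powr (- eta) * T powr eta" .
    then have "g s * exp (- eta * \<bar>ln s - ln r\<bar>) <= M * (r powr (- eta) * T powr eta)"
     by (rule mult_mono[OF g(2)[OF s]]) (use M0 in auto)
    then show ?thesis by (simp add: mult.commute)
   qed
  qed
  moreover have "\<not> ?Theta r <= ?Theta r / 2" using Thetapos[OF r] by simp
  ultimately show ?thesis by (simp add: max_def mult.assoc split: if_splits)
 qed
 then show ?thesis using T(1) by blast
qed

text \<open>For g s = v s * s^B with majorant Theta, the first equation gives u <= C s^(-A) Theta^p
  and the second then gives v <= C s^(-B) Theta^(p q). The exponents return exactly to
  \<open>B\<close> thanks to the relations between \<open>A\<close> and \<open>B\<close>, which
  leaves g <= C Theta^(p q) with p q > 1.\<close>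

lemma lane_emden_decay:
 assumes nu: "nu > 1" and u: "radial_sol nu u (%s. v s powr p)" and v: "radial_sol nu v (%s. u s powr q)"
  and pos: "\<And>s. s >= 0 ==> u s > 0" "\<And>s. s >= 0 ==> v s > 0" and pq: "p > 0" "q > 0"
  and AB: "A > 0" "A <= B" "A + B = nu - 1" "B * p = A + 1" "A * q = B + 1"
  and ulim: "(u \<longlongrightarrow> 0) at_top" and vlim: "(v \<longlongrightarrow> 0) at_top" and glim: "((%s. v s * s powr B) \<longlongrightarrow> 0) at_top"
  and \<sigma>: "0 < \<sigma>" "\<sigma> < A"
 shows "\<exists>C T. T > 0 \<and> (\<forall>s\<ge>T. u s powr q <= C * s powr (- (B + 1) - \<sigma>))"
proof -
 \<comment> \<open>Theta^(p q) then varies with exponent p q eta = sigma. The second potential bound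
   asks for B + sigma < nu - 1 = A + B, which is the assumption sigma < A.\<close>
 define eta where "eta = \<sigma> / (p * q)"
 have eta: "eta > 0" using \<sigma> pq by (simp add: eta_def)
 define g where "g s = v s * s powr B" for s
 have gpos: "g s > 0" if "s > 0" for s using pos(2)[of s] that by (simp add: g_def)
 have "\<exists>M. \<forall>s>0. g s <= M"
 proof -
  have "\<forall>\<^sub>F s in at_top. g s < 1" unfolding g_def by (rule order_tendstoD(2)[OF glim]) simp
  then obtain S where S: "\<And>s. s >= S ==> g s < 1" by (auto simp: eventually_at_top_linorder)
  have "continuous_on {0..max 0 S} (%s. s powr B)"
   using AB by (intro continuous_on_powr' continuous_intros) auto
  moreover have "continuous_on {0..max 0 S} v" using v by (auto simp: radial_sol_def intro: continuous_on_subset)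
  ultimately have "continuous_on {0..max 0 S} g" unfolding g_def[abs_def] by (intro continuous_on_mult)
  then have "bounded (g ` {0..max 0 S})" by (intro compact_imp_bounded compact_continuous_image) auto
  then obtain K where K: "\<forall>y\<in>g ` {0..max 0 S}. norm y <= K" unfolding bounded_iff by blast
  have "g s <= max K 1" if "s > 0" for s
  proof (cases "s <= max 0 S")
   case True
   then have "norm (g s) <= K" using K that by auto
   then show ?thesis by simp
  next
   case False
   then have "g s < 1" by (intro S) simp
   then show ?thesis by simp
  qed
  then show ?thesis by blast
 qed
 then obtain M where M: "\<And>s. s > 0 ==> g s <= M" by blast
 let ?Theta = "slow_majorant eta g"
 have g0: "\<And>s. s > 0 ==> 0 <= g s" using gpos by (simp add: less_imp_le)
 have props1: "s > 0 ==> g s * exp (- eta * \<bar>ln s - ln r\<bar>) <= ?Theta r" for s r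
  by (rule slow_majorant_upper[OF less_imp_le[OF eta] g0 M])
 have props2: "(\<And>s. s > 0 ==> g s * exp (- eta * \<bar>ln s - ln r\<bar>) <= D) ==> ?Theta r <= D" for r D
  by (rule slow_majorant_least[OF less_imp_le[OF eta] g0 M])
 have props3: "r > 0 ==> g r <= ?Theta r" for r by (rule slow_majorant_ge[OF less_imp_le[OF eta] g0 M])
 have props4: "?Theta x <= ?Theta r * exp (eta * \<bar>ln x - ln r\<bar>)" for x r by (rule slow_majorant_slow[OF less_imp_le[OF eta] g0 M])
 note props = props1 props2 props3 props4
 have Thetapos: "?Theta r > 0" if "r > 0" for r using props(3)[of r] gpos[OF that] that by simp
 have slow: "c * ?Theta x powr omega <= (c * ?Theta s powr omega) * (s powr (omega * eta) * x powr (- (omega * eta)))"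
   "c * ?Theta s powr omega <= (c * ?Theta x powr omega) * (s powr (omega * eta) * x powr (- (omega * eta)))"
  if xs: "0 < x" "x <= s" and omega: "omega > 0" and c: "c >= 0" for x s omega c
 proof -
  have s: "0 < s" using xs by simp
  have pw: "(y * (s powr eta * x powr (- eta))) powr omega = y powr omega * (s powr (omega * eta) * x powr (- (omega * eta)))" if "y > 0" for y
   using that xs s by (simp add: powr_mult powr_powr mult.commute)
  have "?Theta x <= ?Theta s * (s powr eta * x powr (- eta))" using props(4)[of x s] unfolding exp_ln_diff_powr(1)[OF xs] .
  then have "?Theta x powr omega <= (?Theta s * (s powr eta * x powr (- eta))) powr omega" using Thetapos[OF xs(1)] omega by (intro powr_mono2) auto
  then have "c * ?Theta x powr omega <= c * (?Theta s powr omega * (s powr (omega * eta) * x powr (- (omega * eta))))"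
   unfolding pw[OF Thetapos[OF s]] using c by (intro mult_left_mono)
  then show "c * ?Theta x powr omega <= (c * ?Theta s powr omega) * (s powr (omega * eta) * x powr (- (omega * eta)))" by (simp add: mult.assoc)
  have "?Theta s <= ?Theta x * (s powr eta * x powr (- eta))" using props(4)[of s x] unfolding exp_ln_diff_powr(2)[OF xs] .
  then have "?Theta s powr omega <= (?Theta x * (s powr eta * x powr (- eta))) powr omega" using Thetapos[OF s] omega by (intro powr_mono2) auto
  then have "c * ?Theta s powr omega <= c * (?Theta x powr omega * (s powr (omega * eta) * x powr (- (omega * eta))))"
   unfolding pw[OF Thetapos[OF xs(1)]] using c by (intro mult_left_mono)
  then show "c * ?Theta s powr omega <= (c * ?Theta x powr omega) * (s powr (omega * eta) * x powr (- (omega * eta)))" by (simp add: mult.assoc)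
 qed
 have "A * q > A * 1" using AB by simp
 then have q1: "q > 1" using AB(1) by simp
 have peta: "p * eta = \<sigma> / q" "p * q * eta = \<sigma>" using pq by (auto simp: eta_def)
 have "\<sigma> / q < \<sigma>" using q1 \<sigma> by (simp add: divide_less_eq)
 then have petaA: "0 <= p * eta" "p * eta < A" "A + p * eta < nu - 1" using \<sigma> AB peta pq eta by auto
 define C1 where "C1 = 1 / (4 * (nu - 1 - A - p * eta) * (A - p * eta))"
 have C1: "C1 > 0" using petaA by (simp add: C1_def)
 have vb: "v t powr p <= t powr (- A - 1) * (1 * ?Theta t powr p)" if t: "t > 0" for t
 proof -
  have "v t = g t * t powr (- B)" using t by (simp add: g_def powr_add[symmetric] mult.assoc)
  then have "v t powr p = g t powr p * t powr (- (B * p))" using t gpos[OF t] by (simp add: powr_mult powr_powr)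
  also have "\<dots> <= ?Theta t powr p * t powr (- (B * p))"
   using props(3)[OF t] gpos[OF t] pq by (intro mult_right_mono powr_mono2) auto
  finally show ?thesis unfolding AB(4) by (simp add: mult.commute)
 qed
 have ub: "u r <= C1 * (r powr (- A) * ?Theta r powr p)" if r: "r > 0" for r
  using radial_potential_bound[OF nu u ulim petaA vb _ slow(1)[OF _ _ pq(1), of _ _ 1] slow(2)[OF _ _ pq(1), of _ _ 1] r]
  unfolding C1_def by simp
 define C2 where "C2 = C1 powr q"
 have C2: "C2 > 0" using C1 by (simp add: C2_def)
 have uqb: "u r powr q <= r powr (- B - 1) * (C2 * ?Theta r powr (p * q))" if r: "r > 0" for r
 proof -
  have "u r powr q <= (C1 * (r powr (- A) * ?Theta r powr p)) powr q"
   using ub[OF r] pos(1)[of r] r pq by (intro powr_mono2) auto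
  also have "\<dots> = C2 * (r powr (- (A * q)) * ?Theta r powr (p * q))"
   using C1 Thetapos[OF r] r by (simp add: powr_mult powr_powr C2_def)
  finally show ?thesis unfolding AB(5) by (simp add: mult_ac)
 qed
 have pq0: "p * q > 0" using pq by simp
 have \<sigma>AB: "0 <= p * q * eta" "p * q * eta < B" "B + p * q * eta < nu - 1" using \<sigma> AB peta by auto
 define C3 where "C3 = C2 / (4 * (nu - 1 - B - p * q * eta) * (B - p * q * eta))"
 have C3: "C3 > 0" using C2 \<sigma>AB by (simp add: C3_def)
 have improve: "g r <= C3 * ?Theta r powr (p * q)" if r: "r > 0" for r
 proof -
  have "v r <= 1 / (4 * (nu - 1 - B - p * q * eta) * (B - p * q * eta)) * (r powr (- B) * (C2 * ?Theta r powr (p * q)))"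
   by (rule radial_potential_bound[OF nu v vlim \<sigma>AB uqb _ slow(1)[OF _ _ pq0] slow(2)[OF _ _ pq0] r])
     (use C2 in auto)
  then have "v r * r powr B <= (C3 * ?Theta r powr (p * q) * r powr (- B)) * r powr B"
   unfolding C3_def by (intro mult_right_mono) (auto simp: mult_ac)
  also have "\<dots> = C3 * ?Theta r powr (p * q)" using r by (simp add: powr_add[symmetric] mult.assoc)
  finally show ?thesis by (simp add: g_def)
 qed
 \<comment> \<open>The left side is (A + 1) (B + 1).\<close>
 have "(B * p) * (A * q) > B * A" using AB by (simp add: algebra_simps)
 then have "(B * A) * (p * q) > (B * A) * 1" by (simp add: mult_ac)
 then have pq1: "p * q > 1" using AB by (simp add: mult_less_cancel_left)
 obtain T where T: "T > 0" "\<And>r. r >= T ==> ?Theta r <= M * T powr eta * r powr (- eta)"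
  using self_improving_decay[of g M eta "p * q" C3, OF gpos M _ eta pq1 C3 improve] glim unfolding g_def by blast
 have "u s powr q <= (C2 * (M * T powr eta) powr (p * q)) * s powr (- (B + 1) - \<sigma>)" if sT: "s >= T" for s
 proof -
  have s: "s > 0" using sT T by simp
  have M0: "M > 0" using gpos[of 1] M[of 1] by simp
  have "?Theta s powr (p * q) <= (M * T powr eta * s powr (- eta)) powr (p * q)"
   using T(2)[OF sT] Thetapos[OF s] pq0 by (intro powr_mono2) auto
  also have "\<dots> = (M * T powr eta) powr (p * q) * s powr (- \<sigma>)"
   using M0 T(1) s peta(2) by (simp add: powr_mult powr_powr mult.commute)
  finally have "s powr (- B - 1) * (C2 * ?Theta s powr (p * q)) <= s powr (- B - 1) * (C2 * ((M * T powr eta) powr (p * q) * s powr (- \<sigma>)))"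
   using C2 by (intro mult_left_mono) auto
  also have "\<dots> = (C2 * (M * T powr eta) powr (p * q)) * (s powr (- B - 1) * s powr (- \<sigma>))" by (simp add: mult_ac)
  also have "s powr (- B - 1) * s powr (- \<sigma>) = s powr (- (B + 1) - \<sigma>)" by (simp add: powr_add[symmetric] algebra_simps)
  finally show ?thesis using uqb[OF s] by simp
 qed
 then show ?thesis using T(1) by blast
qed

section \<open>Distributional Laplacians\<close>

lemma partial_line_deriv:
 fixes f :: "real^'n::finite => real"
 assumes "f differentiable_on UNIV"
 shows "((%s. f (x + s *\<^sub>R axis i 1)) has_real_derivative partial_deriv i f (x + s *\<^sub>R axis i 1)) (at s)"
proof -
 obtain f' where f': "(f has_derivative f') (at (x + s *\<^sub>R axis i 1))"
  using assms unfolding differentiable_on_def differentiable_def by (metis UNIV_I)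
 have "((%s. f (x + s *\<^sub>R axis i 1)) has_derivative (%t. f' (t *\<^sub>R axis i 1))) (at s)"
  by (rule has_derivative_compose[of "%s. x + s *\<^sub>R axis i 1" "%t. t *\<^sub>R axis i 1" s UNIV f f'])
    (use f' in \<open>auto intro!: derivative_eq_intros\<close>)
 moreover have "(%t. f' (t *\<^sub>R axis i 1)) = (*) (f' (axis i 1))"
  using linear_cmul[OF has_derivative_linear[OF f']] by (auto simp: fun_eq_iff mult.commute)
 ultimately show ?thesis by (simp add: has_field_derivative_def partial_deriv_eq[OF f'])
qed

text \<open>The mean value theorem bounds the quotients by the maximum of the partial derivative on
  a ball enlarged by 1, the largest step; the bounded support of \<open>w\<close> makes this an
  integrable majorant.\<close>

lemma difference_quotient_limit:
 fixes f w :: "real^'n::finite => real"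
 assumes f: "f differentiable_on UNIV" and df: "continuous_on UNIV (partial_deriv i f)"
  and w: "continuous_on UNIV w" "\<And>x. norm x >= R ==> w x = 0"
 shows "(%k. LINT x|lborel. (f (z + x + (1 / (real k + 1)) *\<^sub>R axis i 1) - f (z + x)) * (real k + 1) * w x)
   \<longlonglongrightarrow> (LINT x|lborel. partial_deriv i f (z + x) * w x)"
proof -
 have fc: "continuous_on UNIV f" using f by (rule differentiable_imp_continuous_on)
 have [measurable]: "f \<in> bmeas" "partial_deriv i f \<in> bmeas" "w \<in> bmeas"
  using fc df w(1) by (auto intro: borel_measurable_continuous_onI)
 have bd: "\<exists>M. \<forall>x\<in>cball c r. \<bar>g x\<bar> <= M" if "continuous_on UNIV g" for g :: "real^'n => real" and c r
 proof -
  have "bounded (g ` cball c r)"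
   using that by (intro compact_imp_bounded compact_continuous_image) (auto intro: continuous_on_subset)
  then show ?thesis unfolding bounded_iff by auto
 qed
 obtain M where M: "\<And>x. x \<in> cball z (\<bar>R\<bar> + 1) ==> \<bar>partial_deriv i f x\<bar> <= M" using bd[OF df] by blast
 obtain W where W: "\<And>x. x \<in> cball 0 \<bar>R\<bar> ==> \<bar>w x\<bar> <= W" using bd[OF w(1)] by blast
 have M0: "M >= 0" using M[of z] by (auto intro: order_trans[OF abs_ge_zero])
 have W0: "W >= 0" using W[of 0] by (auto intro: order_trans[OF abs_ge_zero])
 define t where "t k = 1 / (real k + 1)" for k :: nat
 have t: "t k > 0" "t k <= 1" "real k + 1 = 1 / t k" for k by (auto simp: t_def)
 show ?thesis unfolding t
 proof (rule integral_dominated_convergence[where w="%x. indicator (cball 0 \<bar>R\<bar>) x * (M * W)"])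
  show "integrable lborel (%x::real^'n. indicator (cball 0 \<bar>R\<bar>) x * (M * W))"
   by (intro integrable_mult_left integrable_real_indicator) (auto simp: emeasure_cball)
  show "AE x in lborel. (%k. (f (z + x + (1 / (1 / t k)) *\<^sub>R axis i 1) - f (z + x)) * (1 / t k) * w x) \<longlonglongrightarrow> partial_deriv i f (z + x) * w x"
  proof (rule AE_I2)
   fix x
   have "((%s. f (z + x + s *\<^sub>R axis i 1)) has_real_derivative partial_deriv i f (z + x)) (at 0)"
    using partial_line_deriv[OF f, of "z + x" i 0] by simp
   then have L: "((%h. (f (z + x + (0 + h) *\<^sub>R axis i 1) - f (z + x + 0 *\<^sub>R axis i 1)) / h) \<longlongrightarrow> partial_deriv i f (z + x)) (at 0)"
    by (simp only: DERIV_def)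
   have "filterlim t (at 0) sequentially"
   proof (rule filterlim_atI)
    show "t \<longlonglongrightarrow> 0" unfolding t_def by real_asymp
    show "\<forall>\<^sub>F k in sequentially. t k \<noteq> 0" using t(1) by (intro always_eventually allI less_imp_neq[symmetric])
   qed
   from filterlim_compose[OF L this]
   have "(%k. (f (z + x + t k *\<^sub>R axis i 1) - f (z + x)) / t k) \<longlonglongrightarrow> partial_deriv i f (z + x)" by simp
   then show "(%k. (f (z + x + (1 / (1 / t k)) *\<^sub>R axis i 1) - f (z + x)) * (1 / t k) * w x) \<longlonglongrightarrow> partial_deriv i f (z + x) * w x"
    by (intro tendsto_mult tendsto_const) simp
  qed
  show "AE x in lborel. norm ((f (z + x + (1 / (1 / t k)) *\<^sub>R axis i 1) - f (z + x)) * (1 / t k) * w x) <= indicator (cball 0 \<bar>R\<bar>) x * (M * W)" for k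
  proof (rule AE_I2)
   fix x :: "real^'n"
   show "norm ((f (z + x + (1 / (1 / t k)) *\<^sub>R axis i 1) - f (z + x)) * (1 / t k) * w x) <= indicator (cball 0 \<bar>R\<bar>) x * (M * W)"
   proof (cases "norm x <= \<bar>R\<bar>")
    case False
    then have "w x = 0" by (intro w(2)) auto
    then show ?thesis using M0 W0 by (simp add: indicator_def)
   next
    case True
    obtain xi where xi: "0 < xi" "xi < t k" "f (z + x + t k *\<^sub>R axis i 1) - f (z + x + 0 *\<^sub>R axis i 1) = (t k - 0) * partial_deriv i f (z + x + xi *\<^sub>R axis i 1)"
     using MVT2[of 0 "t k" "%s. f (z + x + s *\<^sub>R axis i 1)" "%s. partial_deriv i f (z + x + s *\<^sub>R axis i 1)"]
      partial_line_deriv[OF f] t(1)[of k] by blast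
    have "norm (x + xi *\<^sub>R axis i (1::real)) <= norm x + norm (xi *\<^sub>R axis i (1::real) :: real^'n)" by (rule norm_triangle_ineq)
    also have "\<dots> <= \<bar>R\<bar> + 1" using True xi t(2)[of k] by (simp add: norm_axis_1)
    finally have "norm (x + xi *\<^sub>R axis i 1) <= \<bar>R\<bar> + 1" .
    moreover have "z - (z + x + xi *\<^sub>R axis i 1) = - (x + xi *\<^sub>R axis i 1)" by simp
    ultimately have "z + x + xi *\<^sub>R axis i 1 \<in> cball z (\<bar>R\<bar> + 1)"
     by (simp only: mem_cball dist_norm norm_minus_cancel)
    then have b: "\<bar>partial_deriv i f (z + x + xi *\<^sub>R axis i 1)\<bar> <= M" by (rule M)
    have "(f (z + x + (1 / (1 / t k)) *\<^sub>R axis i 1) - f (z + x)) * (1 / t k) = partial_deriv i f (z + x + xi *\<^sub>R axis i 1)"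
     using xi(3) t(1)[of k] by simp
    then have "norm ((f (z + x + (1 / (1 / t k)) *\<^sub>R axis i 1) - f (z + x)) * (1 / t k) * w x) = \<bar>partial_deriv i f (z + x + xi *\<^sub>R axis i 1)\<bar> * \<bar>w x\<bar>"
     by (simp only: real_norm_def abs_mult)
    also have "\<dots> <= M * W" by (intro mult_mono b W M0) (use True in auto)
    finally show ?thesis using True by simp
   qed
  qed
 qed measurable
qed

text \<open>By translation invariance every difference quotient has integral 0, and the integral of
  the derivative is the limit of these.\<close>

lemma integral_partial_deriv_zero:
 fixes f :: "real^'n::finite => real"
 assumes f: "f differentiable_on UNIV" and df: "continuous_on UNIV (partial_deriv i f)" and R: "\<And>x. norm x >= R ==> f x = 0"
 shows "integrable lborel (partial_deriv i f)" "(LINT x|lborel. partial_deriv i f x) = 0"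
proof -
 \<comment> \<open>The limit lemma asks for a weight of bounded support. This one equals 1 up to |R|
   + 2, and shifts have length at most 1, so the quotients of \<open>f\<close> vanish wherever it
   differs from 1.\<close>
 define w :: "real^'n => real" where "w x = max 0 (min 1 (\<bar>R\<bar> + 3 - norm x))" for x
 have wc: "continuous_on UNIV w" unfolding w_def[abs_def] by (intro continuous_intros)
 have w0: "w x = 0" if "norm x >= \<bar>R\<bar> + 3" for x using that by (simp add: w_def)
 have w1: "w x = 1" if "norm x <= \<bar>R\<bar> + 2" for x using that by (simp add: w_def)
 have fc: "continuous_on UNIV f" using f by (rule differentiable_imp_continuous_on)
 have [measurable]: "f \<in> bmeas" using fc by (rule borel_measurable_continuous_onI)
 have d0: "partial_deriv i f x = 0" if "norm x > \<bar>R\<bar>" for x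
 proof -
  have "(f has_derivative (%h. 0)) (at x)"
  proof (rule has_derivative_transform_within_open[of "%_. 0" "%h. 0" x UNIV "{x. norm x > \<bar>R\<bar>}"])
   show "open {x. norm x > \<bar>R\<bar>}" by (intro open_Collect_less continuous_intros)
  qed (use that R in auto)
  then show ?thesis by (simp add: partial_deriv_eq)
 qed
 have fi: "integrable lborel f"
 proof -
  obtain M where M: "\<forall>x\<in>cball 0 \<bar>R\<bar>. \<bar>f x\<bar> <= M"
  proof -
   have "bounded (f ` cball 0 \<bar>R\<bar>)"
    using fc by (intro compact_imp_bounded compact_continuous_image) (auto intro: continuous_on_subset)
   then show ?thesis using that unfolding bounded_iff by auto
  qed
  have "M >= 0" using M by (auto intro: order_trans[OF abs_ge_zero] dest: bspec[of _ _ 0])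
  have "\<bar>f x\<bar> <= M" for x using M R[of x] \<open>M >= 0\<close> by (cases "norm x <= \<bar>R\<bar>") auto
  then show ?thesis by (intro bounded_support_integrable[of f M R] R) auto
 qed
 have fz: "(LINT x|lborel. (f (0 + x + (1 / (real k + 1)) *\<^sub>R axis i 1) - f (0 + x)) * (real k + 1) * w x) = 0" for k
 proof -
  let ?h = "(1 / (real k + 1)) *\<^sub>R axis i (1::real) :: real^'n"
  have hn: "norm ?h <= 1" by (simp add: norm_axis_1)
  have "(f (0 + x + ?h) - f (0 + x)) * (real k + 1) * w x = (f (x + ?h) - f x) * (real k + 1)" for x
  proof (cases "norm x <= \<bar>R\<bar> + 2")
   case False
   have "norm x <= norm (x + ?h) + norm ?h" using norm_triangle_ineq4[of "x + ?h" ?h] by simp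
   then have "norm (x + ?h) >= R" "norm x >= R" using False hn by linarith+
   then show ?thesis by (simp add: R)
  qed (simp add: w1)
  then have "(LINT x|lborel. (f (0 + x + ?h) - f (0 + x)) * (real k + 1) * w x) = (LINT x|lborel. (f (x + ?h) - f x) * (real k + 1))" by (simp only:)
  also have "\<dots> = ((LINT x|lborel. f (x + ?h)) - (LINT x|lborel. f x)) * (real k + 1)"
   using fi integrable_shift[OF fi, of ?h] by simp
  also have "\<dots> = 0" by (simp only: integral_shift[of f ?h] \<open>f \<in> bmeas\<close>) simp
  finally show ?thesis .
 qed
 have "(%k. LINT x|lborel. (f (0 + x + (1 / (real k + 1)) *\<^sub>R axis i 1) - f (0 + x)) * (real k + 1) * w x)
   \<longlonglongrightarrow> (LINT x|lborel. partial_deriv i f (0 + x) * w x)"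
  by (rule difference_quotient_limit[OF f df wc w0])
 then have "(%k::nat. 0::real) \<longlonglongrightarrow> (LINT x|lborel. partial_deriv i f (0 + x) * w x)"
  unfolding fz .
 then have "(LINT x|lborel. partial_deriv i f (0 + x) * w x) = 0" by (simp add: LIMSEQ_const_iff)
 moreover have eq: "partial_deriv i f (0 + x) * w x = partial_deriv i f x" for x
  using d0[of x] w1[of x] by (cases "norm x > \<bar>R\<bar>") auto
 ultimately show "(LINT x|lborel. partial_deriv i f x) = 0" by (simp only: eq)
 have "locint (partial_deriv i f)" by (rule locint_continuous[OF df])
 then have "integrable lborel (%x. indicator (ball 0 (\<bar>R\<bar> + 1)) x * partial_deriv i f x)" unfolding locint_def by blast
 moreover have eq': "indicator (ball 0 (\<bar>R\<bar> + 1)) x * partial_deriv i f x = partial_deriv i f x" for x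
  using d0[of x] by (cases "norm x > \<bar>R\<bar>") auto
 ultimately show "integrable lborel (partial_deriv i f)" by (simp only: eq')
qed

lemma test_function_support:
 fixes eta :: "real^'n::finite => real"
 assumes "test_function eta" obtains R where "R > 0" "\<And>x. norm x >= R ==> eta x = 0"
proof -
 have "bounded {x. eta x \<noteq> 0}"
  using assms compact_imp_bounded bounded_subset[OF _ closure_subset] unfolding test_function_def by blast
 then obtain R where R: "\<forall>x\<in>{x. eta x \<noteq> 0}. norm x <= R" unfolding bounded_iff by blast
 show ?thesis
 proof (rule that[of "\<bar>R\<bar> + 1"])
  fix x :: "real^'n" assume "norm x >= \<bar>R\<bar> + 1"
  then show "eta x = 0" using R by force
 qed auto
qed

text \<open>For each coordinate the integral of the derivative of f times the partial derivative of
  g is 0, in both orders of the two functions; the products of first derivatives cancel in the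
  difference.\<close>

lemma green_identity:
 fixes phi eta :: "real^'n::finite => real"
 assumes phi: "test_function phi" and eta: "test_function eta"
 shows "(LINT x|lborel. phi x * laplacian eta x) = (LINT x|lborel. laplacian phi x * eta x)"
proof -
 obtain R where R: "\<And>x. norm x >= R ==> phi x = 0" using test_function_support[OF phi] by blast
 obtain R' where R': "\<And>x. norm x >= R' ==> eta x = 0" using test_function_support[OF eta] by blast
 have D: "f differentiable_on UNIV" "partial_deriv i f differentiable_on UNIV" "continuous_on UNIV (partial_deriv i (partial_deriv i f))"
  "continuous_on UNIV (partial_deriv i f)" "continuous_on UNIV f"
  if "test_function f" for f :: "real^'n => real" and i
 proof -
  have C: "C_k (Suc (Suc 0)) f" using that unfolding test_function_def by blast
  then show "f differentiable_on UNIV" "partial_deriv i f differentiable_on UNIV" "continuous_on UNIV (partial_deriv i (partial_deriv i f))" by auto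
  then show "continuous_on UNIV (partial_deriv i f)" "continuous_on UNIV f" by (auto intro: differentiable_imp_continuous_on)
 qed
 have pd: "partial_deriv i (%x. f x * partial_deriv i g x) = (%x. f x * partial_deriv i (partial_deriv i g) x + partial_deriv i f x * partial_deriv i g x)"
  if "test_function f" "test_function g" for f g :: "real^'n => real" and i
  by (rule partial_deriv_mult[OF D(1)[OF that(1)] D(2)[OF that(2)]])
 have z: "(LINT x|lborel. f x * partial_deriv i (partial_deriv i g) x + partial_deriv i f x * partial_deriv i g x) = 0"
  "integrable lborel (%x. f x * partial_deriv i (partial_deriv i g) x + partial_deriv i f x * partial_deriv i g x)"
  if fg: "test_function f" "test_function g" for f g :: "real^'n => real" and i
 proof -
  obtain R where R: "\<And>x. norm x >= R ==> f x = 0" using test_function_support[OF fg(1)] by blast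
  have c: "continuous_on UNIV (partial_deriv i (%x. f x * partial_deriv i g x))"
   unfolding pd[OF fg] by (intro continuous_intros D fg)
  have d: "(%x. f x * partial_deriv i g x) differentiable_on UNIV"
   by (intro differentiable_on_mult D fg)
  show "(LINT x|lborel. f x * partial_deriv i (partial_deriv i g) x + partial_deriv i f x * partial_deriv i g x) = 0"
   "integrable lborel (%x. f x * partial_deriv i (partial_deriv i g) x + partial_deriv i f x * partial_deriv i g x)"
   using integral_partial_deriv_zero[OF d c, of R] R unfolding pd[OF fg] by auto
 qed
 have int: "integrable lborel (%x. f x * partial_deriv i (partial_deriv i g) x)"
  if fg: "test_function f" "test_function g" for f g :: "real^'n => real" and i
 proof -
  obtain R where R: "\<And>x. norm x >= R ==> f x = 0" using test_function_support[OF fg(1)] by blast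
  have "locint (%x. f x * partial_deriv i (partial_deriv i g) x)"
   by (intro locint_continuous continuous_intros D fg)
  then have "integrable lborel (%x. indicator (ball 0 R) x * (f x * partial_deriv i (partial_deriv i g) x))" unfolding locint_def by blast
  moreover have eq: "indicator (ball 0 R) x * (f x * partial_deriv i (partial_deriv i g) x) = f x * partial_deriv i (partial_deriv i g) x" for x
   using R[of x] by (cases "norm x < R") auto
  ultimately show ?thesis by (simp only: eq)
 qed
 have one: "(LINT x|lborel. phi x * partial_deriv i (partial_deriv i eta) x) = (LINT x|lborel. eta x * partial_deriv i (partial_deriv i phi) x)" for i
 proof -
  have "(LINT x|lborel. (phi x * partial_deriv i (partial_deriv i eta) x + partial_deriv i phi x * partial_deriv i eta x)
    - (eta x * partial_deriv i (partial_deriv i phi) x + partial_deriv i eta x * partial_deriv i phi x)) = 0"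
   using z[OF phi eta, of i] z[OF eta phi, of i] by (subst Bochner_Integration.integral_diff) auto
  then have "(LINT x|lborel. phi x * partial_deriv i (partial_deriv i eta) x - eta x * partial_deriv i (partial_deriv i phi) x) = 0"
   by (simp add: algebra_simps)
  then show ?thesis using int[OF phi eta] int[OF eta phi] by simp
 qed
 have "(LINT x|lborel. phi x * laplacian eta x) = (LINT x|lborel. (\<Sum>i\<in>UNIV. phi x * partial_deriv i (partial_deriv i eta) x))"
  by (simp add: laplacian_def sum_distrib_left)
 also have "\<dots> = (\<Sum>i\<in>UNIV. LINT x|lborel. phi x * partial_deriv i (partial_deriv i eta) x)"
  by (rule Bochner_Integration.integral_sum) (rule int[OF phi eta])
 also have "\<dots> = (\<Sum>i\<in>UNIV. LINT x|lborel. eta x * partial_deriv i (partial_deriv i phi) x)" by (simp only: one)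
 also have "\<dots> = (LINT x|lborel. (\<Sum>i\<in>UNIV. eta x * partial_deriv i (partial_deriv i phi) x))"
  by (rule Bochner_Integration.integral_sum[symmetric]) (rule int[OF eta phi])
 also have "\<dots> = (LINT x|lborel. laplacian phi x * eta x)"
  by (simp add: laplacian_def sum_distrib_left mult.commute)
 finally show ?thesis .
qed

lemma test_function_bounded:
 fixes eta :: "real^'n::finite => real"
 assumes "test_function eta"
 shows "continuous_on UNIV eta" "continuous_on UNIV (laplacian eta)"
  and "\<exists>M R. R > 0 \<and> M >= 0 \<and> (\<forall>x. \<bar>eta x\<bar> <= M \<and> \<bar>laplacian eta x\<bar> <= M \<and> (norm x >= R --> eta x = 0 \<and> laplacian eta x = 0))"
proof -
 have C: "C_k (Suc (Suc 0)) eta" using assms unfolding test_function_def by blast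
 then have d: "\<And>i. partial_deriv i eta differentiable_on UNIV" "eta differentiable_on UNIV" "\<And>i. continuous_on UNIV (partial_deriv i (partial_deriv i eta))" by auto
 show c: "continuous_on UNIV eta" using d(2) by (rule differentiable_imp_continuous_on)
 show l: "continuous_on UNIV (laplacian eta)" unfolding laplacian_def[abs_def] by (intro continuous_on_sum d(3))
 obtain R where R: "R > 0" "\<And>x. norm x >= R ==> eta x = 0" using test_function_support[OF assms] by blast
 have p0: "partial_deriv i f x = 0" if "norm x > R" "\<And>y. norm y > R ==> f y = 0" for x i and f :: "real^'n => real"
 proof -
  have "(f has_derivative (%h. 0)) (at x)"
  proof (rule has_derivative_transform_within_open[of "%_. 0" "%h. 0" x UNIV "{x. norm x > R}"])
   show "open {x::real^'n. norm x > R}" by (intro open_Collect_less continuous_intros)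
  qed (use that in auto)
  then show ?thesis by (simp add: partial_deriv_eq)
 qed
 have l0: "laplacian eta x = 0" if x: "norm x >= R + 1" for x
 proof -
  have z1: "partial_deriv i eta y = 0" if "norm y > R" for i y by (rule p0[OF that]) (use R(2) in auto)
  have "partial_deriv i (partial_deriv i eta) x = 0" for i by (rule p0[OF _ z1]) (use x in auto)
  then show ?thesis by (simp add: laplacian_def)
 qed
 have bd: "\<exists>M. \<forall>x\<in>cball 0 (R + 1). \<bar>g x\<bar> <= M" if "continuous_on UNIV g" for g :: "real^'n => real"
 proof -
  have "bounded (g ` cball 0 (R + 1))"
   using that by (intro compact_imp_bounded compact_continuous_image) (auto intro: continuous_on_subset)
  then show ?thesis unfolding bounded_iff by auto
 qed
 obtain M1 where M1: "\<forall>x\<in>cball 0 (R + 1). \<bar>eta x\<bar> <= M1" using bd[OF c] by blast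
 obtain M2 where M2: "\<forall>x\<in>cball 0 (R + 1). \<bar>laplacian eta x\<bar> <= M2" using bd[OF l] by blast
 have "\<bar>eta x\<bar> <= max 0 (max M1 M2) \<and> \<bar>laplacian eta x\<bar> <= max 0 (max M1 M2) \<and> (norm x >= R + 1 --> eta x = 0 \<and> laplacian eta x = 0)" for x
 proof (cases "norm x <= R + 1")
  case True
  then have "\<bar>eta x\<bar> <= M1" "\<bar>laplacian eta x\<bar> <= M2" using M1 M2 by auto
  moreover have "norm x >= R + 1 --> eta x = 0 \<and> laplacian eta x = 0" using R(2)[of x] l0[of x] by auto
  ultimately show ?thesis by linarith
 next
  case False
  then have "eta x = 0" "laplacian eta x = 0" using R(2)[of x] l0[of x] by auto
  then show ?thesis by auto
 qed
 then show "\<exists>M R. R > 0 \<and> M >= 0 \<and> (\<forall>x. \<bar>eta x\<bar> <= M \<and> \<bar>laplacian eta x\<bar> <= M \<and> (norm x >= R --> eta x = 0 \<and> laplacian eta x = 0))"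
  using R(1) by (intro exI[of _ "max 0 (max M1 M2)"] exI[of _ "R + 1"]) auto
qed

section \<open>Finite energy and its pointwise consequence\<close>

lemma loc_integrable_mult_compact:
 fixes u w :: "real^'n::finite => real"
 assumes u: "loc_integrable u" and w: "w \<in> borel_measurable lebesgue"
  and M: "\<And>x. \<bar>w x\<bar> <= M" and R: "\<And>x. norm x >= R ==> w x = 0"
 shows "integrable lebesgue (%x. u x * w x)"
proof -
 have "u absolutely_integrable_on cball 0 R" using u unfolding loc_integrable_def by auto
 then have i: "integrable lebesgue (%x. indicator (cball 0 R) x * u x)" by (simp add: set_integrable_def)
 have eq: "u x * w x = (indicator (cball 0 R) x * u x) * w x" for x
  using R[of x] by (cases "norm x <= R") auto
 show ?thesis unfolding eq
 proof (rule Bochner_Integration.integrable_bound)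
  show "integrable lebesgue (%x. M * (indicator (cball 0 R) x * u x))" using i by simp
  show "(%x. indicator (cball 0 R) x * u x * w x) \<in> borel_measurable lebesgue"
   using borel_measurable_integrable[OF i] w by (rule borel_measurable_times)
  show "AE x in lebesgue. norm (indicator (cball 0 R) x * u x * w x) <= norm (M * (indicator (cball 0 R) x * u x))"
  proof (rule AE_I2)
   fix x
   have "\<bar>indicator (cball 0 R) x * u x\<bar> * \<bar>w x\<bar> <= \<bar>indicator (cball 0 R) x * u x\<bar> * \<bar>M\<bar>"
    using M[of x] by (intro mult_left_mono) auto
   then show "norm (indicator (cball 0 R) x * u x * w x) <= norm (M * (indicator (cball 0 R) x * u x))"
    by (simp add: abs_mult mult.commute)
  qed
 qed
qed

text \<open>Young's inequality without its factors 1/s and 1/s'. The free scale \<open>mu\<close>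
  lets it take over the role of Hoelder's inequality: it is sent to infinity or balanced where it is
  applied.\<close>

lemma scaled_young:
 fixes a b mu s s' :: real
 assumes "s > 1" "s' > 1" "1/s + 1/s' = 1" "mu > 0" "a >= 0" "b >= 0"
 shows "a * b <= mu powr s * a powr s + mu powr (- s') * b powr s'"
proof -
 have "(mu * a) * (b / mu) <= (mu * a) powr s / s + (b / mu) powr s' / s'"
  by (rule Youngs_inequality) (use assms in auto)
 also have "\<dots> <= (mu * a) powr s + (b / mu) powr s'"
  using assms by (intro add_mono) (auto simp: divide_le_eq mult_left_le_one_le mult_le_cancel_left1)
 also have "\<dots> = mu powr s * a powr s + mu powr (- s') * b powr s'"
  using assms by (simp add: powr_mult powr_divide powr_minus_divide)
 finally show ?thesis using assms by simp
qed

text \<open>Green's identity for the approximating test functions passes to the limit, since they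
  converge locally in L^1 and their Laplacians converge in L^s. Finite energy enters the decay
  estimate in this form: the right-hand side \<open>f\<close> acts on test functions like - g with
  \<open>g\<close> in L^s.\<close>

lemma D2_weak_laplacian:
 fixes u f :: "real^'n::finite => real"
 assumes s: "s > 1" "s' > 1" "1/s + 1/s' = 1" and u: "u \<in> D2 s" and w: "weak_neg_laplacian u f"
 shows "\<exists>g. Lp_fun s g \<and> (\<forall>eta. test_function eta --> integrable lebesgue (%x. g x * eta x) \<and>
   (LINT x|lebesgue. f x * eta x) = - (LINT x|lebesgue. g x * eta x))"
proof -
 have ul: "loc_integrable u" using w by (simp add: weak_neg_laplacian_def)
 obtain phi :: "nat => real^'n => real" and g where phi: "\<And>k. test_function (phi k)" and g: "Lp_fun s g"
  and c1: "\<And>K. compact K ==> (%k. LINT x:K|lebesgue. \<bar>phi k x - u x\<bar>) \<longlonglongrightarrow> 0"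
  and c2: "(%k. Lp_norm s (%x. laplacian (phi k) x - g x)) \<longlonglongrightarrow> 0"
  using u unfolding D2_def by blast
 have gm: "g \<in> borel_measurable lebesgue" and gi: "integrable lebesgue (%x. \<bar>g x\<bar> powr s)"
  using g by (auto simp: Lp_fun_def)
 have bl: "h \<in> borel_measurable lebesgue" if "continuous_on UNIV h" for h :: "real^'n => real"
  using borel_measurable_continuous_onI[OF that] by (intro measurable_completion) simp
 have cli: "loc_integrable h" if "continuous_on UNIV h" for h :: "real^'n => real"
  unfolding loc_integrable_def
 proof (intro allI impI)
  fix K :: "(real^'n) set" assume "compact K"
  then have i: "integrable lborel (%x. indicator K x *\<^sub>R h x)"
   using that by (intro borel_integrable_compact) (auto intro: continuous_on_subset)
  then have "integrable lebesgue (%x. indicator K x *\<^sub>R h x)"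
   by (subst integrable_completion[OF borel_measurable_integrable[OF i]])
  then show "h absolutely_integrable_on K" by (simp add: set_integrable_def)
 qed
 have "integrable lebesgue (%x. g x * eta x) \<and> (LINT x|lebesgue. f x * eta x) = - (LINT x|lebesgue. g x * eta x)" if eta: "test_function eta" for eta
 proof -
  obtain M R where R: "R > 0" and M0: "M >= 0"
   and M: "\<And>x. \<bar>eta x\<bar> <= M" "\<And>x. \<bar>laplacian eta x\<bar> <= M" "\<And>x. norm x >= R ==> eta x = 0" "\<And>x. norm x >= R ==> laplacian eta x = 0"
   using test_function_bounded(3)[OF eta] by blast
  have etam: "eta \<in> borel_measurable lebesgue" "laplacian eta \<in> borel_measurable lebesgue"
   using test_function_bounded(1,2)[OF eta] by (auto intro: bl)
  define E where "E = (LINT x|lebesgue. \<bar>eta x\<bar> powr s')"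
  have etai: "integrable lebesgue (%x. \<bar>eta x\<bar> powr s')"
  proof -
   have "integrable lebesgue (%x. 1 * (\<bar>eta x\<bar> powr s'))"
    by (rule loc_integrable_mult_compact[OF cli[OF continuous_on_const], of _ "M powr s'" R])
      (use etam M s in \<open>auto intro!: powr_mono2\<close>)
   then show ?thesis by simp
  qed
  have young: "integrable lebesgue (%x. d x * eta x)" "\<bar>LINT x|lebesgue. d x * eta x\<bar> <= mu powr s * (LINT x|lebesgue. \<bar>d x\<bar> powr s) + mu powr (- s') * E"
   if d: "d \<in> borel_measurable lebesgue" "integrable lebesgue (%x. \<bar>d x\<bar> powr s)" and mu: "mu > 0" for d mu
  proof -
   have i: "integrable lebesgue (%x. mu powr s * \<bar>d x\<bar> powr s + mu powr (- s') * \<bar>eta x\<bar> powr s')" using d etai by simp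
   have b: "\<bar>d x * eta x\<bar> <= mu powr s * \<bar>d x\<bar> powr s + mu powr (- s') * \<bar>eta x\<bar> powr s'" for x
    unfolding abs_mult by (rule scaled_young[OF s mu]) auto
   show i1: "integrable lebesgue (%x. d x * eta x)"
    by (rule Bochner_Integration.integrable_bound[OF i]) (use d etam b in \<open>auto intro!: AE_I2 order_trans[OF b] abs_ge_self\<close>)
   have "\<bar>LINT x|lebesgue. d x * eta x\<bar> <= (LINT x|lebesgue. \<bar>d x * eta x\<bar>)"
    using integral_norm_bound[of lebesgue "%x. d x * eta x"] by simp
   also have "\<dots> <= (LINT x|lebesgue. mu powr s * \<bar>d x\<bar> powr s + mu powr (- s') * \<bar>eta x\<bar> powr s')"
    by (rule integral_mono) (use i i1 b in auto)
   also have "\<dots> = mu powr s * (LINT x|lebesgue. \<bar>d x\<bar> powr s) + mu powr (- s') * E"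
    unfolding E_def using d etai by simp
   finally show "\<bar>LINT x|lebesgue. d x * eta x\<bar> <= mu powr s * (LINT x|lebesgue. \<bar>d x\<bar> powr s) + mu powr (- s') * E" .
  qed
  have gi1: "integrable lebesgue (%x. g x * eta x)" by (rule young(1)[OF gm gi, of 1]) simp
  define d where "d k x = laplacian (phi k) x - g x" for k x
  have lm: "laplacian (phi k) \<in> borel_measurable lebesgue" for k using test_function_bounded(2)[OF phi] by (rule bl)
  have dm: "d k \<in> borel_measurable lebesgue" for k unfolding d_def[abs_def] using lm gm by auto
  have di: "integrable lebesgue (%x. \<bar>d k x\<bar> powr s)" for k
  proof -
   obtain Mk Rk where Mk: "\<And>x. \<bar>laplacian (phi k) x\<bar> <= Mk" "\<And>x. norm x >= Rk ==> laplacian (phi k) x = 0"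
    using test_function_bounded(3)[OF phi[of k]] by blast
   have "integrable lebesgue (%x. 1 * (\<bar>laplacian (phi k) x\<bar> powr s))"
    by (rule loc_integrable_mult_compact[OF cli[OF continuous_on_const], of _ "Mk powr s" Rk])
      (use lm Mk s in \<open>auto intro!: powr_mono2\<close>)
   then have i: "integrable lebesgue (%x. 2 powr s * (\<bar>laplacian (phi k) x\<bar> powr s + \<bar>g x\<bar> powr s))" using gi by simp
   show ?thesis
   proof (rule Bochner_Integration.integrable_bound[OF i])
    show "(%x. \<bar>d k x\<bar> powr s) \<in> borel_measurable lebesgue" using dm by measurable
    show "AE x in lebesgue. norm (\<bar>d k x\<bar> powr s) <= norm (2 powr s * (\<bar>laplacian (phi k) x\<bar> powr s + \<bar>g x\<bar> powr s))"
    proof (rule AE_I2)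
     fix x
     let ?m = "max \<bar>laplacian (phi k) x\<bar> \<bar>g x\<bar>"
     have "\<bar>d k x\<bar> powr s <= (2 * ?m) powr s" unfolding d_def using s by (intro powr_mono2) auto
     also have "\<dots> = 2 powr s * ?m powr s" by (simp add: powr_mult)
     also have "\<dots> <= 2 powr s * (\<bar>laplacian (phi k) x\<bar> powr s + \<bar>g x\<bar> powr s)"
      by (intro mult_left_mono) (auto simp: max_def)
     finally show "norm (\<bar>d k x\<bar> powr s) <= norm (2 powr s * (\<bar>laplacian (phi k) x\<bar> powr s + \<bar>g x\<bar> powr s))" by simp
    qed
   qed
  qed
  define x where "x k = (LINT x|lebesgue. \<bar>d k x\<bar> powr s)" for k
  have x0: "x k >= 0" for k unfolding x_def by simp
  have xlim: "x \<longlonglongrightarrow> 0"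
  proof -
   have "(%k. Lp_norm s (%x. laplacian (phi k) x - g x) powr s) \<longlonglongrightarrow> 0 powr s"
    by (rule tendsto_powr2[OF c2 tendsto_const]) (use s in \<open>auto simp: Lp_norm_def\<close>)
   moreover have "Lp_norm s (%x. laplacian (phi k) x - g x) powr s = x k" for k
    using x0[of k] s by (simp add: Lp_norm_def x_def d_def powr_powr)
   ultimately show ?thesis by simp
  qed
  \<comment> \<open>A large \<open>mu\<close> makes the term with the fixed number \<open>E\<close>
    small; afterwards \<open>k\<close> is taken large for this \<open>mu\<close>.\<close>
  have L1: "(%k. LINT x|lebesgue. d k x * eta x) \<longlonglongrightarrow> 0"
  proof (rule LIMSEQ_I)
   fix e :: real assume e: "e > 0"
   have E0: "E >= 0" unfolding E_def by simp
   have fl: "((%mu. mu powr (- s') * E) \<longlongrightarrow> 0 * E) at_top"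
    by (intro tendsto_mult tendsto_const tendsto_neg_powr filterlim_ident) (use s in auto)
   then have "\<forall>\<^sub>F mu in at_top. mu powr (- s') * E < e / 2" by (rule order_tendstoD(2)) (use e in simp)
   moreover have "\<forall>\<^sub>F mu in at_top. mu > (0::real)" by (rule eventually_gt_at_top)
   ultimately have "\<forall>\<^sub>F mu in at_top. mu powr (- s') * E < e / 2 \<and> mu > (0::real)" by (rule eventually_conj)
   then obtain mu where mu: "mu powr (- s') * E < e / 2" "mu > 0" by (auto dest: eventually_happens)
   have "(%k. mu powr s * x k) \<longlonglongrightarrow> mu powr s * 0" by (intro tendsto_mult tendsto_const xlim)
   then have "\<forall>\<^sub>F k in sequentially. mu powr s * x k < e / 2" by (rule order_tendstoD(2)) (use e in simp)
   then obtain K where K: "\<And>k. k >= K ==> mu powr s * x k < e / 2" by (auto simp: eventually_sequentially)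
   show "\<exists>K. \<forall>k\<ge>K. norm ((LINT x|lebesgue. d k x * eta x) - 0) < e"
   proof (intro exI[of _ K] allI impI)
    fix k assume "k >= K"
    then show "norm ((LINT x|lebesgue. d k x * eta x) - 0) < e"
     using young(2)[OF dm di mu(2), of k] K[of k] mu(1) unfolding x_def by simp
   qed
  qed
  have L2: "(%k. LINT x|lebesgue. (phi k x - u x) * laplacian eta x) \<longlonglongrightarrow> 0"
  proof (rule Lim_null_comparison)
   show "(%k. M * (LINT x:cball 0 R|lebesgue. \<bar>phi k x - u x\<bar>)) \<longlonglongrightarrow> 0"
    using tendsto_mult[OF tendsto_const c1[of "cball 0 R"], of M] by simp
   show "\<forall>\<^sub>F k in sequentially. norm (LINT x|lebesgue. (phi k x - u x) * laplacian eta x) <= M * (LINT x:cball 0 R|lebesgue. \<bar>phi k x - u x\<bar>)"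
   proof (rule always_eventually, rule allI)
    fix k
    have dl: "loc_integrable (%x. phi k x - u x)"
     using cli[OF test_function_bounded(1)[OF phi[of k]]] ul unfolding loc_integrable_def
     by (auto intro!: set_integral_diff(1))
    have i1: "integrable lebesgue (%x. (phi k x - u x) * laplacian eta x)"
     by (rule loc_integrable_mult_compact[OF dl etam(2) M(2) M(4)])
    have i2: "integrable lebesgue (%x. indicator (cball 0 R) x * \<bar>phi k x - u x\<bar>)"
    proof -
     have "integrable lebesgue (%x. indicator (cball 0 R) x *\<^sub>R (phi k x - u x))"
      using dl unfolding loc_integrable_def set_integrable_def by auto
     from integrable_abs[OF this] show ?thesis by (simp add: abs_mult)
    qed
    have "norm (LINT x|lebesgue. (phi k x - u x) * laplacian eta x) <= (LINT x|lebesgue. norm ((phi k x - u x) * laplacian eta x))"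
     by (rule integral_norm_bound)
    also have "\<dots> <= (LINT x|lebesgue. M * (indicator (cball 0 R) x * \<bar>phi k x - u x\<bar>))"
    proof (rule integral_mono)
     show "integrable lebesgue (%x. norm ((phi k x - u x) * laplacian eta x))" using i1 by (rule integrable_norm)
     show "integrable lebesgue (%x. M * (indicator (cball 0 R) x * \<bar>phi k x - u x\<bar>))" using i2 by simp
     fix x
     show "norm ((phi k x - u x) * laplacian eta x) <= M * (indicator (cball 0 R) x * \<bar>phi k x - u x\<bar>)"
     proof (cases "norm x <= R")
      case True
      then show ?thesis using M(2)[of x] by (simp add: abs_mult mult.commute mult_right_mono)
     qed (use M(4)[of x] in simp)
    qed
    also have "\<dots> = M * (LINT x:cball 0 R|lebesgue. \<bar>phi k x - u x\<bar>)" by (simp add: set_lebesgue_integral_def)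
    finally show "norm (LINT x|lebesgue. (phi k x - u x) * laplacian eta x) <= M * (LINT x:cball 0 R|lebesgue. \<bar>phi k x - u x\<bar>)" .
   qed
  qed
  have eq: "(LINT x|lebesgue. (phi k x - u x) * laplacian eta x) - (LINT x|lebesgue. d k x * eta x) =
    (LINT x|lebesgue. g x * eta x) - (LINT x|lebesgue. u x * laplacian eta x)" for k
  proof -
   note tb = test_function_bounded[OF phi[of k]] test_function_bounded[OF eta]
   have i1: "integrable lebesgue (%x. phi k x * laplacian eta x)"
    by (rule loc_integrable_mult_compact[OF cli[OF tb(1)] etam(2) M(2) M(4)])
   have i2: "integrable lebesgue (%x. u x * laplacian eta x)"
    by (rule loc_integrable_mult_compact[OF ul etam(2) M(2) M(4)])
   have i3: "integrable lebesgue (%x. laplacian (phi k) x * eta x)"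
    by (rule loc_integrable_mult_compact[OF cli[OF tb(2)] etam(1) M(1) M(3)])
   have "(LINT x|lebesgue. phi k x * laplacian eta x) = (LINT x|lborel. phi k x * laplacian eta x)"
    by (rule integral_completion) (use tb in \<open>auto intro!: borel_measurable_continuous_onI continuous_intros\<close>)
   also have "\<dots> = (LINT x|lborel. laplacian (phi k) x * eta x)" by (rule green_identity[OF phi eta])
   also have "\<dots> = (LINT x|lebesgue. laplacian (phi k) x * eta x)"
    by (rule integral_completion[symmetric]) (use tb in \<open>auto intro!: borel_measurable_continuous_onI continuous_intros\<close>)
   finally have gr: "(LINT x|lebesgue. phi k x * laplacian eta x) = (LINT x|lebesgue. laplacian (phi k) x * eta x)" .
   show ?thesis unfolding d_def left_diff_distrib
    using i1 i2 i3 gi1 gr by simp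
  qed
  have "(%k::nat. (LINT x|lebesgue. g x * eta x) - (LINT x|lebesgue. u x * laplacian eta x)) \<longlonglongrightarrow> 0 - 0"
   using tendsto_diff[OF L2 L1] unfolding eq .
  then have "(LINT x|lebesgue. g x * eta x) = (LINT x|lebesgue. u x * laplacian eta x)"
   by (simp add: LIMSEQ_const_iff)
  moreover have "- (LINT x|lebesgue. u x * laplacian eta x) = (LINT x|lebesgue. f x * eta x)"
   using w eta unfolding weak_neg_laplacian_def by blast
  ultimately show ?thesis using gi1 by simp
 qed
 then show ?thesis using g by blast
qed

lemma bump_volume_pos: "(LINT x|lborel. bump ((x::'a::euclidean_space) \<bullet> x)) > 0"
 and bump_volume_integrable: "integrable lborel (%x::'a. bump (sq x))"
proof -
 have b0: "bump (sq x) = 0" if "norm x >= 2" for x :: 'a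
 proof -
  have "norm x * norm x >= 2 * 2" using that by (intro mult_mono) auto
  then have "x \<bullet> x >= 2" by (simp add: dot_square_norm power2_eq_square)
  then show ?thesis by (simp add: bump_zero)
 qed
 show i: "integrable lborel (%x::'a. bump (sq x))"
  by (rule bounded_support_integrable[of _ 1 2]) (use b0 bump_nonneg bump_le_1 in auto)
 have "shell 1 x = 4 * bump (sq x)" for x :: 'a by (cases "x = 0") (auto simp: shell_def bump_zero)
 then have "(LINT x|lborel. shell 1 (x::'a)) = 4 * (LINT x|lborel. bump ((x::'a) \<bullet> x))" by simp
 then show "(LINT x|lborel. bump ((x::'a) \<bullet> x)) > 0" using shell_integral_pos[of 1, where 'a='a] by simp
qed

lemma bump_volume_scale:
 assumes nu: "nu = real DIM('a::euclidean_space) / 2" and L: "L > 0"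
 shows "integrable lborel (%x::'a. bump ((sq x) / L))"
  and "(LINT x|lborel. bump (((x::'a) \<bullet> x) / L)) = L powr nu * (LINT x|lborel. bump ((x::'a) \<bullet> x))"
proof -
 have b0: "bump ((sq x) / L) = 0" if "norm x >= 2 * sqrt L" for x :: 'a
 proof -
  have "norm x * norm x >= (2 * sqrt L) * (2 * sqrt L)" using that L by (intro mult_mono) auto
  then have "x \<bullet> x >= 4 * L" using L by (simp add: dot_square_norm power2_eq_square)
  then have "(sq x) / L >= 2" using L by (simp add: le_divide_eq)
  then show ?thesis by (simp add: bump_zero)
 qed
 show "integrable lborel (%x::'a. bump ((sq x) / L))"
  by (rule bounded_support_integrable[of _ 1 "2 * sqrt L"]) (use b0 bump_nonneg bump_le_1 in auto)
 have "(LINT x|lborel. bump (((x::'a) \<bullet> x) / L)) = sqrt L ^ DIM('a) * (LINT x|lborel. bump (((sqrt L *\<^sub>R (x::'a)) \<bullet> (sqrt L *\<^sub>R x)) / L))"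
  by (rule integral_scale) (use L in auto)
 moreover have "((sqrt L *\<^sub>R x) \<bullet> (sqrt L *\<^sub>R x)) / L = sq x" for x :: 'a
  using L by (simp add: mult.assoc[symmetric])
 moreover have "sqrt L ^ DIM('a) = L powr nu"
 proof -
  have "sqrt L ^ DIM('a) = (L powr (1/2)) powr real DIM('a)" using L by (simp add: powr_realpow powr_half_sqrt)
  also have "\<dots> = L powr nu" by (simp add: powr_powr nu)
  finally show ?thesis .
 qed
 ultimately show "(LINT x|lborel. bump (((x::'a) \<bullet> x) / L)) = L powr nu * (LINT x|lborel. bump ((x::'a) \<bullet> x))" by simp
qed

lemma superlevel_lebesgue: "{x::real^'n. x \<bullet> x >= L} \<in> sets lebesgue"
proof -
 have "closed {x::real^'n. L <= sq x}" by (intro closed_Collect_le continuous_intros)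
 then have "{x::real^'n. x \<bullet> x >= L} \<in> sets borel" by (rule borel_closed)
 then have "{x::real^'n. x \<bullet> x >= L} \<in> sets lborel" by simp
 then show ?thesis by (rule sets_completionI_sets)
qed

text \<open>Test with a bump living on L < |x|^2 < 2 L. Monotonicity bounds the result from below by
  v (2 L)^p times a volume of order L^nu, and the L^s mass of \<open>g\<close> outside the ball
  |x|^2 < L, which tends to 0, bounds it from above. Balancing gives v (2 L)^p = o(L^(-nu/s)), and
  nu/s = B p.\<close>

lemma finite_energy_decay:
 fixes v :: "real => real" and g :: "real^'n::finite => real"
 assumes p: "p > 0" and s: "s = (p + 1) / p" and nu: "nu = real CARD('n) / 2" and B: "B = nu / (p + 1)"
  and vc: "continuous_on {0..} v" and vpos: "\<And>t. t >= 0 ==> v t > 0" and vdec: "\<And>r t. 0 <= r ==> r <= t ==> v t <= v r"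
  and g: "Lp_fun s g" and id: "\<And>eta. test_function eta ==> integrable lebesgue (%x. g x * eta x) \<and>
    (LINT x|lebesgue. v (sq x) powr p * eta x) = - (LINT x|lebesgue. g x * eta x)"
 shows "((%t. v t * t powr B) \<longlongrightarrow> 0) at_top"
proof -
 define s' where "s' = p + 1"
 have ss: "s > 1" "s' > 1" "1/s + 1/s' = 1" using p by (auto simp: s s'_def field_simps)
 have nu': "nu = real DIM(real^'n) / 2" using nu by simp
 define c where "c = (LINT x|lborel. bump ((x::real^'n) \<bullet> x))"
 have c: "c > 0" unfolding c_def by (rule bump_volume_pos)
 have gm: "g \<in> borel_measurable lebesgue" and gi: "integrable lebesgue (%x. \<bar>g x\<bar> powr s)"
  using g by (auto simp: Lp_fun_def)
 define I where "I L = (LINT x|lebesgue. indicator {x. x \<bullet> x >= L} x * \<bar>g x\<bar> powr s)" for L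
 have Ii: "integrable lebesgue (%x. indicator {x. x \<bullet> x >= L} x * \<bar>g x\<bar> powr s)" for L
 proof -
  have "{x::real^'n. x \<bullet> x >= L} \<in> sets lebesgue"
   by (rule superlevel_lebesgue)
  from integrable_mult_indicator[OF this gi] show ?thesis by simp
 qed
 have Ilim: "(I \<longlongrightarrow> 0) at_top"
 proof -
  have "(I \<longlongrightarrow> (LINT x|(lebesgue :: (real^'n) measure). 0)) at_top"
   unfolding I_def
  proof (rule integral_dominated_convergence_at_top[where w="%x. \<bar>g x\<bar> powr s"])
   show "\<forall>\<^sub>F L in at_top. AE x in lebesgue. norm (indicator {x. x \<bullet> x >= L} x * \<bar>g x\<bar> powr s) <= \<bar>g x\<bar> powr s"
    by (intro always_eventually allI AE_I2) (auto simp: indicator_def)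
   show "AE x in lebesgue. ((%L. indicator {x. x \<bullet> x >= L} x * \<bar>g x\<bar> powr s) \<longlongrightarrow> 0) at_top"
   proof (rule AE_I2, rule tendsto_eventually)
    fix x :: "real^'n"
    have "\<forall>\<^sub>F L in at_top. L > x \<bullet> x" by (rule eventually_gt_at_top)
    then show "\<forall>\<^sub>F L in at_top. indicator {x. x \<bullet> x >= L} x * \<bar>g x\<bar> powr s = 0"
     by eventually_elim (auto simp: indicator_def)
   qed
  qed (use gi borel_measurable_integrable[OF Ii] in auto)
  then show ?thesis by simp
 qed
 have main: "v (2 * L) powr p * (L powr nu * c) <= mu powr s * I L + mu powr (- s') * (L powr nu * c)" if L: "L > 0" and mu: "mu > 0" for L mu
 proof -
  define eta where "eta x = bump ((sq x) / L)" for x :: "real^'n"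
  have sm: "smooth (%t. bump ((1 / L) * t + 0))" by (rule smooth_affine[OF bump_smooth])
  have "test_function (%x::real^'n. bump ((1 / L) * ((x - 0) \<bullet> (x - 0)) + 0))"
  proof (rule test_function_radial[OF sm])
   fix t assume "t >= 2 * L"
   then have "(1 / L) * t + 0 >= 2" using L by (simp add: le_divide_eq)
   then show "bump ((1 / L) * t + 0) = 0" by (simp add: bump_zero)
  qed
  then have eta: "test_function eta" unfolding eta_def[abs_def] by simp
  have etam: "eta \<in> bmeas" unfolding eta_def[abs_def] by measurable
  have eta01: "0 <= eta x" "eta x <= 1" for x unfolding eta_def using bump_nonneg bump_le_1 by auto
  have etai: "integrable lborel eta" "(LINT x|lborel. eta x) = L powr nu * c"
   using bump_volume_scale[OF nu' L] unfolding eta_def[abs_def] c_def by auto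
  have etal: "integrable lebesgue eta" "(LINT x|lebesgue. eta x) = L powr nu * c"
   using etai etam by (auto simp: integrable_completion integral_completion)
  have supp: "L < x \<bullet> x \<and> x \<bullet> x < 2 * L" if "eta x \<noteq> 0" for x
  proof -
   have "1 < (sq x) / L \<and> (sq x) / L < 2" using that bump_zero[of "(sq x) / L"] unfolding eta_def by force
   then show ?thesis using L by (simp add: less_divide_eq divide_less_eq)
  qed
  have fi: "integrable lebesgue (%x. v (sq x) powr p * eta x)"
  proof (rule Bochner_Integration.integrable_bound)
   show "integrable lebesgue (%x. v 0 powr p * eta x)" using etal by simp
   have "continuous_on UNIV (%x::real^'n. v (sq x))"
    by (rule continuous_on_compose2[OF vc]) (auto intro!: continuous_intros)
   then have "(%x::real^'n. v (sq x)) \<in> bmeas" by (rule borel_measurable_continuous_onI)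
   then show "(%x. v (sq x) powr p * eta x) \<in> borel_measurable lebesgue"
    using etam by (intro measurable_completion) simp
   show "AE x in lebesgue. norm (v (sq x) powr p * eta x) <= norm (v 0 powr p * eta x)"
   proof (rule AE_I2)
    fix x :: "real^'n"
    have "v (sq x) powr p <= v 0 powr p" using vpos[of "x \<bullet> x"] vdec[of 0 "x \<bullet> x"] p by (intro powr_mono2) auto
    then show "norm (v (sq x) powr p * eta x) <= norm (v 0 powr p * eta x)"
     using eta01[of x] by (simp add: abs_mult mult_right_mono)
   qed
  qed
  have "v (2 * L) powr p * (L powr nu * c) = (LINT x|lebesgue. v (2 * L) powr p * eta x)" using etal by simp
  also have "\<dots> <= (LINT x|lebesgue. v (sq x) powr p * eta x)"
  proof (rule integral_mono[OF _ fi])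
   show "integrable lebesgue (%x. v (2 * L) powr p * eta x)" using etal by simp
   fix x :: "real^'n"
   show "v (2 * L) powr p * eta x <= v (sq x) powr p * eta x"
   proof (cases "eta x = 0")
    case False
    have "v (2 * L) powr p <= v (sq x) powr p"
     using supp[OF False] vdec[of "x \<bullet> x" "2 * L"] vpos[of "2 * L"] L p by (intro powr_mono2) auto
    then show ?thesis using eta01 by (intro mult_right_mono) auto
   qed simp
  qed
  also have "\<dots> = - (LINT x|lebesgue. g x * eta x)" using id[OF eta] by simp
  also have "\<dots> = (LINT x|lebesgue. - (g x * eta x))" by simp
  also have "\<dots> <= (LINT x|lebesgue. mu powr s * (indicator {x. x \<bullet> x >= L} x * \<bar>g x\<bar> powr s) + mu powr (- s') * eta x)"
  proof (rule integral_mono)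
   show "integrable lebesgue (%x. - (g x * eta x))" using id[OF eta] by simp
   show "integrable lebesgue (%x. mu powr s * (indicator {x. x \<bullet> x >= L} x * \<bar>g x\<bar> powr s) + mu powr (- s') * eta x)"
    using Ii etal by simp
   fix x :: "real^'n"
   show "- (g x * eta x) <= mu powr s * (indicator {x. x \<bullet> x >= L} x * \<bar>g x\<bar> powr s) + mu powr (- s') * eta x"
   proof (cases "eta x = 0")
    case False
    have "- (g x * eta x) = (- g x) * eta x" by simp
    also have "\<dots> <= \<bar>g x\<bar> * eta x" by (rule mult_right_mono) (use eta01[of x] in auto)
    also have "\<dots> <= mu powr s * \<bar>g x\<bar> powr s + mu powr (- s') * eta x powr s'"
     by (rule scaled_young[OF ss mu]) (use eta01 in auto)
    also have "eta x powr s' <= eta x powr 1" using eta01[of x] ss by (intro powr_mono') auto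
    also have "eta x powr 1 = eta x" using eta01[of x] by simp
    finally show ?thesis using supp[OF False] by (simp add: mult_left_mono)
   qed simp
  qed
  also have "\<dots> = mu powr s * I L + mu powr (- s') * (L powr nu * c)"
   unfolding I_def using Ii etal by simp
  finally show ?thesis .
 qed
 have Bp: "B * p = nu / s" "nu / s' = nu - nu / s" using p by (auto simp: B s s'_def field_simps)
 have lim: "((%L. v (2 * L) powr p * L powr (B * p)) \<longlongrightarrow> 0) at_top"
 proof (rule order_tendstoI)
  fix e :: real assume "e < 0"
  have "\<forall>\<^sub>F L in at_top. v (2 * L) powr p * L powr (B * p) >= 0" by (intro always_eventually) auto
  then show "\<forall>\<^sub>F L in at_top. e < v (2 * L) powr p * L powr (B * p)" by eventually_elim (use \<open>e < 0\<close> in linarith)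
 next
  fix e :: real assume e: "e > 0"
  define delta where "delta = e / 2"
  have delta: "delta > 0" using e by (simp add: delta_def)
  have "((%L. delta powr (- (s / s')) * I L / c) \<longlongrightarrow> delta powr (- (s / s')) * 0 / c) at_top"
   by (intro tendsto_intros Ilim) (use c in simp)
  then have "\<forall>\<^sub>F L in at_top. delta powr (- (s / s')) * I L / c < delta" by (rule order_tendstoD(2)) (use delta in simp)
  moreover have "\<forall>\<^sub>F L in at_top. L > (0::real)" by (rule eventually_gt_at_top)
  ultimately show "\<forall>\<^sub>F L in at_top. v (2 * L) powr p * L powr (B * p) < e"
  proof eventually_elim
   case (elim L)
   then have L: "L > 0" by simp
   \<comment> \<open>With this scale both terms on the right carry the power L^(nu/s'), the second
     one with the small coefficient \<open>delta\<close>.\<close>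
   define mu where "mu = delta powr (- (1 / s')) * L powr (nu / (s * s'))"
   have mu: "mu > 0" using delta L by (simp add: mu_def)
   have e1: "mu powr s = delta powr (- (s / s')) * L powr (nu / s')"
    unfolding mu_def using delta L ss by (simp add: powr_mult powr_powr)
   have e2: "mu powr (- s') = delta * L powr (- (nu / s))"
    unfolding mu_def using delta L ss by (simp add: powr_mult powr_powr)
   have e3: "L powr nu = L powr (nu / s') * L powr (B * p)" "L powr (- (nu / s)) * L powr nu = L powr (nu / s')"
    using L unfolding Bp by (simp_all add: powr_add[symmetric])
   have "v (2 * L) powr p * (L powr nu * c) <= delta powr (- (s / s')) * L powr (nu / s') * I L + (delta * L powr (- (nu / s))) * (L powr nu * c)"
    using main[OF L mu] unfolding e1 e2 .
   also have "(delta * L powr (- (nu / s))) * (L powr nu * c) = delta * c * (L powr (- (nu / s)) * L powr nu)" by (simp add: mult_ac)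
   also have "\<dots> = delta * c * L powr (nu / s')" by (simp only: e3(2))
   finally have "L powr (nu / s') * (v (2 * L) powr p * L powr (B * p) * c) <= L powr (nu / s') * (delta powr (- (s / s')) * I L + delta * c)"
    unfolding e3(1) by (simp add: algebra_simps)
   then have "v (2 * L) powr p * L powr (B * p) * c <= delta powr (- (s / s')) * I L + delta * c"
    using L by (simp add: mult_le_cancel_left_pos)
   also have "\<dots> < delta * c + delta * c" using elim(1) c by (simp add: divide_less_eq mult.commute)
   also have "\<dots> = e * c" by (simp add: delta_def)
   finally show ?case using c by simp
  qed
 qed
 have "((%L. 2 powr B * (v (2 * L) powr p * L powr (B * p)) powr (1 / p)) \<longlongrightarrow> 2 powr B * 0) at_top"
  by (intro tendsto_mult tendsto_const tendsto_zero_powrI[OF lim tendsto_const]) (use p in auto)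
 moreover have "filterlim (%t. t / 2) at_top (at_top :: real filter)" by real_asymp
 ultimately have "((%t. 2 powr B * (v (2 * (t / 2)) powr p * (t / 2) powr (B * p)) powr (1 / p)) \<longlongrightarrow> 0) at_top"
  using filterlim_compose[of "%L. 2 powr B * (v (2 * L) powr p * L powr (B * p)) powr (1 / p)" "nhds 0" at_top "%t. t / 2" at_top]
  by simp
 moreover have "\<forall>\<^sub>F t in at_top. 2 powr B * (v (2 * (t / 2)) powr p * (t / 2) powr (B * p)) powr (1 / p) = v t * t powr B"
  using eventually_gt_at_top[of "0::real"]
 proof eventually_elim
  case (elim t)
  have "(v t powr p * (t / 2) powr (B * p)) powr (1 / p) = v t * (t / 2) powr B"
   using vpos[of t] elim p by (simp add: powr_mult powr_powr)
  moreover have "2 powr B * (t / 2) powr B = t powr B" using elim by (simp add: powr_mult[symmetric])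
  ultimately show ?case by (simp add: mult.left_commute)
 qed
 ultimately show ?thesis by (rule Lim_transform_eventually)
qed

section \<open>Profiles of the ground state\<close>

text \<open>The derivative of a regular radial solution, extended to the origin by its limit so that
  it becomes continuous on the closed half line.\<close>

definition slope :: "real => (real => real) => real => real" where
 "slope nu b s = (if s = 0 then - b 0 / (4 * nu) else - (1/4) * (s powr (- nu) * integral {0..s} (%t. t powr (nu - 1) * b t)))"

lemma slope_continuous:
 assumes b: "continuous_on {0..} b" and nu: "nu > 1"
 shows "continuous_on {0..} (slope nu b)"
proof -
 have "(slope nu b \<longlongrightarrow> slope nu b s) (at s within {0..})" if s: "s >= 0" for s
 proof (cases "s = 0")
  case True
  show ?thesis unfolding True
  proof (rule tendstoI)
   fix e :: real assume e: "e > 0"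
   have "(b \<longlongrightarrow> b 0) (at 0 within {0..})" using b by (simp add: continuous_on_def)
   then have "\<forall>\<^sub>F t in at 0 within {0..}. dist (b t) (b 0) < e" using e by (rule tendstoD)
   then obtain d where d: "d > 0" "\<And>t. t \<in> {0..} ==> t \<noteq> 0 ==> dist t 0 < d ==> dist (b t) (b 0) < e"
    unfolding eventually_at by blast
   have near: "\<bar>b t - b 0\<bar> <= e" if "0 <= t" "t < d" for t
    using d(2)[of t] that e by (cases "t = 0") (auto simp: dist_real_def)
   show "\<forall>\<^sub>F x in at 0 within {0..}. dist (slope nu b x) (slope nu b 0) < e"
    unfolding eventually_at
   proof (intro exI[of _ d] conjI ballI impI)
    fix x :: real assume "x \<in> {0..}" and x: "x \<noteq> 0 \<and> dist x 0 < d"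
    then have x0: "x > 0" "x < d" by (auto simp: dist_real_def)
    let ?m = "x powr (- nu) * integral {0..x} (%t. t powr (nu - 1) * b t)"
    have up: "?m <= (b 0 + e) / nu"
     unfolding powr_mean[OF nu x0(1), symmetric]
     by (rule powr_mean_mono[OF nu b]) (use near x0 in \<open>auto simp: abs_le_iff, smt (verit)\<close>)
    have lo: "(b 0 - e) / nu <= ?m"
     unfolding powr_mean[OF nu x0(1), symmetric]
     by (rule powr_mean_mono[OF nu _ b]) (use near x0 in \<open>auto simp: abs_le_iff, smt (verit)\<close>)
    have "\<bar>?m - b 0 / nu\<bar> <= e / nu" using up lo by (simp add: abs_le_iff add_divide_distrib diff_divide_distrib)
    also have "e / nu < 4 * e" using e nu by (simp add: divide_less_eq)
    finally have "\<bar>?m - b 0 / nu\<bar> < 4 * e" .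
    moreover have "slope nu b x - slope nu b 0 = - (1/4) * (?m - b 0 / nu)"
     using x0 nu by (simp add: slope_def right_diff_distrib)
    ultimately show "dist (slope nu b x) (slope nu b 0) < e" by (simp add: dist_real_def)
   qed (use d in simp)
  qed
 next
  case False
  then have s0: "s > 0" using s by simp
  have "continuous_on {0..s+1} (%x. integral {0..x} (%t. t powr (nu - 1) * b t))"
   by (rule indefinite_integral_continuous_1[OF powr_integrable[OF b nu]])
  then have "continuous_on {0<..<s+1} (%x. - (1/4) * (x powr (- nu) * integral {0..x} (%t. t powr (nu - 1) * b t)))"
   by (intro continuous_intros) (auto intro: continuous_on_subset)
  then have "continuous_on {0<..<s+1} (slope nu b)" by (rule continuous_on_eq) (simp add: slope_def)
  then have "isCont (slope nu b) s" using s0 by (simp add: continuous_on_eq_continuous_at)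
  then show ?thesis using continuous_at_imp_continuous_at_within by (simp add: continuous_within)
 qed
 then show ?thesis by (simp add: continuous_on_def)
qed

lemma slope_neg:
 assumes b: "continuous_on {0..} b" "\<And>t. t >= 0 ==> b t > 0" and nu: "nu > 1" and s: "s >= 0"
 shows "slope nu b s < 0"
proof (cases "s = 0")
 case True then show ?thesis using b(2)[of 0] nu by (simp add: slope_def)
next
 case False
 then have s0: "s > 0" using s by simp
 obtain t0 where t0: "t0 \<in> {0..s}" "\<And>t. t \<in> {0..s} ==> b t0 <= b t"
  using continuous_attains_inf[of "{0..s}" b] s b(1) continuous_on_subset[of "{0..}" b "{0..s}"] by auto
 have "b t0 / nu <= s powr (- nu) * integral {0..s} (%t. t powr (nu - 1) * b t)"
  unfolding powr_mean[OF nu s0, symmetric]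
  by (rule powr_mean_mono[OF nu _ b(1)]) (use t0 in auto)
 moreover have "b t0 / nu > 0" using b(2)[of t0] t0 nu by simp
 ultimately show ?thesis using s0 unfolding slope_def by simp
qed

lemma radial_sol_slope: "radial_sol nu a b ==> s > 0 ==> (a has_real_derivative slope nu b s) (at s)"
 by (simp add: radial_sol_def slope_def)

lemma radial_sol_decreasing:
 assumes a: "radial_sol nu a b" and b: "\<And>t. t >= 0 ==> b t > 0" and nu: "nu > 1" and rt: "0 <= r" "r <= t"
 shows "a t <= a r"
proof (cases "r = t")
 case False
 have bc: "continuous_on {0..} b" and ac: "continuous_on {0..} a" using a by (auto simp: radial_sol_def)
 have "\<exists>l z. r < z \<and> z < t \<and> (a has_real_derivative l) (at z) \<and> a t - a r = (t - r) * l"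
 proof (rule MVT)
  show "r < t" using False rt by simp
  show "continuous_on {r..t} a" by (rule continuous_on_subset[OF ac]) (use rt in auto)
  show "\<And>x. r < x ==> x < t ==> a differentiable (at x)"
   using radial_sol_slope[OF a] rt real_differentiable_def by (meson less_le_trans le_less_trans)
 qed
 then obtain l z where z: "r < z" "z < t" "(a has_real_derivative l) (at z)" "a t - a r = (t - r) * l" by blast
 have "l = slope nu b z" by (rule DERIV_unique[OF z(3) radial_sol_slope[OF a]]) (use z rt in simp)
 then have "l < 0" using slope_neg[OF bc b nu, of z] z rt by simp
 then have "(t - r) * l <= 0" using rt by (intro mult_nonneg_nonpos) auto
 then show ?thesis using z by simp
qed simp

text \<open>In terms of x this is a quadratic bound at the origin, which yields differentiability of
  the spatial function there.\<close>

lemma radial_sol_near_0: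
 assumes a: "radial_sol nu a b" and nu: "nu > 1"
 shows "\<exists>M. \<forall>s. 0 <= s --> s <= 1 --> \<bar>a s - a 0\<bar> <= M * s"
proof -
 have bc: "continuous_on {0..1} b" using a continuous_on_subset[of "{0..}" b "{0..1}"] by (auto simp: radial_sol_def)
 then have "bounded (b ` {0..1})" by (intro compact_imp_bounded compact_continuous_image) auto
 then obtain M where M: "\<And>t. 0 <= t ==> t <= 1 ==> \<bar>b t\<bar> <= M" unfolding bounded_iff by fastforce
 show ?thesis
 proof (intro exI[of _ "M / (4 * nu)"] allI impI)
  fix s :: real assume s: "0 <= s" "s <= 1"
  have bM: "b t <= M" "- b t <= M" if "0 <= t" "t <= s" for t using M[of t] that s by auto
  have "a s - a 0 >= - (M / (4 * nu)) * (s - 0)" by (rule radial_sol_increment[OF nu a]) (use s bM in auto)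
  moreover have "- a s - - a 0 >= - (M / (4 * nu)) * (s - 0)" by (rule radial_sol_increment[OF nu radial_sol_neg[OF a]]) (use s bM in auto)
  ultimately show "\<bar>a s - a 0\<bar> <= M / (4 * nu) * s" by (simp add: abs_le_iff)
 qed
qed

text \<open>The ground state as a pair of profiles in s = |x|^2. \<open>decay\<close> is what finite
  energy provides; it is stated for both components so that the locale is invariant under exchanging
  \<open>(p, u)\<close> with \<open>(q, v)\<close>.\<close>

locale emden =
 fixes p q nu :: real and u v :: "real => real"
 assumes pq: "p > 0" "q > 0" and nu: "nu > 1" and hyperbola: "1 / (p + 1) + 1 / (q + 1) = (nu - 1) / nu"
  and u: "radial_sol nu u (%s. v s powr p)" and v: "radial_sol nu v (%s. u s powr q)"
  and pos: "\<And>s. s >= 0 ==> u s > 0" "\<And>s. s >= 0 ==> v s > 0"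
  and decay: "((%s. u s * s powr (nu / (q + 1))) \<longlongrightarrow> 0) at_top" "((%s. v s * s powr (nu / (p + 1))) \<longlongrightarrow> 0) at_top"
begin

lemma swap: "emden q p nu v u"
 by (rule emden.intro) (use pq nu hyperbola u v pos decay in \<open>auto simp: add.commute\<close>)

definition "A = nu / (q + 1)"
definition "B = nu / (p + 1)"

lemma AB: "A > 0" "B > 0" "A + B = nu - 1" "B * p = A + 1" "A * q = B + 1"
proof -
 show "A > 0" "B > 0" using pq nu by (auto simp: A_def B_def)
 have "A + B = nu * (1 / (p + 1) + 1 / (q + 1))" by (simp add: A_def B_def algebra_simps)
 also have "\<dots> = nu - 1" unfolding hyperbola using nu by simp
 finally show s: "A + B = nu - 1" .
 have "B * (p + 1) = nu" "A * (q + 1) = nu" using pq by (auto simp: A_def B_def)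
 then show "B * p = A + 1" "A * q = B + 1" using s by (auto simp: algebra_simps)
qed

text \<open>\<open>A\<close> and \<open>B\<close> are half of the scaling exponents of the system,
  the half coming from s = |x|^2. The critical decay rates and the coefficients in
  \<open>Z_dilation\<close> are therefore the same numbers.\<close>

lemma exponents: "p * q > 1" "2 * (p + 1) / (p * q - 1) = 2 * A" "2 * (q + 1) / (p * q - 1) = 2 * B"
proof -
 have "A * (p * q) = p * (A * q)" by simp
 also have "\<dots> = A + 1 + p" unfolding AB(5) using AB(4) by (simp add: algebra_simps)
 finally have 1: "A * (p * q - 1) = p + 1" by (simp add: algebra_simps)
 have "B * (p * q) = q * (B * p)" by simp
 also have "\<dots> = B + 1 + q" unfolding AB(4) using AB(5) by (simp add: algebra_simps)
 finally have 2: "B * (p * q - 1) = q + 1" by (simp add: algebra_simps)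
 have "A * (p * q - 1) > 0" using 1 pq by simp
 then show pq1: "p * q > 1" using AB(1) by (simp add: zero_less_mult_iff)
 show "2 * (p + 1) / (p * q - 1) = 2 * A" "2 * (q + 1) / (p * q - 1) = 2 * B"
  using 1 2 pq1 by (simp_all add: field_simps)
qed

lemma cont: "continuous_on {0..} u" "continuous_on {0..} v"
 using u v by (auto simp: radial_sol_def)

lemma cont_powr: "continuous_on {0..} (%s. u s powr r)" "continuous_on {0..} (%s. v s powr r)"
 by (intro continuous_intros cont; use pos in fastforce)+

definition "du = slope nu (%s. v s powr p)"
definition "dv = slope nu (%s. u s powr q)"

lemma du_cont: "continuous_on {0..} du" unfolding du_def by (rule slope_continuous[OF cont_powr(2) nu])
lemma du_neg: "s >= 0 ==> du s < 0" unfolding du_def by (rule slope_neg[OF cont_powr(2) _ nu]) (use pos in force)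
lemma du_deriv: "s > 0 ==> (u has_real_derivative du s) (at s)" unfolding du_def by (rule radial_sol_slope[OF u])

lemma du_bound:
 assumes "s >= 0" shows "s * \<bar>du s\<bar> <= 2 powr nu * u s"
proof (cases "s = 0")
 case True then show ?thesis using pos(1)[of 0] by simp
next
 case False
 then have s: "s > 0" using assms by simp
 have "s * ((1/4) * (s powr (- nu) * integral {0..s} (%t. t powr (nu - 1) * v t powr p))) <= 2 powr nu * u s"
  by (rule radial_sol_slope_bound[OF nu u _ _ s]) (use pos in \<open>auto simp: less_imp_le\<close>)
 moreover have "\<bar>du s\<bar> = - du s" using du_neg[of s] s by simp
 moreover have "- du s = (1/4) * (s powr (- nu) * integral {0..s} (%t. t powr (nu - 1) * v t powr p))"
  using s by (simp add: du_def slope_def)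
 ultimately show ?thesis by (simp only:)
qed

lemma u_tendsto_0: "(u \<longlongrightarrow> 0) at_top"
proof -
 have "((%s. u s * s powr A * s powr (- A)) \<longlongrightarrow> 0 * 0) at_top"
  using decay(1) AB(1) unfolding A_def[symmetric] by (intro tendsto_mult tendsto_neg_powr filterlim_ident) auto
 moreover have "\<forall>\<^sub>F s in at_top. u s * s powr A * s powr (- A) = u s"
  using eventually_gt_at_top[of "0::real"] by eventually_elim (simp add: powr_minus)
 ultimately show ?thesis by (simp add: Lim_transform_eventually)
qed

text \<open>Since x . grad U is 2 s u'(s), this and \<open>zV\<close> are the two components of the
  dilation mode in the variable s.\<close>

definition "zU s = 2 * (s * du s) + 2 * A * u s"
definition "zV s = 2 * (s * dv s) + 2 * B * v s"

lemma zU_cont: "continuous_on {0..} zU"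
 unfolding zU_def[abs_def] by (intro continuous_intros du_cont cont)

lemma zU_tendsto_0: "(zU \<longlongrightarrow> 0) at_top"
proof (rule Lim_null_comparison)
 show "\<forall>\<^sub>F s in at_top. norm (zU s) <= (2 * 2 powr nu + 2 * A) * u s"
  using eventually_ge_at_top[of "0::real"]
 proof eventually_elim
  case (elim s)
  have "\<bar>zU s\<bar> <= 2 * (s * \<bar>du s\<bar>) + 2 * A * u s"
   unfolding zU_def using AB(1) pos(1)[of s] elim abs_triangle_ineq[of "2 * (s * du s)" "2 * A * u s"] by (simp add: abs_mult)
  then show ?case using du_bound[OF elim] by (simp add: algebra_simps)
 qed
 show "((%s. (2 * 2 powr nu + 2 * A) * u s) \<longlongrightarrow> 0) at_top"
  using tendsto_mult_left[OF u_tendsto_0, of "2 * 2 powr nu + 2 * A"] by simp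
qed

end

lemma (in emden) dv_eq: "dv = emden.du q nu u" "zV = emden.zU q p nu v u"
proof -
 interpret s: emden q p nu v u by (rule swap)
 show e: "dv = s.du" by (simp add: dv_def s.du_def)
 show "zV = s.zU" unfolding zV_def[abs_def] s.zU_def[abs_def] e B_def s.A_def by simp
qed

context emden begin
text \<open>Every fact about \<open>u\<close> thereby transfers to \<open>v\<close>; the rewrites
  identify the swapped constants with \<open>dv\<close> and \<open>zV\<close>.\<close>

sublocale swap: emden q p nu v u
 rewrites "emden.du q nu u = dv" and "emden.zU q p nu v u = zV"
 by (fact swap) (simp_all add: dv_eq)
end

context emden begin

text \<open>Instead of differentiating the scaling family, the cumulative integral of the linearized
  right-hand side is computed: it is 2 s^nu v^p plus 2 (B p - nu) times the integral of t^(nu-1)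
  v^p. Since B p = A + 1, this matches the derivative of 2 s u' + 2 A u.\<close>

lemma zU_sol: "radial_sol nu zU (%s. p * v s powr (p - 1) * zV s)"
proof -
 have rc: "continuous_on {0..} (%s. p * v s powr (p - 1) * zV s)"
  by (intro continuous_intros cont_powr swap.zU_cont)
 let ?I = "%s. integral {0..s} (%t. t powr (nu - 1) * v t powr p)"
 let ?J = "%s. integral {0..s} (%t. t powr (nu - 1) * (p * v t powr (p - 1) * zV t))"
 have Ji: "(%t. t powr (nu - 1) * (p * v t powr (p - 1) * zV t)) integrable_on {0..s}" for s by (rule powr_integrable[OF rc nu])
 have Ii: "(%t. t powr (nu - 1) * v t powr p) integrable_on {0..s}" for s by (rule powr_integrable[OF cont_powr(2) nu])
 have J: "?J s = 2 * (s powr nu * v s powr p) + 2 * (B * p - nu) * ?I s" if s: "s > 0" for s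
 proof -
  have "((%t. 2 * nu * (t powr (nu - 1) * v t powr p) + 2 * (t powr nu * (p * v t powr (p - 1) * dv t))) has_integral
    (2 * (s powr nu * v s powr p) - 2 * (0 powr nu * v 0 powr p))) {0..s}"
  proof (rule fundamental_theorem_of_calculus_interior)
   show "0 <= s" using s by simp
   have "continuous_on {0..s} (%t. t powr nu)" by (intro continuous_on_powr' continuous_intros) (use nu in auto)
   moreover have "continuous_on {0..s} (%t. v t powr p)" by (rule continuous_on_subset[OF cont_powr(2)]) auto
   ultimately show "continuous_on {0..s} (%t. 2 * (t powr nu * v t powr p))"
    by (intro continuous_on_mult continuous_on_const)
   fix t assume "t \<in> {0<..<s}"
   then have t: "t > 0" by simp
   have vt: "v t > 0" using pos(2)[of t] t by simp
   have "((%t. 2 * (t powr nu * v t powr p)) has_real_derivative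
     2 * (nu * t powr (nu - 1) * v t powr p + t powr nu * (p * v t powr (p - 1) * dv t))) (at t)"
    using t vt by (auto intro!: derivative_eq_intros swap.du_deriv simp: algebra_simps)
   then show "((%t. 2 * (t powr nu * v t powr p)) has_vector_derivative
     2 * nu * (t powr (nu - 1) * v t powr p) + 2 * (t powr nu * (p * v t powr (p - 1) * dv t))) (at t)"
    unfolding has_real_derivative_iff_has_vector_derivative[symmetric] by (simp add: algebra_simps)
  qed
  then have "((%t. (2 * nu * (t powr (nu - 1) * v t powr p) + 2 * (t powr nu * (p * v t powr (p - 1) * dv t)))
     + 2 * (B * p - nu) * (t powr (nu - 1) * v t powr p)) has_integral
    ((2 * (s powr nu * v s powr p) - 2 * (0 powr nu * v 0 powr p)) + 2 * (B * p - nu) * ?I s)) {0..s}"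
   by (intro has_integral_add has_integral_mult_right integrable_integral[OF Ii])
  moreover have "(2 * nu * (t powr (nu - 1) * v t powr p) + 2 * (t powr nu * (p * v t powr (p - 1) * dv t)))
     + 2 * (B * p - nu) * (t powr (nu - 1) * v t powr p) = t powr (nu - 1) * (p * v t powr (p - 1) * zV t)" if "t \<in> {0..s}" for t
  proof (cases "t = 0")
   case True then show ?thesis using nu by simp
  next
   case False
   then have t: "t > 0" using that by simp
   have 1: "t powr nu = t powr (nu - 1) * t" using t powr_add[of t "nu - 1" 1] by simp
   have 2: "v t powr p = v t powr (p - 1) * v t" using pos(2)[of t] t powr_add[of "v t" "p - 1" 1] by simp
   show ?thesis unfolding zV_def 1 2 by (simp add: algebra_simps)
  qed
  ultimately have "((%t. t powr (nu - 1) * (p * v t powr (p - 1) * zV t)) has_integral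
    ((2 * (s powr nu * v s powr p) - 2 * (0 powr nu * v 0 powr p)) + 2 * (B * p - nu) * ?I s)) {0..s}"
   by (rule has_integral_eq[rotated]) auto
  then show ?thesis using nu by (simp add: integral_unique)
 qed
 have "(zU has_real_derivative - (1/4) * (s powr (- nu) * ?J s)) (at s)" if s: "s > 0" for s
 proof -
  \<comment> \<open>\<open>zU\<close> for positive arguments, with the product s u'(s) written out
    through the cumulative integral.\<close>
  define h where "h x = - (1/2) * (x powr (1 - nu) * ?I x) + 2 * A * u x" for x
  have I': "(?I has_real_derivative s powr (nu - 1) * v s powr p) (at s)"
  proof -
   have "continuous_on {0..s+1} (%t. t powr (nu - 1))" by (intro continuous_on_powr' continuous_intros) (use nu in auto)
   moreover have "continuous_on {0..s+1} (%t. v t powr p)" by (rule continuous_on_subset[OF cont_powr(2)]) auto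
   ultimately have "continuous_on {0..s+1} (%t. t powr (nu - 1) * v t powr p)" by (rule continuous_on_mult)
   then have "(?I has_real_derivative s powr (nu - 1) * v s powr p) (at s within {0..s+1})"
    by (rule integral_has_real_derivative) (use s in auto)
   moreover have "at s within {0..s+1} = at s" by (rule at_within_interior) (use s in auto)
   ultimately show ?thesis by simp
  qed
  have "(h has_real_derivative - (1/2) * ((1 - nu) * s powr (- nu) * ?I s + s powr (1 - nu) * (s powr (nu - 1) * v s powr p)) + 2 * A * du s) (at s)"
   unfolding h_def[abs_def] using s by (auto intro!: derivative_eq_intros I' du_deriv)
  moreover have "- (1/2) * ((1 - nu) * s powr (- nu) * ?I s + s powr (1 - nu) * (s powr (nu - 1) * v s powr p)) + 2 * A * du s
    = - (1/4) * (s powr (- nu) * ?J s)"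
  proof -
   have "s powr (1 - nu) * s powr (nu - 1) = 1" "s powr (- nu) * s powr nu = 1"
    using s by (simp_all flip: powr_add)
   then have 1: "s powr (1 - nu) * (s powr (nu - 1) * v s powr p) = v s powr p" "s powr (- nu) * (s powr nu * v s powr p) = v s powr p"
    by (simp_all only: mult.assoc[symmetric] mult_1_left)
   have 2: "s powr (- nu) * ?J s = 2 * v s powr p + 2 * (B * p - nu) * (s powr (- nu) * ?I s)"
   proof -
    have "x * (2 * y + k * i) = 2 * (x * y) + k * (x * i)" for x y k i :: real by (simp add: algebra_simps)
    from this[of "s powr (- nu)" "s powr nu * v s powr p"] show ?thesis unfolding J[OF s] 1 .
   qed
   have 3: "du s = - (1/4) * (s powr (- nu) * ?I s)" using s by (simp add: du_def slope_def)
   show ?thesis unfolding 2 3 AB(4) unfolding 1 by (simp add: algebra_simps)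
  qed
  ultimately have "(h has_real_derivative - (1/4) * (s powr (- nu) * ?J s)) (at s)" by simp
  then show ?thesis
  proof (rule has_field_derivative_transform_within_open[of _ _ _ "{0<..}"])
   fix x :: real assume "x \<in> {0<..}"
   then have x: "x > 0" by simp
   have "x * x powr (- nu) = x powr (1 - nu)" using x powr_add[of x 1 "- nu"] by simp
   then show "h x = zU x" using x unfolding h_def zU_def du_def slope_def by (simp add: mult.assoc[symmetric])
  qed (use s in auto)
 qed
 then show ?thesis unfolding radial_sol_def using zU_cont rc by auto
qed

text \<open>The exponent makes the weighted radial integral \<open>\<integral> Q |f| s\<^sup>\<nu>\<^sup>-\<^sup>1 ds\<close> converge; this uses \<open>p \<le> q\<close>.\<close>
lemma weight_decay:
 assumes le: "p <= q"
 shows "\<exists>C T kappa. T > 0 \<and> kappa < - 1 \<and> (\<forall>s\<ge>T. q * u s powr (q - 1) * (2 * sqrt s * \<bar>du s\<bar>) <= C * s powr (kappa - (nu - 1)))"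
proof -
 have ABle: "A <= B" unfolding A_def B_def using le pq nu by (intro divide_left_mono) auto
 \<comment> \<open>The midpoint of the admissible interval: sigma < A is required by the decay
   estimate, and sigma > A - 1/2 is the same as kappa < -1 for the \<open>kappa\<close>
   below.\<close>
 define \<sigma> where "\<sigma> = (max 0 (A - 1/2) + A) / 2"
 have \<sigma>: "0 < \<sigma>" "\<sigma> < A" "\<sigma> > A - 1/2" using AB(1) by (auto simp: \<sigma>_def)
 obtain C T where T: "T > 0" and C: "\<And>s. s >= T ==> u s powr q <= C * s powr (- (B + 1) - \<sigma>)"
  using lane_emden_decay[OF nu u v pos pq AB(1) ABle AB(3,4,5) u_tendsto_0 swap.u_tendsto_0 decay(2)[folded B_def] \<sigma>(1,2)] by auto
 define kappa where "kappa = A - \<sigma> - 3/2"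
 show ?thesis
 proof (rule exI[of _ "2 * q * 2 powr nu * C"], rule exI[of _ T], rule exI[of _ kappa], intro conjI allI impI)
  show "kappa < - 1" using \<sigma> by (simp add: kappa_def)
  fix s assume sT: "s >= T"
  then have s: "s > 0" using T by simp
  have us: "u s > 0" using pos s by simp
  have "sqrt s * \<bar>du s\<bar> = s powr (-1/2) * (s * \<bar>du s\<bar>)"
  proof -
   have "sqrt s = s powr (-1/2) * s" using s powr_add[of s "-1/2" 1] by (simp add: powr_half_sqrt)
   then show ?thesis by simp
  qed
  also have "\<dots> <= s powr (-1/2) * (2 powr nu * u s)" by (intro mult_left_mono du_bound) (use s in auto)
  finally have "q * u s powr (q - 1) * (2 * (sqrt s * \<bar>du s\<bar>)) <= q * u s powr (q - 1) * (2 * (s powr (-1/2) * (2 powr nu * u s)))"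
   using pq by (intro mult_left_mono) auto
  also have "\<dots> = 2 * q * 2 powr nu * (s powr (-1/2) * (u s powr (q - 1) * u s))" by simp
  also have "u s powr (q - 1) * u s = u s powr q" using us powr_add[of "u s" "q - 1" 1] by simp
  also have "2 * q * 2 powr nu * (s powr (-1/2) * u s powr q) <= 2 * q * 2 powr nu * (s powr (-1/2) * (C * s powr (- (B + 1) - \<sigma>)))"
   using pq by (intro mult_left_mono C sT) auto
  also have "\<dots> = 2 * q * 2 powr nu * C * (s powr (-1/2) * s powr (- (B + 1) - \<sigma>))" by simp
  also have "s powr (-1/2) * s powr (- (B + 1) - \<sigma>) = s powr (kappa - (nu - 1))"
   unfolding powr_add[symmetric] kappa_def AB(3)[symmetric] by (rule arg_cong[where f="%t. s powr t"]) (simp add: algebra_simps)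
  finally show "q * u s powr (q - 1) * (2 * sqrt s * \<bar>du s\<bar>) <= 2 * q * 2 powr nu * C * s powr (kappa - (nu - 1))" by (simp add: mult_ac)
 qed (use T in simp)
qed

end

section \<open>Regularity of weak radial solutions at the origin\<close>

lemma powr_deriv_bound:
 assumes f: "\<And>s. s > 0 ==> (f has_real_derivative f' s) (at s)" and b: "\<And>s. 0 < s ==> s <= 1 ==> \<bar>f' s\<bar> <= C * s powr (- kappa)"
  and kappa: "kappa \<noteq> 1" and gamma: "0 <= gamma" "kappa - 1 <= gamma"
 shows "\<exists>D>0. \<forall>s. 0 < s --> s <= 1 --> \<bar>f s\<bar> <= D * s powr (- gamma)"
proof -
 define G where "G s = C / (1 - kappa) * s powr (1 - kappa)" for s :: real
 have G: "(G has_real_derivative C * s powr (- kappa)) (at s)" if "s > 0" for s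
  unfolding G_def[abs_def] using that kappa by (auto intro!: derivative_eq_intros)
 define D where "D = \<bar>f 1\<bar> + 2 * \<bar>C / (1 - kappa)\<bar> + 1"
 show ?thesis
 proof (intro exI[of _ D] conjI allI impI)
  show "D > 0" unfolding D_def by linarith
  fix s :: real assume s: "0 < s" "s <= 1"
  have "f s + G s <= f 1 + G 1"
  proof (rule DERIV_nonneg_imp_nondecreasing[OF s(2)])
   fix x assume x: "s <= x" "x <= 1"
   then have x0: "x > 0" using s by simp
   show "\<exists>y. ((%x. f x + G x) has_real_derivative y) (at x) \<and> 0 <= y"
    using DERIV_add[OF f[OF x0] G[OF x0]] b[of x] x x0 by (intro exI[of _ "f' x + C * x powr (- kappa)"]) (simp add: abs_le_iff)
  qed
  moreover have "f 1 - G 1 <= f s - G s"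
  proof (rule DERIV_nonpos_imp_nonincreasing[OF s(2)])
   fix x assume x: "s <= x" "x <= 1"
   then have x0: "x > 0" using s by simp
   show "\<exists>y. ((%x. f x - G x) has_real_derivative y) (at x) \<and> y <= 0"
    using DERIV_diff[OF f[OF x0] G[OF x0]] b[of x] x x0 by (intro exI[of _ "f' x - C * x powr (- kappa)"]) (simp add: abs_le_iff)
  qed
  moreover have "\<bar>G r\<bar> <= \<bar>C / (1 - kappa)\<bar> * s powr (- gamma)" if r: "r = s \<or> r = 1" for r
  proof -
   have "r powr (1 - kappa) <= s powr (- gamma)"
   proof (cases "r = s")
    case True then show ?thesis using s gamma by (simp add: powr_mono')
   next
    case False then show ?thesis using r s gamma powr_mono'[of "- gamma" 0 s] by simp
   qed
   then have "\<bar>C / (1 - kappa)\<bar> * r powr (1 - kappa) <= \<bar>C / (1 - kappa)\<bar> * s powr (- gamma)" by (rule mult_left_mono) simp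
   then show ?thesis unfolding G_def by (simp only: abs_mult abs_of_nonneg[OF powr_ge_zero])
  qed
  ultimately have "\<bar>f s\<bar> <= \<bar>f 1\<bar> + 2 * (\<bar>C / (1 - kappa)\<bar> * s powr (- gamma))" by (smt (verit))
  also have "\<bar>f 1\<bar> <= \<bar>f 1\<bar> * s powr (- gamma)" using s gamma powr_mono'[of "- gamma" 0 s] mult_left_mono[of 1 "s powr (- gamma)" "\<bar>f 1\<bar>"] by simp
  finally have "\<bar>f s\<bar> <= (\<bar>f 1\<bar> + 2 * \<bar>C / (1 - kappa)\<bar>) * s powr (- gamma)" by (simp add: algebra_simps)
  also have "\<dots> <= D * s powr (- gamma)" by (rule mult_right_mono) (auto simp: D_def)
  finally show "\<bar>f s\<bar> <= D * s powr (- gamma)" .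
 qed
qed

lemma cumulative_powr_bound:
 assumes [measurable]: "w \<in> bmeas" and w: "AE s in lborel. 0 < s --> s <= 1 --> \<bar>w s\<bar> <= C * s powr (- gamma)"
  and C: "C > 0" and gamma: "nu - gamma >= 1" and t: "0 < t" "t <= 1"
 shows "\<bar>LINT s|lborel. indicator {..<t} s * (radial_density nu s * w s)\<bar> <= C / (nu - gamma) * t powr (nu - gamma)"
proof -
 let ?g = "%s. indicator {..<t} s * (radial_density (nu - gamma) s * C)"
 have "((%s. s powr (nu - gamma - 1) * C) has_integral (t powr (nu - gamma - 1 + 1) / (nu - gamma - 1 + 1)) * C) {0..t}"
  by (intro has_integral_mult_left has_integral_powr_from_0) (use gamma t in auto)
 then have v: "(LINT s|lborel. ?g s) = C / (nu - gamma) * t powr (nu - gamma)"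
  using cumulative_eq_integral(1)[of "%_. C" "nu - gamma" t] gamma t by (simp add: integral_unique del: integral_mult_left Henstock_Kurzweil_Integration.integral_mult_left)
 moreover have "C / (nu - gamma) * t powr (nu - gamma) > 0" using C gamma t by simp
 ultimately have gi: "integrable lborel ?g" using not_integrable_integral_eq by force
 have le: "AE s in lborel. norm (indicator {..<t} s * (radial_density nu s * w s)) <= ?g s"
  using w
 proof eventually_elim
  case (elim s)
  show ?case
  proof (cases "0 < s \<and> s < t")
   case True
   have "\<bar>s powr (nu - 1) * w s\<bar> <= s powr (nu - 1) * (C * s powr (- gamma))"
    unfolding abs_mult using elim True t by (intro mult_mono) auto
   also have "\<dots> = (s powr (nu - 1) * s powr (- gamma)) * C" by simp
   also have "s powr (nu - 1) * s powr (- gamma) = s powr (nu - gamma - 1)" unfolding powr_add[symmetric] by (simp add: algebra_simps)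
   finally show ?thesis using True by (simp add: radial_density_def)
  qed (use C in \<open>auto simp: indicator_def radial_density_def\<close>)
 qed
 show ?thesis
 proof (cases "integrable lborel (%s. indicator {..<t} s * (radial_density nu s * w s))")
  case True
  have "norm (LINT s|lborel. indicator {..<t} s * (radial_density nu s * w s)) <= (LINT s|lborel. ?g s)"
   by (rule order_trans[OF integral_norm_bound integral_mono_AE[OF integrable_norm[OF True] gi le]])
  then show ?thesis unfolding v by simp
 next
  case False
  then show ?thesis using C gamma by (simp add: not_integrable_integral_eq)
 qed
qed

text \<open>A bounded derivative makes \<open>f\<close> Lipschitz on (0, 1], hence uniformly
  continuous there, and such a function extends continuously to 0.\<close>

lemma bounded_derivative_limit:
 fixes f :: "real => real"
 assumes f: "\<And>s. s > 0 ==> (f has_real_derivative f' s) (at s)" and b: "\<And>s. 0 < s ==> s <= 1 ==> \<bar>f' s\<bar> <= C"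
 shows "\<exists>l. continuous_on {0..} (%s. if s > 0 then f s else l)"
proof -
 have lip: "norm (f x - f y) <= C * norm (x - y)" if "x \<in> {0<..1}" "y \<in> {0<..1}" for x y
  by (rule field_differentiable_bound[of "{0<..1}" f f']) (use that f b in \<open>auto intro: has_field_derivative_at_within\<close>)
 have "uniformly_continuous_on {0<..1} f"
  unfolding uniformly_continuous_on_def
 proof (intro allI impI)
  fix e :: real assume e: "e > 0"
  show "\<exists>d>0. \<forall>x\<in>{0<..1}. \<forall>x'\<in>{0<..1}. dist x' x < d --> dist (f x') (f x) < e"
  proof (intro exI[of _ "e / (\<bar>C\<bar> + 1)"] conjI ballI impI)
   fix x x' :: real assume x: "x \<in> {0<..1}" "x' \<in> {0<..1}" "dist x' x < e / (\<bar>C\<bar> + 1)"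
   have "dist (f x') (f x) <= C * dist x' x" using lip[OF x(2,1)] by (simp add: dist_real_def)
   also have "\<dots> <= (\<bar>C\<bar> + 1) * dist x' x" by (rule mult_right_mono) auto
   also have "\<dots> < e" using x(3) by (simp add: less_divide_eq mult.commute add_nonneg_pos)
   finally show "dist (f x') (f x) < e" .
  qed (use e in \<open>auto intro!: divide_pos_pos\<close>)
 qed
 moreover have "(0::real) \<in> closure {0<..1}" by simp
 ultimately obtain l where l: "(f \<longlongrightarrow> l) (at 0 within {0<..1})"
  by (rule uniformly_continuous_on_extension_at_closure)
 let ?F = "%s. if s > 0 then f s else l"
 have lim: "(?F \<longlongrightarrow> ?F s) (at s within {0..})" if s: "s >= 0" for s
 proof (cases "s = 0")
  case True
  have "at 0 within {0..} = at (0::real) within {0<..1}" by (rule at_within_nhd[of _ "{..<1}"]) auto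
  moreover have "(?F \<longlongrightarrow> l) (at 0 within {0<..1})"
   by (rule Lim_transform_eventually[OF l]) (auto simp: eventually_at_filter)
  ultimately show ?thesis using True by simp
 next
  case False
  then have s0: "s > 0" using s by simp
  have "(?F has_real_derivative f' s) (at s)"
   by (rule has_field_derivative_transform_within_open[OF f[OF s0], of "{0<..}"]) (use s0 in auto)
  then have "isCont ?F s" by (rule DERIV_isCont)
  then have "continuous (at s within {0..}) ?F" by (rule continuous_at_imp_continuous_at_within)
  then show ?thesis by (simp only: continuous_within)
 qed
 have "continuous_on {0..} ?F" unfolding continuous_on_def
 proof
  fix s :: real assume "s \<in> {0..}"
  then show "(?F \<longlongrightarrow> ?F s) (at s within {0..})" by (intro lim) (simp only: atLeast_iff)
 qed
 then show ?thesis by (rule exI)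
qed

text \<open>A priori both components are only O(s^(1-nu)) at 0, the size of the fundamental
  solution. The cumulative integrals contain no additional constant, so a bound of order s^(-gamma)
  on both components gives slopes of the same order, and integration improves the bound. Eventually
  the slopes are bounded and the profiles extend to 0.\<close>

lemma radial_regularity:
 fixes a b P Q :: "real => real"
 assumes nu: "nu = real DIM('a::euclidean_space) / 2" "nu >= 3/2"
  and m [measurable]: "a \<in> bmeas" "b \<in> bmeas" "P \<in> bmeas" "Q \<in> bmeas"
  and PQ: "continuous_on {0..} P" "continuous_on {0..} Q"
  and wa: "radial_weak (%x::'a. a (sq x)) (%x. P (sq x) * b (sq x))"
  and wb: "radial_weak (%x::'a. b (sq x)) (%x. Q (sq x) * a (sq x))"
 shows "\<exists>alpha beta. radial_sol nu alpha (%s. P s * beta s) \<and> radial_sol nu beta (%s. Q s * alpha s) \<and>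
  (AE s in lborel. s > 0 --> a s = alpha s \<and> b s = beta s)"
proof -
 have nu1: "nu >= 1" "nu > 1" using nu by auto
 define K1 where "K1 t = (LINT s|lborel. indicator {..<t} s * (radial_density nu s * (P s * b s)))" for t
 define K2 where "K2 t = (LINT s|lborel. indicator {..<t} s * (radial_density nu s * (Q s * a s)))" for t
 obtain A1 where A1: "\<And>s. s > 0 ==> (A1 has_real_derivative - (1/4) * (s powr (- nu) * K1 s)) (at s)" "AE s in lborel. s > 0 --> a s = A1 s"
  using radial_ode[of a "%s. P s * b s", OF _ _ wa nu(1) nu1(1)] unfolding K1_def[abs_def] by auto
 obtain B1 where B1: "\<And>s. s > 0 ==> (B1 has_real_derivative - (1/4) * (s powr (- nu) * K2 s)) (at s)" "AE s in lborel. s > 0 --> b s = B1 s"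
  using radial_ode[of b "%s. Q s * a s", OF _ _ wb nu(1) nu1(1)] unfolding K2_def[abs_def] by auto
 have "\<exists>M. \<forall>s\<in>{0..1}. \<bar>R s\<bar> <= M" if "continuous_on {0..} R" for R :: "real => real"
 proof -
  have "continuous_on {0..1} R" by (rule continuous_on_subset[OF that]) auto
  then have "bounded (R ` {0..1})" by (intro compact_imp_bounded compact_continuous_image) auto
  then show ?thesis unfolding bounded_iff by simp
 qed
 from this[OF PQ(1)] this[OF PQ(2)] obtain M1 M2 where M12: "\<And>s. 0 <= s ==> s <= 1 ==> \<bar>P s\<bar> <= M1" "\<And>s. 0 <= s ==> s <= 1 ==> \<bar>Q s\<bar> <= M2" by fastforce
 define M where "M = \<bar>M1\<bar> + \<bar>M2\<bar> + 1"
 have M0: "M > 0" unfolding M_def by linarith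
 have M: "\<bar>P s\<bar> <= M" "\<bar>Q s\<bar> <= M" if "0 <= s" "s <= 1" for s using M12[OF that] unfolding M_def by linarith+
 define bnd where "bnd gamma \<longleftrightarrow> (\<exists>C>0. \<forall>s. 0 < s --> s <= 1 --> \<bar>A1 s\<bar> <= C * s powr (- gamma) \<and> \<bar>B1 s\<bar> <= C * s powr (- gamma))" for gamma
 have combine: "bnd gamma'" if K: "\<And>s. 0 < s ==> s <= 1 ==> s powr (- nu) * \<bar>K1 s\<bar> <= D * s powr (- kappa)"
   "\<And>s. 0 < s ==> s <= 1 ==> s powr (- nu) * \<bar>K2 s\<bar> <= D * s powr (- kappa)" and kappa: "kappa \<noteq> 1" "0 <= gamma'" "kappa - 1 <= gamma'" for D kappa gamma'
 proof -
  have 1: "\<bar>- (1/4) * (s powr (- nu) * K1 s)\<bar> <= D / 4 * s powr (- kappa)" if "0 < s" "s <= 1" for s using K(1)[OF that] by (simp add: abs_mult)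
  have 2: "\<bar>- (1/4) * (s powr (- nu) * K2 s)\<bar> <= D / 4 * s powr (- kappa)" if "0 < s" "s <= 1" for s using K(2)[OF that] by (simp add: abs_mult)
  obtain D1 where D1: "D1 > 0" "\<And>s. 0 < s ==> s <= 1 ==> \<bar>A1 s\<bar> <= D1 * s powr (- gamma')"
   using powr_deriv_bound[OF A1(1) 1 kappa] by blast
  obtain D2 where D2: "D2 > 0" "\<And>s. 0 < s ==> s <= 1 ==> \<bar>B1 s\<bar> <= D2 * s powr (- gamma')"
   using powr_deriv_bound[OF B1(1) 2 kappa] by blast
  show ?thesis unfolding bnd_def
  proof (intro exI[of _ "D1 + D2"] conjI allI impI)
   fix s :: real assume s: "0 < s" "s <= 1"
   have "D1 * s powr (- gamma') <= (D1 + D2) * s powr (- gamma')" "D2 * s powr (- gamma') <= (D1 + D2) * s powr (- gamma')"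
    using D1 D2 by (auto intro!: mult_right_mono)
   then show "\<bar>A1 s\<bar> <= (D1 + D2) * s powr (- gamma')" "\<bar>B1 s\<bar> <= (D1 + D2) * s powr (- gamma')" using D1(2)[OF s] D2(2)[OF s] by linarith+
  qed (use D1 D2 in simp)
 qed
 have Kstep: "\<exists>D. \<forall>s. 0 < s --> s <= 1 --> s powr (- nu) * \<bar>K1 s\<bar> <= D * s powr (- gamma) \<and> s powr (- nu) * \<bar>K2 s\<bar> <= D * s powr (- gamma)"
  if b: "bnd gamma" and gamma: "0 <= gamma" "gamma <= nu - 1" for gamma
 proof -
  obtain C where C: "C > 0" "\<And>s. 0 < s ==> s <= 1 ==> \<bar>A1 s\<bar> <= C * s powr (- gamma)" "\<And>s. 0 < s ==> s <= 1 ==> \<bar>B1 s\<bar> <= C * s powr (- gamma)"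
   using b unfolding bnd_def by blast
  have a1: "AE s in lborel. 0 < s --> s <= 1 --> \<bar>P s * b s\<bar> <= M * C * s powr (- gamma)"
   using B1(2)
  proof eventually_elim
   case (elim s)
   show ?case
   proof (intro impI)
    assume s: "0 < s" "s <= 1"
    have "\<bar>P s\<bar> * \<bar>B1 s\<bar> <= M * (C * s powr (- gamma))" by (intro mult_mono M C) (use s M0 in auto)
    then show "\<bar>P s * b s\<bar> <= M * C * s powr (- gamma)" using elim s by (simp add: abs_mult)
   qed
  qed
  have a2: "AE s in lborel. 0 < s --> s <= 1 --> \<bar>Q s * a s\<bar> <= M * C * s powr (- gamma)"
   using A1(2)
  proof eventually_elim
   case (elim s)
   show ?case
   proof (intro impI)
    assume s: "0 < s" "s <= 1"
    have "\<bar>Q s\<bar> * \<bar>A1 s\<bar> <= M * (C * s powr (- gamma))" by (intro mult_mono M C) (use s M0 in auto)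
    then show "\<bar>Q s * a s\<bar> <= M * C * s powr (- gamma)" using elim s by (simp add: abs_mult)
   qed
  qed
  have e: "s powr (- nu) * (M * C / (nu - gamma) * s powr (nu - gamma)) = M * C / (nu - gamma) * s powr (- gamma)" if "s > 0" for s
  proof -
   have "s powr (- nu) * s powr (nu - gamma) = s powr (- gamma)" unfolding powr_add[symmetric] by simp
   then show ?thesis by (subst mult.left_commute) (simp only:)
  qed
  show ?thesis
  proof (intro exI[of _ "M * C / (nu - gamma)"] allI impI conjI)
   fix s :: real assume s: "0 < s" "s <= 1"
   show "s powr (- nu) * \<bar>K1 s\<bar> <= M * C / (nu - gamma) * s powr (- gamma)"
    unfolding e[OF s(1), symmetric] K1_def by (intro mult_left_mono cumulative_powr_bound a1) (use gamma M0 C s in auto)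
   show "s powr (- nu) * \<bar>K2 s\<bar> <= M * C / (nu - gamma) * s powr (- gamma)"
    unfolding e[OF s(1), symmetric] K2_def by (intro mult_left_mono cumulative_powr_bound a2) (use gamma M0 C s in auto)
  qed
 qed
 have step: "bnd gamma'" if b: "bnd gamma" and gamma: "0 <= gamma" "gamma <= nu - 1" and kappa: "gamma <= kappa" "kappa \<noteq> 1" "0 <= gamma'" "kappa - 1 <= gamma'" for gamma kappa gamma'
 proof -
  obtain D where D: "\<And>s. 0 < s ==> s <= 1 ==> s powr (- nu) * \<bar>K1 s\<bar> <= D * s powr (- gamma)" "\<And>s. 0 < s ==> s <= 1 ==> s powr (- nu) * \<bar>K2 s\<bar> <= D * s powr (- gamma)"
   using Kstep[OF b gamma] by blast
  have D': "D * s powr (- gamma) <= \<bar>D\<bar> * s powr (- kappa)" if "0 < s" "s <= 1" for s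
   by (intro mult_mono powr_mono') (use that kappa in auto)
  show ?thesis by (rule combine[of "\<bar>D\<bar>" kappa]) (use order_trans[OF D(1) D'] order_trans[OF D(2) D'] kappa in auto)
 qed
 have start: "bnd (nu - 1)"
 proof -
  have l: "integrable lborel (%s. indicator {..1} s * (radial_density nu s * (P s * b s)))"
   "integrable lborel (%s. indicator {..1} s * (radial_density nu s * (Q s * a s)))"
   using radial_weak_locint(2)[OF wa] radial_weak_locint(2)[OF wb] by (auto intro!: locint_radial[OF _ _ nu(1)])
  have gen: "\<bar>LINT s|lborel. indicator {..<t} s * w s\<bar> <= (LINT s|lborel. \<bar>indicator {..1} s * w s\<bar>)"
   if [measurable]: "w \<in> bmeas" and i: "integrable lborel (%s. indicator {..1} s * w s)" and t: "t <= 1" for w :: "real => real" and t :: real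
  proof -
   have le: "AE s in lborel. norm (indicator {..<t} s * w s) <= \<bar>indicator {..1} s * w s\<bar>" using t by (auto simp: indicator_def)
   have i': "integrable lborel (%s. indicator {..<t} s * w s)"
    by (rule Bochner_Integration.integrable_bound[OF i]) (use le in auto)
   show ?thesis using order_trans[OF integral_norm_bound integral_mono_AE[OF integrable_norm[OF i'] integrable_abs[OF i] le]] by simp
  qed
  define D where "D = max (LINT s|lborel. \<bar>indicator {..1} s * (radial_density nu s * (P s * b s))\<bar>) (LINT s|lborel. \<bar>indicator {..1} s * (radial_density nu s * (Q s * a s))\<bar>)"
  have "\<bar>K1 t\<bar> <= D" "\<bar>K2 t\<bar> <= D" if "t <= 1" for t
   using gen[OF _ l(1) that] gen[OF _ l(2) that] unfolding K1_def K2_def D_def by (auto simp: le_max_iff_disj)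
  then show ?thesis
   by (intro combine[of D nu]) (use nu1 in \<open>auto simp: mult.commute[of D] intro!: mult_left_mono\<close>)
 qed
 \<comment> \<open>Each round is charged with a gain of only 1/2, down to the floor 1/4; one more
   round leads from 1/4 to 0. The slack leaves room to keep the slope exponent away from 1, whose
   integral is logarithmic.\<close>
 have iter: "bnd (max (nu - 1 - real k / 2) (1/4))" for k
 proof (induction k)
  case 0 then show ?case using start nu(2) by (simp add: max_def)
 next
  case (Suc k)
  define x where "x = nu - 1 - real k / 2"
  have eq: "nu - 1 - real (Suc k) / 2 = x - 1/2" and x: "x <= nu - 1" by (simp_all add: x_def field_simps)
  have "bnd (max x (1/4))" using Suc by (simp only: x_def)
  \<comment> \<open>The slope exponent gamma + 1/2 hits 1 only for gamma = 1/2; there 3/4 is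
    used.\<close>
  then show ?case unfolding eq
   by (rule step[of "max x (1/4)" "if max x (1/4) = 1/2 then 3/4 else max x (1/4) + 1/2"]) (use nu(2) x in \<open>auto simp: max_def\<close>)
 qed
 obtain k :: nat where "real k > 2 * nu" using reals_Archimedean2 by blast
 then have e: "max (nu - 1 - real k / 2) (1/4) = 1/4" by simp
 have "bnd (1/4)" using iter[of k] unfolding e .
 then have "bnd 0" by (rule step[of _ "1/4"]) (use nu(2) in auto)
 then obtain D where D: "\<And>s. 0 < s ==> s <= 1 ==> s powr (- nu) * \<bar>K1 s\<bar> <= D * s powr (- 0)" "\<And>s. 0 < s ==> s <= 1 ==> s powr (- nu) * \<bar>K2 s\<bar> <= D * s powr (- 0)"
  using Kstep[of 0] nu1 by auto
 have "\<bar>- (1/4) * (s powr (- nu) * K1 s)\<bar> <= D" if "0 < s" "s <= 1" for s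
 proof -
  have "0 <= s powr (- nu) * \<bar>K1 s\<bar>" "s powr (- nu) * \<bar>K1 s\<bar> <= D" using D(1)[OF that] that by simp_all
  then have "s powr (- nu) * \<bar>K1 s\<bar> <= D * 4" by linarith
  then show ?thesis by (simp add: abs_mult)
 qed
 from bounded_derivative_limit[OF A1(1) this] obtain l1 where l1: "continuous_on {0..} (%s. if s > 0 then A1 s else l1)" by auto
 have "\<bar>- (1/4) * (s powr (- nu) * K2 s)\<bar> <= D" if "0 < s" "s <= 1" for s
 proof -
  have "0 <= s powr (- nu) * \<bar>K2 s\<bar>" "s powr (- nu) * \<bar>K2 s\<bar> <= D" using D(2)[OF that] that by simp_all
  then have "s powr (- nu) * \<bar>K2 s\<bar> <= D * 4" by linarith
  then show ?thesis by (simp add: abs_mult)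
 qed
 from bounded_derivative_limit[OF B1(1) this] obtain l2 where l2: "continuous_on {0..} (%s. if s > 0 then B1 s else l2)" by auto
 define alpha where "alpha s = (if s > 0 then A1 s else l1)" for s
 define beta where "beta s = (if s > 0 then B1 s else l2)" for s
 have c: "continuous_on {0..} alpha" "continuous_on {0..} beta" using l1 l2 unfolding alpha_def[abs_def] beta_def[abs_def] by auto
 have ae: "AE s in lborel. s > 0 --> a s = alpha s \<and> b s = beta s"
  using A1(2) B1(2) by eventually_elim (auto simp: alpha_def beta_def)
 have cum: "(LINT s|lborel. indicator {..<t} s * (radial_density nu s * (R s * w s))) = integral {0..t} (%s. s powr (nu - 1) * (R s * omega s))"
  if t: "t > 0" and R: "continuous_on {0..} R" "R \<in> bmeas" and w: "w \<in> bmeas" and omega: "continuous_on {0..} omega" and e: "AE s in lborel. s > 0 --> w s = omega s" for t and R w omega :: "real => real"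
 proof -
  have [measurable]: "R \<in> bmeas" "w \<in> bmeas" by fact+
  define omega' where "omega' s = omega (max 0 s)" for s
  have "continuous_on UNIV omega'" unfolding omega'_def[abs_def] by (rule continuous_on_compose2[OF omega]) (auto intro!: continuous_intros)
  then have [measurable]: "omega' \<in> bmeas" by (rule borel_measurable_continuous_onI)
  have "(LINT s|lborel. indicator {..<t} s * (radial_density nu s * (R s * w s))) = (LINT s|lborel. indicator {..<t} s * (radial_density nu s * (R s * omega' s)))"
  proof (rule integral_cong_AE)
   show "AE s in lborel. indicator {..<t} s * (radial_density nu s * (R s * w s)) = indicator {..<t} s * (radial_density nu s * (R s * omega' s))"
    using e by eventually_elim (auto simp: radial_density_def omega'_def)
  qed auto
  also have "\<dots> = integral {0..t} (%s. s powr (nu - 1) * (R s * omega' s))"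
  proof (rule cumulative_eq_integral(1)[OF _ nu1(1)])
   show "continuous_on {0..} (%s. R s * omega' s)"
    by (intro continuous_on_mult R continuous_on_subset[OF \<open>continuous_on UNIV omega'\<close>]) auto
  qed (use t in simp)
  also have "\<dots> = integral {0..t} (%s. s powr (nu - 1) * (R s * omega s))" by (rule Henstock_Kurzweil_Integration.integral_cong) (auto simp: omega'_def)
  finally show ?thesis .
 qed
 have "radial_sol nu alpha (%s. P s * beta s)"
  unfolding radial_sol_def
 proof (intro conjI allI impI)
  show "continuous_on {0..} (%s. P s * beta s)" by (intro continuous_on_mult PQ c)
  fix s :: real assume s: "s > 0"
  have k: "K1 s = integral {0..s} (%t. t powr (nu - 1) * (P t * beta t))"
   unfolding K1_def by (rule cum[OF s PQ(1) m(3,2) c(2)]) (use ae in auto)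
  show "(alpha has_real_derivative - (1/4) * (s powr (- nu) * integral {0..s} (%t. t powr (nu - 1) * (P t * beta t)))) (at s)"
   unfolding k[symmetric] by (rule has_field_derivative_transform_within_open[OF A1(1)[OF s], of "{0<..}"]) (use s in \<open>auto simp: alpha_def\<close>)
 qed (rule c)
 moreover have "radial_sol nu beta (%s. Q s * alpha s)"
  unfolding radial_sol_def
 proof (intro conjI allI impI)
  show "continuous_on {0..} (%s. Q s * alpha s)" by (intro continuous_on_mult PQ c)
  fix s :: real assume s: "s > 0"
  have k: "K2 s = integral {0..s} (%t. t powr (nu - 1) * (Q t * alpha t))"
   unfolding K2_def by (rule cum[OF s PQ(2) m(4,1) c(1)]) (use ae in auto)
  show "(beta has_real_derivative - (1/4) * (s powr (- nu) * integral {0..s} (%t. t powr (nu - 1) * (Q t * alpha t)))) (at s)"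
   unfolding k[symmetric] by (rule has_field_derivative_transform_within_open[OF B1(1)[OF s], of "{0<..}"]) (use s in \<open>auto simp: beta_def\<close>)
 qed (rule c)
 ultimately show ?thesis using ae by blast
qed

section \<open>The ground state in space\<close>

text \<open>The bridge from the given notions, which use the Lebesgue completion, to Borel
  representatives and \<open>lborel\<close>, where Fubini and measurability are convenient. The
  bounded support of the test functions makes all integrals finite.\<close>

lemma weak_neg_laplacian_radial_weak:
 fixes u f u' f' :: "real^'n::finite => real"
 assumes w: "weak_neg_laplacian u f" and m: "u' \<in> bmeas" "f' \<in> bmeas"
  and eq: "AE x in lebesgue. u x = u' x" "AE x in lebesgue. f x = f' x"
 shows "radial_weak u' f'"
proof -
 have li: "loc_integrable u" "loc_integrable f" using w by (auto simp: weak_neg_laplacian_def)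
 have key: "integrable lborel (%x. g' x * w x) \<and> (LINT x|lebesgue. g x * w x) = (LINT x|lborel. g' x * w x)"
  if g: "loc_integrable g" and g': "g' \<in> bmeas" and e: "AE x in lebesgue. g x = g' x"
   and w: "w \<in> bmeas" "\<And>x. \<bar>w x\<bar> <= M" "\<And>x. norm x >= R ==> w x = 0" for g g' w :: "real^'n => real" and M R
 proof -
  have wl: "w \<in> borel_measurable lebesgue" using w(1) by (intro measurable_completion) simp
  have i: "integrable lebesgue (%x. g x * w x)" by (rule loc_integrable_mult_compact[OF g wl w(2,3)])
  have [measurable]: "g' \<in> bmeas" "w \<in> bmeas" by fact+
  have pm: "(%x. g' x * w x) \<in> borel_measurable lborel" by simp
  have e': "AE x in lebesgue. g x * w x = g' x * w x" using e by eventually_elim simp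
  have i': "integrable lebesgue (%x. g' x * w x)"
   using integrable_cong_AE[OF borel_measurable_integrable[OF i] measurable_completion[OF pm] e'] i by simp
  have "(LINT x|lebesgue. g x * w x) = (LINT x|lebesgue. g' x * w x)"
   by (rule integral_cong_AE[OF borel_measurable_integrable[OF i] measurable_completion[OF pm] e'])
  then show ?thesis using i' pm by (simp add: integrable_completion integral_completion)
 qed
 have lo: "locint g'" if "loc_integrable g" "g' \<in> bmeas" "AE x in lebesgue. g x = g' x" for g g' :: "real^'n => real"
  unfolding locint_def
 proof (intro conjI allI)
  fix R
  have "integrable lborel (%x. g' x * indicator (ball 0 R) x)"
   using key[OF that borel_measurable_indicator[OF borel_open[OF open_ball]], of 0 R 1 R] by (auto simp: indicator_def)
  then show "integrable lborel (%x. indicator (ball 0 R) x * g' x)" by (simp add: mult.commute)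
 qed (rule that)
 show ?thesis unfolding radial_weak_def
 proof (intro conjI allI impI)
  show "locint u'" by (rule lo[OF li(1) m(1) eq(1)])
  show "locint f'" by (rule lo[OF li(2) m(2) eq(2)])
  fix h :: "real => real" and S :: real and z :: "real^'n" assume h: "smooth h" "\<forall>s\<ge>S. h s = 0"
  define eta where "eta x = h ((x - z) \<bullet> (x - z))" for x
  have t: "test_function eta" unfolding eta_def[abs_def] by (rule test_function_radial) (use h in auto)
  have lap: "laplacian eta x = 4 * ((x - z) \<bullet> (x - z)) * deriv (deriv h) ((x - z) \<bullet> (x - z)) + 2 * real DIM(real^'n) * deriv h ((x - z) \<bullet> (x - z))" for x
   unfolding eta_def[abs_def] laplacian_radial[OF h(1)] by simp
  obtain M R where MR: "\<And>x. \<bar>eta x\<bar> <= M" "\<And>x. \<bar>laplacian eta x\<bar> <= M" "\<And>x. norm x >= R ==> eta x = 0" "\<And>x. norm x >= R ==> laplacian eta x = 0"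
   using test_function_bounded(3)[OF t] by blast
  have mm: "eta \<in> bmeas" "laplacian eta \<in> bmeas"
   using test_function_bounded(1,2)[OF t] by (auto intro: borel_measurable_continuous_onI)
  have 1: "(LINT x|lebesgue. u x * laplacian eta x) = (LINT x|lborel. u' x * laplacian eta x)"
   using key[OF li(1) m(1) eq(1) mm(2) MR(2,4)] by simp
  have 2: "(LINT x|lebesgue. f x * eta x) = (LINT x|lborel. f' x * eta x)"
   using key[OF li(2) m(2) eq(2) mm(1) MR(1,3)] by simp
  have w': "- (LINT x|lborel. u' x * laplacian eta x) = (LINT x|lborel. f' x * eta x)"
   using w t unfolding 1[symmetric] 2[symmetric] by (auto simp: weak_neg_laplacian_def)
  have [measurable]: "u' \<in> bmeas" "f' \<in> bmeas" "eta \<in> bmeas" "laplacian eta \<in> bmeas"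
   by (fact m mm)+
  have 3: "(LINT x|lborel. u' (z + x) * (4 * (sq x) * deriv (deriv h) (sq x) + 2 * real DIM(real^'n) * deriv h (sq x))) = (LINT x|lborel. u' x * laplacian eta x)"
  proof -
   have "(%x. u' x * laplacian eta x) \<in> bmeas" by measurable
   from integral_shift[OF this, of z] show ?thesis by (simp add: lap add.commute)
  qed
  have 4: "(LINT x|lborel. f' (z + x) * h (sq x)) = (LINT x|lborel. f' x * eta x)"
  proof -
   have "(%x. f' x * eta x) \<in> bmeas" by measurable
   from integral_shift[OF this, of z] show ?thesis by (simp add: eta_def add.commute)
  qed
  show "(LINT x|lborel. u' (z + x) * (4 * (sq x) * deriv (deriv h) (sq x) + 2 * real DIM(real^'n) * deriv h (sq x))) = - (LINT x|lborel. f' (z + x) * h (sq x))"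
   unfolding 3 4 w'[symmetric] by simp
 qed
qed

lemma radial_weak_radial_sol:
 fixes a b :: "real => real"
 assumes ac: "continuous_on UNIV a" and bc: "continuous_on UNIV b"
  and w: "radial_weak (%x::'a::euclidean_space. a (sq x)) (%x. b (sq x))" and nu: "nu = real DIM('a) / 2" "nu >= 1"
 shows "radial_sol nu a b"
proof -
 have c: "continuous_on {0..} a" "continuous_on {0..} b" using ac bc continuous_on_subset by blast+
 have m: "a \<in> bmeas" "b \<in> bmeas" using ac bc by (auto intro: borel_measurable_continuous_onI)
 show ?thesis unfolding radial_sol_def
 proof (intro conjI c allI impI)
  fix s :: real assume s: "s > 0"
  show "(a has_real_derivative - (1 / 4) * (s powr - nu * integral {0..s} (%t. t powr (nu - 1) * b t))) (at s)"
   using radial_ode_continuous[OF m w nu c(1) s] cumulative_eq_integral(1)[OF c(2) nu(2), of s] s by simp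
 qed
qed

text \<open>The profile is read off along a coordinate axis. The last conjunct lets pointwise
  properties of \<open>U\<close> such as positivity pass to the profile at every nonnegative
  argument.\<close>

lemma radially_symmetric_profile:
 fixes U :: "real^'n::finite => real"
 assumes "continuous_on UNIV U" "radially_symmetric U"
 shows "\<exists>u. continuous_on UNIV u \<and> (\<forall>x. U x = u (sq x)) \<and> (\<forall>s\<ge>0. \<exists>x::real^'n. x \<bullet> x = s)"
proof -
 fix k :: 'n
 let ?u = "%s. U (sqrt s *\<^sub>R axis k 1)"
 have "continuous_on UNIV ?u" by (rule continuous_on_compose2[OF assms(1)]) (auto intro!: continuous_intros)
 moreover have "U x = ?u (sq x)" for x
 proof -
  have "norm (sqrt (sq x) *\<^sub>R axis k (1::real) :: real^'n) = norm x"
   by (simp add: norm_axis_1 flip: norm_eq_sqrt_inner)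
  then show ?thesis using assms(2) unfolding radially_symmetric_def by metis
 qed
 moreover have "\<exists>x::real^'n. x \<bullet> x = s" if "s >= 0" for s
  using that by (intro exI[of _ "sqrt s *\<^sub>R axis k 1"]) (simp add: inner_axis_axis mult.assoc[symmetric])
 ultimately show ?thesis by blast
qed

text \<open>The weak equations become radial ones; their positive right-hand sides make the profiles
  decreasing, and monotonicity turns membership in \<open>D2\<close> into the pointwise
  rates.\<close>

lemma ground_state_emden:
 fixes U V :: "real^'n::finite => real"
 assumes n: "CARD('n) >= 3" and pq: "p > 0" "q > 0" and hyp: "1 / (p + 1) + 1 / (q + 1) = (real CARD('n) - 2) / real CARD('n)"
  and gs: "positive_ground_state p q U V" and r: "radially_symmetric U" "radially_symmetric V"
 shows "\<exists>u v. emden p q (real CARD('n) / 2) u v \<and> continuous_on UNIV u \<and> continuous_on UNIV v \<and>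
  (\<forall>x. U x = u (sq x)) \<and> (\<forall>x. V x = v (sq x))"
proof -
 define nu where "nu = real CARD('n) / 2"
 have nu: "nu > 1" "nu >= 1" "nu = real DIM(real^'n) / 2" using n by (auto simp: nu_def)
 have c: "continuous_on UNIV U" "continuous_on UNIV V" using gs by (auto simp: positive_ground_state_def)
 obtain u where u: "continuous_on UNIV u" "\<And>x. U x = u (sq x)" and onto: "\<And>s. s >= 0 ==> \<exists>x::real^'n. x \<bullet> x = s"
  using radially_symmetric_profile[OF c(1) r(1)] by blast
 obtain v where v: "continuous_on UNIV v" "\<And>x. V x = v (sq x)"
  using radially_symmetric_profile[OF c(2) r(2)] by blast
 have pos: "u s > 0" "v s > 0" if s: "s >= 0" for s
 proof -
  obtain x :: "real^'n" where x: "x \<bullet> x = s" using onto[OF s] by blast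
  have "U x > 0" "V x > 0" using gs by (simp_all add: positive_ground_state_def)
  then show "u s > 0" "v s > 0" unfolding u(2) v(2) x .
 qed
 \<comment> \<open>Freezing the profiles at their value at 0 for negative arguments makes them
   positive and continuous on the whole line.\<close>
 define u' where "u' s = u (max 0 s)" for s
 define v' where "v' s = v (max 0 s)" for s
 have c': "continuous_on UNIV u'" "continuous_on UNIV v'" unfolding u'_def[abs_def] v'_def[abs_def]
  by (rule continuous_on_compose2[OF u(1)] continuous_on_compose2[OF v(1)]; auto intro!: continuous_intros)+
 have U': "U = (%x. u' (sq x))" and V': "V = (%x. v' (sq x))" using u(2) v(2) by (auto simp: u'_def v'_def)
 have pos': "u' s > 0" "v' s > 0" for s unfolding u'_def v'_def using pos by auto
 have cp: "continuous_on UNIV (%s. u' s powr r)" "continuous_on UNIV (%s. v' s powr r)" for r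
  using pos' c' by (auto intro!: continuous_on_powr continuous_on_const simp: less_imp_neq[THEN not_sym])
 have wl: "weak_neg_laplacian (%x. u' (sq x)) (%x::real^'n. v' (sq x) powr p)" "weak_neg_laplacian (%x. v' (sq x)) (%x::real^'n. u' (sq x) powr q)"
  using gs unfolding positive_ground_state_def U' V' by auto
 have bm: "(%x::real^'n. w (sq x)) \<in> bmeas" if "continuous_on UNIV w" for w :: "real => real"
  by (intro borel_measurable_continuous_onI continuous_on_compose2[OF that]) (auto intro!: continuous_intros)
 have su: "radial_sol nu u' (%s. v' s powr p)"
  by (rule radial_weak_radial_sol[OF c'(1) cp(2) _ nu(3,2)])
   (rule weak_neg_laplacian_radial_weak[OF wl(1) bm[OF c'(1)] bm[OF cp(2)[of p]]]; simp)
 have sv: "radial_sol nu v' (%s. u' s powr q)"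
  by (rule radial_weak_radial_sol[OF c'(2) cp(1) _ nu(3,2)])
   (rule weak_neg_laplacian_radial_weak[OF wl(2) bm[OF c'(2)] bm[OF cp(1)[of q]]]; simp)
 have c0: "continuous_on {0..} u'" "continuous_on {0..} v'" using c' continuous_on_subset by blast+
 have pp: "v' t powr p > 0" "u' t powr q > 0" for t using pos'(1)[of t] pos'(2)[of t] by simp_all
 have dec: "u' t <= u' r" "v' t <= v' r" if "0 <= r" "r <= t" for r t
  by (rule radial_sol_decreasing[OF su pp(1) nu(1) that], rule radial_sol_decreasing[OF sv pp(2) nu(1) that])
 have dv: "((%t. v' t * t powr (nu / (p + 1))) \<longlongrightarrow> 0) at_top"
 proof -
  have D: "(%x. u' (sq x)) \<in> (D2 ((p + 1) / p) :: (real^'n => real) set)" using gs unfolding positive_ground_state_def U' by auto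
  have conj: "(p + 1) / p > 1" "p + 1 > 1" "1 / ((p + 1) / p) + 1 / (p + 1) = 1" using pq by (simp_all add: field_simps)
  obtain g where g: "Lp_fun ((p + 1) / p) g" "\<And>eta::real^'n => real. test_function eta ==> integrable lebesgue (%x. g x * eta x) \<and>
    (LINT x|lebesgue. v' (sq x) powr p * eta x) = - (LINT x|lebesgue. g x * eta x)"
   using D2_weak_laplacian[OF conj D wl(1)] by blast
  show ?thesis by (rule finite_energy_decay[OF pq(1) refl nu_def refl c0(2) pos'(2) dec(2) g])
 qed
 have du: "((%t. u' t * t powr (nu / (q + 1))) \<longlongrightarrow> 0) at_top"
 proof -
  have D: "(%x. v' (sq x)) \<in> (D2 ((q + 1) / q) :: (real^'n => real) set)" using gs unfolding positive_ground_state_def V' by auto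
  have conj: "(q + 1) / q > 1" "q + 1 > 1" "1 / ((q + 1) / q) + 1 / (q + 1) = 1" using pq by (simp_all add: field_simps)
  obtain g where g: "Lp_fun ((q + 1) / q) g" "\<And>eta::real^'n => real. test_function eta ==> integrable lebesgue (%x. g x * eta x) \<and>
    (LINT x|lebesgue. u' (sq x) powr q * eta x) = - (LINT x|lebesgue. g x * eta x)"
   using D2_weak_laplacian[OF conj D wl(2)] by blast
  show ?thesis by (rule finite_energy_decay[OF pq(2) refl nu_def refl c0(1) pos'(1) dec(1) g])
 qed
 have "1 / (p + 1) + 1 / (q + 1) = (nu - 1) / nu" unfolding hyp nu_def using n by (simp add: field_simps)
 from emden.intro[OF pq nu(1) this su sv pos' du dv] have "emden p q nu u' v'" .
 then show ?thesis unfolding nu_def[symmetric] by (intro exI[of _ u'] exI[of _ v'] conjI allI c') (simp_all only: U' V')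
qed

text \<open>Difference quotients of the equation converge because only compactly supported weights occur.\<close>
lemma radial_weak_partial_deriv:
 fixes f F :: "real^'n::finite => real"
 assumes w: "radial_weak f F" and f: "f differentiable_on UNIV" "continuous_on UNIV (partial_deriv i f)"
  and F: "F differentiable_on UNIV" "continuous_on UNIV (partial_deriv i F)"
 shows "radial_weak (partial_deriv i f) (partial_deriv i F)"
 unfolding radial_weak_def
proof (intro conjI allI impI)
 show "locint (partial_deriv i f)" "locint (partial_deriv i F)" using f F by (auto intro: locint_continuous)
 fix h :: "real => real" and S :: real and z :: "real^'n" assume h: "smooth h" "\<forall>s\<ge>S. h s = 0"
 define w1 where "w1 x = 4 * (sq x) * deriv (deriv h) (sq x) + 2 * real DIM(real^'n) * deriv h (sq x)" for x :: "real^'n"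
 define w2 where "w2 x = h (sq x)" for x :: "real^'n"
 have "test_function (%x::real^'n. h ((x - 0) \<bullet> (x - 0)))" by (rule test_function_radial) (use h in auto)
 then have t: "test_function w2" unfolding w2_def[abs_def] by simp
 have lap: "laplacian w2 = w1"
  using laplacian_radial[OF h(1), where z="0::real^'n"] unfolding w2_def[abs_def] w1_def[abs_def] by (simp add: fun_eq_iff)
 obtain M R where MR: "\<And>x. norm x >= R ==> w2 x = 0" "\<And>x. norm x >= R ==> w1 x = 0"
  using test_function_bounded(3)[OF t] unfolding lap by blast
 have wc: "continuous_on UNIV w2" "continuous_on UNIV w1" using test_function_bounded(1,2)[OF t] unfolding lap by auto
 have l1: "(%k. LINT x|lborel. (f (z + x + (1 / (real k + 1)) *\<^sub>R axis i 1) - f (z + x)) * (real k + 1) * w1 x)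
   \<longlonglongrightarrow> (LINT x|lborel. partial_deriv i f (z + x) * w1 x)" by (rule difference_quotient_limit[OF f wc(2) MR(2)])
 have l2: "(%k. LINT x|lborel. (F (z + x + (1 / (real k + 1)) *\<^sub>R axis i 1) - F (z + x)) * (real k + 1) * w2 x)
   \<longlonglongrightarrow> (LINT x|lborel. partial_deriv i F (z + x) * w2 x)" by (rule difference_quotient_limit[OF F wc(1) MR(1)])
 have i1: "integrable lborel (%x. f (y + x) * w1 x)" for y
  unfolding w1_def by (rule radial_test_integrable(2)[OF radial_weak_locint(1)[OF w] h])
 have i2: "integrable lborel (%x. F (y + x) * w2 x)" for y
  unfolding w2_def by (rule radial_test_integrable(1)[OF radial_weak_locint(2)[OF w] h])
 have id: "(LINT x|lborel. f (y + x) * w1 x) = - (LINT x|lborel. F (y + x) * w2 x)" for y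
  using w h unfolding radial_weak_def w1_def w2_def by blast
 have split: "(LINT x|lborel. (g (z + x + y) - g (z + x)) * c * w x) = c * ((LINT x|lborel. g (z + y + x) * w x) - (LINT x|lborel. g (z + x) * w x))"
  if i: "\<And>y. integrable lborel (%x. g (y + x) * w x)" for g w :: "real^'n => real" and y c
 proof -
  have "(g (z + x + y) - g (z + x)) * c * w x = c * (g (z + y + x) * w x - g (z + x) * w x)" for x
   by (simp add: algebra_simps)
  then have "(LINT x|lborel. (g (z + x + y) - g (z + x)) * c * w x) = (LINT x|lborel. c * (g (z + y + x) * w x - g (z + x) * w x))" by (simp only:)
  also have "\<dots> = c * ((LINT x|lborel. g (z + y + x) * w x) - (LINT x|lborel. g (z + x) * w x))"
   using i by simp
  finally show ?thesis .
 qed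
 have "(LINT x|lborel. (f (z + x + (1 / (real k + 1)) *\<^sub>R axis i 1) - f (z + x)) * (real k + 1) * w1 x) =
  - (LINT x|lborel. (F (z + x + (1 / (real k + 1)) *\<^sub>R axis i 1) - F (z + x)) * (real k + 1) * w2 x)" for k
  unfolding split[OF i1] split[OF i2] id by (simp add: algebra_simps)
 then have "(%k. LINT x|lborel. (f (z + x + (1 / (real k + 1)) *\<^sub>R axis i 1) - f (z + x)) * (real k + 1) * w1 x)
   \<longlonglongrightarrow> - (LINT x|lborel. partial_deriv i F (z + x) * w2 x)"
  using tendsto_minus[OF l2] by simp
 from LIMSEQ_unique[OF l1 this]
 show "(LINT x|lborel. partial_deriv i f (z + x) * (4 * (sq x) * deriv (deriv h) (sq x) + 2 * real DIM(real^'n) * deriv h (sq x))) =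
  - (LINT x|lborel. partial_deriv i F (z + x) * h (sq x))" unfolding w1_def w2_def .
qed

lemma tendsto_vanishes:
 fixes f :: "'a::euclidean_space => real"
 assumes f: "(f \<longlongrightarrow> 0) at_infinity" shows "vanishes f"
 unfolding vanishes_def
proof (intro allI impI)
 fix e :: real assume e: "e > 0"
 have "\<forall>\<^sub>F x in at_infinity. dist (f x) 0 < e" by (rule tendstoD[OF f e])
 then obtain R where "\<And>x. norm x >= R ==> \<bar>f x\<bar> < e" unfolding eventually_at_infinity by auto
 then show "\<exists>R. AE x in lborel. norm x >= R --> \<bar>f x\<bar> <= e" by (intro exI[of _ R] AE_I2) (auto simp: less_imp_le)
qed

lemma radial_tendsto:
 assumes "(w \<longlongrightarrow> 0) at_top" shows "((%x::'a::euclidean_space. w (sq x)) \<longlongrightarrow> (0::real)) at_infinity"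
proof -
 have "filterlim (%x::'a. (norm x)\<^sup>2) at_top at_infinity"
  by (rule filterlim_pow_at_top[OF _ filterlim_norm_at_top]) simp
 then have "filterlim (%x::'a. x \<bullet> x) at_top at_infinity" by (simp add: power2_norm_eq_inner)
 from filterlim_compose[OF assms this] show ?thesis .
qed

lemma radial_weak_sum:
 fixes phi F :: "'b => 'a::euclidean_space => real"
 assumes "finite S" "radial_weak phi0 F0" "\<And>i. i \<in> S ==> radial_weak (phi i) (F i)"
 shows "radial_weak (%x. phi0 x + (\<Sum>i\<in>S. c i * phi i x)) (%x. F0 x + (\<Sum>i\<in>S. c i * F i x))"
 using assms
proof (induction S rule: finite_induct)
 case empty then show ?case by simp
next
 case (insert j S)
 have "radial_weak (%x. (phi0 x + (\<Sum>i\<in>S. c i * phi i x)) + c j * phi j x) (%x. (F0 x + (\<Sum>i\<in>S. c i * F i x)) + c j * F j x)"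
  by (rule radial_weak_add_scaled) (use insert in auto)
 then show ?case using insert(1,2) by (simp add: algebra_simps)
qed

text \<open>In the variable s the density s^(nu-1) compensates the shift of the exponent, and
  s^kappa is integrable at infinity.\<close>

lemma powr_tail_integrable:
 assumes kappa: "kappa < - 1" and T: "T > 0" and nu: "nu = real DIM('a::euclidean_space) / 2"
 shows "integrable lborel (%x::'a. indicator {T..} (sq x) * (sq x) powr (kappa - (nu - 1)))"
proof -
 have [measurable]: "(%s. indicator {T..} s * s powr (kappa - (nu - 1))) \<in> bmeas" by measurable
 have "((%x. x powr kappa) has_integral - (T powr (kappa + 1)) / (kappa + 1)) {T..}" by (rule has_integral_powr_to_inf[OF kappa T])
 then have "(%x. x powr kappa) absolutely_integrable_on {T..}"
  by (intro nonnegative_absolutely_integrable_1) (auto intro: has_integral_integrable)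
 then have "integrable lebesgue (%s. indicator {T..} s * s powr kappa)" by (simp add: set_integrable_def)
 then have "integrable lborel (%s. indicator {T..} s * s powr kappa)" by (subst (asm) integrable_completion) auto
 moreover have "indicator {T..} s * s powr kappa = radial_density nu s * (indicator {T..} s * s powr (kappa - (nu - 1)))" for s
  using T by (auto simp: indicator_def radial_density_def powr_add[symmetric])
 ultimately have "integrable lborel (%s. radial_density nu s * (indicator {T..} s * s powr (kappa - (nu - 1))))" by (simp only:)
 then show ?thesis by (subst radial_integral(1)[OF _ nu]) auto
qed

section \<open>Derivatives of the ground state\<close>

locale emden_space = emden +
 fixes U V :: "real^'n::finite => real"
 assumes n: "CARD('n) >= 3" and nun: "nu = real CARD('n) / 2"
  and uv_cont: "continuous_on UNIV u" "continuous_on UNIV v"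
  and UV: "U = (%x. u (sq x))" "V = (%x. v (sq x))"
  and weak: "radial_weak U (%x. V x powr p)" "radial_weak V (%x. U x powr q)"
begin

lemma space_swap: "emden_space q p nu v u V U"
 by (intro emden_space.intro emden_space_axioms.intro swap n nun uv_cont UV weak)

lemma nuDIM: "nu = real DIM(real^'n) / 2" using nun by simp

definition P :: "real^'n => real" where "P x = p * V x powr (p - 1)"
definition Q :: "real^'n => real" where "Q x = q * U x powr (q - 1)"
text \<open>Minus the derivative of \<open>U\<close> in direction \<open>e\<close>; as the profile
  decreases, this sign makes it positive on the half space of positive height x . e.\<close>

definition dU :: "real^'n => real^'n => real" where "dU e x = - (2 * (x \<bullet> e) * du (sq x))"
definition dV :: "real^'n => real^'n => real" where "dV e x = - (2 * (x \<bullet> e) * dv (sq x))"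

lemma U_pos: "U x > 0" by (simp add: UV pos)

lemma U_cont: "continuous_on UNIV U"
 unfolding UV by (rule continuous_on_compose2[OF uv_cont(1)]) (auto intro!: continuous_intros)

lemma Q_cont: "continuous_on UNIV Q"
proof -
 have "U x \<noteq> 0" for x using U_pos[of x] by simp
 then show ?thesis unfolding Q_def[abs_def]
  by (intro continuous_on_mult continuous_on_const continuous_on_powr U_cont) auto
qed

lemma Q_pos: "Q x > 0" unfolding Q_def using U_pos[of x] pq by simp

lemma dU_cont: "continuous_on UNIV (dU e)"
proof -
 have "continuous_on UNIV (%x::real^'n. du (sq x))"
  by (rule continuous_on_compose2[OF du_cont]) (auto intro!: continuous_intros)
 then show ?thesis unfolding dU_def[abs_def] by (intro continuous_intros)
qed

text \<open>Away from the origin this is the chain rule. At the origin the bound |u(s) - u(0)| <= M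
  s with s = |x|^2 makes the derivative zero, as the formula predicts.\<close>

lemma U_has_derivative: "(U has_derivative (%h. du (sq x) * (2 * (x \<bullet> h)))) (at x)"
proof (cases "x = 0")
 case False
 then have "x \<bullet> x > 0" by simp
 from radial_has_derivative[where z=0 and x=x and h=u, simplified, OF du_deriv[OF this]] show ?thesis unfolding UV by simp
next
 case True
 obtain M where M: "\<And>s. 0 <= s ==> s <= 1 ==> \<bar>u s - u 0\<bar> <= M * s" using radial_sol_near_0[OF u nu] by blast
 have "((%y. (U y - U 0) /\<^sub>R norm y) \<longlongrightarrow> 0) (at 0)"
 proof (rule Lim_null_comparison)
  show "((%y::real^'n. M * norm y) \<longlongrightarrow> 0) (at 0)" by (auto intro!: tendsto_eq_intros)
  have "\<forall>\<^sub>F y::real^'n in at 0. dist y 0 < 1 \<and> y \<noteq> 0" unfolding eventually_at by (intro exI[of _ 1]) auto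
  then show "\<forall>\<^sub>F y in at 0. norm ((U y - U 0) /\<^sub>R norm y) <= M * norm y"
  proof eventually_elim
   case (elim y)
   have y: "norm y > 0" "norm y < 1" using elim by auto
   have "y \<bullet> y = norm y * norm y" by (simp add: dot_square_norm power2_eq_square)
   moreover have "norm y * norm y <= 1" using y mult_mono[of "norm y" 1 "norm y" 1] by simp
   ultimately have "\<bar>u (sq y) - u 0\<bar> <= M * (norm y * norm y)" using M[of "y \<bullet> y"] by simp
   then have "\<bar>u (sq y) - u 0\<bar> / norm y <= M * norm y" using y by (simp add: divide_le_eq mult.assoc)
   then show ?case unfolding UV by (simp add: divide_inverse mult.commute abs_mult)
  qed
 qed
 then have "(U has_derivative (%h. 0)) (at 0)" by (simp add: has_derivative_at_within has_derivative_def divide_inverse_commute)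
 then show ?thesis using True by simp
qed

lemma U_partial: "partial_deriv i U = (%x. - dU (axis i 1) x)"
 unfolding partial_deriv_eq[OF U_has_derivative] by (simp add: dU_def mult_ac)

lemma U_differentiable: "U differentiable_on UNIV"
 unfolding differentiable_on_def differentiable_def using U_has_derivative by blast

lemma U_powr: "(%x. U x powr r) differentiable_on UNIV"
  "partial_deriv i (%x. U x powr r) = (%x. - (r * U x powr (r - 1) * dU (axis i 1) x))"
proof -
 have d: "((%x. U x powr r) has_derivative (%h. r * U x powr (r - 1) * (du (sq x) * (2 * (x \<bullet> h))))) (at x)" for x
 proof -
  have "((%t. t powr r) has_real_derivative r * U x powr (r - 1)) (at (U x))"
   using U_pos[of x] by (rule has_real_derivative_powr)
  from has_derivative_compose[OF U_has_derivative this[unfolded has_field_derivative_def]] show ?thesis .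
 qed
 then show "(%x. U x powr r) differentiable_on UNIV" unfolding differentiable_on_def differentiable_def by blast
 show "partial_deriv i (%x. U x powr r) = (%x. - (r * U x powr (r - 1) * dU (axis i 1) x))"
  unfolding partial_deriv_eq[OF d] by (simp add: dU_def mult_ac)
qed

text \<open>For |x| >= 1 the height is at most |x|^2 |e|, and s |u'(s)| is controlled by u(s), which
  tends to 0.\<close>

lemma dU_tendsto: "(dU e \<longlongrightarrow> 0) at_infinity"
proof (rule Lim_null_comparison)
 show "((%x. 2 * norm e * 2 powr nu * u (sq x)) \<longlongrightarrow> 0) (at_infinity :: (real^'n) filter)"
  using tendsto_mult_left[OF radial_tendsto[OF u_tendsto_0], of "2 * norm e * 2 powr nu"] by simp
 have "\<forall>\<^sub>F x in at_infinity. norm (x::real^'n) >= 1" unfolding eventually_at_infinity by auto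
 then show "\<forall>\<^sub>F x in at_infinity. norm (dU e x) <= 2 * norm e * 2 powr nu * u (sq x)"
 proof eventually_elim
  case (elim x)
  have "\<bar>x \<bullet> e\<bar> <= norm x * norm e" by (rule Cauchy_Schwarz_ineq2)
  also have "\<dots> <= (norm x * norm x) * norm e" using elim mult_right_mono[of 1 "norm x" "norm x"] by (intro mult_right_mono) auto
  also have "\<dots> = (sq x) * norm e" by (simp add: dot_square_norm power2_eq_square)
  finally have "\<bar>x \<bullet> e\<bar> * \<bar>du (sq x)\<bar> <= ((sq x) * norm e) * \<bar>du (sq x)\<bar>" by (intro mult_right_mono) auto
  also have "\<dots> = norm e * ((sq x) * \<bar>du (sq x)\<bar>)" by simp
  also have "\<dots> <= norm e * (2 powr nu * u (sq x))" by (intro mult_left_mono du_bound) auto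
  finally show ?case by (simp add: dU_def abs_mult)
 qed
qed

lemma dU_odd: "norm e = 1 ==> dU e (mirror e x) = - dU e x"
 by (simp add: dU_def mirror_inner mirror_inner_e)

lemma dU_sign: "x \<bullet> e \<noteq> 0 ==> dU e x * (x \<bullet> e) > 0"
proof -
 assume "x \<bullet> e \<noteq> 0"
 then have "(x \<bullet> e)\<^sup>2 > 0" by simp
 then have "(2 * (x \<bullet> e)\<^sup>2) * (- du (sq x)) > 0" using du_neg[of "x \<bullet> x"] by (intro mult_pos_pos) auto
 then show ?thesis by (simp add: dU_def power2_eq_square algebra_simps)
qed

text \<open>Inside a large ball the weight is bounded and \<open>h\<close> integrable; outside it
  |h| <= 1 and the weight is integrable by \<open>weight_decay\<close>, whose assumption
  \<open>p <= q\<close> is inherited.\<close>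

lemma weight_finite:
 assumes le: "p <= q" and e: "norm e = 1" and h: "locint h" "vanishes h"
 shows "(\<integral>\<^sup>+x. ennreal \<bar>Q x * h x\<bar> * ennreal \<bar>dU e x\<bar> \<partial>lborel) < \<infinity>"
proof -
 obtain C T kappa where T: "T > 0" "kappa < - 1" and C: "\<And>s. s >= T ==> q * u s powr (q - 1) * (2 * sqrt s * \<bar>du s\<bar>) <= C * s powr (kappa - (nu - 1))"
  using weight_decay[OF le] by blast
 obtain R0 where R0: "AE x in lborel. norm x >= R0 --> \<bar>h x\<bar> <= 1" using h(2) unfolding vanishes_def by (meson zero_less_one)
 define R where "R = max R0 (sqrt T)"
 have "continuous_on (cball 0 R) (%x. Q x * dU e x)" by (intro continuous_on_mult continuous_on_subset[OF Q_cont] continuous_on_subset[OF dU_cont]) auto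
 then have "bounded ((%x. Q x * dU e x) ` cball 0 R)" by (intro compact_imp_bounded compact_continuous_image) auto
 then obtain K where "\<forall>x\<in>cball 0 R. \<bar>Q x * dU e x\<bar> <= K" unfolding bounded_iff by auto
 then have K: "\<bar>Q x * dU e x\<bar> <= K" if "norm x <= R" for x using that by simp
 let ?g = "%x. \<bar>K\<bar> * \<bar>indicator (ball 0 R) x * h x\<bar> + C * (indicator {T..} (sq x) * (sq x) powr (kappa - (nu - 1)))"
 have gi: "integrable lborel ?g"
  using h(1) powr_tail_integrable[OF T(2,1) nuDIM] unfolding locint_def by (intro Bochner_Integration.integrable_add integrable_mult_right integrable_abs) auto
 have "AE x in lborel. ennreal \<bar>Q x * h x\<bar> * ennreal \<bar>dU e x\<bar> <= ennreal (?g x)"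
  using R0
 proof eventually_elim
  case (elim x)
  have tail: "\<bar>Q x * dU e x\<bar> <= C * (sq x) powr (kappa - (nu - 1))" if "x \<bullet> x >= T"
  proof -
   have "\<bar>x \<bullet> e\<bar> <= sqrt (sq x)" using Cauchy_Schwarz_ineq2[of x e] e by (simp add: norm_eq_sqrt_inner)
   then have "\<bar>dU e x\<bar> <= 2 * sqrt (sq x) * \<bar>du (sq x)\<bar>" unfolding dU_def by (simp add: abs_mult mult_right_mono)
   then have "Q x * \<bar>dU e x\<bar> <= Q x * (2 * sqrt (sq x) * \<bar>du (sq x)\<bar>)" using Q_pos[of x] by (intro mult_left_mono) auto
   also have "\<dots> <= C * (sq x) powr (kappa - (nu - 1))" using C[OF that] unfolding Q_def unfolding UV(1) .
   finally show ?thesis using Q_pos[of x] by (simp add: abs_mult)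
  qed
  have g2: "C * (indicator {T..} (sq x) * (sq x) powr (kappa - (nu - 1))) >= 0"
  proof (cases "x \<bullet> x >= T")
   case True then show ?thesis using order_trans[OF abs_ge_zero tail[OF True]] by simp
  qed (simp add: indicator_def)
  have "\<bar>h x\<bar> * \<bar>Q x * dU e x\<bar> <= ?g x"
  proof (cases "norm x < R")
   case True
   have "\<bar>h x\<bar> * \<bar>Q x * dU e x\<bar> <= \<bar>h x\<bar> * \<bar>K\<bar>" using K[of x] True by (intro mult_left_mono) auto
   also have "\<dots> = \<bar>K\<bar> * \<bar>indicator (ball 0 R) x * h x\<bar>" using True by (simp add: indicator_def)
   finally show ?thesis using g2 by linarith
  next
   case False
   then have xR: "norm x >= R" by simp
   then have "sqrt T <= sqrt (sq x)" unfolding R_def norm_eq_sqrt_inner by simp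
   then have xT: "x \<bullet> x >= T" by simp
   have "\<bar>h x\<bar> * \<bar>Q x * dU e x\<bar> <= 1 * (C * (sq x) powr (kappa - (nu - 1)))"
    by (intro mult_mono tail[OF xT]) (use elim xR in \<open>auto simp: R_def\<close>)
   then show ?thesis using xT False by simp
  qed
  moreover have "ennreal \<bar>Q x * h x\<bar> * ennreal \<bar>dU e x\<bar> = ennreal (\<bar>h x\<bar> * \<bar>Q x * dU e x\<bar>)"
   by (simp add: ennreal_mult[symmetric] abs_mult mult_ac)
  ultimately show ?case by (simp only: ennreal_leI)
 qed
 then have "(\<integral>\<^sup>+x. ennreal \<bar>Q x * h x\<bar> * ennreal \<bar>dU e x\<bar> \<partial>lborel) <= (\<integral>\<^sup>+x. ennreal (?g x) \<partial>lborel)" by (rule nn_integral_mono_AE)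
 also have "\<dots> <= (\<integral>\<^sup>+x. ennreal (norm (?g x)) \<partial>lborel)"
  by (intro nn_integral_mono ennreal_leI) (simp only: real_norm_def abs_ge_self)
 also have "\<dots> < \<infinity>" using gi unfolding integrable_iff_bounded by (rule conjunct2)
 finally show ?thesis .
qed

end

lemma (in emden_space) swap_eq: "emden_space.P q U = Q" "emden_space.Q p V = P" "emden_space.dU q nu u = dV" "emden_space.dV p nu v = dU"
proof -
 interpret s: emden_space q p nu v u V U by (rule space_swap)
 show "s.P = Q" "s.Q = P" by (simp_all add: fun_eq_iff s.P_def Q_def s.Q_def P_def)
 have "emden.dv p nu v = du" by (simp add: emden.dv_def[OF swap] du_def)
 then show "s.dU = dV" "s.dV = dU" by (simp_all add: fun_eq_iff s.dU_def dV_def s.dV_def dU_def flip: dv_eq(1))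
qed

context emden_space begin

lemmas P_cont = emden_space.Q_cont[OF space_swap, unfolded swap_eq]
 and P_pos = emden_space.Q_pos[OF space_swap, unfolded swap_eq]
 and V_pos = emden_space.U_pos[OF space_swap]
 and V_partial = emden_space.U_partial[OF space_swap, unfolded swap_eq]
 and V_powr = emden_space.U_powr[OF space_swap, unfolded swap_eq]
 and V_cont = emden_space.U_cont[OF space_swap]
 and V_differentiable = emden_space.U_differentiable[OF space_swap]
 and dV_cont = emden_space.dU_cont[OF space_swap, unfolded swap_eq]
 and dV_tendsto = emden_space.dU_tendsto[OF space_swap, unfolded swap_eq]
 and dV_odd = emden_space.dU_odd[OF space_swap, unfolded swap_eq]
 and dV_sign = emden_space.dU_sign[OF space_swap, unfolded swap_eq]

section \<open>Translation modes and odd parts of linearized solutions\<close>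

lemma dU_sum: "dU e x = (\<Sum>i\<in>UNIV. e $ i * dU (axis i 1) x)"
proof -
 have "x \<bullet> e = (\<Sum>i\<in>UNIV. x $ i * e $ i)" by (simp add: inner_vec_def)
 then have "dU e x = - (2 * du (sq x)) * (\<Sum>i\<in>UNIV. x $ i * e $ i)" by (simp add: dU_def)
 also have "\<dots> = (\<Sum>i\<in>UNIV. e $ i * dU (axis i 1) x)"
  unfolding sum_distrib_left by (rule sum.cong) (simp_all add: dU_def inner_axis)
 finally show ?thesis .
qed

lemma radial_weak_axis: "radial_weak (dU (axis i 1)) (%x. P x * dV (axis i 1) x)"
proof -
 have c: "continuous_on UNIV (partial_deriv i U)" unfolding U_partial by (intro continuous_intros dU_cont)
 have e: "partial_deriv i (%x. V x powr p) = (%x. - (P x * dV (axis i 1) x))" unfolding V_powr(2) P_def ..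
 have c': "continuous_on UNIV (partial_deriv i (%x. V x powr p))" unfolding e by (intro continuous_intros dV_cont P_cont)
 have w: "radial_weak (partial_deriv i U) (partial_deriv i (%x. V x powr p))"
  by (rule radial_weak_partial_deriv[OF weak(1) U_differentiable c V_powr(1) c'])
 from radial_weak_add_scaled[OF w w, of "-2"] show ?thesis unfolding U_partial e by simp
qed

lemma radial_weak_zero: "radial_weak (%x::real^'n. 0) (%x. 0)"
 using radial_weak_add_scaled[OF weak(1) weak(1), of "-1"] by simp

lemma radial_weak_dU: "radial_weak (dU e) (%x. P x * dV e x)"
proof -
 have s: "dV e x = (\<Sum>i\<in>UNIV. e $ i * dV (axis i 1) x)" for x
  by (rule emden_space.dU_sum[OF space_swap, unfolded swap_eq])
 have "radial_weak (%x. 0 + (\<Sum>i\<in>UNIV. e $ i * dU (axis i 1) x)) (%x. 0 + (\<Sum>i\<in>UNIV. e $ i * (P x * dV (axis i 1) x)))"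
  by (rule radial_weak_sum[OF finite radial_weak_zero radial_weak_axis])
 moreover have "0 + (\<Sum>i\<in>UNIV. e $ i * dU (axis i 1) x) = dU e x" for x unfolding dU_sum[of e x] by simp
 moreover have "0 + (\<Sum>i\<in>UNIV. e $ i * (P x * dV (axis i 1) x)) = P x * dV e x" for x
  unfolding s sum_distrib_left by (simp add: mult.left_commute)
 ultimately show ?thesis by (simp only:)
qed

lemmas radial_weak_dV = emden_space.radial_weak_dU[OF space_swap, unfolded swap_eq]

text \<open>The weights \<open>P\<close> and \<open>Q\<close> are even, so the difference of a
  solution and its reflection solves the odd system, in which \<open>(dU e, dV e)\<close> is the
  positive pair.\<close>

lemma odd_part_le:
 assumes le: "p <= q" and e: "norm e = 1" and w: "radial_weak phi (%x. P x * psi x)" "radial_weak psi (%x. Q x * phi x)"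
  and v: "vanishes phi" "vanishes psi"
 shows "\<exists>t. AE x in lborel. phi x - phi (mirror e x) = t * dU e x \<and> psi x - psi (mirror e x) = t * dV e x"
proof -
 have PQe: "P (mirror e x) = P x" "Q (mirror e x) = Q x" for x unfolding P_def Q_def unfolding UV by (simp_all add: mirror_inner[OF e])
 interpret o: odd_pair e P Q "dU e" "dV e"
  by (rule odd_pair.intro)
   (use n in simp, (rule e P_cont Q_cont P_pos Q_pos PQe radial_weak_dU radial_weak_dV tendsto_vanishes[OF dU_tendsto] tendsto_vanishes[OF dV_tendsto]
    dU_odd[OF e] dV_odd[OF e] dU_sign dV_sign weight_finite[OF le e]; assumption?)+)
 have r: "radial_weak (%x. phi x + (-1) * phi (mirror e x)) (%x. P x * psi x + (-1) * (P (mirror e x) * psi (mirror e x)))"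
  "radial_weak (%x. psi x + (-1) * psi (mirror e x)) (%x. Q x * phi x + (-1) * (Q (mirror e x) * phi (mirror e x)))"
  by (rule radial_weak_add_scaled[OF w(1) radial_weak_refl[OF w(1) e]], rule radial_weak_add_scaled[OF w(2) radial_weak_refl[OF w(2) e]])
 have "o.solution (%x. phi x + (-1) * phi (mirror e x)) (%x. psi x + (-1) * psi (mirror e x))"
  unfolding o.solution_def
 proof (intro conjI allI)
  show "radial_weak (%x. phi x + (-1) * phi (mirror e x)) (%x. P x * (psi x + (-1) * psi (mirror e x)))"
   using r(1) by (simp add: PQe right_diff_distrib)
  show "radial_weak (%x. psi x + (-1) * psi (mirror e x)) (%x. Q x * (phi x + (-1) * phi (mirror e x)))"
   using r(2) by (simp add: PQe right_diff_distrib)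
  show "vanishes (%x. phi x + (-1) * phi (mirror e x))" "vanishes (%x. psi x + (-1) * psi (mirror e x))"
   by (rule vanishes_add_scaled[OF v(1) vanishes_refl[OF v(1) e]], rule vanishes_add_scaled[OF v(2) vanishes_refl[OF v(2) e]])
 qed (simp_all add: mirror_mirror[OF e])
 from o.solution_unique[OF this] show ?thesis by simp
qed

text \<open>For q < p the two components exchange their roles: the pairing shown to be finite is
  then the one with the other weight.\<close>

lemma odd_part:
 assumes e: "norm e = 1" and w: "radial_weak phi (%x. P x * psi x)" "radial_weak psi (%x. Q x * phi x)"
  and v: "vanishes phi" "vanishes psi"
 shows "\<exists>t. AE x in lborel. phi x - phi (mirror e x) = t * dU e x \<and> psi x - psi (mirror e x) = t * dV e x"
proof (cases "p <= q")
 case True then show ?thesis by (rule odd_part_le[OF _ assms])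
next
 case False
 then have "q <= p" by simp
 from emden_space.odd_part_le[OF space_swap this e, unfolded swap_eq, OF w(2,1) v(2,1)]
 show ?thesis by (auto simp: conj_commute)
qed

end

section \<open>Classification of the linearized solutions\<close>

text \<open>The perpendicular bisector of two points of equal norm contains the origin.\<close>

lemma mirror_swap:
 fixes z w :: "'a::euclidean_space"
 assumes "norm z = norm w" "z \<noteq> w"
 defines "e \<equiv> (1 / norm (z - w)) *\<^sub>R (z - w)"
 shows "norm e = 1" "mirror e z = w"
proof -
 have d: "norm (z - w) > 0" using assms by simp
 show "norm e = 1" unfolding e_def using d by simp
 have "z \<bullet> z = sq w" using assms(1) by (simp add: dot_square_norm)
 then have "2 * (z \<bullet> (z - w)) = (z - w) \<bullet> (z - w)" by (simp add: inner_diff inner_commute)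
 then have E: "2 * (z \<bullet> (z - w)) = norm (z - w) * norm (z - w)" by (simp add: dot_square_norm power2_eq_square)
 have alg: "2 * ((1 / k) * i) * (1 / k) = 1" if "k > 0" "2 * i = k * k" for k i :: real
 proof -
  have "2 * ((1 / k) * i) * (1 / k) = (2 * i) / (k * k)" by simp
  also have "\<dots> = (k * k) / (k * k)" by (simp only: that(2))
  also have "\<dots> = 1" using that(1) by simp
  finally show ?thesis .
 qed
 have H: "2 * (z \<bullet> e) * (1 / norm (z - w)) = 1" unfolding e_def inner_scaleR_right by (rule alg[OF d E])
 have "(2 * (z \<bullet> e)) *\<^sub>R e = (2 * (z \<bullet> e)) *\<^sub>R ((1 / norm (z - w)) *\<^sub>R (z - w))" by (simp only: e_def)
 also have "\<dots> = z - w" by (simp only: scaleR_scaleR H scaleR_one)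
 finally have "(2 * (z \<bullet> e)) *\<^sub>R e = z - w" .
 then show "mirror e z = w" by (simp add: mirror_def)
qed

text \<open>Invariance holds only off a null set that depends on \<open>e\<close>, so it cannot be
  combined pointwise over all directions. Mollifying with the radial \<open>shell\<close> makes it
  exact; a mollification is then a function of |z|^2, since some reflection exchanges any two
  distinct points of equal norm, and so is its limit.\<close>

lemma mirror_invariant_radial:
 fixes phi :: "'a::euclidean_space => real"
 assumes l: "locint phi" and inv: "\<And>e. norm e = 1 ==> AE x in lborel. phi (mirror e x) = phi x"
 shows "\<exists>a. a \<in> bmeas \<and> (AE x in lborel. phi x = a (sq x))"
proof -
 have [measurable]: "phi \<in> bmeas" using l by (rule locint_measurable)
 obtain b :: 'a where b: "b \<in> Basis" using nonempty_Basis by blast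
 define c where "c = (LINT y|lborel. shell 1 (y::'a))"
 have c: "c > 0" unfolding c_def by (rule shell_integral_pos) simp
 define Phi where "Phi k z = (LINT y|lborel. phi (z + (1 / (real k + 1)) *\<^sub>R y) * shell 1 y)" for k z
 have Phim [measurable]: "Phi k \<in> bmeas" for k
  unfolding Phi_def[abs_def] by (rule lborel.borel_measurable_lebesgue_integral) measurable
 have Phimirror: "Phi k (mirror e z) = Phi k z" if e: "norm e = 1" for k e z
 proof -
  have m: "(%y. phi (mirror e z + (1 / (real k + 1)) *\<^sub>R y) * shell 1 y) \<in> bmeas" by measurable
  have "Phi k (mirror e z) = (LINT y|lborel. phi (mirror e z + (1 / (real k + 1)) *\<^sub>R mirror e y) * shell 1 (mirror e y))"
   unfolding Phi_def by (rule integral_refl[OF m e, symmetric])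
  also have "\<dots> = Phi k z" unfolding Phi_def
  proof (rule integral_cong_AE)
   have "AE y in lborel. phi (mirror e (z + (1 / (real k + 1)) *\<^sub>R y)) = phi (z + (1 / (real k + 1)) *\<^sub>R y)"
    by (rule AE_scale_shift[OF inv[OF e]]) simp
   then show "AE y in lborel. phi (mirror e z + (1 / (real k + 1)) *\<^sub>R mirror e y) * shell 1 (mirror e y) = phi (z + (1 / (real k + 1)) *\<^sub>R y) * shell 1 y"
   proof eventually_elim
    case (elim y)
    have "mirror e z + (1 / (real k + 1)) *\<^sub>R mirror e y = mirror e (z + (1 / (real k + 1)) *\<^sub>R y)"
     by (simp add: mirror_def algebra_simps inner_simps)
    moreover have "shell 1 (mirror e y) = shell 1 y" by (simp add: shell_def mirror_inner[OF e])
    ultimately show ?case using elim by simp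
   qed
  qed measurable
  finally show ?thesis .
 qed
 have Phirad: "Phi k z = Phi k (sqrt (sq z) *\<^sub>R b)" for k z
 proof (cases "z = sqrt (sq z) *\<^sub>R b")
  case True then show ?thesis by simp
 next
  case False
  have "norm z = norm (sqrt (sq z) *\<^sub>R b)" using b by (simp add: norm_eq_sqrt_inner[of z])
  from Phimirror[OF mirror_swap(1)[OF this False], of k z] show ?thesis unfolding mirror_swap(2)[OF \<open>norm z = _\<close> False] by (rule sym)
 qed
 have "\<exists>a. a \<in> bmeas \<and> (AE x in lborel. norm x < real R --> phi x = a (sq x))" for R :: nat
 proof -
  obtain r where r: "AE z in lborel. norm z < real R --> (%k. LINT y|lborel. phi (z + (1 / (real (r k) + 1)) *\<^sub>R y) * shell 1 y) \<longlonglongrightarrow> phi z * (LINT y|lborel. shell 1 (y::'a))"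
  proof -
   have "\<exists>r. strict_mono r \<and> (AE z in lborel. norm z < real R --> (%k. LINT y|lborel. phi (z + (1 / (real (r k) + 1)) *\<^sub>R y) * shell 1 y) \<longlonglongrightarrow> phi z * (LINT y|lborel. shell 1 (y::'a)))"
    by (rule mollifier_AE[where M=4 and ?r0.0=2, OF l shell_measurable]) (simp_all add: shell_abs shell_bounds)
   then show ?thesis using that by blast
  qed
  define a where "a s = lim (%k. Phi (r k) (sqrt s *\<^sub>R b)) / c" for s
  have am: "a \<in> bmeas" unfolding a_def[abs_def] by measurable
  have "AE z in lborel. norm z < real R --> phi z = a (sq z)"
   using r
  proof eventually_elim
   case (elim z)
   show ?case
   proof
    assume "norm z < real R"
    then have "(%k. Phi (r k) z) \<longlonglongrightarrow> phi z * c" using elim unfolding Phi_def c_def by simp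
    then have "(%k. Phi (r k) (sqrt (sq z) *\<^sub>R b)) \<longlonglongrightarrow> phi z * c" unfolding Phirad[of _ z] .
    then have "lim (%k. Phi (r k) (sqrt (sq z) *\<^sub>R b)) = phi z * c" by (rule limI)
    then show "phi z = a (sq z)" unfolding a_def using c by simp
   qed
  qed
  then show ?thesis using am by blast
 qed
 then have "\<forall>R::nat. \<exists>a. a \<in> bmeas \<and> (AE x in lborel. norm x < real R --> phi x = a (sq x))" ..
 from choice[OF this] obtain a where am [measurable]: "\<And>R. a R \<in> bmeas" and a: "\<And>R. AE x in lborel. norm x < real R --> phi x = a R (sq x)"
  by blast
 \<comment> \<open>The profile found on a ball depends on the radius of the ball. \<open>N s\<close>
   picks an integer radius exceeding sqrt s, so that countably many profiles are glued
   measurably.\<close>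
 define N where "N s = nat (\<lceil>sqrt s\<rceil> + 1)" for s :: real
 have Nm [measurable]: "N \<in> borel \<rightarrow>\<^sub>M count_space UNIV" unfolding N_def[abs_def] by measurable
 have "(%s. a (N s) s) \<in> bmeas" by (rule measurable_compose_countable[OF am Nm])
 moreover have "AE x in lborel. phi x = a (N (sq x)) (sq x)"
 proof -
  have "AE x in lborel. \<forall>R. norm x < real R --> phi x = a R (sq x)" unfolding AE_all_countable using a by (rule allI)
  then show ?thesis
 proof eventually_elim
  case (elim x)
  have "norm x < real (N (sq x))" unfolding N_def norm_eq_sqrt_inner[of x, symmetric] by linarith
  then show ?case using elim by blast
 qed
 qed
 ultimately show ?thesis by blast
qed

section \<open>Splitting off the translation modes\<close>

context emden_space begin

definition lin_sol :: "(real^'n => real) => (real^'n => real) => bool" where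
 "lin_sol phi psi \<longleftrightarrow> radial_weak phi (%x. P x * psi x) \<and> radial_weak psi (%x. Q x * phi x) \<and> vanishes phi \<and> vanishes psi"

lemma lin_sol_add_sum:
 assumes "finite S" "lin_sol phi psi"
 shows "lin_sol (%x. phi x + (\<Sum>i\<in>S. c i * dU (axis i 1) x)) (%x. psi x + (\<Sum>i\<in>S. c i * dV (axis i 1) x))"
 using assms
proof (induction S rule: finite_induct)
 case empty then show ?case by simp
next
 case (insert j S)
 let ?f = "%x. phi x + (\<Sum>i\<in>S. c i * dU (axis i 1) x)" and ?g = "%x. psi x + (\<Sum>i\<in>S. c i * dV (axis i 1) x)"
 have s: "radial_weak ?f (%x. P x * ?g x)" "radial_weak ?g (%x. Q x * ?f x)" "vanishes ?f" "vanishes ?g"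
  using insert unfolding lin_sol_def by blast+
 have 1: "radial_weak (%x. ?f x + c j * dU (axis j 1) x) (%x. P x * ?g x + c j * (P x * dV (axis j 1) x))"
  by (rule radial_weak_add_scaled[OF s(1) radial_weak_dU])
 have 2: "radial_weak (%x. ?g x + c j * dV (axis j 1) x) (%x. Q x * ?f x + c j * (Q x * dU (axis j 1) x))"
  by (rule radial_weak_add_scaled[OF s(2) radial_weak_dV])
 have e: "phi x + (\<Sum>i\<in>insert j S. c i * dU (axis i 1) x) = ?f x + c j * dU (axis j 1) x"
   "psi x + (\<Sum>i\<in>insert j S. c i * dV (axis i 1) x) = ?g x + c j * dV (axis j 1) x" for x using insert(1,2) by simp_all
 have d: "a * (y + k * z) = a * y + k * (a * z)" for a y k z :: real by (simp add: algebra_simps)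
 show ?case unfolding lin_sol_def e d
  by (intro conjI 1 2 vanishes_add_scaled s(3,4) tendsto_vanishes[OF dU_tendsto] tendsto_vanishes[OF dV_tendsto])
qed

lemma dU_mirror: "dU e' (mirror e x) = dU e' x + 4 * ((x \<bullet> e) * (e \<bullet> e')) * du (sq x)" if "norm e = 1"
 using that by (simp add: dU_def mirror_inner) (simp add: mirror_def inner_diff_left algebra_simps)

lemma dU_mirror_axis: "dU (axis i 1) (mirror (axis j 1) x) = (if i = j then - dU (axis i 1) x else dU (axis i 1) x)"
 using dU_mirror[of "axis j 1" "axis i 1" x] by (auto simp: dU_def inner_axis_axis)

lemma sum_dU_mirror:
 "(\<Sum>i\<in>UNIV. c i * dU (axis i 1) (mirror (axis j 1) x)) = (\<Sum>i\<in>UNIV. c i * dU (axis i 1) x) - 2 * (c j * dU (axis j 1) x)"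
proof -
 have "(\<Sum>i\<in>UNIV. c i * dU (axis i 1) x) - (\<Sum>i\<in>UNIV. c i * dU (axis i 1) (mirror (axis j 1) x)) = (\<Sum>i\<in>UNIV. if i = j then 2 * (c j * dU (axis j 1) x) else 0)"
  unfolding sum_subtractf[symmetric] dU_mirror_axis by (rule sum.cong) auto
 then show ?thesis by simp
qed

text \<open>The composition of the coordinate reflections with index in \<open>S\<close>; for
  \<open>S = UNIV\<close> it is x -> - x.\<close>

definition flip :: "'n set => real^'n => real^'n" where "flip S x = (\<chi> i. if i \<in> S then - x $ i else x $ i)"

lemma flip_insert: "j \<notin> S ==> flip (insert j S) x = flip S (mirror (axis j 1) x)"
 by (simp add: flip_def mirror_def vec_eq_iff inner_axis) (auto simp: axis_def)

lemma flip_invariant: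
 fixes phi :: "real^'n => real"
 assumes "finite S" and inv: "\<And>j. AE x in lborel. phi (mirror (axis j 1) x) = phi x"
 shows "AE x in lborel. phi (flip S x) = phi x"
 using assms(1)
proof (induction S rule: finite_induct)
 case empty
 have "flip {} x = x" for x by (simp add: flip_def vec_eq_iff)
 then show ?case by simp
next
 case (insert j S)
 have "AE x in lborel. phi (flip S (mirror (axis j 1) x)) = phi (mirror (axis j 1) x)" by (rule AE_refl[OF insert(3)]) simp
 then show ?case using inv[of j] unfolding flip_insert[OF insert(2)] by eventually_elim simp
qed

text \<open>The coordinate reflections already fix all coefficients; after the correction the pair
  is invariant under them and hence under x -> - x. In any other direction \<open>e\<close> the odd
  part is r times \<open>dU e\<close>; it is even under x -> - x whereas \<open>dU e\<close> is odd,
  so r = 0.\<close>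

lemma even_part:
 assumes s: "lin_sol phi psi"
 shows "\<exists>c. let phi' = (%x. phi x + (\<Sum>i\<in>UNIV. c i * dU (axis i 1) x)); psi' = (%x. psi x + (\<Sum>i\<in>UNIV. c i * dV (axis i 1) x)) in
  lin_sol phi' psi' \<and> (\<forall>e. norm e = 1 --> (AE x in lborel. phi' (mirror e x) = phi' x) \<and> (AE x in lborel. psi' (mirror e x) = psi' x))"
proof -
 have "\<exists>t. AE x in lborel. phi x - phi (mirror (axis j 1) x) = t * dU (axis j 1) x \<and> psi x - psi (mirror (axis j 1) x) = t * dV (axis j 1) x" for j
  using s unfolding lin_sol_def by (intro odd_part) auto
 then obtain t where t: "\<And>j. AE x in lborel. phi x - phi (mirror (axis j 1) x) = t j * dU (axis j 1) x \<and> psi x - psi (mirror (axis j 1) x) = t j * dV (axis j 1) x"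
  unfolding atomize_all using choice[of "%j t. AE x in lborel. phi x - phi (mirror (axis j 1) x) = t * dU (axis j 1) x \<and> psi x - psi (mirror (axis j 1) x) = t * dV (axis j 1) x"] by blast
 \<comment> \<open>\<open>dU (axis i 1)\<close> changes sign under its own reflection, so the
   difference of a function and its reflection counts this mode twice.\<close>
 define c where "c i = - (t i / 2)" for i
 define phi' where "phi' x = phi x + (\<Sum>i\<in>UNIV. c i * dU (axis i 1) x)" for x
 define psi' where "psi' x = psi x + (\<Sum>i\<in>UNIV. c i * dV (axis i 1) x)" for x
 have s': "lin_sol phi' psi'" unfolding phi'_def[abs_def] psi'_def[abs_def] by (rule lin_sol_add_sum[OF finite s])
 have ax: "AE x in lborel. phi' (mirror (axis j 1) x) = phi' x" "AE x in lborel. psi' (mirror (axis j 1) x) = psi' x" for j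
 proof -
  have sV: "(\<Sum>i\<in>UNIV. c i * dV (axis i 1) (mirror (axis j 1) x)) = (\<Sum>i\<in>UNIV. c i * dV (axis i 1) x) - 2 * (c j * dV (axis j 1) x)" for x
   by (rule emden_space.sum_dU_mirror[OF space_swap, unfolded swap_eq])
  have cj: "t j = - 2 * c j" by (simp add: c_def)
  show "AE x in lborel. phi' (mirror (axis j 1) x) = phi' x" using t[of j]
   by eventually_elim (simp add: phi'_def sum_dU_mirror cj algebra_simps)
  show "AE x in lborel. psi' (mirror (axis j 1) x) = psi' x" using t[of j]
   by eventually_elim (simp add: psi'_def sV cj algebra_simps)
 qed
 have fl: "flip UNIV x = - x" for x by (simp add: flip_def vec_eq_iff)
 have ev: "AE x in lborel. phi' (- x) = phi' x" "AE x in lborel. psi' (- x) = psi' x"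
  using flip_invariant[OF finite ax(1), of UNIV] flip_invariant[OF finite ax(2), of UNIV] unfolding fl by auto
 have inv: "(AE x in lborel. phi' (mirror e x) = phi' x) \<and> (AE x in lborel. psi' (mirror e x) = psi' x)" if e: "norm e = 1" for e
 proof -
  obtain r where r: "AE x in lborel. phi' x - phi' (mirror e x) = r * dU e x \<and> psi' x - psi' (mirror e x) = r * dV e x"
   using odd_part[OF e] s' unfolding lin_sol_def by blast
  have neg: "AE x in lborel. phi' (- x) - phi' (mirror e (- x)) = r * dU e (- x)"
   using AE_scale_shift[OF r, of "-1" 0] by simp
  have evm: "AE x in lborel. phi' (- (mirror e x)) = phi' (mirror e x)" by (rule AE_refl[OF ev(1) e])
  have "AE x in lborel. r * dU e x = 0"
   using neg evm ev(1) r
  proof eventually_elim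
   case (elim x)
   have "mirror e (- x) = - (mirror e x)" by (simp add: mirror_def)
   moreover have "dU e (- x) = - dU e x" by (simp add: dU_def)
   ultimately show ?case using elim by simp
  qed
  with r have "AE x in lborel. x \<bullet> e \<noteq> 0 --> r = 0"
  proof eventually_elim
   case (elim x)
   then show ?case using dU_sign[of x e] by auto
  qed
  then have "AE x::real^'n in lborel. r = 0" using AE_off_hyperplane[OF e] by eventually_elim simp
  then have "r = 0"
  proof (rule contrapos_pp)
   assume "r \<noteq> 0"
   show "\<not> (AE x::real^'n in lborel. r = 0)"
   proof
    assume "AE x::real^'n in lborel. r = 0"
    then have "AE x::real^'n in lborel. False" using \<open>r \<noteq> 0\<close> by simp
    then have "(UNIV::(real^'n) set) \<in> null_sets lborel" using AE_iff_null[of lborel "%_::real^'n. False"] by simp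
    then show False by (simp add: null_sets_def emeasure_lborel_UNIV)
   qed
  qed
  then show ?thesis using r by auto
 qed
 show ?thesis by (rule exI[of _ c]) (use s' inv in \<open>simp add: Let_def phi'_def[abs_def] psi'_def[abs_def]\<close>)
qed

end

section \<open>The radial part and the classification\<close>

lemma radial_weak_cong_AE:
 fixes phi F phi' F' :: "'a::euclidean_space => real"
 assumes w: "radial_weak phi F" and m: "phi' \<in> bmeas" "F' \<in> bmeas"
  and e: "AE x in lborel. phi x = phi' x" "AE x in lborel. F x = F' x"
 shows "radial_weak phi' F'"
proof -
 have l: "locint g'" if "locint g" "g' \<in> bmeas" "AE x in lborel. g x = g' x" for g g' :: "'a => real"
  unfolding locint_def
 proof (intro conjI allI that(2))
  fix R
  have [measurable]: "g \<in> bmeas" "g' \<in> bmeas" by (rule locint_measurable[OF that(1)], rule that(2))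
  have i: "integrable lborel (%x. indicator (ball 0 R) x * g x)" using that(1) unfolding locint_def by blast
  have "AE x in lborel. indicator (ball 0 R) x * g x = indicator (ball 0 R) x * g' x" using that(3) by eventually_elim simp
  moreover have "(%x. indicator (ball 0 R) x * g' x) \<in> borel_measurable lborel"
   by (intro borel_measurable_times borel_measurable_indicator) auto
  ultimately show "integrable lborel (%x. indicator (ball 0 R) x * g' x)"
   using iffD1[OF integrable_cong_AE[OF borel_measurable_integrable[OF i]] i] by blast
 qed
 have [measurable]: "phi' \<in> bmeas" "F' \<in> bmeas" "phi \<in> bmeas" "F \<in> bmeas"
  using m radial_weak_locint[OF w] locint_measurable by auto
 show ?thesis unfolding radial_weak_def
 proof (intro conjI allI impI)
  show "locint phi'" "locint F'" using l[OF radial_weak_locint(1)[OF w] m(1) e(1)] l[OF radial_weak_locint(2)[OF w] m(2) e(2)] .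
  fix h S and z :: 'a assume h: "smooth h" "\<forall>s\<ge>S. h s = (0::real)"
  have [measurable]: "h \<in> bmeas" "deriv h \<in> bmeas" "deriv (deriv h) \<in> bmeas"
   using h(1) smooth_derivD(2) by (auto intro!: borel_measurable_continuous_onI smooth_continuous)
  have s: "AE x in lborel. phi (z + x) = phi' (z + x)" "AE x in lborel. F (z + x) = F' (z + x)"
   using AE_scale_shift[OF e(1), of 1 z] AE_scale_shift[OF e(2), of 1 z] by auto
  have 1: "(LINT x|lborel. phi' (z + x) * (4 * (sq x) * deriv (deriv h) (sq x) + 2 * real DIM('a) * deriv h (sq x))) =
   (LINT x|lborel. phi (z + x) * (4 * (sq x) * deriv (deriv h) (sq x) + 2 * real DIM('a) * deriv h (sq x)))"
  proof (rule integral_cong_AE)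
   show "AE x in lborel. phi' (z + x) * (4 * (sq x) * deriv (deriv h) (sq x) + 2 * real DIM('a) * deriv h (sq x)) =
    phi (z + x) * (4 * (sq x) * deriv (deriv h) (sq x) + 2 * real DIM('a) * deriv h (sq x))"
    using s(1) by eventually_elim simp
  qed measurable
  have 2: "(LINT x|lborel. F' (z + x) * h (sq x)) = (LINT x|lborel. F (z + x) * h (sq x))"
  proof (rule integral_cong_AE)
   show "AE x in lborel. F' (z + x) * h (sq x) = F (z + x) * h (sq x)" using s(2) by eventually_elim simp
  qed measurable
  show "(LINT x|lborel. phi' (z + x) * (4 * (sq x) * deriv (deriv h) (sq x) + 2 * real DIM('a) * deriv h (sq x))) = - (LINT x|lborel. F' (z + x) * h (sq x))"
   unfolding 1 2 using w h unfolding radial_weak_def by blast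
 qed
qed

lemma vanishes_cong_AE:
 assumes "vanishes phi" "AE x in lborel. phi x = phi' x" shows "vanishes phi'"
 unfolding vanishes_def
proof (intro allI impI)
 fix e :: real assume "e > 0"
 then obtain R where R: "AE x in lborel. norm x >= R --> \<bar>phi x\<bar> <= e" using assms(1) unfolding vanishes_def by blast
 show "\<exists>R. AE x in lborel. norm x >= R --> \<bar>phi' x\<bar> <= e"
  by (rule exI[of _ R]) (use R assms(2) in \<open>eventually_elim, simp\<close>)
qed

text \<open>\<open>beta\<close> is the continuous representative of the profile, so an essential
  bound becomes a pointwise one.\<close>

lemma vanishes_radial_tendsto:
 fixes b beta :: "real => real"
 assumes v: "vanishes (%x::'a::euclidean_space. b (sq x))" and bm [measurable]: "b \<in> bmeas" and beta: "continuous_on {0..} beta"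
  and e: "AE s in lborel. s > 0 --> b s = beta s" and nu: "nu = real DIM('a) / 2"
 shows "(beta \<longlongrightarrow> 0) at_top"
proof (rule tendstoI)
 fix epsilon :: real assume epsilon: "epsilon > 0"
 then obtain R where R: "AE x in lborel. norm (x::'a) >= R --> \<bar>b (sq x)\<bar> <= epsilon / 2" using v half_gt_zero[OF epsilon] unfolding vanishes_def by blast
 define T where "T = max 1 (R\<^sup>2)"
 have pm: "Measurable.pred borel (%s. s >= T --> \<bar>b s\<bar> <= epsilon / 2)" by measurable
 have "AE x in lborel. (x::'a) \<bullet> x >= T --> \<bar>b (sq x)\<bar> <= epsilon / 2"
  using R
 proof eventually_elim
  case (elim x)
  have "norm x >= R" if "x \<bullet> x >= T"
  proof -
   have "R\<^sup>2 <= (norm x)\<^sup>2" using that by (simp add: T_def power2_norm_eq_inner)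
   then show ?thesis by (rule power2_le_imp_le) simp
  qed
  then show ?case using elim by blast
 qed
 then have "AE s in lborel. s > 0 --> s >= T --> \<bar>b s\<bar> <= epsilon / 2" unfolding radial_AE[OF pm nu] .
 \<comment> \<open>The conditional bound is encoded as the vanishing of one continuous product, so
   that equality almost everywhere of continuous functions upgrades to equality.\<close>
 then have ae: "AE s in lborel. s > 0 --> max (\<bar>beta s\<bar> - epsilon / 2) 0 * max (s - T) 0 = 0"
  using e by eventually_elim (auto simp: max_def)
 have "\<bar>beta s\<bar> <= epsilon / 2" if s: "s > T" for s
 proof -
  have s0: "s > 0" using s by (simp add: T_def)
  have c: "continuous_on {0<..} (%s. max (\<bar>beta s\<bar> - epsilon / 2) 0 * max (s - T) 0)"
   by (intro continuous_intros continuous_on_subset[OF beta]) auto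
  have "max (\<bar>beta s\<bar> - epsilon / 2) 0 * max (s - T) 0 = 0"
   by (rule AE_eq_continuous_pos[OF c _ ae s0]) simp
  then show ?thesis using s by (simp add: max_def split: if_splits)
 qed
 then have "dist (beta s) 0 < epsilon" if "s > T" for s using that epsilon by fastforce
 then show "\<forall>\<^sub>F s in at_top. dist (beta s) 0 < epsilon" using eventually_gt_at_top[of T] by (rule eventually_mono[rotated])
qed

context emden_space begin

text \<open>Since \<open>zU 0\<close> is positive, a multiple of the dilation mode matches
  \<open>alpha\<close> at 0. In the difference the first component starts at 0 and the second tends
  to 0 at infinity, so both vanish.\<close>

lemma radial_part:
 assumes s: "lin_sol phi psi" and inv: "\<And>e. norm e = 1 ==> AE x in lborel. phi (mirror e x) = phi x" "\<And>e. norm e = 1 ==> AE x in lborel. psi (mirror e x) = psi x"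
 shows "\<exists>t. AE x in lborel. phi x = t * zU (sq x) \<and> psi x = t * zV (sq x)"
proof -
 have l: "locint phi" "locint psi" using s radial_weak_locint(1) unfolding lin_sol_def by blast+
 obtain a where a [measurable]: "a \<in> bmeas" and ae: "AE x in lborel. phi x = a (sq x)"
  using mirror_invariant_radial[OF l(1) inv(1)] by blast
 obtain b where b [measurable]: "b \<in> bmeas" and be: "AE x in lborel. psi x = b (sq x)"
  using mirror_invariant_radial[OF l(2) inv(2)] by blast
 have um [measurable]: "u \<in> bmeas" "v \<in> bmeas" using uv_cont by (auto intro: borel_measurable_continuous_onI)
 define P' where "P' s = p * v s powr (p - 1)" for s
 define Q' where "Q' s = q * u s powr (q - 1)" for s
 have PQ': "P x = P' (sq x)" "Q x = Q' (sq x)" for x unfolding P_def Q_def P'_def Q'_def unfolding UV by (rule refl)+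
 have PQm [measurable]: "P' \<in> bmeas" "Q' \<in> bmeas" unfolding P'_def[abs_def] Q'_def[abs_def] by measurable
 have PQc: "continuous_on {0..} P'" "continuous_on {0..} Q'" unfolding P'_def[abs_def] Q'_def[abs_def] by (intro continuous_on_mult continuous_on_const cont_powr)+
 have PQpos: "P' s > 0" "Q' s > 0" if "s >= 0" for s unfolding P'_def Q'_def using pq pos(1)[OF that] pos(2)[OF that] by simp_all
 have wa: "radial_weak (%x::real^'n. a (sq x)) (%x. P' (sq x) * b (sq x))"
 proof (rule radial_weak_cong_AE)
  show "radial_weak phi (%x. P x * psi x)" using s unfolding lin_sol_def by blast
  show "AE x in lborel. P x * psi x = P' (sq x) * b (sq x)" using be by eventually_elim (simp add: PQ')
  show "AE x in lborel. phi x = a (sq x)" by (rule ae)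
 qed measurable
 have wb: "radial_weak (%x::real^'n. b (sq x)) (%x. Q' (sq x) * a (sq x))"
 proof (rule radial_weak_cong_AE)
  show "radial_weak psi (%x. Q x * phi x)" using s unfolding lin_sol_def by blast
  show "AE x in lborel. Q x * phi x = Q' (sq x) * a (sq x)" using ae by eventually_elim (simp add: PQ')
  show "AE x in lborel. psi x = b (sq x)" by (rule be)
 qed measurable
 have nu32: "nu >= 3/2" unfolding nun using n by simp
 obtain alpha beta where sol: "radial_sol nu alpha (%s. P' s * beta s)" "radial_sol nu beta (%s. Q' s * alpha s)"
  and ab: "AE s in lborel. s > 0 --> a s = alpha s \<and> b s = beta s"
  using radial_regularity[OF nuDIM nu32 a b PQm PQc wa wb] by blast
 have betac: "continuous_on {0..} beta" using sol(2) by (simp add: radial_sol_def)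
 have "vanishes psi" using s unfolding lin_sol_def by blast
 from vanishes_cong_AE[OF this be] have betalim: "(beta \<longlongrightarrow> 0) at_top"
  by (rule vanishes_radial_tendsto[OF _ b betac _ nuDIM]) (use ab in \<open>eventually_elim, blast\<close>)
 have z0: "zU 0 > 0" using AB(1) pos(1)[of 0] by (simp add: zU_def)
 define t where "t = alpha 0 / zU 0"
 have zs: "radial_sol nu zU (%s. P' s * zV s)" "radial_sol nu zV (%s. Q' s * zU s)"
  using zU_sol swap.zU_sol unfolding P'_def[abs_def] Q'_def[abs_def] unfolding emden.dv_eq(2)[OF swap] .
 have d: "c * y + k * (c * z) = c * (y + k * z)" for c y k z :: real by (simp add: algebra_simps)
 have 1: "radial_sol nu (%s. alpha s + (- t) * zU s) (%s. P' s * (beta s + (- t) * zV s))"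
  using radial_sol_add_scaled[OF nu sol(1) zs(1), of "- t"] unfolding d .
 have 2: "radial_sol nu (%s. beta s + (- t) * zV s) (%s. Q' s * (alpha s + (- t) * zU s))"
  using radial_sol_add_scaled[OF nu sol(2) zs(2), of "- t"] unfolding d .
 have lim: "((%s. beta s + (- t) * zV s) \<longlongrightarrow> 0) at_top"
  using tendsto_add[OF betalim tendsto_mult_left[OF swap.zU_tendsto_0, of "- t"]] by simp
 have i: "alpha 0 + (- t) * zU 0 = 0" using z0 by (simp add: t_def)
 have eq: "alpha s = t * zU s \<and> beta s = t * zV s" if "s >= 0" for s
  using radial_linear_unique[OF nu 1 2 PQc PQpos i lim that] by simp
 \<comment> \<open>Clamping the argument at 0 gives measurability on the whole line; only
   nonnegative arguments are of interest.\<close>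
 have zc: "continuous_on UNIV (%s. zU (max 0 s))" "continuous_on UNIV (%s. zV (max 0 s))"
  by (rule continuous_on_compose2[OF zU_cont] continuous_on_compose2[OF swap.zU_cont]; auto intro!: continuous_intros)+
 have [measurable]: "(%s. zU (max 0 s)) \<in> bmeas" "(%s. zV (max 0 s)) \<in> bmeas"
  using zc by (auto intro: borel_measurable_continuous_onI)
 have pm: "Measurable.pred borel (%s. a s = t * zU (max 0 s) \<and> b s = t * zV (max 0 s))" by measurable
 have "AE s in lborel. s > 0 --> a s = t * zU (max 0 s) \<and> b s = t * zV (max 0 s)"
  using ab
 proof eventually_elim
  case (elim s)
  show ?case
  proof
   assume "s > 0"
   then show "a s = t * zU (max 0 s) \<and> b s = t * zV (max 0 s)" using elim eq[of s] by simp
  qed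
 qed
 then have "AE x in lborel. a ((x::real^'n) \<bullet> x) = t * zU (max 0 (sq x)) \<and> b (sq x) = t * zV (max 0 (sq x))"
  unfolding radial_AE[OF pm nuDIM, symmetric] .
 then have "AE x in lborel. phi x = t * zU (sq x) \<and> psi x = t * zV (sq x)"
  using ae be by eventually_elim simp
 then show ?thesis ..
qed

lemma lin_sol_classified:
 assumes s: "lin_sol phi psi"
 shows "\<exists>t c. AE x in lborel. phi x = t * zU (sq x) + (\<Sum>i\<in>UNIV. c i * partial_deriv i U x) \<and>
  psi x = t * zV (sq x) + (\<Sum>i\<in>UNIV. c i * partial_deriv i V x)"
proof -
 let ?f = "%c x. phi x + (\<Sum>i\<in>UNIV. c i * dU (axis i 1) x)" and ?g = "%c x. psi x + (\<Sum>i\<in>UNIV. c i * dV (axis i 1) x)"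
 obtain c where c0: "lin_sol (?f c) (?g c) \<and>
   (\<forall>e. norm e = 1 --> (AE x in lborel. ?f c (mirror e x) = ?f c x) \<and> (AE x in lborel. ?g c (mirror e x) = ?g c x))"
  using even_part[OF s] unfolding Let_def by (rule exE)
 have c: "lin_sol (?f c) (?g c)" by (rule c0[THEN conjunct1])
 have inv: "AE x in lborel. ?f c (mirror e x) = ?f c x" "AE x in lborel. ?g c (mirror e x) = ?g c x" if "norm e = 1" for e
  using c0[THEN conjunct2, THEN spec, THEN mp, OF that] by (rule conjunct1, rule conjunct2)
 obtain t where t: "AE x in lborel. phi x + (\<Sum>i\<in>UNIV. c i * dU (axis i 1) x) = t * zU (sq x) \<and> psi x + (\<Sum>i\<in>UNIV. c i * dV (axis i 1) x) = t * zV (sq x)"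
  using radial_part[OF c inv] by (rule exE)
 show ?thesis
  by (intro exI[of _ t] exI[of _ c]) (use t in \<open>eventually_elim, simp add: U_partial V_partial sum_negf algebra_simps\<close>)
qed

lemma zU_dilation: "zU (sq x) = x \<bullet> grad U x + 2 * (p + 1) / (p * q - 1) * U x"
proof -
 have "x \<bullet> grad U x = (\<Sum>i\<in>UNIV. x $ i * (2 * x $ i * du (sq x)))"
  unfolding inner_vec_def[of x "grad U x"] by (rule sum.cong) (simp_all add: grad_def U_partial dU_def inner_axis)
 also have "\<dots> = 2 * ((\<Sum>i\<in>UNIV. x $ i * x $ i) * du (sq x))"
  by (simp add: sum_distrib_left sum_distrib_right mult_ac)
 also have "(\<Sum>i\<in>UNIV. x $ i * x $ i) = sq x" by (simp add: inner_vec_def)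
 finally show ?thesis unfolding exponents(2) zU_def by (simp add: UV(1))
qed

lemma zV_dilation: "zV (sq x) = x \<bullet> grad V x + 2 * (q + 1) / (p * q - 1) * V x"
 using emden_space.zU_dilation[OF space_swap, of x] by (simp add: mult.commute[of q p] flip: dv_eq(2))

text \<open>The given pair is replaced by Borel functions that agree with it almost everywhere, for
  which the limit at infinity takes the form \<open>vanishes\<close>; the classification is then
  carried back to the completion.\<close>

lemma nondegenerate_UV: "nondegenerate p q U V"
 unfolding nondegenerate_def
proof (intro allI impI)
 fix phi psi :: "real^'n => real"
 assume ls: "linearized_solution p q U V phi psi" and lim: "((%x. (phi x, psi x)) \<longlongrightarrow> (0, 0)) at_infinity"
 have w: "weak_neg_laplacian phi (%x. P x * psi x)" "weak_neg_laplacian psi (%x. Q x * phi x)"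
  using ls unfolding linearized_solution_def P_def Q_def by auto
 have lm: "f \<in> borel_measurable lebesgue" if "loc_integrable f" for f :: "real^'n => real"
 proof (rule borel_measurable_LIMSEQ_real)
  fix x :: "real^'n"
  have "\<forall>\<^sub>F k in sequentially. indicator (cball 0 (real k)) x *\<^sub>R f x = f x"
   using eventually_ge_at_top[of "nat \<lceil>norm x\<rceil>"] by eventually_elim (auto simp: nat_le_iff ceiling_le_iff)
  then show "(%k. indicator (cball 0 (real k)) x *\<^sub>R f x) \<longlonglongrightarrow> f x" by (rule tendsto_eventually)
 next
  fix k :: nat
  show "(%x. indicator (cball 0 (real k)) x *\<^sub>R f x) \<in> borel_measurable lebesgue"
   using that unfolding loc_integrable_def set_integrable_def by (intro borel_measurable_integrable) simp
 qed
 have m: "phi \<in> borel_measurable lebesgue" "psi \<in> borel_measurable lebesgue" using w lm unfolding weak_neg_laplacian_def by blast+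
 obtain phi' where phi': "phi' \<in> borel_measurable lborel" "AE x in lborel. phi x = phi' x" using completion_ex_borel_measurable_real[OF m(1)] by blast
 obtain psi' where psi': "psi' \<in> borel_measurable lborel" "AE x in lborel. psi x = psi' x" using completion_ex_borel_measurable_real[OF m(2)] by blast
 have PQm [measurable]: "P \<in> bmeas" "Q \<in> bmeas" using P_cont Q_cont by (auto intro: borel_measurable_continuous_onI)
 have bm [measurable]: "phi' \<in> bmeas" "psi' \<in> bmeas" using phi'(1) psi'(1) by simp_all
 have ae: "AE x in lebesgue. phi x = phi' x" "AE x in lebesgue. psi x = psi' x" using phi'(2) psi'(2) by (auto intro: AE_completion)
 have aePQ: "AE x in lebesgue. P x * psi x = P x * psi' x" "AE x in lebesgue. Q x * phi x = Q x * phi' x"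
  using ae(2) apply (rule AE_mp) apply simp using ae(1) by (rule AE_mp) simp
 have pm: "(%x. P x * psi' x) \<in> bmeas" "(%x. Q x * phi' x) \<in> bmeas" by measurable
 have l: "(phi \<longlongrightarrow> 0) at_infinity" "(psi \<longlongrightarrow> 0) at_infinity" using tendsto_fst[OF lim] tendsto_snd[OF lim] by simp_all
 have "lin_sol phi' psi'" unfolding lin_sol_def
  by (intro conjI weak_neg_laplacian_radial_weak[OF w(1) bm(1) pm(1) ae(1) aePQ(1)] weak_neg_laplacian_radial_weak[OF w(2) bm(2) pm(2) ae(2) aePQ(2)]
   vanishes_cong_AE[OF tendsto_vanishes[OF l(1)] phi'(2)] vanishes_cong_AE[OF tendsto_vanishes[OF l(2)] psi'(2)])
 from lin_sol_classified[OF this] obtain t c where tc: "AE x in lborel. phi' x = t * zU (sq x) + (\<Sum>i\<in>UNIV. c i * partial_deriv i U x) \<and>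
  psi' x = t * zV (sq x) + (\<Sum>i\<in>UNIV. c i * partial_deriv i V x)" by blast
 have sp: "(\<Sum>i\<in>S. c i *\<^sub>R Z_translation i U V x) = (\<Sum>i\<in>S. c i * partial_deriv i U x, \<Sum>i\<in>S. c i * partial_deriv i V x)" if "finite S" for S x
  using that by (induction S rule: finite_induct) (simp_all add: Z_translation_def zero_prod_def)
 have "AE x in lborel. (phi x, psi x) = t *\<^sub>R Z_dilation p q U V x + (\<Sum>i\<in>UNIV. c i *\<^sub>R Z_translation i U V x)"
  using tc phi'(2) psi'(2)
  by eventually_elim (simp add: sp[OF finite] Z_dilation_def zU_dilation zV_dilation)
 then have "AE x in lebesgue. (phi x, psi x) = t *\<^sub>R Z_dilation p q U V x + (\<Sum>i\<in>UNIV. c i *\<^sub>R Z_translation i U V x)"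
  by (rule AE_completion)
 then show "\<exists>a b. AE x in lebesgue. (phi x, psi x) = a *\<^sub>R Z_dilation p q U V x + (\<Sum>i\<in>UNIV. b i *\<^sub>R Z_translation i U V x)" by blast
qed

end

theorem theorem1p1:
  assumes "CARD('n::finite) \<ge> 3"
  shows "\<exists>\<epsilon>>0. \<forall>(p::real) (q::real) (U :: real^'n \<Rightarrow> real) (V :: real^'n \<Rightarrow> real).
    p > 0 \<longrightarrow> q > 0 \<longrightarrow>
    1 / (p + 1) + 1 / (q + 1) = (real CARD('n) - 2) / real CARD('n) \<longrightarrow>
    (\<bar>p - 1\<bar> \<le> \<epsilon> \<and> CARD('n) \<ge> 5 \<or>
     \<bar>p - (real CARD('n) + 2) / (real CARD('n) - 2)\<bar> \<le> \<epsilon>) \<longrightarrow>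
    positive_ground_state p q U V \<longrightarrow>
    radially_symmetric U \<longrightarrow> radially_symmetric V \<longrightarrow> U 0 = 1 \<longrightarrow>
    nondegenerate p q U V"
proof (rule exI[of _ 1], intro conjI allI impI)
 fix p q :: real and U V :: "real^'n => real"
 assume pq: "p > 0" "q > 0" and hyp: "1 / (p + 1) + 1 / (q + 1) = (real CARD('n) - 2) / real CARD('n)"
  and gs: "positive_ground_state p q U V" and r: "radially_symmetric U" "radially_symmetric V"
 obtain u v where uv: "emden p q (real CARD('n) / 2) u v" "continuous_on UNIV u" "continuous_on UNIV v"
  "\<forall>x. U x = u (sq x)" "\<forall>x. V x = v (sq x)"
  using ground_state_emden[OF assms pq hyp gs r] by blast
 have UV: "U = (%x. u (sq x))" "V = (%x. v (sq x))" using uv(4,5) by auto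
 have c: "continuous_on UNIV U" "continuous_on UNIV V" and pos: "\<And>x. U x \<noteq> 0" "\<And>x. V x \<noteq> 0"
  and w: "weak_neg_laplacian U (%x. V x powr p)" "weak_neg_laplacian V (%x. U x powr q)"
  using gs by (auto simp: positive_ground_state_def less_imp_neq[THEN not_sym])
 have m: "U \<in> bmeas" "V \<in> bmeas" using c by (auto intro: borel_measurable_continuous_onI)
 have mp: "(%x. V x powr p) \<in> bmeas" "(%x. U x powr q) \<in> bmeas" using m by auto
 have rw: "radial_weak U (%x. V x powr p)" "radial_weak V (%x. U x powr q)"
  by (rule weak_neg_laplacian_radial_weak[OF w(1) m(1) mp(1)]; simp) (rule weak_neg_laplacian_radial_weak[OF w(2) m(2) mp(2)]; simp)
 have "emden_space p q (real CARD('n) / 2) u v U V"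
  by (intro emden_space.intro emden_space_axioms.intro uv UV rw assms refl)
 then show "nondegenerate p q U V" by (rule emden_space.nondegenerate_UV)
qed simp

end
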